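(* Let $\nu\ge-1/2$ and $1<p<\infty$. Then $\mathbf{W}_\nu^p=\mathbf{L}_\nu^{p,1}$ in the sense of isomorphism of Banach spaces (that is, the two spaces of functions coincide and their norms are equivalent).
   Context: All $L^p$ spaces are over the interval $(0,1)$. For $\nu>-1$ let $J_\nu$ be the Bessel function of the first kind of order $\nu$ on $(0,\infty)$, and let $0<\lambda_{1,\nu}<\lambda_{2,\nu}<\dots$ be its successive positive zeros. For $n\ge1$ and $x\in(0,1)$ set $$\phi_n^\nu(x)=\frac{\sqrt2}{|J_{\nu+1}(\lambda_{n,\nu})|}x^{-\nu}J_\nu(\lambda_{n,\nu}x),\qquad \varphi_n^\nu(x)=\frac{\phi_n^\nu(x)}{\phi_1^\nu(x)},\qquad d\eta_\nu(x)=x^{2\nu+1}[\phi_1^\nu(x)]^2dx.$$ The system $\{\varphi_n^\nu:n\ge1\}$ is an orthonormal basis of $L^2(d\eta_\nu)$. Sobolev space: with $d_\nu=\frac{d}{dx}$ understood in the weak (distributional) sense on $(0,1)$, $$\mathbf{W}_\nu^p=\{f\in L^p(d\eta_\nu): d_\nu f\in L^p(d\eta_\nu)\},\qquad \|f\|_{\mathbf{W}_\nu^p}=\|f\|_{L^p(d\eta_\nu)}+\|d_\nu f\|_{L^p(d\eta_\nu)}.$$ Potential space: for $t>0$ let $\mathfrak{G}_t^\nu(x,y)=\sum_{n\ge1}e^{-\lambda_{n,\nu}^2t}\varphi_n^\nu(x)\varphi_n^\nu(y)$, and for $\sigma>0$ let $$\mathfrak{K}_\sigma^\nu(x,y)=\frac1{\Gamma(\sigma)}\int_0^\infty\mathfrak{G}_t^\nu(x,y)t^{\sigma-1}dt,\qquad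 \mathfrak{I}_\sigma^\nu f(x)=\int_0^1\mathfrak{K}_\sigma^\nu(x,y)f(y)\,d\eta_\nu(y).$$ The operator $\mathfrak{I}_\sigma^\nu$ is well defined, bounded and, for $1<p<\infty$, injective on $L^p(d\eta_\nu)$. For $\sigma>0$ and $1<p<\infty$, $$\mathbf{L}_\nu^{p,\sigma}=\mathfrak{I}_{\sigma/2}^\nu\big(L^p(d\eta_\nu)\big),\qquad \|f\|_{\mathbf{L}_\nu^{p,\sigma}}=\|g\|_{L^p(d\eta_\nu)}\ \text{ if } f=\mathfrak{I}_{\sigma/2}^\nu g,\ g\in L^p(d\eta_\nu).$$ *)

theory Defs
  imports "HOL-Analysis.Analysis"
begin

section \<open>Bessel functions and the Fourier--Bessel system\<close>

text \<open>Order \<open>\<nu> > -1\<close> and argument \<open>x > 0\<close> are intended.\<close>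

definition bessel_J :: "real \<Rightarrow> real \<Rightarrow> real" where
  "bessel_J \<nu> x =
     (\<Sum>m. (-1) ^ m / (fact m * Gamma (real m + \<nu> + 1)) * (x / 2) powr (2 * real m + \<nu>))"

text \<open>The \<open>n\<close>-th positive zero (\<open>n \<ge> 1\<close>) is the positive zero with exactly \<open>n\<close> positive zeros
  up to and including itself.\<close>

definition bessel_zero :: "real \<Rightarrow> nat \<Rightarrow> real" where
  "bessel_zero \<nu> n =
     (THE z. 0 < z \<and> bessel_J \<nu> z = 0 \<and> card {y. 0 < y \<and> y \<le> z \<and> bessel_J \<nu> y = 0} = n)"

definition fb_phi :: "real \<Rightarrow> nat \<Rightarrow> real \<Rightarrow> real" where
  "fb_phi \<nu> n x =
     sqrt 2 / \<bar>bessel_J (\<nu> + 1) (bessel_zero \<nu> n)\<bar> * x powr (- \<nu>)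
       * bessel_J \<nu> (bessel_zero \<nu> n * x)"

definition fb_varphi :: "real \<Rightarrow> nat \<Rightarrow> real \<Rightarrow> real" where
  "fb_varphi \<nu> n x = fb_phi \<nu> n x / fb_phi \<nu> 1 x"

definition fb_eta :: "real \<Rightarrow> real measure" where
  "fb_eta \<nu> = density (restrict_space lborel {0<..<1})
                (\<lambda>x. ennreal (x powr (2 * \<nu> + 1) * (fb_phi \<nu> 1 x)\<^sup>2))"

section \<open>Lebesgue spaces\<close>

text \<open>Elements of \<open>L\<^sup>p\<close> are represented by functions, not by classes modulo equality almost everywhere.
  All function spaces below are closed under almost everywhere equality (among measurable
  functions), and the norms below do not distinguish almost everywhere equal functions.
  The values of a representative outside \<open>(0,1)\<close> are irrelevant.\<close>

definition Lp_space :: "'b measure \<Rightarrow> real \<Rightarrow> ('b \<Rightarrow> 'a::{banach,second_countable_topology}) set" where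
  "Lp_space M p = {f \<in> borel_measurable M. integrable M (\<lambda>x. norm (f x) powr p)}"

definition Lp_norm :: "'b measure \<Rightarrow> real \<Rightarrow> ('b \<Rightarrow> 'a::{banach,second_countable_topology}) \<Rightarrow> real" where
  "Lp_norm M p f = (\<integral>x. norm (f x) powr p \<partial>M) powr (1 / p)"

section \<open>Weak derivatives on the unit interval and the Sobolev space\<close>

definition test_function :: "(real \<Rightarrow> real) \<Rightarrow> bool" where
  "test_function \<psi> \<longleftrightarrow>
     (\<forall>k x. (deriv ^^ k) \<psi> differentiable (at x)) \<and>
     (\<exists>a b. 0 < a \<and> b < 1 \<and> (\<forall>x. x \<notin> {a..b} \<longrightarrow> \<psi> x = 0))"

definition locally_integrable :: "(real \<Rightarrow> 'a::{banach,second_countable_topology}) \<Rightarrow> bool" where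
  "locally_integrable f \<longleftrightarrow> (\<forall>a b. 0 < a \<and> b < 1 \<longrightarrow> set_integrable lborel {a..b} f)"

definition has_weak_deriv ::
  "(real \<Rightarrow> 'a::{banach,second_countable_topology}) \<Rightarrow> (real \<Rightarrow> 'a) \<Rightarrow> bool" where
  "has_weak_deriv f g \<longleftrightarrow>
     locally_integrable f \<and> locally_integrable g \<and>
     (\<forall>\<psi>. test_function \<psi> \<longrightarrow>
        (LINT x:{0<..<1}|lborel. deriv \<psi> x *\<^sub>R f x) = - (LINT x:{0<..<1}|lborel. \<psi> x *\<^sub>R g x))"

text \<open>The weak derivative is unique up to equality almost everywhere.\<close>

definition weak_deriv :: "(real \<Rightarrow> 'a::{banach,second_countable_topology}) \<Rightarrow> real \<Rightarrow> 'a" where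
  "weak_deriv f = (SOME g. has_weak_deriv f g)"

definition sobolev_space :: "real \<Rightarrow> real \<Rightarrow> (real \<Rightarrow> 'a::{banach,second_countable_topology}) set" where
  "sobolev_space \<nu> p =
     {f \<in> Lp_space (fb_eta \<nu>) p. \<exists>g \<in> Lp_space (fb_eta \<nu>) p. has_weak_deriv f g}"

definition sobolev_norm :: "real \<Rightarrow> real \<Rightarrow> (real \<Rightarrow> 'a::{banach,second_countable_topology}) \<Rightarrow> real" where
  "sobolev_norm \<nu> p f = Lp_norm (fb_eta \<nu>) p f + Lp_norm (fb_eta \<nu>) p (weak_deriv f)"

section \<open>Potential operators and the potential space\<close>

definition heat_kernel :: "real \<Rightarrow> real \<Rightarrow> real \<Rightarrow> real \<Rightarrow> real" where
  "heat_kernel \<nu> t x y =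
     (\<Sum>n. exp (- (bessel_zero \<nu> (Suc n))\<^sup>2 * t) * fb_varphi \<nu> (Suc n) x * fb_varphi \<nu> (Suc n) y)"

text \<open>For small \<open>\<sigma>\<close> the integral diverges on the diagonal \<open>x = y\<close>, where the formal value is \<open>0\<close>;
  this null set does not affect the potential operator.\<close>

definition potential_kernel :: "real \<Rightarrow> real \<Rightarrow> real \<Rightarrow> real \<Rightarrow> real" where
  "potential_kernel \<nu> \<sigma> x y =
     1 / Gamma \<sigma> * (LINT t:{0<..}|lborel. heat_kernel \<nu> t x y * t powr (\<sigma> - 1))"

definition potential_op ::
  "real \<Rightarrow> real \<Rightarrow> (real \<Rightarrow> 'a::{banach,second_countable_topology}) \<Rightarrow> real \<Rightarrow> 'a" where
  "potential_op \<nu> \<sigma> f x = (\<integral>y. potential_kernel \<nu> \<sigma> x y *\<^sub>R f y \<partial>fb_eta \<nu>)"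

definition is_potential_of ::
  "real \<Rightarrow> real \<Rightarrow> real \<Rightarrow> (real \<Rightarrow> 'a::{banach,second_countable_topology}) \<Rightarrow> (real \<Rightarrow> 'a) \<Rightarrow> bool" where
  "is_potential_of \<nu> p \<sigma> f g \<longleftrightarrow>
     g \<in> Lp_space (fb_eta \<nu>) p \<and> (AE x in fb_eta \<nu>. f x = potential_op \<nu> (\<sigma> / 2) g x)"

definition potential_space ::
  "real \<Rightarrow> real \<Rightarrow> real \<Rightarrow> (real \<Rightarrow> 'a::{banach,second_countable_topology}) set" where
  "potential_space \<nu> p \<sigma> =
     {f \<in> borel_measurable (fb_eta \<nu>). \<exists>g. is_potential_of \<nu> p \<sigma> f g}"

text \<open>By injectivity of the potential operator on \<open>L\<^sup>p\<close>, the function \<open>g\<close> is unique up to equality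
  almost everywhere.\<close>

definition potential_norm ::
  "real \<Rightarrow> real \<Rightarrow> real \<Rightarrow> (real \<Rightarrow> 'a::{banach,second_countable_topology}) \<Rightarrow> real" where
  "potential_norm \<nu> p \<sigma> f = Lp_norm (fb_eta \<nu>) p (SOME g. is_potential_of \<nu> p \<sigma> f g)"

end

(*
  Conjugating by phi_1 turns the Bessel operator into a Sturm--Liouville operator with eigenvalues
  lambda_n^2 - lambda_1^2, whose heat flow is positive and contractive; the derivatives of the
  eigenfunctions form a second system of the same kind, with a nonnegative potential. Integrated along
  the Poisson flows exp(-lambda_n t) of the two systems, a smooth Bellman function of Nazarov--Treil
  type is convex in t and its second derivative dominates the bilinear form of the Riesz transform
  d I_{1/2}, which is therefore bounded on L^p x L^q. The bound gives one inclusion; its dual, the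
  reverse Riesz inequality, together with a Poincare inequality gives the other.
*)
theory Submission
  imports Defs
begin

text \<open>With eigenvalues shifted to \<open>kappa n = (lam n)^2 - (lam 0)^2\<close>, a flow with
  exponent \<open>lam n\<close> solves an equation with the extra term \<open>(lam 0)^2 * u\<close>.
  This is harmless: like the potential of the second system it multiplies a quantity that is
  nonnegative because the Bellman function grows with the size of its arguments. That potential is
  nonnegative because the weight is log-concave, which rests on \<open>2 * \<nu> + 1 >= 0\<close>.
  The obstacle is that the coefficients are singular at the ends and that expansions are not known
  to converge in L^p. So the Riesz and Poincare inequalities are proved for finite sums, where
  boundary terms carry a factor \<open>x * (1 - x)\<close>, and extended by density. Density in L^p
  comes from completeness in L^2 by a short heat flow, which regularises without raising the sup
  norm; completeness comes from counting zeros. A Poincare inequality is needed because the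
  derivative kills the ground state 1; the free constant is used to make sums vanish at 1/2. The
  scalars may be real or complex, so the analysis is done for real functions and applied to
  Euclidean components.\<close>

notation (input) LIMSEQ ("((_)/ ----> (_))" [60, 60] 60)
notation (input) tendsto (infixr "--->" 55)

lemmas DERIV_transform_open = has_field_derivative_transform_within_open
lemmas DERIV_cont_on = DERIV_continuous_on[OF DERIV_subset]

section \<open>Power inequalities in place of the Minkowski, Hoelder and Jensen inequalities\<close>

lemma powr_add_le:
  fixes a b p :: real
  assumes "0 <= a" "0 <= b" "0 < p"
  shows "(a + b) powr p <= 2 powr p * (a powr p + b powr p)"
proof -
  have "(a + b) powr p <= (2 * max a b) powr p" using assms by (intro powr_mono2) auto
  also have "... = 2 powr p * max a b powr p" using assms by (simp add: powr_mult)
  also have "... <= 2 powr p * (a powr p + b powr p)" by (intro mult_left_mono) (auto simp: max_def)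
  finally show ?thesis .
qed

lemma norm_add_powr_le:
  fixes a b :: "'a::real_normed_vector"
  assumes "0 < p"
  shows "norm (a + b) powr p <= 2 powr p * (norm a powr p + norm b powr p)"
proof -
  have "norm (a + b) powr p <= (norm a + norm b) powr p"
    using assms by (intro powr_mono2 norm_triangle_ineq) auto
  also have "... <= 2 powr p * (norm a powr p + norm b powr p)" using assms by (intro powr_add_le) auto
  finally show ?thesis .
qed

lemma norm_diff_powr_le:
  fixes a b :: "'a::real_normed_vector"
  assumes "0 < p"
  shows "norm (a - b) powr p <= 2 powr p * (norm a powr p + norm b powr p)"
  using norm_add_powr_le[OF assms, of a "- b"] by simp

text \<open>Young's inequality with the weights of the two powers dropped; a free scale \<open>s\<close> replaces
  Hoelder's inequality throughout.\<close>

lemma young_scaled: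
  fixes a b p q s :: real
  assumes "0 <= a" "0 <= b" "0 < s" "1 < p" "1 < q" "1 / p + 1 / q = 1"
  shows "a * b <= s powr (- p) * a powr p + s powr q * b powr q"
proof -
  have "a * b = (a / s) * (s * b)" using assms by simp
  also have "... <= (a / s) powr p / p + (s * b) powr q / q" using assms by (intro Youngs_inequality) auto
  also have "... <= (a / s) powr p + (s * b) powr q"
    using assms by (intro add_mono) (auto simp: divide_le_eq mult_left_le mult_le_cancel_left1)
  also have "... = s powr (- p) * a powr p + s powr q * b powr q"
    using assms by (simp add: powr_divide powr_mult powr_minus divide_simps)
  finally show ?thesis .
qed

text \<open>Above \<open>d\<close> the ratio \<open>(a / d) powr (p - 1)\<close> is at least 1.
  Integrated against a kernel of bounded mass and optimised in \<open>d\<close>, this gives Jensen's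
  inequality up to a constant.\<close>

lemma le_delta_powr:
  fixes a d p :: real
  assumes "0 <= a" "0 < d" "1 <= p"
  shows "a <= d + d powr (1 - p) * a powr p"
proof (cases "a <= d")
  case True
  thus ?thesis by (simp add: add_increasing2)
next
  case False
  hence "a = a powr p * a powr (1 - p)" using assms by (simp flip: powr_add)
  also have "... <= a powr p * d powr (1 - p)" using False assms by (intro mult_left_mono powr_mono2') auto
  finally show ?thesis using assms by (simp add: mult.commute add_increasing)
qed

text \<open>Values up to \<open>d\<close> contribute at most \<open>d powr p\<close>; above
  \<open>d\<close> the factor \<open>a^2 / d^2\<close> exceeds 1. On a finite measure it turns L^2
  smallness of a bounded function into L^p smallness, for \<open>p\<close> on either side of
  2.\<close>

lemma powr_le_delta_sq:
  fixes a d p A :: real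
  assumes "0 <= a" "a <= A" "0 < d" "0 < p"
  shows "a powr p <= d powr p + A powr p / d\<^sup>2 * a\<^sup>2"
proof (cases "a <= d")
  case True
  hence "a powr p <= d powr p" using assms by (intro powr_mono2) auto
  thus ?thesis by (simp add: add_increasing2)
next
  case False
  have "a powr p <= A powr p" using assms by (intro powr_mono2) auto
  also have "... <= A powr p * (a\<^sup>2 / d\<^sup>2)"
    using False assms by (intro mult_le_cancel_left1[THEN iffD2]) (auto simp: divide_simps power_mono)
  finally show ?thesis by (simp add: add_increasing)
qed

section \<open>Lebesgue spaces\<close>

text \<open>Estimates are carried out on the integral of the p-th power, without the root: the
  triangle inequality costs a factor \<open>2 powr p\<close>, and roots return only when the norms
  are compared at the end.\<close>

abbreviation Lp_int :: "'b measure => real => ('b => 'a::{banach,second_countable_topology}) => real" where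
  "Lp_int M p f \<equiv> (LINT x|M. norm (f x) powr p)"

abbreviation Lp_lim :: "'b measure => real => (nat => 'b => 'a::{banach,second_countable_topology}) => ('b => 'a) => bool" where
  "Lp_lim M p u f \<equiv> (%k. Lp_int M p (%x. u k x - f x)) ----> 0"

lemma Lp_spaceD:
  assumes "f \<in> Lp_space M p"
  shows "f \<in> borel_measurable M" "integrable M (%x. norm (f x) powr p)"
  using assms by (auto simp: Lp_space_def)

lemma Lp_spaceI:
  "f \<in> borel_measurable M ==> integrable M (%x. norm (f x) powr p) ==> f \<in> Lp_space M p"
  by (auto simp: Lp_space_def)

lemma Lp_int_nonneg: "0 <= Lp_int M p f"
  by (intro Bochner_Integration.integral_nonneg) auto

lemma Lp_space_dominated:
  assumes "f \<in> borel_measurable M" "integrable M g" "AE x in M. norm (f x) powr p <= g x"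
  shows "f \<in> Lp_space M p" "Lp_int M p f <= integral\<^sup>L M g"
proof -
  show "f \<in> Lp_space M p" using assms
    by (intro Lp_spaceI assms(1) Bochner_Integration.integrable_bound[OF assms(2)]) auto
  thus "Lp_int M p f <= integral\<^sup>L M g" using assms by (intro integral_mono_AE Lp_spaceD) auto
qed

lemma Lp_add:
  assumes "f \<in> Lp_space M p" "g \<in> Lp_space M p" "0 < p"
  shows "(%x. f x + g x) \<in> Lp_space M p"
    and "Lp_int M p (%x. f x + g x) <= 2 powr p * (Lp_int M p f + Lp_int M p g)"
proof -
  note * = Lp_spaceD[OF assms(1)] Lp_spaceD[OF assms(2)]
  have i: "integrable M (%x. 2 powr p * (norm (f x) powr p + norm (g x) powr p))" using * by auto
  note L = Lp_space_dominated[OF _ i, of "%x. f x + g x"]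
  show "(%x. f x + g x) \<in> Lp_space M p" using * norm_add_powr_le[OF assms(3)] by (intro L(1)) auto
  have "Lp_int M p (%x. f x + g x) <= (LINT x|M. 2 powr p * (norm (f x) powr p + norm (g x) powr p))"
    using * norm_add_powr_le[OF assms(3)] by (intro L(2)) auto
  also have "... = 2 powr p * (Lp_int M p f + Lp_int M p g)" using * by simp
  finally show "Lp_int M p (%x. f x + g x) <= 2 powr p * (Lp_int M p f + Lp_int M p g)" .
qed

lemma Lp_scale:
  assumes "f \<in> Lp_space M p"
  shows "(%x. c *\<^sub>R f x) \<in> Lp_space M p"
    and "Lp_int M p (%x. c *\<^sub>R f x) = \<bar>c\<bar> powr p * Lp_int M p f"
  using Lp_spaceD[OF assms] by (auto simp: powr_mult intro!: Lp_spaceI)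

lemma Lp_minus:
  assumes "f \<in> Lp_space M p"
  shows "(%x. - f x) \<in> Lp_space M p" "Lp_int M p (%x. - f x) = Lp_int M p f"
  using Lp_spaceD[OF assms] by (auto intro!: Lp_spaceI)

lemma Lp_diff:
  assumes "f \<in> Lp_space M p" "g \<in> Lp_space M p" "0 < p"
  shows "(%x. f x - g x) \<in> Lp_space M p"
    and "Lp_int M p (%x. f x - g x) <= 2 powr p * (Lp_int M p f + Lp_int M p g)"
  using Lp_add[OF assms(1) Lp_minus(1)[OF assms(2)] assms(3)] by auto

lemma Lp_cong_AE:
  assumes "f \<in> Lp_space M p" "g \<in> borel_measurable M" "AE x in M. f x = g x"
  shows "g \<in> Lp_space M p" "Lp_int M p g = Lp_int M p f"
proof -
  note * = Lp_spaceD[OF assms(1)]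
  have "integrable M (%x. norm (g x) powr p) \<longleftrightarrow> integrable M (%x. norm (f x) powr p)"
    using assms * by (intro integrable_cong_AE) auto
  thus "g \<in> Lp_space M p" using * assms by (auto intro: Lp_spaceI)
  show "Lp_int M p g = Lp_int M p f" using assms * by (intro integral_cong_AE) auto
qed

lemma (in finite_measure) Lp_bounded:
  assumes "f \<in> borel_measurable M" "AE x in M. norm (f x) <= C" "0 < p"
  shows "f \<in> Lp_space M p"
  using assms
  by (intro Lp_space_dominated(1)[where g = "%_. C powr p"]) (auto elim!: eventually_mono intro: powr_mono2)

lemma Lp_pairing:
  fixes f g :: "'b => real"
  assumes "f \<in> Lp_space M p" "g \<in> Lp_space M q" "1 < p" "1 < q" "1 / p + 1 / q = 1" "0 < s"
  shows "integrable M (%x. f x * g x)"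
    and "(LINT x|M. \<bar>f x * g x\<bar>) <= s powr (- p) * Lp_int M p f + s powr q * Lp_int M q g"
    and "\<bar>LINT x|M. f x * g x\<bar> <= s powr (- p) * Lp_int M p f + s powr q * Lp_int M q g"
proof -
  note * = Lp_spaceD[OF assms(1)] Lp_spaceD[OF assms(2)]
  have i: "integrable M (%x. s powr (- p) * norm (f x) powr p + s powr q * norm (g x) powr q)"
    using * by auto
  have le: "\<bar>f x * g x\<bar> <= s powr (- p) * norm (f x) powr p + s powr q * norm (g x) powr q" for x
    using young_scaled[of "\<bar>f x\<bar>" "\<bar>g x\<bar>" s p q] assms by (simp add: abs_mult)
  show I: "integrable M (%x. f x * g x)"
    by (rule Bochner_Integration.integrable_bound[OF i]) (use le * in \<open>auto intro!: AE_I2 order_trans[OF le]\<close>)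
  have "(LINT x|M. \<bar>f x * g x\<bar>) <= (LINT x|M. s powr (- p) * norm (f x) powr p + s powr q * norm (g x) powr q)"
    using I i le by (intro integral_mono) auto
  also have "... = s powr (- p) * Lp_int M p f + s powr q * Lp_int M q g" using * by simp
  finally show 1: "(LINT x|M. \<bar>f x * g x\<bar>) <= s powr (- p) * Lp_int M p f + s powr q * Lp_int M q g" .
  show "\<bar>LINT x|M. f x * g x\<bar> <= s powr (- p) * Lp_int M p f + s powr q * Lp_int M q g"
    using integral_abs_bound[of M "%x. f x * g x"] 1 by linarith
qed

lemma Lp_pairing_tendsto:
  fixes f g :: "'b => real"
  assumes "!!k. u k \<in> Lp_space M p" "f \<in> Lp_space M p" "g \<in> Lp_space M q"
    and "1 < p" "1 < q" "1 / p + 1 / q = 1"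
    and lim: "Lp_lim M p u f"
  shows "(%k. LINT x|M. u k x * g x) ----> (LINT x|M. f x * g x)"
proof (rule LIMSEQ_I)
  fix e :: real assume "0 < e"
  define G where "G = Lp_int M q g + 1"
  have G: "0 < G" unfolding G_def using Lp_int_nonneg[of M g q] by linarith
  \<comment> \<open>This scale makes the part of Young's inequality with \<open>g\<close> at most
    \<open>e / 2\<close>; the other part is small for large \<open>k\<close>.\<close>
  define s where "s = (e / (2 * G)) powr (1 / q)"
  have s: "0 < s" "s powr q = e / (2 * G)"
    using \<open>0 < e\<close> G assms(5) by (auto simp: s_def powr_powr)
  have "\<forall>\<^sub>F k in sequentially. Lp_int M p (%x. u k x - f x) < e / 2 * s powr p"
    using lim s \<open>0 < e\<close> by (intro order_tendstoD(2)) auto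
  then obtain N where N: "!!k. k >= N ==> Lp_int M p (%x. u k x - f x) < e / 2 * s powr p"
    by (auto simp: eventually_sequentially)
  show "\<exists>N. \<forall>k\<ge>N. norm ((LINT x|M. u k x * g x) - (LINT x|M. f x * g x)) < e"
  proof (intro exI allI impI)
    fix k assume k: "N <= k"
    have "(LINT x|M. u k x * g x) - (LINT x|M. f x * g x) = (LINT x|M. (u k x - f x) * g x)"
      using Lp_pairing(1)[OF assms(1)[of k] assms(3-6) s(1)] Lp_pairing(1)[OF assms(2-6) s(1)]
      by (simp add: algebra_simps)
    hence "norm ((LINT x|M. u k x * g x) - (LINT x|M. f x * g x))
        <= s powr (- p) * Lp_int M p (%x. u k x - f x) + s powr q * Lp_int M q g"
      using Lp_pairing(3)[OF Lp_diff(1)[OF assms(1)[of k] assms(2)] assms(3-6) s(1)] assms(4) by simp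
    also have "s powr (- p) * Lp_int M p (%x. u k x - f x) < s powr (- p) * (e / 2 * s powr p)"
      using N[OF k] s by (intro mult_strict_left_mono) auto
    also have "s powr (- p) * (e / 2 * s powr p) = e / 2" using s by (simp add: powr_minus)
    also have "s powr q * Lp_int M q g <= s powr q * G" by (intro mult_left_mono) (simp_all add: G_def)
    also have "s powr q * G = e / 2" using s G by simp
    finally show "norm ((LINT x|M. u k x * g x) - (LINT x|M. f x * g x)) < e" by simp
  qed
qed

lemma Lp_int_le_of_tendsto:
  assumes "!!k. u k \<in> Lp_space M p" "f \<in> Lp_space M p" "0 < p"
    and lim: "Lp_lim M p u f"
    and le: "!!k. Lp_int M p (u k) <= C"
  shows "Lp_int M p f <= 2 powr p * C"
proof (rule tendsto_lowerbound[OF _ _ sequentially_bot])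
  show "(%k. 2 powr p * (C + Lp_int M p (%x. u k x - f x))) ----> 2 powr p * C"
    by (rule tendsto_eq_intros lim refl | simp)+
  have "Lp_int M p f <= 2 powr p * (C + Lp_int M p (%x. u k x - f x))" for k proof -
    have "Lp_int M p f = Lp_int M p (%x. u k x - (u k x - f x))" by simp
    also have "... <= 2 powr p * (Lp_int M p (u k) + Lp_int M p (%x. u k x - f x))" by (intro Lp_diff assms)
    also have "... <= 2 powr p * (C + Lp_int M p (%x. u k x - f x))"
      using le[of k] by (intro mult_left_mono) auto
    finally show ?thesis .
  qed
  thus "\<forall>\<^sub>F k in sequentially. Lp_int M p f <= 2 powr p * (C + Lp_int M p (%x. u k x - f x))"
    by simp
qed

lemma Lp_int_bounded_of_tendsto:
  assumes "!!k. u k \<in> Lp_space M p" "f \<in> Lp_space M p" "0 < p"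
    and lim: "Lp_lim M p u f" and that: "0 < d"
  shows "\<forall>\<^sub>F k in sequentially. Lp_int M p (u k) <= 2 powr p * (Lp_int M p f + d)"
proof -
  have "\<forall>\<^sub>F k in sequentially. Lp_int M p (%x. u k x - f x) < d"
    using lim that by (intro order_tendstoD(2)) auto
  thus ?thesis proof eventually_elim
    fix k assume k: "Lp_int M p (%x. u k x - f x) < d"
    have "Lp_int M p (u k) = Lp_int M p (%x. f x + (u k x - f x))" by simp
    also have "... <= 2 powr p * (Lp_int M p f + Lp_int M p (%x. u k x - f x))"
      by (intro Lp_add Lp_diff assms)
    also have "... <= 2 powr p * (Lp_int M p f + d)" using k by (intro mult_left_mono) auto
    finally show "Lp_int M p (u k) <= 2 powr p * (Lp_int M p f + d)" .
  qed
qed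

text \<open>Riesz-Fischer on p-th powers: a subsequence with rapidly decaying increments converges
  almost everywhere, and Fatou's lemma shows that its limit is the limit of the whole
  sequence.\<close>

lemma Lp_complete:
  fixes u :: "nat => 'b => real"
  assumes u: "!!k. u k \<in> Lp_space M p" and p: "0 < p"
    and cauchy: "!!d. 0 < d ==> \<exists>N. \<forall>m\<ge>N. \<forall>n\<ge>N. Lp_int M p (%x. u m x - u n x) < d"
  shows "\<exists>f\<in>Lp_space M p. Lp_lim M p u f"
proof -
  \<comment> \<open>The factor \<open>2 powr (- p)\<close> leaves room for the weights
    \<open>(2 powr p) ^ k\<close>, and \<open>1 / 2\<close> makes the weighted integrals summable.
    Finiteness of the weighted sum then bounds the k-th increment by a multiple of
    \<open>(1 / 2) ^ k\<close>.\<close>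
  define delta where "delta k = (2 powr (- p) / 2) ^ k" for k :: nat
  have delta: "0 < delta k" for k by (simp add: delta_def)
  have "\<forall>k. \<exists>N. \<forall>m\<ge>N. \<forall>n\<ge>N. Lp_int M p (%x. u m x - u n x) < delta k"
    using cauchy delta by blast
  then obtain N where N: "!!k m n. m >= N k ==> n >= N k ==> Lp_int M p (%x. u m x - u n x) < delta k"
    by metis
  \<comment> \<open>The summand \<open>k\<close> sends the indices to infinity, as Fatou's lemma
    requires below.\<close>
  define s where "s k = Max (N ` {..k}) + k" for k
  have s: "N k <= s k" "N k <= s (Suc k)" "k <= s k" for k
    by (auto simp: s_def intro!: trans_le_add1 Max_ge le_SucI)
  define D where "D k x = norm (u (s (Suc k)) x - u (s k) x) powr p" for k x
  have Dint: "integrable M (D k)" "integral\<^sup>L M (D k) < delta k" for k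
    unfolding D_def by (intro Lp_spaceD(2) Lp_diff u p, intro N s)
  have [measurable]: "D k \<in> borel_measurable M" for k using Dint(1)[of k] by auto
  have [measurable]: "u k \<in> borel_measurable M" for k using u[of k] by (auto simp: Lp_space_def)
  have D0: "0 <= D k x" for k x by (simp add: D_def)
  have "(\<integral>\<^sup>+x. (\<Sum>k. ennreal ((2 powr p) ^ k * D k x)) \<partial>M) = (\<Sum>k. \<integral>\<^sup>+x. ennreal ((2 powr p) ^ k * D k x) \<partial>M)"
    by (intro nn_integral_suminf) auto
  also have "... <= (\<Sum>k. ennreal ((1 / 2) ^ k))" proof (intro suminf_le summableI)
    fix k
    have "(\<integral>\<^sup>+x. ennreal ((2 powr p) ^ k * D k x) \<partial>M) = ennreal (LINT x|M. (2 powr p) ^ k * D k x)"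
      using Dint(1)[of k] D0 by (intro nn_integral_eq_integral) auto
    moreover have "(LINT x|M. (2 powr p) ^ k * D k x) <= (2 powr p) ^ k * delta k"
      using Dint(2)[of k] by simp
    moreover have "(2 powr p) ^ k * delta k = (2 powr p * (2 powr (- p) / 2)) ^ k"
      unfolding delta_def by (rule power_mult_distrib[symmetric])
    moreover have "2 powr p * (2 powr (- p) / 2) = (1 / 2 :: real)" by (simp add: powr_minus)
    ultimately show "(\<integral>\<^sup>+x. ennreal ((2 powr p) ^ k * D k x) \<partial>M) <= ennreal ((1 / 2) ^ k)"
      by (metis ennreal_leI)
  qed
  also have "... < \<infinity>" using summable_geometric[of "1 / 2 :: real"] by (subst suminf_ennreal2) auto
  finally have "AE x in M. (\<Sum>k. ennreal ((2 powr p) ^ k * D k x)) ~= \<infinity>"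
    by (intro nn_integral_PInf_AE) auto
  hence conv: "AE x in M. convergent (%k. u (s k) x)" proof eventually_elim
    fix x assume *: "(\<Sum>k. ennreal ((2 powr p) ^ k * D k x)) ~= \<infinity>"
    hence sm: "summable (%k. (2 powr p) ^ k * D k x)" using D0 by (intro summable_suminf_not_top) auto
    hence "Bseq (%k. (2 powr p) ^ k * D k x)"
      by (intro convergent_imp_Bseq) (auto dest: summable_LIMSEQ_zero simp: convergent_def)
    then obtain C where C: "0 < C" "!!k. norm ((2 powr p) ^ k * D k x) <= C" by (auto elim: BseqE)
    have "norm (u (s (Suc k)) x - u (s k) x) <= C powr (1 / p) * (1 / 2) ^ k" for k proof -
      have "((2 ^ k) * norm (u (s (Suc k)) x - u (s k) x)) powr p <= C" proof -
        have "((2::real) ^ k) powr p = (2 powr real k) powr p" by (simp add: powr_realpow)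
        also have "... = (2 powr p) ^ k" by (simp add: powr_powr powr_power)
        finally show ?thesis using C(2)[of k] D0[of k x] by (simp add: D_def powr_mult)
      qed
      hence "(((2 ^ k) * norm (u (s (Suc k)) x - u (s k) x)) powr p) powr (1 / p) <= C powr (1 / p)"
        using p by (intro powr_mono2) auto
      hence "2 ^ k * norm (u (s (Suc k)) x - u (s k) x) <= C powr (1 / p)" using p by (simp add: powr_powr)
      thus ?thesis by (simp add: power_one_over field_simps)
    qed
    hence "summable (%k. u (s (Suc k)) x - u (s k) x)"
      by (rule summable_comparison_test'[where g = "%k. C powr (1 / p) * (1 / 2) ^ k" and N = 0, rotated])
        (auto intro!: summable_mult summable_geometric)
    thus "convergent (%k. u (s k) x)" using sum_lessThan_telescope[of "%k. u (s k) x"]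
      by (simp add: summable_iff_convergent convergent_diff_const_right_iff)
  qed
  define f where "f x = lim (%k. u (s k) x)" for x
  have [measurable]: "f \<in> borel_measurable M" unfolding f_def by measurable
  have lim: "AE x in M. (%k. u (s k) x) ----> f x"
    using conv by eventually_elim (simp add: f_def convergent_LIMSEQ_iff)
  have fatou: "integrable M (%x. norm (u n x - f x) powr p) & Lp_int M p (%x. u n x - f x) <= delta j"
    if n: "n >= N j" for n j proof -
    have "(\<integral>\<^sup>+x. ennreal (norm (u n x - f x) powr p) \<partial>M)
        = (\<integral>\<^sup>+x. liminf (%k. ennreal (norm (u n x - u (s k) x) powr p)) \<partial>M)"
    proof (rule nn_integral_cong_AE, use lim in eventually_elim)
      fix x assume "(%k. u (s k) x) ----> f x"
      hence "(%k. ennreal (norm (u n x - u (s k) x) powr p)) ----> ennreal (norm (u n x - f x) powr p)"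
        using p by (intro tendsto_ennrealI tendsto_powr2 tendsto_norm tendsto_diff tendsto_const) auto
      thus "ennreal (norm (u n x - f x) powr p) = liminf (%k. ennreal (norm (u n x - u (s k) x) powr p))"
        by (rule lim_imp_Liminf[OF sequentially_bot, symmetric])
    qed
    also have "... <= liminf (%k. \<integral>\<^sup>+x. ennreal (norm (u n x - u (s k) x) powr p) \<partial>M)"
      by (intro nn_integral_liminf) auto
    also have "... <= ennreal (delta j)"
    proof (rule Liminf_le[OF sequentially_bot], rule eventually_sequentiallyI[of "N j"])
      fix k assume "N j <= k"
      hence k: "N j <= s k" using s(3)[of k] by linarith
      have "(\<integral>\<^sup>+x. ennreal (norm (u n x - u (s k) x) powr p) \<partial>M) = ennreal (Lp_int M p (%x. u n x - u (s k) x))"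
        using u p by (intro nn_integral_eq_integral Lp_spaceD(2) Lp_diff) auto
      also have "... <= ennreal (delta j)" using N[OF n k] by (intro ennreal_leI) auto
      finally show "(\<integral>\<^sup>+x. ennreal (norm (u n x - u (s k) x) powr p) \<partial>M) <= ennreal (delta j)" .
    qed
    finally have le: "(\<integral>\<^sup>+x. ennreal (norm (u n x - f x) powr p) \<partial>M) <= ennreal (delta j)" .
    hence "(\<integral>\<^sup>+x. ennreal (norm (u n x - f x) powr p) \<partial>M) < \<infinity>"
      by (auto intro: le_less_trans)
    hence i: "integrable M (%x. norm (u n x - f x) powr p)" by (intro integrableI_nonneg) auto
    moreover have "ennreal (Lp_int M p (%x. u n x - f x)) <= ennreal (delta j)"
      using le i by (subst (asm) nn_integral_eq_integral) auto
    ultimately show ?thesis using delta[of j] by (auto simp: ennreal_le_iff)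
  qed
  have uf: "(%x. u (N 0) x - f x) \<in> Lp_space M p" using fatou[of 0 "N 0"] by (intro Lp_spaceI) auto
  have "(%x. u (N 0) x - (u (N 0) x - f x)) \<in> Lp_space M p" by (intro Lp_diff u uf p)
  hence "f \<in> Lp_space M p" by simp
  moreover have "Lp_lim M p u f" proof (rule LIMSEQ_I)
    fix d :: real assume d: "0 < d"
    have "2 powr (- p) / 2 < (1::real)" using p powr_less_mono[of "-p" 0 2] by simp
    hence "delta ----> 0" unfolding delta_def by (intro LIMSEQ_power_zero) auto
    hence "\<forall>\<^sub>F j in sequentially. delta j < d" using d by (intro order_tendstoD(2))
    then obtain j where j: "delta j < d" by (auto simp: eventually_sequentially)
    show "\<exists>N. \<forall>k\<ge>N. norm (Lp_int M p (%x. u k x - f x) - 0) < d"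
      using fatou[where j = j] j Lp_int_nonneg
      by (intro exI[of _ "N j"] allI impI) (fastforce simp: abs_of_nonneg intro: le_less_trans)
  qed
  ultimately show ?thesis by blast
qed

text \<open>Testing \<open>F\<close> against a multiple of the extremal function
  \<open>sgn F * |F| powr (p - 1)\<close> gives \<open>s * N\<close> on the left, \<open>N\<close>
  being the integral of \<open>|F| powr p\<close>, and a term of order \<open>s powr q * N\<close>
  on the right; as \<open>q > 1\<close>, a small \<open>s\<close> allows absorption.
  \<open>K\<close> is fixed before \<open>M\<close>, \<open>F\<close> and \<open>A\<close>, and only
  approximants of \<open>G\<close> must satisfy the bound, which suits bounds known on a dense
  span.\<close>

lemma duality_bound:
  fixes p q C :: real
  assumes "1 < p" "1 < q" "1 / p + 1 / q = 1" "0 < C"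
  obtains K where "0 < K" and
    "!!(M :: 'b measure) (F :: 'b => real) A. F \<in> Lp_space M p ==>
      (!!G d. G \<in> Lp_space M q ==> 0 < d ==> \<exists>g\<in>Lp_space M q.
        Lp_int M q (%x. g x - G x) < d & \<bar>LINT x|M. F x * g x\<bar> <= A + C * Lp_int M q g) ==>
      Lp_int M p F <= K * A" proof -
  \<comment> \<open>Solves \<open>C * 2 powr q * s powr q = s / 2\<close>; the factor
    \<open>2 powr q\<close> is lost in passing from the approximants to their limit.\<close>
  define s where "s = (1 / (2 * C * 2 powr q)) powr (1 / (q - 1))"
  have s: "0 < s" using assms by (simp add: s_def)
  have sq: "C * 2 powr q * s powr q = s / 2" proof -
    have "s powr q = s powr (q - 1) * s powr 1" by (subst powr_add[symmetric]) simp
    also have "s powr (q - 1) = 1 / (2 * C * 2 powr q)" using assms by (simp add: s_def powr_powr)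
    finally show ?thesis using s assms by (simp add: field_simps)
  qed
  have pq: "(p - 1) * q = p" using assms by (simp add: field_simps)
  show thesis proof (rule that[of "2 / s"])
    show "0 < 2 / s" using s by simp
    fix M :: "'b measure" and F :: "'b => real" and A
    assume F: "F \<in> Lp_space M p"
      and approx: "!!G d. G \<in> Lp_space M q ==> 0 < d ==> \<exists>g\<in>Lp_space M q.
        Lp_int M q (%x. g x - G x) < d & \<bar>LINT x|M. F x * g x\<bar> <= A + C * Lp_int M q g"
    define N where "N = Lp_int M p F"
    define G where "G x = s * sgn (F x) * norm (F x) powr (p - 1)" for x
    have [measurable]: "F \<in> borel_measurable M" using F by (rule Lp_spaceD)
    have Gq: "norm (G x) powr q = s powr q * norm (F x) powr p" for x
      using s assms pq by (cases "F x = 0") (auto simp: G_def abs_mult powr_mult powr_powr abs_sgn_eq)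
    have G: "G \<in> Lp_space M q" proof (rule Lp_spaceI)
      show "G \<in> borel_measurable M" unfolding G_def by measurable
      show "integrable M (%x. norm (G x) powr q)"
        unfolding Gq using Lp_spaceD[OF F] by (intro integrable_mult_right)
    qed
    have GN: "Lp_int M q G = s powr q * N" unfolding N_def by (simp only: Gq integral_mult_right_zero)
    have FG: "F x * G x = s * norm (F x) powr p" for x proof -
      have "F x * G x = s * (\<bar>F x\<bar> powr 1 * \<bar>F x\<bar> powr (p - 1))"
        by (simp add: G_def mult_ac abs_sgn[symmetric])
      also have "... = s * norm (F x) powr p" by (subst powr_add[symmetric]) simp
      finally show ?thesis .
    qed
    have FGN: "(LINT x|M. F x * G x) = s * N" unfolding FG N_def by simp
    have "\<forall>k. \<exists>g. g \<in> Lp_space M q & Lp_int M q (%x. g x - G x) < 1 / (real k + 1)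
        & \<bar>LINT x|M. F x * g x\<bar> <= A + C * Lp_int M q g" proof
      fix k :: nat
      have "0 < 1 / (real k + 1)" by simp
      from approx[OF G this] show "\<exists>g. g \<in> Lp_space M q & Lp_int M q (%x. g x - G x) < 1 / (real k + 1)
        & \<bar>LINT x|M. F x * g x\<bar> <= A + C * Lp_int M q g" by blast
    qed
    from choice[OF this] obtain g where g: "!!k. g k \<in> Lp_space M q"
      "!!k. Lp_int M q (%x. g k x - G x) < 1 / (real k + 1)"
      "!!k. \<bar>LINT x|M. F x * g k x\<bar> <= A + C * Lp_int M q (g k)" by blast
    have lim: "Lp_lim M q g G" proof (rule tendsto_sandwich[OF _ _ tendsto_const])
      show "\<forall>\<^sub>F k in sequentially. 0 <= Lp_int M q (%x. g k x - G x)"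
        using Lp_int_nonneg by (intro always_eventually allI)
      show "\<forall>\<^sub>F k in sequentially. Lp_int M q (%x. g k x - G x) <= inverse (real (Suc k))"
        using g(2) by (intro always_eventually allI) (simp add: inverse_eq_divide less_imp_le add.commute)
    qed (rule LIMSEQ_inverse_real_of_nat)
    have "(%k. LINT x|M. g k x * F x) ----> (LINT x|M. G x * F x)"
      using assms by (intro Lp_pairing_tendsto[OF g(1) G F _ _ _ lim]) auto
    hence l1: "(%k. LINT x|M. F x * g k x) ----> s * N" using FGN by (simp add: mult.commute)
    have *: "s * N <= A + C * (2 powr q * (s powr q * N + d))" if d: "0 < d" for d
    proof (rule tendsto_upperbound[OF l1 _ sequentially_bot])
      have "\<forall>\<^sub>F k in sequentially. Lp_int M q (g k) <= 2 powr q * (Lp_int M q G + d)"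
        using assms by (intro Lp_int_bounded_of_tendsto g G lim d) auto
      thus "\<forall>\<^sub>F k in sequentially. (LINT x|M. F x * g k x) <= A + C * (2 powr q * (s powr q * N + d))"
      proof eventually_elim
        fix k assume "Lp_int M q (g k) <= 2 powr q * (Lp_int M q G + d)"
        hence "C * Lp_int M q (g k) <= C * (2 powr q * (s powr q * N + d))"
          using assms unfolding GN by (intro mult_left_mono) auto
        thus "(LINT x|M. F x * g k x) <= A + C * (2 powr q * (s powr q * N + d))"
          using g(3)[of k] by linarith
      qed
    qed
    have *: "s * N <= A + C * 2 powr q * s powr q * N + d * (C * 2 powr q)" if d: "0 < d" for d
      using *[OF d] by (simp add: algebra_simps)
    have "s * N <= A + C * 2 powr q * s powr q * N" proof (rule field_le_epsilon)
      fix e :: real assume "0 < e"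
      thus "s * N <= A + C * 2 powr q * s powr q * N + e" using *[of "e / (C * 2 powr q)"] assms by simp
    qed
    hence "s * N <= A + s / 2 * N" unfolding sq .
    thus "Lp_int M p F <= 2 / s * A" using s unfolding N_def[symmetric] by (simp add: field_simps)
  qed
qed

section \<open>Test functions\<close>

definition smooth_fun :: "(real => real) => bool" where
  "smooth_fun f \<longleftrightarrow> (\<forall>k x. (deriv ^^ k) f differentiable (at x))"

text \<open>A class of differentiable functions closed under \<open>deriv\<close> contains all
  iterated derivatives of its members, so none of them has to be computed.\<close>

lemma smooth_funI:
  assumes "f \<in> A" and A: "!!g. g \<in> A ==> deriv g \<in> A" "!!g x. g \<in> A ==> g differentiable (at x)"
  shows "smooth_fun f"
proof -
  have "(deriv ^^ k) f \<in> A" for k by (induction k) (auto simp: assms)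
  thus ?thesis using A by (auto simp: smooth_fun_def)
qed

lemma smooth_fun_deriv:
  assumes "smooth_fun f"
  shows "smooth_fun (deriv f)"
  unfolding smooth_fun_def proof (intro allI)
  fix k x
  have "(deriv ^^ Suc k) f differentiable (at x)" using assms unfolding smooth_fun_def by blast
  thus "(deriv ^^ k) (deriv f) differentiable (at x)" by (simp add: funpow_swap1)
qed

lemma smooth_fun_differentiable:
  assumes "smooth_fun f"
  shows "f differentiable (at x)" "DERIV f x :> deriv f x" "isCont f x"
proof -
  have "(deriv ^^ 0) f differentiable (at x)" using assms unfolding smooth_fun_def by blast
  thus *: "f differentiable (at x)" by simp
  thus "DERIV f x :> deriv f x" by (simp add: DERIV_deriv_iff_real_differentiable)
  thus "isCont f x" by (rule DERIV_isCont)
qed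

lemma smooth_fun_lin:
  assumes "smooth_fun f" "smooth_fun g"
  shows "smooth_fun (%x. a * f x + b * g x)"
proof (rule smooth_funI[where A = "{(%x. a * f x + b * g x) |f g. smooth_fun f & smooth_fun g}"])
  show "(%x. a * f x + b * g x) \<in> {(%x. a * f x + b * g x) |f g. smooth_fun f & smooth_fun g}"
    using assms by blast
next
  fix h assume "h \<in> {(%x. a * f x + b * g x) |f g. smooth_fun f & smooth_fun g}"
  then obtain f g where h: "h = (%x. a * f x + b * g x)" "smooth_fun f" "smooth_fun g" by blast
  have *: "DERIV h x :> a * deriv f x + b * deriv g x" for x
    unfolding h(1) by (intro DERIV_add DERIV_cmult smooth_fun_differentiable h)
  hence "deriv h = (%x. a * deriv f x + b * deriv g x)" by (intro ext DERIV_imp_deriv)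
  thus "deriv h \<in> {(%x. a * f x + b * g x) |f g. smooth_fun f & smooth_fun g}"
    using smooth_fun_deriv h by blast
  show "h differentiable (at x)" for x using * real_differentiable_def by blast
qed

lemma test_function_iff:
  "test_function psi \<longleftrightarrow> smooth_fun psi & (\<exists>a b. 0 < a & b < 1 & (\<forall>x. x \<notin> {a..b} --> psi x = 0))"
  by (simp add: test_function_def smooth_fun_def)

lemma test_functionE:
  assumes "test_function psi"
  obtains a b where "0 < a" "a < b" "b < 1" "!!x. x \<notin> {a..b} ==> psi x = 0" proof -
  obtain a b where ab: "0 < a" "b < 1" "!!x. x \<notin> {a..b} ==> psi x = 0"
    using assms by (auto simp: test_function_iff)
  show thesis proof (cases "a < b")
    case True
    thus ?thesis using ab that by blast
  next
    \<comment> \<open>Here the support is at most one point; the wider interval is nondegenerate and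
      still contains it.\<close>
    case False
    hence "psi x = 0" if "x \<notin> {min (1/4) a..max (1/2) b}" for x
      using ab that False by (auto simp: min_def max_def split: if_splits)
    thus ?thesis using ab by (intro that[of "min (1/4) a" "max (1/2) b"]) auto
  qed
qed

lemma test_function_smooth: "test_function psi ==> smooth_fun psi"
  by (simp add: test_function_iff)

lemmas test_function_deriv = smooth_fun_differentiable(2)[OF test_function_smooth]

lemma deriv_eq_0_outside:
  fixes psi :: "real => real"
  assumes "!!x. x \<notin> {a..b} ==> psi x = 0" "x \<notin> {a..b}"
  shows "deriv psi x = 0"
proof -
  have "open (- {a..b})" by (intro open_Compl closed_atLeastAtMost)
  hence "eventually (%y. y \<in> - {a..b}) (nhds x)" using assms(2) by (intro eventually_nhds_in_open) auto
  hence "deriv psi x = deriv (%_. 0) x" using assms by (intro deriv_cong_ev) (auto elim!: eventually_mono)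
  thus ?thesis by simp
qed

lemma test_function_derivI:
  assumes "test_function psi" shows "test_function (deriv psi)"
proof -
  obtain a b where ab: "0 < a" "b < 1" "!!x. x \<notin> {a..b} ==> psi x = 0"
    using assms by (auto elim: test_functionE)
  hence "!!x. x \<notin> {a..b} ==> deriv psi x = 0" using deriv_eq_0_outside by blast
  thus ?thesis using assms ab unfolding test_function_iff by (auto intro: smooth_fun_deriv)
qed

lemma test_function_cont:
  assumes "test_function psi"
  shows "continuous_on A psi" "psi \<in> borel_measurable borel"
proof -
  have "continuous_on UNIV psi" using smooth_fun_differentiable(3)[OF test_function_smooth[OF assms]]
    by (auto simp: continuous_on_eq_continuous_at)
  thus "continuous_on A psi" "psi \<in> borel_measurable borel"
    by (auto intro: continuous_on_subset borel_measurable_continuous_onI)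
qed

lemma test_function_bounded:
  assumes "test_function psi"
  obtains C where "0 < C" "!!x. \<bar>psi x\<bar> <= C" proof -
  obtain a b where ab: "0 < a" "b < 1" "!!x. x \<notin> {a..b} ==> psi x = 0"
    using assms by (auto elim: test_functionE)
  have "bounded (psi ` {a..b})"
    using test_function_cont[OF assms] by (intro compact_imp_bounded compact_continuous_image) auto
  then obtain C where C: "0 < C" "!!x. x \<in> {a..b} ==> \<bar>psi x\<bar> <= C"
    by (auto simp: bounded_pos)
  show thesis proof (rule that[of C])
    show "\<bar>psi x\<bar> <= C" for x using ab(3)[of x] C by (cases "x \<in> {a..b}") auto
  qed (rule C)
qed

lemma test_function_lin:
  assumes "test_function psi" "test_function theta"
  shows "test_function (%x. s * psi x + t * theta x)"
proof -
  obtain a b where ab: "0 < a" "b < 1" "!!x. x \<notin> {a..b} ==> psi x = 0"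
    using assms(1) by (auto elim: test_functionE)
  obtain c d where cd: "0 < c" "d < 1" "!!x. x \<notin> {c..d} ==> theta x = 0"
    using assms(2) by (auto elim: test_functionE)
  have "s * psi x + t * theta x = 0" if "x \<notin> {min a c..max b d}" for x
    using ab(3)[of x] cd(3)[of x] that by (auto simp: min_def max_def split: if_splits)
  moreover have "0 < min a c" "max b d < 1" using ab cd by auto
  moreover have "smooth_fun (%x. s * psi x + t * theta x)"
    using assms by (intro smooth_fun_lin test_function_smooth)
  ultimately show ?thesis unfolding test_function_iff by blast
qed

section \<open>Smooth bumps with compact support\<close>

definition exp_bump :: "real => nat => real => real" where
  "exp_bump s j y = (if 0 < y then exp (- s / y) / y ^ j else 0)"

text \<open>From \<open>(1 + (s / y) / n) ^ n <= exp (s / y)\<close> with \<open>n = j + 2\<close>: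
  the exponential beats the pole of order \<open>j\<close> with two powers to spare, and a quadratic
  bound is what makes the derivative at 0 vanish.\<close>

lemma exp_bump_le:
  assumes "0 < s"
  shows "\<bar>exp_bump s j y\<bar> <= (real (j + 2) / s) ^ (j + 2) * y\<^sup>2"
proof (cases "0 < y")
  case True
  define n where "n = j + 2"
  define z where "z = real n / s * y"
  have z: "0 < z" using assms True by (simp add: z_def n_def)
  have "(1 / z) ^ n <= (1 + (s / y) / real n) ^ n"
    using assms True by (intro power_mono) (auto simp: z_def n_def field_simps)
  also have "... <= exp (s / y)" using assms True order_trans[of "- real n" 0 "s / y"]
    by (intro exp_ge_one_plus_x_over_n_power_n) (auto simp: n_def)
  finally have "1 / exp (s / y) <= z ^ n" using z by (simp add: power_one_over field_simps)
  hence "exp (- s / y) <= (real n / s) ^ n * y ^ n"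
    by (simp add: exp_minus z_def power_mult_distrib divide_inverse flip: minus_divide_left)
  hence "exp (- s / y) / y ^ j <= (real n / s) ^ n * y ^ n / y ^ j"
    using True by (intro divide_right_mono) auto
  thus ?thesis using True by (simp add: exp_bump_def n_def power_add power2_eq_square mult.assoc)
next
  case False
  thus ?thesis using assms by (simp add: exp_bump_def)
qed

lemma exp_bump_deriv:
  assumes "0 < s"
  shows "DERIV (exp_bump s j) y :> - real j * exp_bump s (j + 1) y + s * exp_bump s (j + 2) y"
proof -
  consider "0 < y" | "y < 0" | "y = 0" by linarith
  thus ?thesis proof cases
    case 1
    have "((%y. exp (- s / y) / y ^ j) has_real_derivative
        - real j * exp_bump s (j + 1) y + s * exp_bump s (j + 2) y) (at y)" using 1
      by (auto intro!: derivative_eq_intros simp: exp_bump_def divide_simps power_add power2_eq_square)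
         (cases j; simp add: algebra_simps)
    thus ?thesis
      by (rule DERIV_transform_open[where S = "{0<..}"]) (use 1 in \<open>auto simp: exp_bump_def\<close>)
  next
    case 2
    have "DERIV (%y. 0) y :> - real j * exp_bump s (j + 1) y + s * exp_bump s (j + 2) y"
      using 2 by (auto intro!: derivative_eq_intros simp: exp_bump_def)
    thus ?thesis
      by (rule DERIV_transform_open[where S = "{..<0}"]) (use 2 in \<open>auto simp: exp_bump_def\<close>)
  next
    case 3
    define C where "C = (real (j + 2) / s) ^ (j + 2)"
    have "((%h. exp_bump s j h / h) ---> 0) (at 0)" proof (rule Lim_null_comparison)
      show "((%h. C * \<bar>h\<bar>) ---> 0) (at 0)" by (rule tendsto_eq_intros refl | simp)+
      have "norm (exp_bump s j h / h) <= C * \<bar>h\<bar>" for h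
        using exp_bump_le[OF assms, of j h] by (cases "h = 0") (auto simp: C_def divide_simps abs_mult power2_eq_square)
      thus "\<forall>\<^sub>F h in at 0. norm (exp_bump s j h / h) <= C * \<bar>h\<bar>" by simp
    qed
    thus ?thesis using 3 by (simp add: DERIV_def exp_bump_def)
  qed
qed

text \<open>As \<open>s\<close> tends to 0, the bump tends to the indicator of the open interval
  while staying below 1.\<close>

definition bump :: "real => real => real => real => real" where
  "bump s a b x = exp_bump s 0 ((x - a) * (b - x))"

text \<open>The derivative of \<open>exp_bump s j\<close> involves the pole orders
  \<open>j + 1\<close> and \<open>j + 2\<close>, so sums over all orders with polynomial factors are
  closed under differentiation.\<close>

inductive_set bump_class :: "real => real => real => (real => real) set" for s a b where
  base: "(%x. poly R x * exp_bump s j ((x - a) * (b - x))) \<in> bump_class s a b"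
| add: "f \<in> bump_class s a b ==> g \<in> bump_class s a b ==> (%x. f x + g x) \<in> bump_class s a b"

lemma bump_class_deriv:
  assumes "f \<in> bump_class s a b" "0 < s"
  shows "\<exists>f'\<in>bump_class s a b. \<forall>x. DERIV f x :> f' x"
  using assms(1) proof induction
  case (base R j)
  let ?y = "%x. (x - a) * (b - x)"
  let ?f' = "%x. poly (pderiv R) x * exp_bump s j (?y x)
      + (poly (R * [:a + b, -2:] * [:- real j:]) x * exp_bump s (j + 1) (?y x)
      + poly (R * [:a + b, -2:] * [:s:]) x * exp_bump s (j + 2) (?y x))"
  have y: "DERIV (?y) x :> a + b - 2 * x" for x by (auto intro!: derivative_eq_intros)
  have "DERIV (%x. poly R x * exp_bump s j (?y x)) x :> ?f' x" for x proof -
    have "((%x. poly R x * exp_bump s j (?y x)) has_real_derivative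
        poly R x * ((- real j * exp_bump s (j + 1) (?y x) + s * exp_bump s (j + 2) (?y x)) * (a + b - 2 * x))
        + poly (pderiv R) x * exp_bump s j (?y x)) (at x)"
      by (rule DERIV_mult' poly_DERIV DERIV_chain2 exp_bump_deriv y assms)+
    thus ?thesis by (rule DERIV_cong) (simp add: algebra_simps)
  qed
  moreover have "?f' \<in> bump_class s a b" by (intro bump_class.intros)
  ultimately show ?case by (intro bexI[of _ ?f']) auto
next
  case (add f g)
  then obtain f' g' where *: "f' \<in> bump_class s a b" "g' \<in> bump_class s a b"
    "\<forall>x. DERIV f x :> f' x" "\<forall>x. DERIV g x :> g' x" by blast
  hence "(%x. f' x + g' x) \<in> bump_class s a b" by (intro bump_class.add)
  moreover have "\<forall>x. DERIV (%x. f x + g x) x :> f' x + g' x"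
    using * by (auto intro!: derivative_intros)
  ultimately show ?case by (intro bexI[of _ "%x. f' x + g' x"])
qed

lemma smooth_fun_bump:
  assumes "0 < s" shows "smooth_fun (bump s a b)"
proof (rule smooth_funI[where A = "bump_class s a b"])
  have "(%x. poly 1 x * exp_bump s 0 ((x - a) * (b - x))) \<in> bump_class s a b" by (rule bump_class.base)
  thus "bump s a b \<in> bump_class s a b" by (simp add: bump_def[abs_def])
next
  fix g assume "g \<in> bump_class s a b"
  then obtain g' where *: "g' \<in> bump_class s a b" "\<forall>x. DERIV g x :> g' x"
    using bump_class_deriv assms by blast
  hence "deriv g = g'" by (auto intro: DERIV_imp_deriv)
  thus "deriv g \<in> bump_class s a b" using * by simp
  show "g differentiable (at x)" for x using * real_differentiable_def by blast
qed

lemma bump_outside: "a < b ==> x \<notin> {a<..<b} ==> bump s a b x = 0"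
  by (auto simp: bump_def exp_bump_def zero_less_mult_iff)

lemma bump_pos: "a < x ==> x < b ==> 0 < bump s a b x"
  by (auto simp: bump_def exp_bump_def)

lemma bump_bounds: "0 < s ==> 0 <= bump s a b x" "0 < s ==> bump s a b x <= 1"
  by (auto simp: bump_def exp_bump_def)

lemma test_function_bump:
  assumes "0 < s" "0 < a" "a < b" "b < 1"
  shows "test_function (bump s a b)"
proof -
  have "\<forall>x. x \<notin> {a..b} --> bump s a b x = 0" using assms by (auto intro!: bump_outside)
  thus ?thesis unfolding test_function_iff using assms smooth_fun_bump[OF assms(1)] by blast
qed

lemma bump_tendsto:
  assumes "a < b" "u ----> a" "v ----> b" "s ----> 0"
    and uv: "!!n. a <= u n" "!!n. u n < v n" "!!n. v n <= b"
  shows "(%n. bump (s n) (u n) (v n) x) ----> indicator {a<..<b} x"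
proof (cases "x \<in> {a<..<b}")
  case True
  hence 0: "0 < (x - a) * (b - x)" by auto
  have *: "(%n. (x - u n) * (v n - x)) ----> (x - a) * (b - x)" using assms by (intro tendsto_intros)
  hence ev: "\<forall>\<^sub>F n in sequentially. 0 < (x - u n) * (v n - x)"
    using 0 by (rule order_tendstoD)
  have "(%n. exp (- s n / ((x - u n) * (v n - x)))) ----> exp (- 0 / ((x - a) * (b - x)))"
    using 0 * assms by (intro tendsto_intros) auto
  hence "(%n. exp (- s n / ((x - u n) * (v n - x)))) ----> indicator {a<..<b} x" using True by simp
  thus ?thesis
    by (rule Lim_transform_eventually) (use ev in \<open>auto elim!: eventually_mono simp: bump_def exp_bump_def\<close>)
next
  case False
  hence "x \<notin> {u n<..<v n}" for n using uv(1,3)[of n] by auto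
  hence "bump (s n) (u n) (v n) x = 0" for n using uv by (intro bump_outside)
  thus ?thesis using False by simp
qed

lemma bump_sequence:
  assumes "0 <= a" "a < b" "b <= 1"
  obtains psi :: "nat => real => real" where "!!n. test_function (psi n)" "!!n x. 0 <= psi n x" "!!n x. psi n x <= 1"
    "!!n x. x \<notin> {a<..<b} ==> psi n x = 0"
    "!!x. (%n. psi n x) ----> indicator {a<..<b} x" proof -
  \<comment> \<open>A third of the length: margins of at most \<open>d\<close> on both sides keep
    \<open>u n < v n\<close>.\<close>
  define d where "d = (b - a) / 3"
  have d: "0 < d" using assms by (simp add: d_def)
  define u v s where "u n = a + d * inverse (real (Suc n))" and "v n = b - d * inverse (real (Suc n))"
    and "s n = inverse (real (Suc n))" for n
  have s: "0 < s n" "s n <= 1" for n by (auto simp: s_def divide_simps)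
  have ds: "0 < d * s n" "d * s n <= d" for n using s[of n] d by (auto simp: mult_le_cancel_left1)
  have uv: "a < u n" "u n < v n" "v n < b" for n
    using ds[of n] d unfolding u_def v_def s_def[symmetric] by (auto simp: d_def field_simps)
  have s0: "s ----> 0" unfolding s_def by (rule LIMSEQ_inverse_real_of_nat)
  have "u ----> a + d * 0" "v ----> b - d * 0"
    unfolding u_def v_def by (intro tendsto_intros LIMSEQ_inverse_real_of_nat)+
  hence lim: "u ----> a" "v ----> b" by auto
  show thesis proof (rule that[of "%n. bump (s n) (u n) (v n)"])
    show "test_function (bump (s n) (u n) (v n))" for n
      using uv[of n] s[of n] assms by (intro test_function_bump) auto
    show "bump (s n) (u n) (v n) x = 0" if "x \<notin> {a<..<b}" for n x
      using uv[of n] that by (intro bump_outside) auto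
    show "(%n. bump (s n) (u n) (v n) x) ----> indicator {a<..<b} x" for x
      using assms lim s0 uv by (intro bump_tendsto) (auto intro: less_imp_le)
  qed (use s in \<open>auto intro: bump_bounds\<close>)
qed

section \<open>Density of the test functions in L^p of a finite measure on (0,1)\<close>

locale unit_interval_measure = finite_measure M for M :: "real measure" +
  assumes sets_M: "sets M = sets (restrict_space borel {0<..<1})"
begin

lemma space_M: "space M = {0<..<1}"
  using sets_eq_imp_space_eq[OF sets_M] by (simp add: space_restrict_space)

lemma measurable_M: "f \<in> borel_measurable borel ==> f \<in> borel_measurable M"
  unfolding measurable_cong_sets[OF sets_M refl] by (rule measurable_restrict_space1)

lemma measurable_M_continuous:
  fixes f :: "real => 'a::topological_space"
  shows "continuous_on {0<..<1} f ==> f \<in> borel_measurable M"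
  unfolding measurable_cong_sets[OF sets_M refl] by (rule borel_measurable_continuous_on_restrict)

lemma sets_M_iff: "A \<in> sets M \<longleftrightarrow> A \<in> sets borel & A \<subseteq> {0<..<1}"
  unfolding sets_M by (subst sets_restrict_space_iff) auto

lemma Lp_test: "0 < p ==> test_function psi ==> psi \<in> Lp_space M p"
proof -
  assume p: "0 < p" and psi: "test_function psi"
  obtain C where "!!x. \<bar>psi x\<bar> <= C" using test_function_bounded[OF psi] by blast
  thus "psi \<in> Lp_space M p"
    using p psi by (intro Lp_bounded[where C = C] measurable_M test_function_cont) auto
qed

definition test_approx :: "real => (real => real) => bool" where
  "test_approx p f \<longleftrightarrow> f \<in> Lp_space M p & (\<forall>d>0. \<exists>psi. test_function psi & Lp_int M p (%x. psi x - f x) < d)"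

lemma test_approx_Lp: "test_approx p f ==> f \<in> Lp_space M p"
  by (simp add: test_approx_def)

lemma test_approx_limit:
  assumes p: "0 < p" and u: "!!n. test_approx p (u n)" and f: "f \<in> Lp_space M p"
    and lim: "Lp_lim M p u f"
  shows "test_approx p f"
  unfolding test_approx_def proof (intro conjI f allI impI)
  fix d :: real assume d: "0 < d"
  define e where "e = d / (2 * 2 powr p)"
  have e: "0 < e" using d by (simp add: e_def)
  have "\<forall>\<^sub>F n in sequentially. Lp_int M p (%x. u n x - f x) < e"
    using lim e by (rule order_tendstoD)
  then obtain n where n: "Lp_int M p (%x. u n x - f x) < e" by (auto simp: eventually_sequentially)
  obtain psi where psi: "test_function psi" "Lp_int M p (%x. psi x - u n x) < e"
    using u[of n] e unfolding test_approx_def by blast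
  have "Lp_int M p (%x. psi x - f x) = Lp_int M p (%x. (psi x - u n x) + (u n x - f x))" by simp
  also have "... <= 2 powr p * (Lp_int M p (%x. psi x - u n x) + Lp_int M p (%x. u n x - f x))"
    by (intro Lp_add Lp_diff p f Lp_test psi test_approx_Lp u)
  also have "... < 2 powr p * (e + e)" using n psi by (intro mult_strict_left_mono) auto
  also have "... = d" by (simp add: e_def)
  finally show "\<exists>psi. test_function psi & Lp_int M p (%x. psi x - f x) < d" using psi by blast
qed

lemma test_approx_limit_dominated:
  assumes p: "0 < p" and u: "!!n. test_approx p (u n)" and f: "f \<in> borel_measurable M" and g: "g \<in> Lp_space M p"
    and lim: "AE x in M. (%n. u n x) ----> f x"
    and le: "!!n. AE x in M. norm (u n x) <= norm (g x)"
  shows "test_approx p f"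
proof (rule test_approx_limit[OF p u])
  have [measurable]: "u n \<in> borel_measurable M" for n
    using test_approx_Lp[OF u[of n]] by (auto simp: Lp_space_def)
  note [measurable] = f
  have le': "AE x in M. norm (f x) <= norm (g x)" proof -
    have "AE x in M. \<forall>n. norm (u n x) <= norm (g x)" using le by (simp add: AE_all_countable)
    with lim show ?thesis by eventually_elim (rule tendsto_upperbound[OF tendsto_norm], auto)
  qed
  show fp: "f \<in> Lp_space M p"
    using le' p Lp_spaceD[OF g] by (intro Lp_space_dominated[where g = "%x. norm (g x) powr p"])
      (auto elim!: eventually_mono intro: powr_mono2)
  have "(%n. Lp_int M p (%x. u n x - f x)) ----> (LINT x|M. 0)" proof (rule integral_dominated_convergence)
    show "integrable M (%x. 2 powr p * (norm (g x) powr p + norm (g x) powr p))"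
      using Lp_spaceD[OF g] by auto
    show "AE x in M. (%n. norm (u n x - f x) powr p) ----> 0" using lim proof eventually_elim
      fix x assume "(%n. u n x) ----> f x"
      hence "(%n. norm (u n x - f x) powr p) ----> norm (f x - f x) powr p"
        using p by (intro tendsto_powr2 tendsto_norm tendsto_diff tendsto_const) auto
      thus "(%n. norm (u n x - f x) powr p) ----> 0" by simp
    qed
    show "AE x in M. norm (norm (u n x - f x) powr p) <= 2 powr p * (norm (g x) powr p + norm (g x) powr p)" for n
      using le[of n] le' proof eventually_elim
      fix x assume *: "norm (u n x) <= norm (g x)" "norm (f x) <= norm (g x)"
      have "norm (u n x - f x) powr p <= 2 powr p * (norm (u n x) powr p + norm (f x) powr p)"
        by (rule norm_diff_powr_le[OF p])
      also have "... <= 2 powr p * (norm (g x) powr p + norm (g x) powr p)"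
        using * p by (intro mult_left_mono add_mono powr_mono2) auto
      finally show "norm (norm (u n x - f x) powr p) <= 2 powr p * (norm (g x) powr p + norm (g x) powr p)"
        by simp
    qed
  qed auto
  thus "Lp_lim M p u f" by simp
qed

lemma test_approx_lin:
  assumes p: "0 < p" and f: "test_approx p f" and g: "test_approx p g"
  shows "test_approx p (%x. s * f x + t * g x)"
  unfolding test_approx_def proof (intro conjI allI impI)
  note L = test_approx_Lp[OF f] test_approx_Lp[OF g]
  have sc: "(%x. c * h x) \<in> Lp_space M p" and sc2: "Lp_int M p (%x. c * h x) = \<bar>c\<bar> powr p * Lp_int M p h"
    if "h \<in> Lp_space M p" for c and h :: "real => real" using Lp_scale[OF that, of c] by simp_all
  show "(%x. s * f x + t * g x) \<in> Lp_space M p" by (intro Lp_add sc L p)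
  fix d :: real assume d: "0 < d"
  define e where "e = d / (2 powr p * (\<bar>s\<bar> powr p + \<bar>t\<bar> powr p + 1))"
  have D: "0 < \<bar>s\<bar> powr p + \<bar>t\<bar> powr p + 1" by (simp add: add_nonneg_pos)
  hence e: "0 < e" using d by (simp add: e_def)
  obtain psi theta where psi: "test_function psi" "Lp_int M p (%x. psi x - f x) < e"
    and theta: "test_function theta" "Lp_int M p (%x. theta x - g x) < e"
    using f g e unfolding test_approx_def by blast
  have d1: "(%x. psi x - f x) \<in> Lp_space M p" "(%x. theta x - g x) \<in> Lp_space M p"
    by (intro Lp_diff Lp_test psi theta p L)+
  have "Lp_int M p (%x. (s * psi x + t * theta x) - (s * f x + t * g x))
      = Lp_int M p (%x. s * (psi x - f x) + t * (theta x - g x))" by (simp add: algebra_simps)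
  also have "... <= 2 powr p * (Lp_int M p (%x. s * (psi x - f x)) + Lp_int M p (%x. t * (theta x - g x)))"
    by (intro Lp_add sc d1 p)
  also have "... = 2 powr p * (\<bar>s\<bar> powr p * Lp_int M p (%x. psi x - f x) + \<bar>t\<bar> powr p * Lp_int M p (%x. theta x - g x))"
    unfolding sc2[OF d1(1)] sc2[OF d1(2)] ..
  also have "... <= 2 powr p * (\<bar>s\<bar> powr p * e + \<bar>t\<bar> powr p * e)"
    using psi theta by (intro mult_left_mono add_mono) auto
  also have "... < 2 powr p * ((\<bar>s\<bar> powr p + \<bar>t\<bar> powr p + 1) * e)"
    using e by (intro mult_strict_left_mono) (auto simp: algebra_simps)
  also have "... = d" using D by (simp add: e_def)
  finally show "\<exists>psi. test_function psi & Lp_int M p (%x. psi x - (s * f x + t * g x)) < d"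
    using test_function_lin[OF psi(1) theta(1)] by blast
qed

lemma test_approx_test: "0 < p ==> test_function psi ==> test_approx p psi"
  unfolding test_approx_def by (auto intro!: Lp_test exI[of _ psi])

lemma test_approx_0: "0 < p ==> test_approx p (%x. 0)"
  using test_approx_lin[OF _ test_approx_test test_approx_test,
      OF _ _ test_function_bump[of 1 "1/4" "1/2"] _ test_function_bump[of 1 "1/4" "1/2"], of p 0 0] by simp

text \<open>Dynkin's argument: open intervals are limits of bumps, and linearity with dominated
  convergence gives stability under complements and disjoint unions.\<close>

lemma test_approx_indicator:
  assumes p: "0 < p" and "A \<in> sets borel"
  shows "test_approx p (indicator A :: real => real)"
proof -
  let ?G = "range (%(a, b). box a b :: real set)"
  have one: "(%_. 1 :: real) \<in> Lp_space M p" by (intro Lp_bounded[where C = 1] p) auto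
  have meas[measurable]: "indicator A \<in> borel_measurable M" if "A \<in> sets borel" for A
    using that by (intro measurable_M) auto
  have ival: "test_approx p (indicator (box a b) :: real => real)" for a b proof -
    define a' b' where "a' = max a 0" and "b' = min b 1"
    show ?thesis proof (cases "a' < b'")
      case True
      have "0 <= a'" "b' <= 1" by (auto simp: a'_def b'_def)
      then obtain psi where psi: "!!n. test_function (psi n)" "!!n x. 0 <= psi n x" "!!n x. psi n x <= (1::real)"
        "!!x. (%n. psi n x) ----> indicator {a'<..<b'} x" using bump_sequence[OF _ True] by metis
      have "(%n. psi n x) ----> indicator (box a b) x" if "x \<in> space M" for x proof -
        have "indicator (box a b) x = (indicator {a'<..<b'} x :: real)"
          using that unfolding space_M by (auto simp: a'_def b'_def box_real indicator_def)
        thus ?thesis using psi(4)[of x] by simp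
      qed
      hence lim: "AE x in M. (%n. psi n x) ----> indicator (box a b) x" by (rule AE_I2)
      have "norm (psi n x) <= norm (1::real)" for n x using psi(2,3)[of n x] by simp
      hence le: "AE x in M. norm (psi n x) <= norm (1::real)" for n by (intro AE_I2)
      show ?thesis by (rule test_approx_limit_dominated[where u = psi and f = "indicator (box a b)",
              OF p test_approx_test[OF p psi(1)] meas one lim le]) simp
    next
      case False
      hence "indicator (box a b) x = (0::real)" if "x \<in> space M" for x proof -
        have "x \<notin> box a b" proof
          assume "x \<in> box a b"
          hence "a' < x" "x < b'" using that unfolding space_M by (auto simp: a'_def b'_def)
          thus False using False by simp
        qed
        thus ?thesis by simp
      qed
      thus ?thesis
        by (intro test_approx_limit_dominated[where u = "%_ _. 0" and f = "indicator (box a b)", OF p _ _ one]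
            meas test_approx_0 p) auto
    qed
  qed
  have "Int_stable ?G" proof (rule Int_stableI)
    fix X Y assume "X \<in> ?G" "Y \<in> ?G"
    then obtain a b c d where "X = box a b" "Y = box c d" by auto
    hence "X \<inter> Y = box (max a c) (min b d)" by auto
    thus "X \<inter> Y \<in> ?G" by (auto intro!: image_eqI[of _ _ "(max a c, min b d)"])
  qed
  moreover have "?G \<subseteq> Pow UNIV" by auto
  moreover have "A \<in> sigma_sets UNIV ?G" using assms(2) by (simp add: borel_eq_box)
  ultimately show ?thesis proof (induction rule: sigma_sets_induct_disjoint)
    case (basic A)
    thus ?case using ival by auto
  next
    case empty
    thus ?case using test_approx_0[OF p] by (simp add: indicator_def)
  next
    case (compl A)
    \<comment> \<open>On the space (0,1) the indicator of \<open>box (-1) 2\<close> is the constant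
      1, already known to be approximable.\<close>
    have "test_approx p (%x. 1 * indicator (box (-1) 2) x + (-1) * indicator A x)"
      by (intro test_approx_lin p ival compl)
    moreover have "A \<in> sets borel" using compl(1) by (simp add: borel_eq_box)
    ultimately show ?case
      by (intro test_approx_limit_dominated[where f = "indicator (UNIV - A)", OF p _ _ one, of "%_ x. 1 * indicator (box (-1) 2) x + (-1) * indicator A x"] meas)
         (auto simp: space_M box_real indicator_def)
  next
    case (union A)
    have A: "A n \<in> sets borel" for n using union(2) by (auto simp: borel_eq_box)
    have fin: "test_approx p (%x. \<Sum>i<n. indicator (A i) x)" for n proof (induction n)
      case 0
      thus ?case using test_approx_0[OF p] by simp
    next
      case (Suc n)
      thus ?case using test_approx_lin[OF p Suc union(3)[of n], of 1 1] by simp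
    qed
    have lim: "(%n. \<Sum>i<n. indicator (A i) x) ----> (indicator (\<Union>i. A i) x :: real)" for x
      using indicator_sums[of A x] union(1) by (auto simp: sums_def disjoint_family_on_def)
    have "(\<Sum>i<n. indicator (A i) x :: real) = indicator (\<Union>i<n. A i) x" for n x
      using union(1) by (subst indicator_UN_disjoint) (auto simp: disjoint_family_on_def)
    thus ?case using A lim
      by (intro test_approx_limit_dominated[where u = "%n x. \<Sum>i<n. indicator (A i) x" and f = "indicator (\<Union>i. A i)",
            OF p fin _ one] meas) auto
  qed
qed

lemma test_dense:
  assumes p: "0 < p" and f: "f \<in> Lp_space M p"
  shows "test_approx p f"
proof -
  obtain F where F: "!!i. simple_function M (F i)" "!!x. x \<in> space M ==> (%i. F i x) ----> f x"
    "!!i x. x \<in> space M ==> dist (F i x) 0 <= 2 * dist (f x) 0"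
    using borel_measurable_implies_sequence_metric[OF Lp_spaceD(1)[OF f], of 0] by blast
  show ?thesis proof (rule test_approx_limit_dominated[OF p _ Lp_spaceD(1)[OF f] Lp_scale(1)[OF f, of 2]])
    show "AE x in M. (%i. F i x) ----> f x" using F(2) by auto
    show "AE x in M. norm (F i x) <= norm (2 *\<^sub>R f x)" for i
      using F(3)[of _ i] by (intro AE_I2) (simp add: abs_mult)
    fix i
    have fin: "finite (F i ` space M)" using F(1) by (rule simple_functionD)
    have sets: "F i -` {y} \<inter> space M \<in> sets borel" for y
      using simple_functionD(2)[OF F(1)[of i], of "{y}"] by (simp add: sets_M_iff)
    have "test_approx p (%x. \<Sum>y\<in>Y. y * indicator (F i -` {y} \<inter> space M) x)" if "finite Y" for Y
      using that proof induction
      case empty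
      thus ?case using test_approx_0[OF p] by simp
    next
      case (insert y Y)
      have "test_approx p (%x. y * indicator (F i -` {y} \<inter> space M) x
          + 1 * (\<Sum>y\<in>Y. y * indicator (F i -` {y} \<inter> space M) x))"
        by (intro test_approx_lin p test_approx_indicator sets insert.IH)
      thus ?case unfolding sum.insert[OF insert.hyps] mult_1 .
    qed
    from this[OF fin] have *: "test_approx p (%x. \<Sum>y\<in>F i ` space M. y * indicator (F i -` {y} \<inter> space M) x)" .
    have "(\<Sum>y\<in>F i ` space M. y * indicator (F i -` {y} \<inter> space M) x) = F i x" if "x \<in> space M" for x
      using that fin by (subst sum.remove[of _ "F i x"]) (auto intro!: sum.neutral simp: indicator_def)
    thus "test_approx p (F i)"
      by (intro test_approx_limit_dominated[OF p * borel_measurable_simple_function[OF F(1)] test_approx_Lp[OF *]]) auto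
  qed
qed

end

section \<open>Weak derivatives\<close>

lemma locally_integrable_test:
  fixes g :: "real => 'a::{banach,second_countable_topology}"
  assumes "locally_integrable g" "test_function psi"
  shows "set_integrable lborel {0<..<1} (%x. psi x *\<^sub>R g x)"
proof -
  obtain a b where ab: "0 < a" "a < b" "b < 1" "!!x. x \<notin> {a..b} ==> psi x = 0"
    using assms(2) by (rule test_functionE) blast
  obtain C where C: "!!x. \<bar>psi x\<bar> <= C" using test_function_bounded[OF assms(2)] by blast
  have i: "set_integrable lborel {a..b} g" using assms(1) ab by (auto simp: locally_integrable_def)
  have [measurable]: "psi \<in> borel_measurable borel" using assms(2) by (rule test_function_cont)
  have "integrable lborel (%x. psi x *\<^sub>R (indicator {a..b} x *\<^sub>R g x))"
  proof (rule Bochner_Integration.integrable_bound)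
    show "integrable lborel (%x. C *\<^sub>R (indicator {a..b} x *\<^sub>R g x))"
      using i unfolding set_integrable_def by (rule integrable_scaleR_right)
    show "(%x. psi x *\<^sub>R indicator {a..b} x *\<^sub>R g x) \<in> borel_measurable lborel"
      using borel_measurable_integrable[OF i[unfolded set_integrable_def]]
      by (intro borel_measurable_scaleR[where f = psi]) simp_all
    show "AE x in lborel. norm (psi x *\<^sub>R indicator {a..b} x *\<^sub>R g x) <= norm (C *\<^sub>R indicator {a..b} x *\<^sub>R g x)"
      using C by (intro AE_I2) (auto simp: indicator_def intro!: mult_right_mono intro: order_trans[OF C abs_ge_self])
  qed
  moreover have "psi x *\<^sub>R (indicator {a..b} x *\<^sub>R g x) = indicator {0<..<1} x *\<^sub>R (psi x *\<^sub>R g x)" for x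
    using ab by (cases "x \<in> {a..b}") (auto simp: indicator_def)
  ultimately show ?thesis unfolding set_integrable_def by (simp only:)
qed

text \<open>Dominated convergence along bumps shows that \<open>g\<close> has integral 0 over every
  open interval with closure in (0,1); Dynkin's argument extends this to Borel sets, where
  \<open>density_zero\<close> applies.\<close>

lemma AE_zero_of_test:
  fixes g :: "real => real"
  assumes li: "locally_integrable g"
    and z: "!!psi. test_function psi ==> (LINT x:{0<..<1}|lborel. psi x *\<^sub>R g x) = 0"
  shows "AE x in lborel. x \<in> {0<..<1} --> g x = 0"
proof -
  have ival: "(LINT x:{a<..<b}|lborel. g x) = 0" if ab: "0 < a" "a < b" "b < 1" for a b proof -
    obtain psi :: "nat => real => real" where psi: "!!n. test_function (psi n)" "!!n x. 0 <= psi n x" "!!n x. psi n x <= 1"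
      "!!n x. x \<notin> {a<..<b} ==> psi n x = 0"
      "!!x. (%n. psi n x) ----> indicator {a<..<b} x" using bump_sequence[of a b] ab by (metis less_imp_le)
    have i: "integrable lborel (%x. indicator {a..b} x *\<^sub>R g x)"
      using li ab by (auto simp: locally_integrable_def set_integrable_def)
    note [measurable] = borel_measurable_integrable[OF i]
    have [measurable]: "psi n \<in> borel_measurable borel" for n using psi(1) by (rule test_function_cont)
    have eq: "indicator {0<..<1} x *\<^sub>R psi n x *\<^sub>R g x = psi n x *\<^sub>R (indicator {a..b} x *\<^sub>R g x)" for n x
      using psi(4)[of x n] ab by (cases "x \<in> {a<..<b}") (auto simp: indicator_def)
    have eq': "indicator {a<..<b} x *\<^sub>R g x = indicator {a<..<b} x *\<^sub>R (indicator {a..b} x *\<^sub>R g x)" for x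
      by (auto simp: indicator_def)
    have "(%n. LINT x:{0<..<1}|lborel. psi n x *\<^sub>R g x) ----> (LINT x:{a<..<b}|lborel. g x)"
      unfolding set_lebesgue_integral_def eq eq'
    proof (rule integral_dominated_convergence[where w = "%x. norm (indicator {a..b} x *\<^sub>R g x)"])
      show "AE x in lborel. (%n. psi n x *\<^sub>R indicator {a..b} x *\<^sub>R g x)
          ----> indicator {a<..<b} x *\<^sub>R indicator {a..b} x *\<^sub>R g x"
        by (intro AE_I2 tendsto_scaleR tendsto_const psi)
      show "AE x in lborel. norm (psi n x *\<^sub>R indicator {a..b} x *\<^sub>R g x) <= norm (indicator {a..b} x *\<^sub>R g x)" for n
        using psi(2,3)[of n] by (intro AE_I2) (auto simp: abs_mult intro: mult_left_le_one_le)
    qed (use i in auto)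
    thus ?thesis using z[OF psi(1)] by (simp add: LIMSEQ_const_iff)
  qed
  have sub: "AE x in lborel. indicator {a<..<b} x *\<^sub>R g x = 0" if ab: "0 < a" "a < b" "b < 1" for a b
  proof (rule sigma_finite_measure.density_zero[OF sigma_finite_lborel])
    let ?f = "%x. indicator {a<..<b} x *\<^sub>R g x"
    have "set_integrable lborel {a..b} g" using li ab by (auto simp: locally_integrable_def)
    hence "set_integrable lborel {a<..<b} g" by (rule set_integrable_subset) auto
    thus i: "integrable lborel ?f" by (simp add: set_integrable_def)
    have si: "set_integrable lborel A ?f" if "A \<in> sets lborel" for A
      unfolding set_integrable_def using integrable_mult_indicator[OF that i] .
    fix A :: "real set" assume "A \<in> sets lborel"
    hence A: "A \<in> sigma_sets UNIV (range (%(a, b). box a b :: real set))" by (simp add: borel_eq_box)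
    have st: "Int_stable (range (%(a, b). box a b :: real set))" proof (rule Int_stableI)
      fix X Y assume "X \<in> range (%(a, b). box a b :: real set)" "Y \<in> range (%(a, b). box a b :: real set)"
      then obtain a b c d where "X = box a b" "Y = box c d" by auto
      hence "X \<inter> Y = box (max a c) (min b d)" by auto
      thus "X \<inter> Y \<in> range (%(a, b). box a b)" by (auto intro!: image_eqI[of _ _ "(max a c, min b d)"])
    qed
    have ss: "sigma_sets UNIV (range (%(a, b). box a b :: real set)) = sets lborel"
      by (simp add: borel_eq_box)
    have sub: "range (%(a, b). box a b :: real set) \<subseteq> Pow UNIV" by auto
    from st sub A show "(LINT x:A|lborel. ?f x) = 0" proof (induction rule: sigma_sets_induct_disjoint)
      case (basic A)
      then obtain c d where A: "A = box c d" by auto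
      have *: "indicator A x *\<^sub>R ?f x = indicator {max a c<..<min b d} x *\<^sub>R g x" for x
        by (auto simp: A box_real indicator_def)
      show ?case using ival[of "max a c" "min b d"] ab
        by (cases "max a c < min b d") (auto simp only: set_lebesgue_integral_def *, auto)
    next
      case empty
      thus ?case by (simp add: set_lebesgue_integral_def)
    next
      case (compl A)
      have A: "A \<in> sets lborel" using compl(1) unfolding ss .
      have "(LINT x:UNIV|lborel. ?f x) = 0" using ival[OF ab] by (simp add: set_lebesgue_integral_def)
      moreover have "(LINT x:UNIV|lborel. ?f x) = (LINT x:A|lborel. ?f x) + (LINT x:UNIV - A|lborel. ?f x)"
        using set_integral_Un[of A "UNIV - A" lborel ?f] si[OF A] si[of "UNIV - A"] A by auto
      ultimately show ?case using compl(2) by simp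
    next
      case (union A)
      have A: "A n \<in> sets lborel" for n using union(2) unfolding ss by auto
      have "(LINT x:(\<Union>i. A i)|lborel. ?f x) = (\<Sum>i. (LINT x:(A i)|lborel. ?f x))"
        using A union(1) by (intro lebesgue_integral_countable_add si) (auto simp: disjoint_family_on_def)
      thus ?case using union(3) by simp
    qed
  qed
  define u :: "nat => real" where "u n = inverse (real (Suc (Suc (Suc n))))" for n
  have u: "0 < u n" "u n < 1/2" for n by (auto simp: u_def divide_simps)
  have "AE x in lborel. \<forall>n. indicator {u n<..<1 - u n} x *\<^sub>R g x = 0"
    unfolding AE_all_countable using u by (intro allI sub) (auto simp: field_simps)
  thus ?thesis proof eventually_elim
    fix x assume *: "\<forall>n. indicator {u n<..<1 - u n} x *\<^sub>R g x = 0"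
    show "x \<in> {0<..<1} --> g x = 0" proof
      assume x: "x \<in> {0<..<1::real}"
      hence "0 < min x (1 - x)" by auto
      then obtain n where "inverse (real (Suc n)) < min x (1 - x)" using reals_Archimedean by blast
      moreover have "u n <= inverse (real (Suc n))" by (simp add: u_def)
      ultimately have "x \<in> {u n<..<1 - u n}" by auto
      thus "g x = 0" using spec[OF *, of n] by simp
    qed
  qed
qed

text \<open>The primitive starting at 0 vanishes to the left of the support, and to the right of it
  because the total integral is 0.\<close>

lemma test_function_antideriv:
  assumes theta: "test_function theta" and int0: "(LINT x:{0<..<1}|lborel. theta x) = 0"
  obtains psi where "test_function psi" "deriv psi = theta" proof -
  obtain a b where ab: "0 < a" "a < b" "b < 1" "!!x. x \<notin> {a..b} ==> theta x = 0"
    using theta by (rule test_functionE) blast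
  have cont: "continuous_on A theta" for A using theta by (rule test_function_cont)
  have int: "theta integrable_on {c..d}" for c d using cont by (intro integrable_continuous_real)
  define psi where "psi x = integral {0..x} theta" for x
  have zero: "integral {c..d} theta = 0" if "d <= a \<or> b <= c" for c d
  proof (rule integral_unique, rule has_integral_spike_finite[of "{a, b}"])
    show "theta x = 0" if "x \<in> {c..d} - {a, b}" for x
      using that \<open>d <= a \<or> b <= c\<close> by (intro ab(4)) auto
  qed (auto intro: has_integral_0)
  have "set_integrable lborel {0..1} theta" using cont by (intro borel_integrable_atLeastAtMost') auto
  hence "(LINT x:{0..1}|lborel. theta x) = integral {0..1} theta" by (intro set_borel_integral_eq_integral)
  moreover have "(LINT x:{0..1}|lborel. theta x) = (LINT x:{0<..<1}|lborel. theta x)"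
    unfolding set_lebesgue_integral_def
    using ab by (intro Bochner_Integration.integral_cong refl) (auto simp: indicator_def)
  ultimately have i01: "integral {0..1} theta = 0" using int0 by simp
  have b0: "psi x = 0" if "b <= x" for x proof -
    have "integral {0..b} theta + integral {b..1} theta = integral {0..1} theta"
      using ab int by (intro Henstock_Kurzweil_Integration.integral_combine) auto
    hence "integral {0..b} theta = 0" using zero[of 1 b] i01 by simp
    moreover have "integral {0..b} theta + integral {b..x} theta = integral {0..x} theta"
      using ab int that by (intro Henstock_Kurzweil_Integration.integral_combine) auto
    ultimately show ?thesis using zero[of x b] by (simp add: psi_def)
  qed
  have a0: "psi x = 0" if "x <= a" for x using zero[of x 0] that by (simp add: psi_def)
  have deriv: "DERIV psi x :> theta x" for x proof (cases "x < a")
    case True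
    have "DERIV (%_. 0) x :> 0" by simp
    hence "DERIV psi x :> 0" by (rule DERIV_transform_open[where S = "{..<a}"]) (use True a0 in auto)
    thus ?thesis using ab(4)[of x] True by simp
  next
    case False
    hence x: "0 < x" using ab by simp
    have "((%u. integral {0..u} theta) has_real_derivative theta x) (at x within {0..x + 1})"
      using x cont by (intro integral_has_real_derivative) auto
    hence "((%u. integral {0..u} theta) has_real_derivative theta x) (at x within {0<..<x + 1})"
      by (rule has_field_derivative_subset) auto
    thus ?thesis using x by (simp add: psi_def[abs_def] at_within_open[of x "{0<..<x + 1}"])
  qed
  have d: "deriv psi = theta" by (intro ext DERIV_imp_deriv deriv)
  have "smooth_fun psi" proof (rule smooth_funI[where A = "{psi} \<union> {g. smooth_fun g}"])
    show "deriv g \<in> {psi} \<union> {g. smooth_fun g}" if "g \<in> {psi} \<union> {g. smooth_fun g}" for g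
      using that d test_function_smooth[OF theta] smooth_fun_deriv by auto
    show "g differentiable (at x)" if "g \<in> {psi} \<union> {g. smooth_fun g}" for g x
      using that deriv smooth_fun_differentiable(1) real_differentiable_def by blast
  qed auto
  hence "test_function psi"
    unfolding test_function_iff using a0 b0 ab(1,3) by (intro conjI exI[of _ a] exI[of _ b]) auto
  thus thesis using d by (rule that)
qed

lemma locally_integrable_const: "locally_integrable (%_. c :: real)"
  unfolding locally_integrable_def set_integrable_def
  by (auto intro!: integrable_mult_left simp: emeasure_lborel_Icc_eq)

text \<open>A test function minus the multiple of a fixed bump \<open>rho\<close> with the same
  integral is the derivative of a test function. Hence \<open>f\<close> minus its
  \<open>rho\<close>-average annihilates all test functions.\<close>

lemma AE_const_of_test:
  fixes f :: "real => real"
  assumes li: "locally_integrable f"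
    and z: "!!psi. test_function psi ==> (LINT x:{0<..<1}|lborel. deriv psi x *\<^sub>R f x) = 0"
  shows "\<exists>c. AE x in lborel. x \<in> {0<..<1} --> f x = c"
proof -
  define I where "I psi = (LINT x:{0<..<1}|lborel. psi x)" for psi :: "real => real"
  define rho where "rho = bump 1 (1/4) (3/4 :: real)"
  have rho: "test_function rho" unfolding rho_def by (intro test_function_bump) auto
  have ti: "set_integrable lborel {0<..<1} psi" if "test_function psi" for psi
    using locally_integrable_test[OF locally_integrable_const[of 1] that] by simp
  have "I rho ~= 0" proof
    assume "I rho = 0"
    hence "AE x in lborel. indicator {0<..<1} x *\<^sub>R rho x = 0"
      unfolding I_def set_lebesgue_integral_def
      using ti[OF rho] by (subst (asm) integral_nonneg_eq_0_iff_AE) (auto simp: set_integrable_def rho_def bump_bounds)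
    hence "AE x in lborel. x \<notin> {1/4<..<3/4::real}" proof eventually_elim
      case (elim x)
      show ?case proof
        assume x: "x \<in> {1/4<..<3/4::real}"
        hence "0 < rho x" unfolding rho_def by (intro bump_pos) auto
        thus False using elim x by auto
      qed
    qed
    hence "emeasure lborel {1/4<..<3/4::real} = 0"
      by (subst (asm) AE_iff_measurable[where N = "{1/4<..<3/4}"]) (auto simp del: emeasure_lborel_Ioo)
    thus False by simp
  qed
  define c where "c = (LINT x:{0<..<1}|lborel. rho x *\<^sub>R f x) / I rho"
  have "AE x in lborel. x \<in> {0<..<1} --> f x - c = 0" proof (rule AE_zero_of_test)
    show "locally_integrable (%x. f x - c)"
      using li locally_integrable_const[of c] unfolding locally_integrable_def by (auto intro: set_integral_diff)
    fix psi assume psi: "test_function psi"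
    define t where "t = I psi / I rho"
    define theta where "theta x = 1 * psi x + (- t) * rho x" for x
    have theta: "test_function theta" unfolding theta_def by (intro test_function_lin psi rho)
    have "I theta = I psi - t * I rho" unfolding I_def theta_def using ti[OF psi] ti[OF rho] by simp
    hence "(LINT x:{0<..<1}|lborel. theta x) = 0" using \<open>I rho ~= 0\<close> by (simp add: t_def I_def)
    then obtain Psi where "test_function Psi" "deriv Psi = theta"
      using test_function_antideriv[OF theta] by blast
    hence "(LINT x:{0<..<1}|lborel. theta x *\<^sub>R f x) = 0" using z[of Psi] by simp
    moreover have "(LINT x:{0<..<1}|lborel. theta x *\<^sub>R f x)
        = (LINT x:{0<..<1}|lborel. psi x *\<^sub>R f x) - t * (LINT x:{0<..<1}|lborel. rho x *\<^sub>R f x)"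
      using locally_integrable_test[OF li psi] locally_integrable_test[OF li rho]
      by (simp add: theta_def algebra_simps)
    moreover have "t * (LINT x:{0<..<1}|lborel. rho x *\<^sub>R f x) = c * I psi" by (simp add: t_def c_def)
    ultimately have "(LINT x:{0<..<1}|lborel. psi x *\<^sub>R f x) = c * I psi" by simp
    thus "(LINT x:{0<..<1}|lborel. psi x *\<^sub>R (f x - c)) = 0"
      using locally_integrable_test[OF li psi] ti[OF psi] by (simp add: algebra_simps I_def)
  qed
  thus ?thesis by (auto intro!: exI[of _ c])
qed

section \<open>A smooth Bellman function\<close>

text \<open>With \<open>P = (u\<^sup>2 + eps) powr (p/2)\<close>, \<open>W = (v\<^sup>2 + eps) powr (q/2)\<close> and \<open>a = 1 - 2/p\<close>, the function is
  \<open>(u\<^sup>2 + eps) * (P + W) powr a + K * W\<close>, a smooth substitute for the Nazarov--Treil function: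
  its Hessian dominates \<open>A x\<^sup>2 + y\<^sup>2 / A\<close> with \<open>A = (P + W) powr a\<close>.\<close>

locale bellman =
  fixes p q eps :: real
  assumes p: "2 <= p" and pq: "1 / p + 1 / q = 1" and eps: "0 < eps"
begin

definition "a = 1 - 2 / p"
definition "K = 24 / (q * (q - 1))"
definition "SS u = u\<^sup>2 + eps"
definition "UU u = SS u powr (p / 2 - 1)"
definition "RR v = SS v powr (q / 2 - 1)"
definition "NN u v = SS u * UU u + SS v * RR v"
definition "BB u v = NN u v powr (a - 1)"
definition "Q u v = SS u * (NN u v * BB u v) + K * (SS v * RR v)"
definition "Qu u v = u * BB u v * (p * (SS u * UU u) + 2 * (SS v * RR v))"
definition "Qv u v = q * v * RR v * (a * SS u * BB u v + K)"
definition "Quu u v = BB u v * (p * (SS u * UU u) + 2 * (SS v * RR v))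
  + p * u\<^sup>2 * UU u * (BB u v / NN u v) * ((a - 1) * (p * (SS u * UU u) + 2 * (SS v * RR v)) + p * NN u v)"
definition "Quv u v = u * v * q * RR v * (BB u v / NN u v) * (2 * a * (SS v * RR v))"
definition "Qvv u v = q * (RR v / SS v) * (a * SS u * BB u v + K) * (SS v + (q - 2) * v\<^sup>2)
  + a * (a - 1) * q\<^sup>2 * v\<^sup>2 * (RR v)\<^sup>2 * SS u * (BB u v / NN u v)"

lemma q: "1 < q" "q <= 2"
proof -
  have "q = 1 + 1 / (p - 1)" using p pq by (cases "q = 0") (auto simp: field_simps)
  moreover have "0 < 1 / (p - 1)" "1 / (p - 1) <= 1" using p by auto
  ultimately show "1 < q" "q <= 2" by linarith+
qed

lemma a: "0 <= a" "a < 1" "(a - 1) * p = - 2" "a * p = p - 2" "1 - 2 / q = - a"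
proof -
  have "1 / q = 1 - 1 / p" using pq by simp
  thus "1 - 2 / q = - a" by (simp add: a_def)
qed (use p in \<open>auto simp: a_def field_simps\<close>)

lemma K: "0 < K" "q * (q - 1) * K = 24"
  using q by (auto simp: K_def)

lemma SS_pos: "0 < SS u" using eps by (simp add: SS_def add_nonneg_pos)
lemma UU_pos: "0 < UU u" using SS_pos[of u] by (simp add: UU_def)
lemma RR_pos: "0 < RR u" using SS_pos[of u] by (simp add: RR_def)
lemma NN_pos: "0 < NN u v" unfolding NN_def using SS_pos UU_pos RR_pos by (simp add: add_pos_pos)
lemma BB_pos: "0 < BB u v" using NN_pos[of u v] by (simp add: BB_def)

lemmas pos = SS_pos UU_pos RR_pos NN_pos BB_pos
lemmas nz = pos[THEN less_imp_neq, symmetric]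

lemma powr_half: "SS u * UU u = SS u powr (p / 2)" "SS v * RR v = SS v powr (q / 2)"
  using powr_add[of "SS u" 1 "p / 2 - 1"] powr_add[of "SS v" 1 "q / 2 - 1"] SS_pos[of u] SS_pos[of v]
  by (auto simp: UU_def RR_def)

lemma NN_BB: "NN u v * BB u v = NN u v powr a"
  using powr_add[of "NN u v" 1 "a - 1"] NN_pos[of u v] by (auto simp: BB_def)

lemma powr_minus_1: "0 < x ==> x powr (y - of_nat 1) = x powr y / (x :: real)"
  by (simp add: powr_diff)

context
  fixes u v :: "real => real" and u' v' s :: real
  assumes u: "DERIV u s :> u'" and v: "DERIV v s :> v'"
begin

lemma SS_deriv:
  "DERIV (%s. SS (u s)) s :> 2 * u s * u'"
  "DERIV (%s. SS (v s)) s :> 2 * v s * v'" unfolding SS_def by (auto intro!: derivative_eq_intros u v)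

lemma UU_deriv: "DERIV (%s. UU (u s)) s :> (p - 2) * u s * (UU (u s) / SS (u s)) * u'"
  unfolding UU_def by (rule DERIV_cong, rule DERIV_fun_powr[OF SS_deriv(1) SS_pos])
     (use SS_pos[of "u s"] in \<open>subst powr_minus_1, simp, simp add: field_simps\<close>)

lemma RR_deriv: "DERIV (%s. RR (v s)) s :> (q - 2) * v s * (RR (v s) / SS (v s)) * v'"
  unfolding RR_def by (rule DERIV_cong, rule DERIV_fun_powr[OF SS_deriv(2) SS_pos])
     (use SS_pos[of "v s"] in \<open>subst powr_minus_1, simp, simp add: field_simps\<close>)

lemma P_deriv: "DERIV (%s. SS (u s) * UU (u s)) s :> p * u s * UU (u s) * u'"
  by (rule DERIV_cong, rule DERIV_mult[OF SS_deriv(1) UU_deriv])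
     (use SS_pos[of "u s"] in \<open>simp add: field_simps\<close>)

lemma W_deriv: "DERIV (%s. SS (v s) * RR (v s)) s :> q * v s * RR (v s) * v'"
  by (rule DERIV_cong, rule DERIV_mult[OF SS_deriv(2) RR_deriv])
     (use SS_pos[of "v s"] in \<open>simp add: field_simps\<close>)

lemma NN_deriv: "DERIV (%s. NN (u s) (v s)) s :> p * u s * UU (u s) * u' + q * v s * RR (v s) * v'"
  unfolding NN_def by (rule DERIV_add[OF P_deriv W_deriv])

lemma BB_deriv: "((%s. BB (u s) (v s)) has_real_derivative
    (a - 1) * (BB (u s) (v s) / NN (u s) (v s)) * (p * u s * UU (u s) * u' + q * v s * RR (v s) * v')) (at s)"
  unfolding BB_def by (rule DERIV_cong, rule DERIV_fun_powr[OF NN_deriv NN_pos])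
     (use NN_pos[of "u s" "v s"] in \<open>subst powr_minus_1, simp, simp\<close>)

lemma Q_deriv: "DERIV (%s. Q (u s) (v s)) s :> Qu (u s) (v s) * u' + Qv (u s) (v s) * v'"
proof -
  define S U T R N B where "S = SS (u s)" "U = UU (u s)" "T = SS (v s)" "R = RR (v s)"
    "N = NN (u s) (v s)" "B = BB (u s) (v s)"
  note defs = this
  define D where "D = p * u s * U * u' + q * v s * R * v'"
  have N: "N = S * U + T * R" by (simp add: defs NN_def)
  have N0: "N ~= 0" "S ~= 0" using nz by (auto simp: defs)
  have "((%s. Q (u s) (v s)) has_real_derivative
     (2 * u s * u') * (N * B) + (D * B + (a - 1) * (B / N) * D * N) * S + K * (q * v s * R * v')) (at s)"
    unfolding Q_def defs D_def
    by (intro DERIV_add DERIV_mult DERIV_cmult SS_deriv NN_deriv BB_deriv W_deriv)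
  thus ?thesis proof (rule DERIV_cong)
    have "(2 * u s * u') * (N * B) + (D * B + (a - 1) * (B / N) * D * N) * S + K * (q * v s * R * v')
      = 2 * u s * u' * N * B + a * p * (B * u s * U * u' * S) + a * B * q * v s * R * v' * S + K * (q * v s * R * v')"
      using N0 by (simp add: D_def algebra_simps)
    also have "... = Qu (u s) (v s) * u' + Qv (u s) (v s) * v'"
      unfolding a(4) N by (simp add: Qu_def Qv_def defs algebra_simps)
    finally show "(2 * u s * u') * (N * B) + (D * B + (a - 1) * (B / N) * D * N) * S + K * (q * v s * R * v')
      = Qu (u s) (v s) * u' + Qv (u s) (v s) * v'" .
  qed
qed

lemma Qu_deriv: "DERIV (%s. Qu (u s) (v s)) s :> Quu (u s) (v s) * u' + Quv (u s) (v s) * v'"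
proof -
  define S U T R N B where "S = SS (u s)" "U = UU (u s)" "T = SS (v s)" "R = RR (v s)"
    "N = NN (u s) (v s)" "B = BB (u s) (v s)"
  note defs = this
  define D where "D = p * u s * U * u' + q * v s * R * v'"
  have N: "S * U + T * R = N" by (simp add: defs NN_def)
  have N0: "N ~= 0" "S ~= 0" using nz by (auto simp: defs)
  have "((%s. Qu (u s) (v s)) has_real_derivative
     (u' * B + (a - 1) * (B / N) * D * u s) * (p * (S * U) + 2 * (T * R))
     + (p * (p * u s * U * u') + 2 * (q * v s * R * v')) * (u s * B)) (at s)" unfolding Qu_def defs D_def
    by (intro DERIV_add DERIV_mult DERIV_cmult P_deriv BB_deriv W_deriv u)
  thus ?thesis proof (rule DERIV_cong)
    \<comment> \<open>Since \<open>(a - 1) * p = - 2\<close>, the part with P cancels and only W is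
      left in the mixed derivative.\<close>
    have 1: "(a - 1) * (p * (S * U) + 2 * (T * R)) + 2 * N = 2 * a * (T * R)" proof -
      have "(a - 1) * (p * (S * U) + 2 * (T * R)) = ((a - 1) * p) * (S * U) + 2 * (a - 1) * (T * R)"
        by (simp add: algebra_simps)
      thus ?thesis unfolding a(3) N[symmetric] by (simp add: algebra_simps)
    qed
    have "(u' * B + (a - 1) * (B / N) * D * u s) * (p * (S * U) + 2 * (T * R))
       + (p * (p * u s * U * u') + 2 * (q * v s * R * v')) * (u s * B)
      = (B * (p * (S * U) + 2 * (T * R)) + p * (u s)\<^sup>2 * U * (B / N) * ((a - 1) * (p * (S * U) + 2 * (T * R)) + p * N)) * u'
       + (u s * v s * q * R * (B / N) * ((a - 1) * (p * (S * U) + 2 * (T * R)) + 2 * N)) * v'"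
      using N0 by (simp add: D_def field_simps power2_eq_square)
    also have "... = Quu (u s) (v s) * u' + Quv (u s) (v s) * v'"
      unfolding 1 by (simp add: Quu_def Quv_def defs)
    finally show "(u' * B + (a - 1) * (B / N) * D * u s) * (p * (S * U) + 2 * (T * R))
       + (p * (p * u s * U * u') + 2 * (q * v s * R * v')) * (u s * B)
      = Quu (u s) (v s) * u' + Quv (u s) (v s) * v'" .
  qed
qed

lemma Qv_deriv: "DERIV (%s. Qv (u s) (v s)) s :> Quv (u s) (v s) * u' + Qvv (u s) (v s) * v'"
proof -
  define S U T R N B where "S = SS (u s)" "U = UU (u s)" "T = SS (v s)" "R = RR (v s)"
    "N = NN (u s) (v s)" "B = BB (u s) (v s)"
  note defs = this
  define D where "D = p * u s * U * u' + q * v s * R * v'"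
  have N: "S * U + T * R = N" by (simp add: defs NN_def)
  have N0: "N ~= 0" "S ~= 0" "T ~= 0" using nz by (auto simp: defs)
  have "((%s. Qv (u s) (v s)) has_real_derivative
     (q * v' * R + (q - 2) * v s * (R / T) * v' * (q * v s)) * (a * S * B + K)
     + ((a * (2 * u s * u')) * B + (a - 1) * (B / N) * D * (a * S)) * (q * v s * R)) (at s)"
    unfolding Qv_def defs D_def
    by (rule DERIV_cong, (rule DERIV_add DERIV_mult DERIV_cmult SS_deriv RR_deriv BB_deriv DERIV_const u v)+) simp
  thus ?thesis proof (rule DERIV_cong)
    \<comment> \<open>The same cancellation from the other side: both orders of differentiation give
      the one \<open>Quv\<close>.\<close>
    have 1: "a * (2 * N + (a - 1) * p * (S * U)) = 2 * a * (T * R)"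
      unfolding a(3) N[symmetric] by (simp add: algebra_simps)
    have "(q * v' * R + (q - 2) * v s * (R / T) * v' * (q * v s)) * (a * S * B + K)
     + ((a * (2 * u s * u')) * B + (a - 1) * (B / N) * D * (a * S)) * (q * v s * R)
      = (u s * v s * q * R * (B / N) * (a * (2 * N + (a - 1) * p * (S * U)))) * u'
       + (q * (R / T) * (a * S * B + K) * (T + (q - 2) * (v s)\<^sup>2) + a * (a - 1) * q\<^sup>2 * (v s)\<^sup>2 * R\<^sup>2 * S * (B / N)) * v'"
      using N0 by (simp add: D_def field_simps power2_eq_square)
    also have "... = Quv (u s) (v s) * u' + Qvv (u s) (v s) * v'"
      unfolding 1 by (simp add: Quv_def Qvv_def defs)
    finally show "(q * v' * R + (q - 2) * v s * (R / T) * v' * (q * v s)) * (a * S * B + K)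
     + ((a * (2 * u s * u')) * B + (a - 1) * (B / N) * D * (a * S)) * (q * v s * R)
      = Quv (u s) (v s) * u' + Qvv (u s) (v s) * v'" .
  qed
qed

end

text \<open>Monotonicity in the size of \<open>u\<close>. Along the flow the potential and the
  spectral shift multiply \<open>Qu u v * u\<close>, so this gives their contribution a favourable
  sign.\<close>

lemma Qu_sign: "0 <= Qu u v * u"
proof -
  have "Qu u v * u = u\<^sup>2 * BB u v * (p * (SS u * UU u) + 2 * (SS v * RR v))"
    by (simp add: Qu_def power2_eq_square)
  thus ?thesis using pos p by (simp add: less_imp_le)
qed

lemma Qv_sign: "0 <= Qv u v * v"
proof -
  have "Qv u v * v = q * v\<^sup>2 * RR v * (a * SS u * BB u v + K)" by (simp add: Qv_def power2_eq_square)
  thus ?thesis using pos a K q by (simp add: less_imp_le add_nonneg_nonneg)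
qed

text \<open>Roots of \<open>P <= NN\<close> and \<open>W <= NN\<close>. The third bound uses that
  \<open>RR v\<close> is W to the exponent \<open>1 - 2 / q = - a\<close>, which is
  nonpositive.\<close>

lemma powr_le_NN:
  "SS u <= NN u v powr (2 / p)" "SS v <= NN u v powr (2 / q)" "RR v >= NN u v powr (- a)" proof -
  have 1: "SS u powr (p / 2) <= NN u v" "SS v powr (q / 2) <= NN u v"
    using pos unfolding powr_half[symmetric] NN_def by (auto simp: less_imp_le)
  have "SS u = (SS u powr (p / 2)) powr (2 / p)" using pos(1)[of u] p by (simp add: powr_powr)
  also have "... <= NN u v powr (2 / p)" using 1 p by (intro powr_mono2) auto
  finally show "SS u <= NN u v powr (2 / p)" .
  have "SS v = (SS v powr (q / 2)) powr (2 / q)" using pos(1)[of v] q by (simp add: powr_powr)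
  also have "... <= NN u v powr (2 / q)" using 1 q by (intro powr_mono2) auto
  finally show "SS v <= NN u v powr (2 / q)" .
  have "NN u v powr (- a) <= (SS v powr (q / 2)) powr (- a)"
    using 1 a pos(1)[of v] by (intro powr_mono2') auto
  also have "... = RR v" proof -
    have "q / 2 * (1 - 2 / q) = q / 2 - 1" using q(1) by (simp add: field_simps)
    thus ?thesis unfolding a(5)[symmetric] RR_def powr_powr by (simp only:)
  qed
  finally show "RR v >= NN u v powr (- a)" .
qed

lemma Q_bounds: "0 <= Q u v" "Q u v <= (1 + K) * NN u v"
proof -
  show "0 <= Q u v" using pos K by (auto simp: Q_def less_imp_le)
  have "SS u * (NN u v * BB u v) <= NN u v powr (2 / p) * NN u v powr a"
    unfolding NN_BB by (intro mult_right_mono powr_le_NN) auto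
  also have "... = NN u v" using NN_pos[of u v] by (simp add: powr_add[symmetric] a_def)
  finally have "SS u * (NN u v * BB u v) <= NN u v" .
  moreover have "K * (SS v * RR v) <= K * NN u v"
    using K pos by (intro mult_left_mono) (auto simp: NN_def less_imp_le)
  ultimately show "Q u v <= (1 + K) * NN u v" by (simp add: Q_def algebra_simps)
qed

text \<open>Because \<open>p >= 2\<close>, the first summand of \<open>Quu\<close> is at least
  \<open>2 * NN powr a\<close>, and the bracket in the second equals
  \<open>(p - 2) * P + (p - 4 / p) * W\<close>, which is nonnegative.\<close>

lemma Quu_ge: "Quu u v >= 2 * NN u v powr a"
proof -
  let ?P = "SS u * UU u" and ?W = "SS v * RR v"
  have PW: "0 < ?P" "0 < ?W" using pos by auto
  have "2 * NN u v powr a = BB u v * (2 * ?P + 2 * ?W)"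
    unfolding NN_BB[symmetric] by (simp add: NN_def algebra_simps)
  also have "... <= BB u v * (p * ?P + 2 * ?W)"
    using p PW pos by (intro mult_left_mono add_mono mult_right_mono) (auto simp: less_imp_le)
  finally have 1: "2 * NN u v powr a <= BB u v * (p * ?P + 2 * ?W)" .
  have "4 <= p * p" using p mult_mono[of 2 p 2 p] by simp
  hence "0 <= p - 4 / p" using p by (simp add: field_simps)
  moreover have "(a - 1) * (p * ?P + 2 * ?W) + p * NN u v = (p - 2) * ?P + (p - 4 / p) * ?W" proof -
    have "(a - 1) * (p * ?P + 2 * ?W) = (a - 1) * p * ?P + (a - 1) * 2 * ?W" by (simp add: algebra_simps)
    also have "... = - 2 * ?P - 4 / p * ?W" unfolding a(3) by (simp add: a_def)
    finally show ?thesis by (simp add: NN_def algebra_simps)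
  qed
  ultimately have "0 <= (a - 1) * (p * ?P + 2 * ?W) + p * NN u v"
    using p PW by (simp add: add_nonneg_nonneg)
  hence "0 <= p * u\<^sup>2 * UU u * (BB u v / NN u v) * ((a - 1) * (p * ?P + 2 * ?W) + p * NN u v)"
    using p pos by (intro mult_nonneg_nonneg) (auto simp: less_imp_le)
  thus ?thesis using 1 by (simp add: Quu_def)
qed

lemma abs_le_SS: "\<bar>u\<bar> <= SS u powr (1 / 2)" "u\<^sup>2 <= SS u"
proof -
  show "u\<^sup>2 <= SS u" using eps by (simp add: SS_def)
  hence "sqrt (u\<^sup>2) <= sqrt (SS u)" by (intro real_sqrt_le_mono)
  thus "\<bar>u\<bar> <= SS u powr (1 / 2)" using pos(1)[of u] by (simp add: powr_half_sqrt)
qed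

text \<open>Scaling: bounded by powers of \<open>NN\<close>, the factors have exponents
  \<open>1 / p\<close>, \<open>2 - 1 / q\<close> and \<open>a - 2\<close>, whose sum is 0. The
  constant is \<open>2 * a * q <= 4\<close>.\<close>

lemma Quv_le: "\<bar>Quv u v\<bar> <= 4"
proof -
  let ?N = "NN u v"
  have "\<bar>u\<bar> <= (?N powr (2 / p)) powr (1 / 2)"
    using powr_le_NN(1)[of u v] pos(1)[of u] by (intro order_trans[OF abs_le_SS(1)] powr_mono2) auto
  hence u: "\<bar>u\<bar> <= ?N powr (1 / p)" by (simp add: powr_powr)
  have "\<bar>v\<bar> * RR v * (SS v * RR v) <= SS v powr (1 / 2) * RR v * (SS v * RR v)"
    using pos by (intro mult_right_mono abs_le_SS) (auto simp: less_imp_le)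
  also have "... = SS v powr (q - 1 / 2)" unfolding powr_half by (simp add: RR_def powr_add[symmetric])
  also have "... <= (?N powr (2 / q)) powr (q - 1 / 2)"
    using powr_le_NN(2)[of v u] pos(1)[of v] q by (intro powr_mono2) auto
  also have "... = ?N powr (2 - 1 / q)" proof -
    have "2 / q * (q - 1 / 2) = 2 - 1 / q" using q by (simp add: field_simps)
    thus ?thesis unfolding powr_powr by simp
  qed
  finally have v: "\<bar>v\<bar> * RR v * (SS v * RR v) <= ?N powr (2 - 1 / q)" .
  have "BB u v / ?N = ?N powr (a - 2)" using powr_add[of ?N "a - 2" 1] NN_pos[of u v] by (simp add: BB_def)
  hence "\<bar>Quv u v\<bar> = 2 * a * q * (\<bar>u\<bar> * (\<bar>v\<bar> * RR v * (SS v * RR v)) * ?N powr (a - 2))"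
    using pos q a by (simp add: Quv_def abs_mult mult_ac abs_of_pos)
  also have "... <= 2 * a * q * (?N powr (1 / p) * ?N powr (2 - 1 / q) * ?N powr (a - 2))"
    using u v a q pos by (intro mult_left_mono mult_right_mono mult_mono) (auto simp: less_imp_le)
  also have "?N powr (1 / p) * ?N powr (2 - 1 / q) * ?N powr (a - 2) = ?N powr (1 / p + (2 - 1 / q) + (a - 2))"
    by (simp only: powr_add)
  also have "1 / p + (2 - 1 / q) + (a - 2) = 0" using pq by (simp add: a_def)
  also have "?N powr 0 = 1" using NN_pos[of u v] by simp
  also have "2 * a * q * 1 <= 2 * 1 * 2" using mult_mono[of a 1 q 2] a q by (simp add: mult.commute)
  finally show ?thesis by simp
qed

text \<open>The summand with \<open>K\<close> supplies \<open>24 * RR v\<close>. The last summand is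
  nonpositive as \<open>a < 1\<close>; by scaling it is at least \<open>- 4 * NN powr (- a)\<close>,
  because \<open>a * (1 - a) <= 1\<close> and \<open>q <= 2\<close>.\<close>

lemma Qvv_ge: "Qvv u v >= 20 * NN u v powr (- a)"
proof -
  let ?N = "NN u v"
  have "(q - 1) * SS v <= SS v + (q - 2) * v\<^sup>2"
    using mult_left_mono[OF abs_le_SS(2)[of v], of "2 - q"] q by (simp add: algebra_simps)
  hence "q * (RR v / SS v) * (a * SS u * BB u v + K) * ((q - 1) * SS v)
      <= q * (RR v / SS v) * (a * SS u * BB u v + K) * (SS v + (q - 2) * v\<^sup>2)"
    using pos q a K by (intro mult_left_mono mult_nonneg_nonneg add_nonneg_nonneg) (auto simp: less_imp_le)
  moreover have "q * (RR v / SS v) * (a * SS u * BB u v + K) * ((q - 1) * SS v)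
      = q * (q - 1) * RR v * (a * SS u * BB u v) + (q * (q - 1) * K) * RR v"
    using nz(1)[of v] by (simp add: field_simps)
  moreover have "0 <= q * (q - 1) * RR v * (a * SS u * BB u v)" using pos q a by (auto simp: less_imp_le)
  ultimately have 1: "24 * RR v <= q * (RR v / SS v) * (a * SS u * BB u v + K) * (SS v + (q - 2) * v\<^sup>2)"
    unfolding K(2) by linarith
  have "v\<^sup>2 * (RR v)\<^sup>2 <= SS v * (RR v)\<^sup>2" by (intro mult_right_mono abs_le_SS) auto
  also have "... = SS v powr (q - 1)" proof -
    have "(RR v)\<^sup>2 = SS v powr (q - 2)" by (simp add: RR_def power2_eq_square flip: powr_add)
    thus ?thesis using pos(1)[of v] powr_add[of "SS v" 1 "q - 2"] by simp
  qed
  also have "... <= (?N powr (2 / q)) powr (q - 1)"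
    using powr_le_NN(2)[of v u] pos(1)[of v] q by (intro powr_mono2) auto
  also have "... = ?N powr (2 - 2 / q)" using q by (simp add: powr_powr field_simps)
  finally have v: "v\<^sup>2 * (RR v)\<^sup>2 <= ?N powr (2 - 2 / q)" .
  have B: "BB u v / ?N = ?N powr (a - 2)"
    using powr_add[of ?N "a - 2" 1] NN_pos[of u v] by (simp add: BB_def)
  have "v\<^sup>2 * (RR v)\<^sup>2 * SS u * (BB u v / ?N) <= ?N powr (2 - 2 / q) * ?N powr (2 / p) * ?N powr (a - 2)"
    unfolding B using v powr_le_NN(1)[of u v] pos by (intro mult_mono mult_right_mono) (auto simp: less_imp_le)
  also have "... = ?N powr ((2 - 2 / q) + 2 / p + (a - 2))" by (simp only: powr_add)
  also have "(2 - 2 / q) + 2 / p + (a - 2) = - a" using a(5) by (simp add: a_def)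
  finally have 2: "v\<^sup>2 * (RR v)\<^sup>2 * SS u * (BB u v / ?N) <= ?N powr (- a)" .
  have c: "0 <= a * (1 - a) * q\<^sup>2" "a * (1 - a) * q\<^sup>2 <= 1 * 1 * 2\<^sup>2"
    using mult_mono[of "a * (1 - a)" 1 "q\<^sup>2" 4] mult_le_one[of a "1 - a"] power_mono[of q 2 2] a q by simp_all
  have "a * (1 - a) * q\<^sup>2 * (v\<^sup>2 * (RR v)\<^sup>2 * SS u * (BB u v / ?N)) <= (1 * 1 * 2\<^sup>2) * ?N powr (- a)"
    using pos by (intro mult_mono[OF c(2) 2]) (auto simp: less_imp_le)
  hence "a * (a - 1) * q\<^sup>2 * v\<^sup>2 * (RR v)\<^sup>2 * SS u * (BB u v / ?N) >= - 4 * ?N powr (- a)"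
    by (simp add: algebra_simps diff_divide_distrib)
  thus ?thesis using 1 powr_le_NN(3)[of u v] unfolding Qvv_def by linarith
qed

lemma hess_ge:
  "NN u v powr a * x\<^sup>2 + NN u v powr (- a) * y\<^sup>2 <= Quu u v * x\<^sup>2 + 2 * Quv u v * x * y + Qvv u v * y\<^sup>2"
proof -
  define A where "A = NN u v powr a"
  have A: "0 < A" "NN u v powr (- a) = 1 / A" using NN_pos[of u v] by (auto simp: A_def powr_minus divide_simps)
  have 1: "2 * A * x\<^sup>2 <= Quu u v * x\<^sup>2" "20 * (1 / A) * y\<^sup>2 <= Qvv u v * y\<^sup>2"
    using mult_right_mono[OF Quu_ge[of u v], of "x\<^sup>2"] mult_right_mono[OF Qvv_ge[of u v], of "y\<^sup>2"]
    unfolding A(2) A_def[symmetric] by simp_all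
  have "\<bar>2 * Quv u v * x * y\<bar> = 2 * \<bar>Quv u v\<bar> * (\<bar>x\<bar> * \<bar>y\<bar>)" by (simp add: abs_mult)
  also have "... <= 2 * 4 * (\<bar>x\<bar> * \<bar>y\<bar>)"
    using Quv_le[of u v] by (intro mult_right_mono mult_left_mono) auto
  finally have 2: "- 8 * (\<bar>x\<bar> * \<bar>y\<bar>) <= 2 * Quv u v * x * y" by linarith
  have "0 <= (A * \<bar>x\<bar> - 4 * \<bar>y\<bar>)\<^sup>2 / A" using A by simp
  also have "... = A * x\<^sup>2 - 8 * (\<bar>x\<bar> * \<bar>y\<bar>) + 16 * (1 / A) * y\<^sup>2"
    using A by (simp add: power2_diff field_simps power2_eq_square)
  finally have "0 <= A * x\<^sup>2 - 8 * (\<bar>x\<bar> * \<bar>y\<bar>) + 16 * (1 / A) * y\<^sup>2" .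
  moreover have "0 <= 1 / A * y\<^sup>2" using A by simp
  ultimately show ?thesis using 1 2 unfolding A(2) A_def[symmetric] by linarith
qed

text \<open>With A for \<open>NN powr a\<close>,
  \<open>2 * |x1 * y2| <= A * x1^2 + y2^2 / A\<close>, where the first direction pays for
  \<open>x1\<close> and the second for \<open>y2\<close>. In the flow the directions are the space
  and time derivatives, so the product of a space derivative of one function with a time derivative
  of the other is controlled.\<close>

lemma hess_pair:
  "2 * \<bar>x1 * y2\<bar> <= (Quu u v * x1\<^sup>2 + 2 * Quv u v * x1 * y1 + Qvv u v * y1\<^sup>2)
     + (Quu u v * x2\<^sup>2 + 2 * Quv u v * x2 * y2 + Qvv u v * y2\<^sup>2)" proof -
  define A where "A = NN u v powr a"
  have A: "0 < A" "NN u v powr (- a) = 1 / A" using NN_pos[of u v] by (auto simp: A_def powr_minus divide_simps)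
  have "0 <= (A * \<bar>x1\<bar> - \<bar>y2\<bar>)\<^sup>2 / A" using A by simp
  also have "... = A * x1\<^sup>2 - 2 * \<bar>x1 * y2\<bar> + (1 / A) * y2\<^sup>2"
    using A by (simp add: power2_diff field_simps power2_eq_square abs_mult)
  finally have "2 * \<bar>x1 * y2\<bar> <= A * x1\<^sup>2 + (1 / A) * y2\<^sup>2" by simp
  moreover have "0 <= A * x2\<^sup>2" "0 <= (1 / A) * y1\<^sup>2" using A by auto
  ultimately show ?thesis
    using hess_ge[of u v x1 y1] hess_ge[of u v x2 y2] unfolding A(2) A_def[symmetric] by linarith
qed

lemma continuous_Q:
  "continuous_on UNIV (%(u, v). Q u v)" "continuous_on UNIV (%(u, v). Qu u v)"
  "continuous_on UNIV (%(u, v). Qv u v)" "continuous_on UNIV (%(u, v). Quu u v)"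
  "continuous_on UNIV (%(u, v). Quv u v)" "continuous_on UNIV (%(u, v). Qvv u v)" proof -
  have S: "continuous_on UNIV (%z::real \<times> real. SS (fst z))" "continuous_on UNIV (%z::real \<times> real. SS (snd z))"
    unfolding SS_def by (intro continuous_intros)+
  have U: "continuous_on UNIV (%z::real \<times> real. UU (fst z))" "continuous_on UNIV (%z::real \<times> real. RR (snd z))"
    unfolding UU_def RR_def using nz by (intro continuous_on_powr S continuous_on_const ballI; simp)+
  have N: "continuous_on UNIV (%z::real \<times> real. NN (fst z) (snd z))"
    unfolding NN_def by (intro continuous_intros S U)
  have B: "continuous_on UNIV (%z::real \<times> real. BB (fst z) (snd z))"
    unfolding BB_def using nz by (intro continuous_on_powr N continuous_on_const ballI; simp)
  show "continuous_on UNIV (%(u, v). Q u v)" "continuous_on UNIV (%(u, v). Qu u v)"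
    "continuous_on UNIV (%(u, v). Qv u v)" "continuous_on UNIV (%(u, v). Quu u v)"
    "continuous_on UNIV (%(u, v). Quv u v)" "continuous_on UNIV (%(u, v). Qvv u v)"
    unfolding case_prod_beta Q_def Qu_def Qv_def Quu_def Quv_def Qvv_def
    using nz by (intro continuous_intros S U N B ballI; simp)+
qed

end

section \<open>Singular Sturm--Liouville systems on the unit interval\<close>

text \<open>The operator is \<open>f'' + b * f'\<close>, symmetric for the weight \<open>w\<close>;
  \<open>b\<close> is the logarithmic derivative of \<open>w\<close>, and \<open>r = - b'\<close>
  becomes the potential in the equation of the derivatives \<open>e1 n\<close>. Division by the
  ground state has shifted the spectrum, so \<open>e 0 = 1\<close>, while \<open>lam n\<close> is
  the unshifted frequency. By \<open>w_left\<close> and \<open>w_right\<close> the weight decreases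
  towards each end up to the factor \<open>K\<close>; \<open>ends\<close> and the facts on zeros
  serve the comparison argument for completeness.\<close>

locale sturm =
  fixes w b r :: "real => real" and e e1 e2 :: "nat => real => real"
    and lam B :: "nat => real" and K :: real
  assumes w_pos: "x \<in> {0<..<1} ==> 0 < w x"
    and w_deriv: "x \<in> {0<..<1} ==> DERIV w x :> b x * w x"
    and b_deriv: "x \<in> {0<..<1} ==> DERIV b x :> - r x"
    and r_nonneg: "x \<in> {0<..<1} ==> 0 <= r x"
    and w_left: "0 < x ==> x <= y ==> y <= 1/2 ==> w x <= K * w y"
    and w_right: "1/2 <= x ==> x <= y ==> y < 1 ==> w y <= K * w x"
    and b_bound: "x \<in> {0<..<1} ==> \<bar>b x\<bar> * (x * (1 - x)) <= K"
    and e_deriv: "x \<in> {0<..<1} ==> DERIV (e n) x :> e1 n x"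
    and e1_deriv: "x \<in> {0<..<1} ==> DERIV (e1 n) x :> e2 n x"
    and ode: "x \<in> {0<..<1} ==> e2 n x + b x * e1 n x = - ((lam n)\<^sup>2 - (lam 0)\<^sup>2) * e n x"
    and e_0: "x \<in> {0<..<1} ==> e 0 x = 1"
    and e_bound: "x \<in> {0<..<1} ==> \<bar>e n x\<bar> <= B n"
    and flux_e: "((%x. w x * e1 n x) ---> 0) (at_right 0)" "((%x. w x * e1 n x) ---> 0) (at_left 1)"
    and lam_pos: "0 < lam n"
    and lam_mono: "strict_mono lam"
    and lam_at_top: "filterlim lam at_top sequentially"
    and summable_B: "0 < t ==> summable (%n. exp (- (lam n)\<^sup>2 * t) * (B n)\<^sup>2)"
    and zeros_finite: "finite {x \<in> {0<..<1}. e n x = 0}"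
    and zeros_card: "card {x \<in> {0<..<1}. e n x = 0} = n"
    and zeros_simple: "x \<in> {0<..<1} ==> e n x = 0 ==> e1 n x ~= 0"
    and ends: "\<exists>c>0. \<forall>\<^sub>F x in at_right 0. c <= \<bar>e n x\<bar>" "\<exists>c>0. \<forall>\<^sub>F x in at_left 1. c <= \<bar>e n x\<bar>"
    and e_norm: "(\<integral>x. (e n x)\<^sup>2 \<partial>density (restrict_space lborel {0<..<1}) (%x. ennreal (w x))) = 1"
begin

definition M :: "real measure" where
  "M = density (restrict_space lborel {0<..<1}) (%x. ennreal (w x))"

definition kappa :: "nat => real" where "kappa n = (lam n)\<^sup>2 - (lam 0)\<^sup>2"

abbreviation "I \<equiv> {0<..<1::real}"

lemma ev_I: "\<forall>\<^sub>F x in at_right 0. x \<in> I" "\<forall>\<^sub>F x in at_left 1. x \<in> I"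
  by (auto simp: eventually_at_right[of 0 1] eventually_at_left[of 0 1] intro!: exI[of _ "1/2::real"])

lemma sets_M': "sets M = sets (restrict_space borel I)"
  by (simp add: M_def sets_restrict_space)

lemma K_ge_1: "1 <= K"
  using w_left[of "1/4" "1/4"] w_pos[of "1/4"] by simp

definition W where "W = K * w (1/2)"

lemma w_le: "x \<in> I ==> w x <= W"
  using w_left[of x "1/2"] w_right[of "1/2" x] by (cases "x <= 1/2") (auto simp: W_def)

lemma W_pos: "0 < W" using K_ge_1 w_pos[of "1/2"] by (simp add: W_def)

lemma continuous_w: "continuous_on I w"
  by (rule DERIV_cont_on[OF w_deriv]) auto

lemma measurable_w: "w \<in> borel_measurable (restrict_space lborel I)"
  using borel_measurable_continuous_on_restrict[OF continuous_w]
  by (simp add: measurable_def sets_restrict_space space_restrict_space)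

lemma finite_M: "finite_measure M"
proof (rule finite_measureI)
  have "emeasure M (space M) = (\<integral>\<^sup>+x. ennreal (w x) \<partial>restrict_space lborel I)"
    unfolding M_def by (subst emeasure_density)
       (auto intro!: nn_integral_cong measurable_w[THEN measurable_compose, OF measurable_ennreal] simp: sets_restrict_space_iff)
  also have "... <= (\<integral>\<^sup>+x. ennreal W \<partial>restrict_space lborel I)"
    using w_le by (intro nn_integral_mono) (auto simp: space_restrict_space intro!: ennreal_leI)
  also have "... = ennreal W"
    by (simp add: emeasure_restrict_space space_restrict_space sets_restrict_space_iff)
  finally show "emeasure M (space M) ~= \<infinity>" by (auto simp: top_unique)
qed

sublocale unit_interval_measure M
  using finite_M sets_M' by (simp add: unit_interval_measure_def unit_interval_measure_axioms_def)

lemma measurable_M_iff: "f \<in> borel_measurable M \<longleftrightarrow> f \<in> borel_measurable (restrict_space lborel I)"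
  by (intro arg_cong[where f = "%S. f \<in> S"] measurable_cong_sets) (simp_all add: M_def)

lemma AE_M_iff: "(AE x in M. P x) \<longleftrightarrow> (AE x in lborel. x \<in> I --> P x)"
proof -
  have "(AE x in M. P x) \<longleftrightarrow> (AE x in restrict_space lborel I. 0 < ennreal (w x) --> P x)"
    unfolding M_def by (rule AE_density) (intro measurable_compose[OF measurable_w measurable_ennreal])
  also have "... \<longleftrightarrow> (AE x in restrict_space lborel I. P x)"
    by (intro AE_cong) (auto simp: space_restrict_space w_pos)
  also have "... \<longleftrightarrow> (AE x in lborel. x \<in> I --> P x)"
    by (rule AE_restrict_space_iff) simp
  finally show ?thesis .
qed

lemma integral_M:
  fixes f :: "real => real"
  assumes "f \<in> borel_measurable M"
  shows "(LINT x|M. f x) = (LINT x:I|lborel. w x * f x)"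
    and "integrable M f \<longleftrightarrow> set_integrable lborel I (%x. w x * f x)"
proof -
  have AEw: "AE x in restrict_space lborel I. 0 <= w x"
    using w_pos by (intro AE_I2) (auto simp: space_restrict_space less_imp_le)
  show "(LINT x|M. f x) = (LINT x:I|lborel. w x * f x)" unfolding M_def set_lebesgue_integral_def
    using assms AEw measurable_w unfolding measurable_M_iff
    by (subst integral_density) (auto simp: integral_restrict_space)
  show "integrable M f \<longleftrightarrow> set_integrable lborel I (%x. w x * f x)"
    unfolding M_def set_integrable_def using assms AEw measurable_w unfolding measurable_M_iff
    by (subst integrable_density) (auto simp: integrable_restrict_space set_integrable_def)
qed

lemma integrable_bounded:
  fixes f :: "real => real"
  assumes "f \<in> borel_measurable M" "!!x. x \<in> I ==> \<bar>f x\<bar> <= C"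
  shows "integrable M f"
  using assms by (intro integrable_const_bound[where B = C]) (auto simp: space_M)

lemma integral_tendsto_bounded:
  fixes u :: "nat => real => real"
  assumes "!!n. u n \<in> borel_measurable M" "f \<in> borel_measurable M"
    and "!!x. x \<in> I ==> (%n. u n x) ----> f x" "!!n x. x \<in> I ==> \<bar>u n x\<bar> <= C"
  shows "(%n. LINT x|M. u n x) ----> (LINT x|M. f x)"
  using assms by (intro integral_dominated_convergence[where w = "%_. C"]) (auto simp: space_M)

text \<open>The fundamental theorem on compact subintervals, whose boundary terms vanish in the
  limit. Only a bounded minorant \<open>k\<close> of \<open>D\<close> is integrated, as
  \<open>D\<close> may contain an unbounded potential; \<open>S\<close> admits points where
  \<open>A\<close> is merely continuous.\<close>

lemma flux:
  fixes A D k :: "real => real"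
  assumes S: "finite S" and A: "continuous_on I A"
    "!!x. x \<in> I - S ==> DERIV A x :> w x * D x"
    "(A ---> 0) (at_right 0)" "(A ---> 0) (at_left 1)"
    and k: "k \<in> borel_measurable M" "!!x. x \<in> I ==> \<bar>k x\<bar> <= C" "!!x. x \<in> I - S ==> k x <= D x"
  shows "(LINT x|M. k x) <= 0"
proof -
  define alpha beta :: "nat => real" where "alpha n = inverse (real (Suc (Suc (Suc n))))" and "beta n = 1 - alpha n" for n
  have alpha: "0 < alpha n" "alpha n < 1/2" for n by (auto simp: alpha_def divide_simps)
  have alpha': "alpha n ~= 0" for n using alpha(1)[of n] by simp
  have beta: "1/2 < beta n" "beta n < 1" for n using alpha[of n] by (auto simp: beta_def)
  have alpha0: "alpha ----> 0" unfolding alpha_def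
    by (intro LIMSEQ_Suc[OF LIMSEQ_Suc[OF LIMSEQ_inverse_real_of_nat]])
  have beta1: "beta ----> 1" unfolding beta_def using alpha0 tendsto_diff[OF tendsto_const, of alpha 0 sequentially 1] by simp
  have A0: "(%n. A (alpha n)) ----> 0"
    using alpha alpha' alpha0 by (intro filterlim_compose[OF A(3)]) (auto simp: filterlim_at)
  have A1: "(%n. A (beta n)) ----> 0"
    using beta beta1 by (intro filterlim_compose[OF A(4)]) (auto simp: filterlim_at less_imp_neq)
  note [measurable] = k(1)
  have le: "(LINT x|M. k x * indicator {alpha n..beta n} x) <= A (beta n) - A (alpha n)" for n proof -
    have sub: "{alpha n..beta n} \<subseteq> I" using alpha[of n] beta[of n] by auto
    have D: "((%x. w x * D x) has_integral A (beta n) - A (alpha n)) {alpha n..beta n}"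
    proof (rule fundamental_theorem_of_calculus_interior_strong[OF S])
      show "alpha n <= beta n" using alpha[of n] beta[of n] by auto
      show "(A has_vector_derivative w x * D x) (at x)" if "x \<in> {alpha n<..<beta n} - S" for x proof -
        have "x \<in> I - S" using alpha(1)[of n] beta(2)[of n] that by auto
        thus ?thesis using A(2) by (simp add: has_real_derivative_iff_has_vector_derivative)
      qed
      show "continuous_on {alpha n..beta n} A" using A(1) sub by (rule continuous_on_subset)
    qed
    have m: "(%x. k x * indicator {alpha n..beta n} x) \<in> borel_measurable M"
      by (intro borel_measurable_times k measurable_M) auto
    have "integrable M (%x. k x * indicator {alpha n..beta n} x)" proof (rule integrable_bounded[OF m])
      show "\<bar>k x * indicator {alpha n..beta n} x\<bar> <= C" if "x \<in> I" for x
        using k(2)[OF that] by (auto simp: indicator_def)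
    qed
    hence si: "set_integrable lborel I (%x. w x * (k x * indicator {alpha n..beta n} x))"
      using integral_M(2)[OF m] by simp
    have eq: "indicator I x *\<^sub>R (w x * (k x * indicator {alpha n..beta n} x))
        = indicator {alpha n..beta n} x *\<^sub>R (w x * k x)" for x using sub by (auto simp: indicator_def)
    have si': "set_integrable lborel {alpha n..beta n} (%x. w x * k x)"
      using si unfolding set_integrable_def eq .
    have "(LINT x|M. k x * indicator {alpha n..beta n} x) = (LINT x:{alpha n..beta n}|lborel. w x * k x)"
      unfolding integral_M(1)[OF m] set_lebesgue_integral_def eq ..
    also have "... = integral {alpha n..beta n} (%x. w x * k x)"
      by (rule set_borel_integral_eq_integral(2)[OF si'])
    also have "... <= A (beta n) - A (alpha n)" proof (rule has_integral_le)
      have "((%x. w x * k x) has_integral integral {alpha n..beta n} (%x. w x * k x)) {alpha n..beta n}"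
        using set_borel_integral_eq_integral(1)[OF si'] by (rule integrable_integral)
      thus "((%x. if x \<in> S then w x * D x else w x * k x) has_integral
          integral {alpha n..beta n} (%x. w x * k x)) {alpha n..beta n}"
        by (rule has_integral_spike_finite[OF S, rotated]) auto
      show "((%x. w x * D x) has_integral A (beta n) - A (alpha n)) {alpha n..beta n}" by (rule D)
      show "(if x \<in> S then w x * D x else w x * k x) <= w x * D x" if "x \<in> {alpha n..beta n}" for x
      proof -
        have x: "x \<in> I" using sub that by blast
        show ?thesis using k(3)[of x] w_pos[OF x] x by simp
      qed
    qed
    finally show ?thesis .
  qed
  have lim: "(%n. LINT x|M. k x * indicator {alpha n..beta n} x) ----> (LINT x|M. k x)"
  proof (rule integral_tendsto_bounded[where C = C])
    show "(%x. k x * indicator {alpha n..beta n} x) \<in> borel_measurable M" for n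
      by (intro borel_measurable_times k measurable_M) auto
    show "\<bar>k x * indicator {alpha n..beta n} x\<bar> <= C" if "x \<in> I" for n x
      using k(2)[OF that] by (auto simp: indicator_def)
    fix x assume x: "x \<in> I"
    have "\<forall>\<^sub>F n in sequentially. alpha n < x" "\<forall>\<^sub>F n in sequentially. x < beta n"
      using x alpha0 beta1 by (auto intro: order_tendstoD)
    hence "\<forall>\<^sub>F n in sequentially. k x * indicator {alpha n..beta n} x = k x"
      by eventually_elim auto
    thus "(%n. k x * indicator {alpha n..beta n} x) ----> k x" by (rule tendsto_eventually)
  qed (rule k(1))
  show ?thesis proof (rule LIMSEQ_le[OF lim])
    show "(%n. A (beta n) - A (alpha n)) ----> 0" using tendsto_diff[OF A1 A0] by simp
  qed (use le in auto)
qed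

lemma flux_eq:
  fixes A D :: "real => real"
  assumes A: "!!x. x \<in> I ==> DERIV A x :> w x * D x"
    "(A ---> 0) (at_right 0)" "(A ---> 0) (at_left 1)"
    and D: "D \<in> borel_measurable M" "!!x. x \<in> I ==> \<bar>D x\<bar> <= C"
  shows "(LINT x|M. D x) = 0"
proof (rule antisym)
  have c: "continuous_on I A" by (rule DERIV_cont_on[OF A(1)]) auto
  show "(LINT x|M. D x) <= 0" using A D by (intro flux[of "{}" A D D C] c) auto
  have "(LINT x|M. - D x) <= 0" proof (rule flux[of "{}" "%x. - A x" "%x. - D x" "%x. - D x" C])
    show "DERIV (%x. - A x) x :> w x * - D x" if "x \<in> I - {}" for x
      using A(1)[of x] that by (auto intro!: derivative_eq_intros)
    show "((%x. - A x) ---> 0) (at_right 0)" "((%x. - A x) ---> 0) (at_left 1)"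
      using tendsto_minus[OF A(2)] tendsto_minus[OF A(3)] by simp_all
  qed (use c D in \<open>auto intro!: continuous_intros\<close>)
  thus "0 <= (LINT x|M. D x)" by simp
qed

lemma kappa_0: "kappa 0 = 0" by (simp add: kappa_def)

lemma kappa_mono: "m < n ==> kappa m < kappa n"
  using strict_monoD[OF lam_mono, of m n] lam_pos[of m] by (auto simp: kappa_def intro!: power_strict_mono)

lemma kappa_nonneg: "0 <= kappa n" using kappa_mono[of 0 n] kappa_0 by (cases n) auto

lemma kappa_pos: "0 < n ==> 0 < kappa n" using kappa_mono[of 0 n] kappa_0 by auto

lemma B_nonneg: "0 <= B n" using e_bound[of "1/2" n] by auto

lemma we1_deriv: "x \<in> I ==> DERIV (%x. w x * e1 n x) x :> w x * (- kappa n * e n x)"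
proof -
  assume x: "x \<in> I"
  have "DERIV (%x. w x * e1 n x) x :> b x * w x * e1 n x + e2 n x * w x"
    by (rule DERIV_mult[OF w_deriv e1_deriv]) (use x in auto)
  moreover have "e2 n x = - kappa n * e n x - b x * e1 n x" using ode[OF x, of n] by (simp add: kappa_def)
  ultimately show ?thesis by (auto elim!: DERIV_cong simp: algebra_simps)
qed

text \<open>By the mean value theorem: \<open>w * e1 n\<close> has slope
  \<open>- kappa n * w * e n\<close>, where \<open>w\<close> is at most \<open>K * w x\<close> on
  (0,x), and it starts from 0. So \<open>e1 n\<close> vanishes linearly although \<open>b\<close>
  may be singular.\<close>

lemma e1_left: "x \<in> I ==> x <= 1/2 ==> \<bar>e1 n x\<bar> <= kappa n * B n * K * x"
proof -
  assume x: "x \<in> I" "x <= 1/2"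
  let ?C = "kappa n * B n * K * w x"
  have C: "0 <= ?C" using kappa_nonneg B_nonneg K_ge_1 w_pos[OF x(1)] by simp
  have "\<bar>w x * e1 n x - w y * e1 n y\<bar> <= ?C * x" if y: "0 < y" "y < x" for y proof -
    have "\<exists>z>y. z < x & w x * e1 n x - w y * e1 n y = (x - y) * (w z * (- kappa n * e n z))"
      using x y by (intro MVT2 we1_deriv) auto
    then obtain z where z: "y < z" "z < x" "w x * e1 n x - w y * e1 n y = (x - y) * (w z * (- kappa n * e n z))" by blast
    have zI: "z \<in> I" using z x y by auto
    have "\<bar>w z * (- kappa n * e n z)\<bar> = w z * kappa n * \<bar>e n z\<bar>"
      using w_pos[OF zI] kappa_nonneg[of n] by (simp add: abs_mult)
    also have "... <= (K * w x) * kappa n * B n"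
      using w_left[of z x] e_bound[OF zI, of n] kappa_nonneg[of n] w_pos[OF zI] w_pos[OF x(1)] K_ge_1 z y x
      by (intro mult_mono mult_right_mono) auto
    finally have "\<bar>w z * (- kappa n * e n z)\<bar> <= ?C" by (simp add: mult_ac)
    hence "\<bar>w x * e1 n x - w y * e1 n y\<bar> <= (x - y) * ?C"
      using y unfolding z(3) abs_mult by (simp add: mult_left_mono)
    also have "... <= x * ?C" using y C by (intro mult_right_mono) auto
    finally show ?thesis by (simp add: mult.commute)
  qed
  hence ev: "\<forall>\<^sub>F y in at_right 0. \<bar>w x * e1 n x - w y * e1 n y\<bar> <= ?C * x"
    using x by (auto simp: eventually_at_right[of 0 1] intro!: exI[of _ x])
  have "((%y. \<bar>w x * e1 n x - w y * e1 n y\<bar>) ---> \<bar>w x * e1 n x - 0\<bar>) (at_right 0)"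
    by (intro tendsto_intros flux_e)
  hence "\<bar>w x * e1 n x - 0\<bar> <= ?C * x" by (rule tendsto_upperbound[OF _ ev]) simp
  hence "w x * \<bar>e1 n x\<bar> <= w x * (kappa n * B n * K * x)"
    using w_pos[OF x(1)] by (simp add: abs_mult mult_ac)
  thus ?thesis using w_pos[OF x(1)] by simp
qed

lemma e1_right: "x \<in> I ==> 1/2 <= x ==> \<bar>e1 n x\<bar> <= kappa n * B n * K * (1 - x)"
proof -
  assume x: "x \<in> I" "1/2 <= x"
  let ?C = "kappa n * B n * K * w x"
  have C: "0 <= ?C" using kappa_nonneg B_nonneg K_ge_1 w_pos[OF x(1)] by simp
  have "\<bar>w y * e1 n y - w x * e1 n x\<bar> <= ?C * (1 - x)" if y: "x < y" "y < 1" for y proof -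
    have "\<exists>z>x. z < y & w y * e1 n y - w x * e1 n x = (y - x) * (w z * (- kappa n * e n z))"
      using x y by (intro MVT2 we1_deriv) auto
    then obtain z where z: "x < z" "z < y" "w y * e1 n y - w x * e1 n x = (y - x) * (w z * (- kappa n * e n z))" by blast
    have zI: "z \<in> I" using z x y by auto
    have "\<bar>w z * (- kappa n * e n z)\<bar> = w z * kappa n * \<bar>e n z\<bar>"
      using w_pos[OF zI] kappa_nonneg[of n] by (simp add: abs_mult)
    also have "... <= (K * w x) * kappa n * B n"
      using w_right[of x z] e_bound[OF zI, of n] kappa_nonneg[of n] w_pos[OF zI] w_pos[OF x(1)] K_ge_1 z y x
      by (intro mult_mono mult_right_mono) auto
    finally have "\<bar>w z * (- kappa n * e n z)\<bar> <= ?C" by (simp add: mult_ac)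
    hence "\<bar>w y * e1 n y - w x * e1 n x\<bar> <= (y - x) * ?C"
      using y unfolding z(3) abs_mult by (simp add: mult_left_mono)
    also have "... <= (1 - x) * ?C" using y C by (intro mult_right_mono) auto
    finally show ?thesis by (simp add: mult.commute)
  qed
  hence ev: "\<forall>\<^sub>F y in at_left 1. \<bar>w y * e1 n y - w x * e1 n x\<bar> <= ?C * (1 - x)"
    using x by (auto simp: eventually_at_left[of 0 1] intro!: exI[of _ x])
  have "((%y. \<bar>w y * e1 n y - w x * e1 n x\<bar>) ---> \<bar>0 - w x * e1 n x\<bar>) (at_left 1)"
    by (intro tendsto_intros flux_e)
  hence "\<bar>0 - w x * e1 n x\<bar> <= ?C * (1 - x)" by (rule tendsto_upperbound[OF _ ev]) simp
  hence "w x * \<bar>e1 n x\<bar> <= w x * (kappa n * B n * K * (1 - x))"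
    using w_pos[OF x(1)] by (simp add: abs_mult mult_ac)
  thus ?thesis using w_pos[OF x(1)] by simp
qed

text \<open>In units of \<open>kappa n * B n\<close> the summands 1, \<open>2 * K\<close> and
  \<open>2 * K^2\<close> bound \<open>kappa n * e n\<close>, \<open>e1 n\<close> and
  \<open>b * e1 n\<close>; by the equation their sum bounds \<open>e2 n\<close> as well.\<close>

definition D where "D n = kappa n * B n * (1 + 2 * K + 2 * K\<^sup>2)"

lemma D_nonneg: "0 <= D n" using kappa_nonneg B_nonneg K_ge_1 by (simp add: D_def)

lemma e1_bound: "x \<in> I ==> \<bar>e1 n x\<bar> <= D n * (x * (1 - x))"
proof -
  assume x: "x \<in> I"
  have kB: "0 <= kappa n * B n" using kappa_nonneg B_nonneg by simp
  have "\<bar>e1 n x\<bar> <= kappa n * B n * K * (2 * (x * (1 - x)))" proof (cases "x <= 1/2")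
    case True
    have "\<bar>e1 n x\<bar> <= kappa n * B n * K * x" using e1_left[OF x True] .
    also have "... <= kappa n * B n * K * (2 * (x * (1 - x)))"
      using x True kB K_ge_1 by (intro mult_left_mono) (auto simp: field_simps)
    finally show ?thesis .
  next
    case False
    have "\<bar>e1 n x\<bar> <= kappa n * B n * K * (1 - x)" using e1_right[OF x] False by simp
    also have "... <= kappa n * B n * K * (2 * (x * (1 - x)))"
      using x False kB K_ge_1 mult_right_mono[of 1 "2 * x" "1 - x"] by (intro mult_left_mono) auto
    finally show ?thesis .
  qed
  also have "... = kappa n * B n * (2 * K) * (x * (1 - x))" by simp
  also have "... <= D n * (x * (1 - x))"
    unfolding D_def using x kB K_ge_1 by (intro mult_right_mono mult_left_mono) auto
  finally show ?thesis .
qed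

lemma e1_bound': "x \<in> I ==> \<bar>e1 n x\<bar> <= D n"
  using e1_bound[of x n] mult_left_le[OF _ D_nonneg, of "x * (1 - x)" n] mult_le_one[of x "1 - x"] by fastforce

lemma e2_bound: "x \<in> I ==> \<bar>e2 n x\<bar> <= D n"
proof -
  assume x: "x \<in> I"
  have kB: "0 <= kappa n * B n" using kappa_nonneg B_nonneg by simp
  have 1: "\<bar>e1 n x\<bar> <= kappa n * B n * (2 * K) * (x * (1 - x))" proof (cases "x <= 1/2")
    case True
    have "\<bar>e1 n x\<bar> <= kappa n * B n * K * x" using e1_left[OF x True] .
    also have "... <= kappa n * B n * K * (2 * (x * (1 - x)))"
      using x True kB K_ge_1 by (intro mult_left_mono) (auto simp: field_simps)
    finally show ?thesis by simp
  next
    case False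
    have "\<bar>e1 n x\<bar> <= kappa n * B n * K * (1 - x)" using e1_right[OF x] False by simp
    also have "... <= kappa n * B n * K * (2 * (x * (1 - x)))"
      using x False kB K_ge_1 mult_right_mono[of 1 "2 * x" "1 - x"] by (intro mult_left_mono) auto
    finally show ?thesis by simp
  qed
  have "\<bar>b x * e1 n x\<bar> <= \<bar>b x\<bar> * (kappa n * B n * (2 * K) * (x * (1 - x)))"
    unfolding abs_mult using 1 by (intro mult_left_mono) auto
  also have "... = kappa n * B n * (2 * K) * (\<bar>b x\<bar> * (x * (1 - x)))" by simp
  also have "... <= kappa n * B n * (2 * K) * K"
    using kB K_ge_1 b_bound[OF x] by (intro mult_left_mono) auto
  finally have 2: "\<bar>b x * e1 n x\<bar> <= kappa n * B n * (2 * K\<^sup>2)" by (simp add: power2_eq_square)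
  have "\<bar>kappa n * e n x\<bar> <= kappa n * B n"
    using e_bound[OF x, of n] kappa_nonneg[of n] by (simp add: abs_mult mult_left_mono)
  moreover have "e2 n x = - kappa n * e n x - b x * e1 n x" using ode[OF x, of n] by (simp add: kappa_def)
  moreover have "0 <= kappa n * B n * (2 * K)" using kB K_ge_1 by simp
  moreover have "D n = kappa n * B n + kappa n * B n * (2 * K) + kappa n * B n * (2 * K\<^sup>2)"
    by (simp add: D_def algebra_simps)
  ultimately show ?thesis using 2 by linarith
qed

lemma cont_e: "continuous_on I (e n)" "continuous_on I (e1 n)"
  by (rule DERIV_cont_on[OF e_deriv] DERIV_cont_on[OF e1_deriv]; simp)+

lemma continuous_b: "continuous_on I b"
  by (rule DERIV_cont_on[OF b_deriv]) auto

lemma cont_e2: "continuous_on I (e2 n)"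
proof -
  have "continuous_on I (%x. - kappa n * e n x - b x * e1 n x)"
    by (intro continuous_intros cont_e continuous_b)
  thus ?thesis
    by (rule continuous_on_eq) (use ode[of _ n] in \<open>auto simp: kappa_def algebra_simps\<close>)
qed

lemma meas_e [measurable]: "e n \<in> borel_measurable M" "e1 n \<in> borel_measurable M" "e2 n \<in> borel_measurable M"
  by (intro measurable_M_continuous cont_e cont_e2)+

lemma tendsto_0_bounded:
  fixes f g :: "real => real"
  assumes "(f ---> 0) F" "\<forall>\<^sub>F x in F. \<bar>g x\<bar> <= C * \<bar>f x\<bar>"
  shows "(g ---> 0) F"
proof (rule Lim_null_comparison)
  show "\<forall>\<^sub>F x in F. norm (g x) <= C * \<bar>f x\<bar>" using assms(2) by simp
  show "((%x. C * \<bar>f x\<bar>) ---> 0) F"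
    using tendsto_mult_right_zero[OF tendsto_rabs_zero[OF assms(1)]] by simp
qed

lemma tendsto_ends:
  fixes g :: "real => real"
  assumes "!!x. x \<in> I ==> \<bar>g x\<bar> <= C * (x * (1 - x))"
  shows "(g ---> 0) (at_right 0)" "(g ---> 0) (at_left 1)"
proof -
  have le: "\<forall>\<^sub>F x in at_right 0. \<bar>g x\<bar> <= C * \<bar>x * (1 - x)\<bar>" "\<forall>\<^sub>F x in at_left 1. \<bar>g x\<bar> <= C * \<bar>x * (1 - x)\<bar>"
    by (use ev_I(1) in eventually_elim, use assms in \<open>auto simp: abs_of_pos\<close>)
       (use ev_I(2) in eventually_elim, use assms in \<open>auto simp: abs_of_pos\<close>)
  have "((%x::real. x * (1 - x)) ---> 0 * (1 - 0)) (at_right 0)" "((%x::real. x * (1 - x)) ---> 1 * (1 - 1)) (at_left 1)"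
    by (intro tendsto_intros)+
  thus "(g ---> 0) (at_right 0)" "(g ---> 0) (at_left 1)"
    using tendsto_0_bounded[OF _ le(1)] tendsto_0_bounded[OF _ le(2)] by auto
qed

lemma we1_bound: "x \<in> I ==> \<bar>w x * e1 n x\<bar> <= W * D n * (x * (1 - x))"
  using mult_mono[OF w_le[of x] e1_bound[of x n]] w_pos[of x] W_pos by (auto simp: abs_mult abs_of_pos mult_ac)

text \<open>Integration by parts; the boundary term inherits a factor \<open>x * (1 - x)\<close>
  from \<open>e1 n\<close>.\<close>

lemma weak_form:
  assumes f: "!!x. x \<in> I ==> DERIV f x :> f1 x" "f1 \<in> borel_measurable M"
    and b: "!!x. x \<in> I ==> \<bar>f x\<bar> <= C" "!!x. x \<in> I ==> \<bar>f1 x\<bar> <= C"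
  shows "(LINT x|M. e1 n x * f1 x) = kappa n * (LINT x|M. e n x * f x)"
proof -
  have C: "0 <= C" using b(1)[of "1/2"] by auto
  have cf: "continuous_on I f" by (rule DERIV_cont_on[OF f(1)]) auto
  note [measurable] = f(2) measurable_M_continuous[OF cf]
  have bd: "\<bar>e1 n x * f1 x\<bar> <= D n * C" "\<bar>e n x * f x\<bar> <= B n * C" if "x \<in> I" for x
    unfolding abs_mult using that e1_bound'[OF that, of n] e_bound[OF that, of n] b[OF that] B_nonneg D_nonneg
    by (auto intro: mult_mono)
  have i: "integrable M (%x. e1 n x * f1 x)" "integrable M (%x. e n x * f x)"
    by (rule integrable_bounded[OF _ bd(1)] integrable_bounded[OF _ bd(2)]; simp)+
  have "(LINT x|M. e1 n x * f1 x - kappa n * (e n x * f x)) = 0"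
  proof (rule flux_eq[where A = "%x. (w x * e1 n x) * f x"])
    show "DERIV (%x. (w x * e1 n x) * f x) x :> w x * (e1 n x * f1 x - kappa n * (e n x * f x))"
      if "x \<in> I" for x
      by (rule DERIV_cong[OF DERIV_mult[OF we1_deriv[OF that] f(1)[OF that]]]) (simp add: algebra_simps)
    have "\<bar>w x * e1 n x * f x\<bar> <= (W * D n * C) * (x * (1 - x))" if "x \<in> I" for x
      using mult_mono[OF we1_bound[OF that, of n] b(1)[OF that]] that W_pos D_nonneg[of n] C
      by (simp add: abs_mult mult_ac)
    from tendsto_ends[OF this]
    show "((%x. w x * e1 n x * f x) ---> 0) (at_right 0)" "((%x. w x * e1 n x * f x) ---> 0) (at_left 1)" by auto
    show "\<bar>e1 n x * f1 x - kappa n * (e n x * f x)\<bar> <= D n * C + kappa n * (B n * C)" if "x \<in> I" for x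
      using bd[OF that] mult_left_mono[OF bd(2)[OF that] kappa_nonneg[of n]] kappa_nonneg[of n]
      by (intro order_trans[OF abs_triangle_ineq4 add_mono]) (auto simp: abs_mult)
  qed measurable
  thus ?thesis using i by simp
qed

lemma orth_e: "(LINT x|M. e m x * e n x) = (if m = n then 1 else 0)"
proof (cases "m = n")
  case True
  thus ?thesis using e_norm[of n] by (simp add: M_def power2_eq_square)
next
  case False
  have "(LINT x|M. e1 m x * e1 n x) = kappa m * (LINT x|M. e m x * e n x)" for m n
    using e_bound[of _ n] e1_bound'[of _ n]
    by (intro weak_form[where C = "max (B n) (D n)"] e_deriv) (auto simp: le_max_iff_disj)
  from this[of m n] this[of n m] have "(kappa m - kappa n) * (LINT x|M. e m x * e n x) = 0"
    by (simp add: mult.commute algebra_simps)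
  moreover have "kappa m ~= kappa n" using kappa_mono[of m n] kappa_mono[of n m] False by (metis less_irrefl linorder_neqE_nat)
  ultimately show ?thesis using False by simp
qed

lemma orth_e1: "(LINT x|M. e1 m x * e1 n x) = (if m = n then kappa n else 0)"
proof -
  have "(LINT x|M. e1 m x * e1 n x) = kappa m * (LINT x|M. e m x * e n x)"
    using e_bound[of _ n] e1_bound'[of _ n]
    by (intro weak_form[where C = "max (B n) (D n)"] e_deriv) (auto simp: le_max_iff_disj)
  thus ?thesis by (simp add: orth_e)
qed

end

section \<open>Completeness in L^2 of the eigenfunctions and of their derivatives\<close>

lemma underdetermined_system:
  fixes F :: "'j => 'z => real"
  assumes "finite Z" "finite J" "card Z < card J"
  shows "\<exists>c. (\<exists>j\<in>J. c j ~= 0) & (\<forall>z\<in>Z. (\<Sum>j\<in>J. c j * F j z) = 0)"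
  using assms proof (induction Z arbitrary: J F rule: finite_induct)
  case empty
  hence "J ~= {}" by auto
  thus ?case by (intro exI[of _ "%_. 1"]) auto
next
  case (insert z Z)
  show ?case proof (cases "\<forall>j\<in>J. F j z = 0")
    case True
    have "card Z < card J" using insert by simp
    then obtain c where "\<exists>j\<in>J. c j ~= 0" "\<forall>z\<in>Z. (\<Sum>j\<in>J. c j * F j z) = 0"
      using insert.IH[OF insert.prems(1)] by blast
    thus ?thesis using True by (intro exI[of _ c]) auto
  next
    case False
    then obtain j0 where j0: "j0 \<in> J" "F j0 z ~= 0" by blast
    define F' where "F' j y = F j y - F j z / F j0 z * F j0 y" for j y
    have "card Z < card (J - {j0})" using insert j0 by simp
    then obtain c' where c': "\<exists>j\<in>J - {j0}. c' j ~= 0" "\<forall>y\<in>Z. (\<Sum>j\<in>J - {j0}. c' j * F' j y) = 0"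
      using insert.IH[of "J - {j0}" F'] insert.prems by auto
    define c where "c j = (if j = j0 then - (\<Sum>j\<in>J - {j0}. c' j * (F j z / F j0 z)) else c' j)" for j
    have sum: "(\<Sum>j\<in>J. c j * F j y) = (\<Sum>j\<in>J - {j0}. c' j * F' j y)" for y proof -
      have "(\<Sum>j\<in>J. c j * F j y) = c j0 * F j0 y + (\<Sum>j\<in>J - {j0}. c j * F j y)"
        using insert.prems j0 by (simp add: sum.remove)
      also have "(\<Sum>j\<in>J - {j0}. c j * F j y) = (\<Sum>j\<in>J - {j0}. c' j * F j y)"
        by (intro sum.cong) (auto simp: c_def)
      also have "c j0 * F j0 y = - (\<Sum>j\<in>J - {j0}. c' j * (F j z / F j0 z) * F j0 y)"
        by (simp add: c_def sum_distrib_right)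
      finally show ?thesis by (simp add: F'_def algebra_simps sum_subtractf)
    qed
    have "F' j z = 0" for j using j0 by (simp add: F'_def)
    hence "(\<Sum>j\<in>J. c j * F j y) = 0" if "y \<in> insert z Z" for y
      using sum[of y] c'(2) that by auto
    moreover have "\<exists>j\<in>J. c j ~= 0" using c'(1) by (auto simp: c_def)
    ultimately show ?thesis by blast
  qed
qed

context sturm
begin

definition bm :: "(real => real) => bool" where
  "bm f \<longleftrightarrow> f \<in> borel_measurable M & (\<exists>C. \<forall>x\<in>I. \<bar>f x\<bar> <= C)"

definition ip :: "(real => real) => (real => real) => real" where
  "ip f g = (LINT x|M. f x * g x)"

lemma bmI: "f \<in> borel_measurable M ==> (!!x. x \<in> I ==> \<bar>f x\<bar> <= C) ==> bm f"
  unfolding bm_def by blast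

lemma bm_meas: "bm f ==> f \<in> borel_measurable M" by (simp add: bm_def)

lemma bmE:
  assumes "bm f" obtains C where "0 < C" "!!x. x \<in> I ==> \<bar>f x\<bar> <= C"
proof -
  obtain C where C: "!!x. x \<in> I ==> \<bar>f x\<bar> <= C" using assms unfolding bm_def by blast
  show thesis by (rule that[of "max 1 C"]) (use C in \<open>auto simp: le_max_iff_disj\<close>)
qed

lemma bm_integrable: assumes "bm f" shows "integrable M f"
proof -
  obtain C where "!!x. x \<in> I ==> \<bar>f x\<bar> <= C" using bmE[OF assms] by blast
  thus ?thesis by (rule integrable_bounded[OF bm_meas[OF assms]])
qed

lemma bm_mult: assumes "bm f" "bm g" shows "bm (%x. f x * g x)"
proof -
  obtain C where C: "0 < C" "!!x. x \<in> I ==> \<bar>f x\<bar> <= C" using bmE[OF assms(1)] by blast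
  obtain C' where C': "0 < C'" "!!x. x \<in> I ==> \<bar>g x\<bar> <= C'" using bmE[OF assms(2)] by blast
  from C C' have "\<bar>f x * g x\<bar> <= C * C'" if "x \<in> I" for x
    using that unfolding abs_mult by (intro mult_mono) auto
  thus ?thesis by (rule bmI[OF borel_measurable_times[OF bm_meas[OF assms(1)] bm_meas[OF assms(2)]]])
qed

lemma bm_add: assumes "bm f" "bm g" shows "bm (%x. f x + g x)"
proof -
  obtain C where C: "0 < C" "!!x. x \<in> I ==> \<bar>f x\<bar> <= C" using bmE[OF assms(1)] by blast
  obtain C' where C': "0 < C'" "!!x. x \<in> I ==> \<bar>g x\<bar> <= C'" using bmE[OF assms(2)] by blast
  from C C' have "\<bar>f x + g x\<bar> <= C + C'" if "x \<in> I" for x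
    using that by (intro order_trans[OF abs_triangle_ineq add_mono]) auto
  thus ?thesis by (rule bmI[OF borel_measurable_add[OF bm_meas[OF assms(1)] bm_meas[OF assms(2)]]])
qed

lemma bm_const: "bm (%x. c)" by (rule bmI[of _ "\<bar>c\<bar>"]) auto

lemma bm_cmult: "bm f ==> bm (%x. c * f x)" by (intro bm_mult bm_const)

lemma bm_diff: "bm f ==> bm g ==> bm (%x. f x - g x)"
  using bm_add[of f "%x. - 1 * g x"] bm_cmult[of g "-1"] by simp

lemma bm_sum: "(!!i. i \<in> A ==> bm (f i)) ==> bm (%x. \<Sum>i\<in>A. f i x)"
  by (induction A rule: infinite_finite_induct) (auto intro: bm_const bm_add)

lemma bm_e: "bm (e n)" "bm (e1 n)" "bm (e2 n)"
  by (rule bmI[OF meas_e(1) e_bound] bmI[OF meas_e(2) e1_bound'] bmI[OF meas_e(3) e2_bound]; assumption)+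

lemma bm_test: "test_function psi ==> bm psi"
proof -
  assume psi: "test_function psi"
  obtain C where "!!x. \<bar>psi x\<bar> <= C" using test_function_bounded[OF psi] by blast
  thus "bm psi" using psi by (intro bmI measurable_M test_function_cont)
qed

lemma ip_commute: "ip f g = ip g f" by (simp add: ip_def mult.commute)

lemma ip_add: "bm f ==> bm g ==> bm h ==> ip (%x. f x + g x) h = ip f h + ip g h"
  unfolding ip_def by (simp add: distrib_right bm_integrable[OF bm_mult])

lemma ip_cmult: "ip (%x. c * f x) h = c * ip f h"
  unfolding ip_def by (simp add: mult.assoc)

lemma ip_diff: "bm f ==> bm g ==> bm h ==> ip (%x. f x - g x) h = ip f h - ip g h"
  unfolding ip_def by (simp add: left_diff_distrib bm_integrable[OF bm_mult])

lemma ip_add_right: "bm f ==> bm g ==> bm h ==> ip h (%x. f x + g x) = ip h f + ip h g"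
  using ip_add[of f g h] by (simp only: ip_commute[of h])

lemma ip_cmult_right: "ip h (%x. c * f x) = c * ip h f"
  using ip_cmult[of c f h] by (simp only: ip_commute[of h])

lemma ip_diff_right: "bm f ==> bm g ==> bm h ==> ip h (%x. f x - g x) = ip h f - ip h g"
  using ip_diff[of f g h] by (simp only: ip_commute[of h])

lemma ip_sum: "(!!i. i \<in> A ==> bm (f i)) ==> bm h ==> ip (%x. \<Sum>i\<in>A. f i x) h = (\<Sum>i\<in>A. ip (f i) h)"
  unfolding ip_def sum_distrib_right by (intro Bochner_Integration.integral_sum bm_integrable bm_mult)

lemma ip_nonneg: "0 <= ip f f" unfolding ip_def by (intro Bochner_Integration.integral_nonneg) auto

lemma ip_e: "ip (e m) (e n) = (if m = n then 1 else 0)" "ip (e1 m) (e1 n) = (if m = n then kappa n else 0)"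
  by (simp_all add: ip_def orth_e orth_e1)

lemma ip_square_add:
  assumes "bm f" "bm g"
  shows "ip (%x. f x + g x) (%x. f x + g x) = ip f f + 2 * ip f g + ip g g"
  using assms by (simp add: ip_add bm_add ip_add_right ip_commute[of g f])

lemma ip_square_diff:
  assumes "bm f" "bm g"
  shows "ip (%x. f x - g x) (%x. f x - g x) = ip f f - 2 * ip f g + ip g g"
  using assms by (simp add: ip_diff bm_diff ip_diff_right ip_commute[of g f])

lemma ip_cauchy_schwarz:
  assumes "bm f" "bm g"
  shows "(ip f g)\<^sup>2 <= ip f f * ip g g"
proof -
  have *: "0 <= ip f f + 2 * t * ip f g + t\<^sup>2 * ip g g" for t proof -
    have "0 <= ip (%x. f x + t * g x) (%x. f x + t * g x)" by (rule ip_nonneg)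
    also have "... = ip f f + 2 * ip f (%x. t * g x) + ip (%x. t * g x) (%x. t * g x)"
      by (intro ip_square_add assms bm_cmult)
    also have "... = ip f f + 2 * t * ip f g + t\<^sup>2 * ip g g"
      by (simp add: ip_cmult ip_cmult_right power2_eq_square)
    finally show ?thesis .
  qed
  show ?thesis proof (cases "ip g g = 0")
    case True
    have "ip f g = 0" proof (rule ccontr)
      assume "ip f g ~= 0"
      thus False using *[of "- (ip f f + 1) / (2 * ip f g)"] True by (simp add: field_simps)
    qed
    thus ?thesis using True by simp
  next
    case False
    hence "0 < ip g g" using ip_nonneg[of g] by simp
    thus ?thesis using *[of "- ip f g / ip g g"] by (simp add: field_simps power2_eq_square)
  qed
qed

lemma ip_tendsto_0:
  assumes "bm h" "!!n. bm (u n)" "(%n. ip (u n) (u n)) ----> 0"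
  shows "(%n. ip h (u n)) ----> 0"
proof -
  have "(%n. (ip h (u n))\<^sup>2) ----> 0" proof (rule tendsto_sandwich[OF _ _ tendsto_const])
    show "(%n. ip h h * ip (u n) (u n)) ----> 0" using tendsto_mult_right_zero[OF assms(3)] .
  qed (use ip_cauchy_schwarz assms in auto)
  hence "(%n. sqrt ((ip h (u n))\<^sup>2)) ----> sqrt 0" by (rule tendsto_real_sqrt)
  thus ?thesis by (simp add: tendsto_rabs_zero_iff)
qed

text \<open>The family \<open>Z\<close> is a parameter so that the same coefficients serve
  \<open>e\<close>, \<open>e1\<close> and \<open>e2\<close>: differentiating a sum only changes the
  family.\<close>

definition fs :: "(nat => real => real) => nat => (nat => real) => real => real" where
  "fs Z N c x = (\<Sum>n<N. c n * Z n x)"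

lemma bm_fs: "(!!n. bm (Z n)) ==> bm (fs Z N c)"
  unfolding fs_def[abs_def] by (intro bm_sum bm_cmult)

lemmas bm_fs_e = bm_fs[of e, OF bm_e(1)] bm_fs[of e1, OF bm_e(2)] bm_fs[of e2, OF bm_e(3)]

lemma ip_fs: "(!!n. bm (Z n)) ==> bm h ==> ip (fs Z N c) h = (\<Sum>n<N. c n * ip (Z n) h)"
  unfolding fs_def[abs_def] by (subst ip_sum) (auto simp: ip_cmult intro: bm_cmult)

lemma ip_fs_right: "(!!n. bm (Z n)) ==> bm h ==> ip h (fs Z N c) = (\<Sum>n<N. c n * ip h (Z n))"
  using ip_fs[of Z h N c] by (simp only: ip_commute[of h])

lemma ip_fs_fs:
  assumes "!!n. bm (Z n)" "!!m n. ip (Z m) (Z n) = (if m = n then gamma n else 0)"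
  shows "ip (fs Z N c) (fs Z N d) = (\<Sum>n<N. gamma n * (c n * d n))"
proof -
  have "ip (fs Z N c) (fs Z N d) = (\<Sum>n<N. c n * ip (Z n) (fs Z N d))" by (intro ip_fs bm_fs assms)
  also have "... = (\<Sum>n<N. c n * (\<Sum>m<N. d m * ip (Z n) (Z m)))" by (simp add: ip_fs_right assms(1))
  also have "... = (\<Sum>n<N. gamma n * (c n * d n))"
    by (intro sum.cong refl) (simp add: assms(2) if_distrib cong: if_cong)
  finally show ?thesis .
qed

lemma ip_fs_e: "ip (fs e N c) (fs e N d) = (\<Sum>n<N. c n * d n)"
  "ip (fs e1 N c) (fs e1 N d) = (\<Sum>n<N. kappa n * (c n * d n))"
  using ip_fs_fs[of e "%_. 1" N c d] ip_fs_fs[of e1 kappa N c d] by (simp_all add: bm_e ip_e)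

lemma fs_deriv:
  "(!!n. (Z n has_real_derivative Z' n x) (at x)) ==> DERIV (fs Z N c) x :> fs Z' N c x"
  unfolding fs_def[abs_def] by (intro DERIV_sum DERIV_cmult)

lemma weak_form_ip:
  assumes "!!x. x \<in> I ==> DERIV f x :> f1 x" "bm f1" "bm f"
  shows "ip (e1 n) f1 = kappa n * ip (e n) f"
proof -
  obtain C where C: "!!x. x \<in> I ==> \<bar>f x\<bar> <= C" using bmE[OF assms(3)] by blast
  obtain C' where C': "!!x. x \<in> I ==> \<bar>f1 x\<bar> <= C'" using bmE[OF assms(2)] by blast
  from C C' show ?thesis unfolding ip_def
    using assms by (intro weak_form[where C = "max C C'"] bm_meas) (auto simp: le_max_iff_disj)
qed

lemma coefficient_bound:
  assumes f: "f \<in> borel_measurable M" "!!x. x \<in> I ==> \<bar>f x\<bar> <= C" and "0 <= C"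
  shows "\<bar>ip f (e k)\<bar> <= C * measure M (space M) * B k"
proof -
  have bf: "bm f" using f by (intro bmI)
  have "\<bar>ip f (e k)\<bar> <= (LINT x|M. \<bar>f x * e k x\<bar>)" unfolding ip_def by (rule integral_abs_bound)
  also have "... <= (LINT x|M. C * B k)" proof (rule integral_mono)
    show "integrable M (%x. \<bar>f x * e k x\<bar>)" by (intro integrable_abs bm_integrable bm_mult bf bm_e)
    show "\<bar>f x * e k x\<bar> <= C * B k" if "x \<in> space M" for x
      unfolding abs_mult using that f(2)[of x] e_bound[of x k] \<open>0 <= C\<close> by (intro mult_mono) (auto simp: space_M)
  qed auto
  also have "... = C * measure M (space M) * B k" by simp
  finally show ?thesis .
qed

text \<open>Picone's identity: \<open>kappa n * h^2 - h1^2\<close> plus the square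
  \<open>(h1 - e1 n * h / e n)^2\<close> is a divergence. At a simple zero of \<open>e n\<close> the
  quotient \<open>h^2 / e n\<close> stays continuous because \<open>h\<close> vanishes there
  too.\<close>

lemma picone:
  assumes h: "!!x. x \<in> I ==> DERIV h x :> h1 x" "bm h1" "bm h"
    and zero: "!!x. x \<in> I ==> e n x = 0 ==> h x = 0"
  shows "kappa n * ip h h <= ip h1 h1"
proof -
  define S where "S = {x \<in> I. e n x = 0}"
  define A where "A x = - ((w x * e1 n x) * ((h x)\<^sup>2 / e n x))" for x
  define D' where "D' x = (kappa n * (h x)\<^sup>2 - (h1 x)\<^sup>2) + (h1 x - e1 n x * h x / e n x)\<^sup>2" for x
  obtain C where C: "0 < C" "!!x. x \<in> I ==> \<bar>h x\<bar> <= C" using bmE[OF h(3)] by blast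
  have bk: "bm (%x. kappa n * (h x)\<^sup>2 - (h1 x)\<^sup>2)"
    unfolding power2_eq_square by (intro bm_diff bm_cmult bm_mult h)
  obtain Ck where Ck: "!!x. x \<in> I ==> \<bar>kappa n * (h x)\<^sup>2 - (h1 x)\<^sup>2\<bar> <= Ck" using bmE[OF bk] by blast
  have deriv: "DERIV A x :> w x * D' x" if x: "x \<in> I - S" for x proof -
    have xI: "x \<in> I" and e0: "e n x ~= 0" using x by (auto simp: S_def)
    have "(A has_real_derivative
       - ((w x * (- kappa n * e n x)) * ((h x)\<^sup>2 / e n x)
        + ((2 * h x * h1 x * e n x - (h x)\<^sup>2 * e1 n x) / (e n x * e n x)) * (w x * e1 n x))) (at x)"
      unfolding A_def proof (intro DERIV_minus DERIV_mult we1_deriv xI DERIV_divide e0 e_deriv)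
      show "DERIV (%x. (h x)\<^sup>2) x :> 2 * h x * h1 x"
        by (rule DERIV_cong[OF DERIV_power[OF h(1)[OF xI], of 2]]) simp
    qed
    thus ?thesis
      by (rule DERIV_cong) (use e0 in \<open>simp add: D'_def field_simps power2_eq_square\<close>)
  qed
  have cont: "isCont A x" if x: "x \<in> I" for x proof (cases "x \<in> S")
    case False
    thus ?thesis using deriv x by (blast intro: DERIV_isCont)
  next
    case True
    hence e0: "e n x = 0" "h x = 0" using zero by (auto simp: S_def)
    have "((%y. (h y - h x) / (y - x)) ---> h1 x) (at x)" "((%y. (e n y - e n x) / (y - x)) ---> e1 n x) (at x)"
      using h(1)[OF x] e_deriv[OF x, of n] by (simp_all add: has_field_derivative_iff)
    moreover have "isCont w x" "isCont (e1 n) x"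
      using w_deriv[OF x] e1_deriv[OF x, of n] by (blast intro: DERIV_isCont)+
    \<comment> \<open>Dividing both \<open>h\<close> and \<open>e n\<close> by \<open>y - x\<close>
      exhibits \<open>h^2 / e n\<close> as a bounded multiple of \<open>y - x\<close>, the zero of
      \<open>e n\<close> being simple.\<close>
    ultimately have "((%y. - ((w y * e1 n y) * (((h y - h x) / (y - x))\<^sup>2 * (y - x) / ((e n y - e n x) / (y - x)))))
        ---> - ((w x * e1 n x) * ((h1 x)\<^sup>2 * (x - x) / e1 n x))) (at x)"
      using zeros_simple[OF x e0(1)] by (intro tendsto_intros) (auto simp: isCont_def)
    moreover have "\<forall>\<^sub>F y in at x. - ((w y * e1 n y) * (((h y - h x) / (y - x))\<^sup>2 * (y - x) / ((e n y - e n x) / (y - x)))) = A y"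
      unfolding e0 A_def by (auto simp: eventually_at_filter power2_eq_square)
    ultimately have "(A ---> - ((w x * e1 n x) * ((h1 x)\<^sup>2 * (x - x) / e1 n x))) (at x)"
      by (rule Lim_transform_eventually)
    thus ?thesis using e0 by (simp add: isCont_def A_def)
  qed
  have lim: "(A ---> 0) F"
    if F: "((%x. w x * e1 n x) ---> 0) F" "\<exists>c>0. \<forall>\<^sub>F x in F. c <= \<bar>e n x\<bar>" "\<forall>\<^sub>F x in F. x \<in> I" for F
  proof -
    obtain c where c: "0 < c" "\<forall>\<^sub>F x in F. c <= \<bar>e n x\<bar>" using F(2) by blast
    have "\<forall>\<^sub>F x in F. \<bar>A x\<bar> <= (C\<^sup>2 / c) * \<bar>w x * e1 n x\<bar>"
      using c(2) F(3) proof eventually_elim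
      fix x assume x: "c <= \<bar>e n x\<bar>" "x \<in> I"
      have "(h x)\<^sup>2 <= C\<^sup>2" using C(2)[OF x(2)] C(1) by (intro abs_le_square_iff[THEN iffD1]) auto
      hence "(h x)\<^sup>2 / \<bar>e n x\<bar> <= C\<^sup>2 / c" using x c by (intro frac_le) auto
      hence "\<bar>w x * e1 n x\<bar> * ((h x)\<^sup>2 / \<bar>e n x\<bar>) <= \<bar>w x * e1 n x\<bar> * (C\<^sup>2 / c)"
        by (intro mult_left_mono) auto
      thus "\<bar>A x\<bar> <= (C\<^sup>2 / c) * \<bar>w x * e1 n x\<bar>"
        by (simp add: A_def abs_mult mult_ac)
    qed
    thus ?thesis by (rule tendsto_0_bounded[OF F(1)])
  qed
  have "(LINT x|M. kappa n * (h x)\<^sup>2 - (h1 x)\<^sup>2) <= 0"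
  proof (rule flux[where S = S and A = A and D = D' and C = Ck])
    show "finite S" unfolding S_def by (rule zeros_finite)
    show "continuous_on I A" using cont by (simp add: continuous_at_imp_continuous_on)
    show "(A ---> 0) (at_right 0)" by (rule lim[OF flux_e(1) ends(1) ev_I(1)])
    show "(A ---> 0) (at_left 1)" by (rule lim[OF flux_e(2) ends(2) ev_I(2)])
  qed (use deriv bm_meas[OF bk] Ck in \<open>auto simp: D'_def\<close>)
  moreover have "integrable M (%x. h x * h x)" "integrable M (%x. h1 x * h1 x)"
    by (intro bm_integrable bm_mult h)+
  ultimately show ?thesis by (simp add: ip_def power2_eq_square)
qed

text \<open>Zero counting replaces the min-max principle. The residual \<open>g\<close> and the
  first n eigenfunctions are n + 1 functions, \<open>e n\<close> has n zeros, so a nontrivial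
  combination \<open>h\<close> vanishes at all of them and Picone's inequality applies. By
  orthogonality it says that the sum of \<open>(kappa n - kappa k) * (d k)^2\<close> is at most
  \<open>(d n)^2 * (ip g1 g1 - kappa n * ip g g)\<close>.\<close>

lemma completeness_bound:
  assumes f: "!!x. x \<in> I ==> DERIV f x :> f1 x" "bm f1" "bm f"
  defines "c \<equiv> %k. ip f (e k)"
  shows "kappa n * ip (%x. f x - fs e n c x) (%x. f x - fs e n c x) <= ip f1 f1"
proof -
  define g g1 where "g x = f x - fs e n c x" and "g1 x = f1 x - fs e1 n c x" for x
  have bg: "bm g" "bm g1" unfolding g_def[abs_def] g1_def[abs_def] by (intro bm_diff f bm_fs_e)+
  have gd: "DERIV g x :> g1 x" if "x \<in> I" for x
    unfolding g_def[abs_def] g1_def using that by (intro DERIV_diff f fs_deriv e_deriv)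
  have ge: "ip (e k) g = 0" if "k < n" for k proof -
    have "ip g (e k) = ip f (e k) - (\<Sum>m<n. c m * ip (e m) (e k))"
      unfolding g_def[abs_def] by (simp add: ip_diff f bm_fs_e bm_e ip_fs)
    also have "(\<Sum>m<n. c m * ip (e m) (e k)) = c k" using that by (simp add: ip_e if_distrib cong: if_cong)
    finally show ?thesis by (simp add: c_def ip_commute)
  qed
  have g1e: "ip (e1 k) g1 = 0" if "k < n" for k using weak_form_ip[OF gd bg(2,1), of k] ge[OF that] by simp
  define F where "F k = (if k < n then e k else g)" for k
  have "card {x \<in> I. e n x = 0} < card {..n}" using zeros_card[of n] by simp
  from underdetermined_system[OF zeros_finite _ this, of F]
  obtain d where d: "\<exists>j\<in>{..n}. d j ~= 0" "!!z. z \<in> I ==> e n z = 0 ==> (\<Sum>j\<le>n. d j * F j z) = 0"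
    by auto
  define h h1 where "h x = fs e n d x + d n * g x" and "h1 x = fs e1 n d x + d n * g1 x" for x
  have hF: "h x = (\<Sum>j\<le>n. d j * F j x)" for x
    by (simp add: h_def fs_def F_def lessThan_Suc_atMost[symmetric])
  have hd: "DERIV h x :> h1 x" if "x \<in> I" for x
    unfolding h_def[abs_def] h1_def using that by (intro DERIV_add DERIV_cmult gd fs_deriv e_deriv)
  have bh: "bm h" "bm h1" unfolding h_def[abs_def] h1_def[abs_def] by (intro bm_add bm_cmult bg bm_fs_e)+
  have pic: "kappa n * ip h h <= ip h1 h1" using d(2) by (intro picone[OF hd bh(2,1)]) (auto simp: hF)
  have 0: "ip (fs e n d) g = 0" "ip (fs e1 n d) g1 = 0" by (simp_all add: ip_fs bm_e bg ge g1e)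
  have "ip h h = (\<Sum>k<n. d k * d k) + (d n)\<^sup>2 * ip g g" unfolding h_def[abs_def] using 0
    by (simp add: ip_square_add bm_fs_e bm_cmult bg ip_fs_e ip_cmult ip_cmult_right power2_eq_square)
  moreover have "ip h1 h1 = (\<Sum>k<n. kappa k * (d k * d k)) + (d n)\<^sup>2 * ip g1 g1"
    unfolding h1_def[abs_def] using 0
    by (simp add: ip_square_add bm_fs_e bm_cmult bg ip_fs_e ip_cmult ip_cmult_right power2_eq_square)
  ultimately have "(\<Sum>k<n. (kappa n - kappa k) * (d k)\<^sup>2) <= (d n)\<^sup>2 * (ip g1 g1 - kappa n * ip g g)"
    using pic by (simp add: algebra_simps sum_distrib_left sum_subtractf power2_eq_square)
  moreover have nn: "0 <= (kappa n - kappa k) * (d k)\<^sup>2" if "k < n" for k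
    using kappa_mono[OF that] by simp
  \<comment> \<open>If \<open>g\<close> did not occur, the positive weights
    \<open>kappa n - kappa k\<close> would force the combination to be trivial.\<close>
  have dn: "d n ~= 0" proof
    assume "d n = 0"
    then obtain k where k: "k < n" "d k ~= 0" using d(1) by (metis atMost_iff le_neq_implies_less)
    have "0 < (\<Sum>k<n. (kappa n - kappa k) * (d k)\<^sup>2)"
      using k kappa_mono[OF k(1)] nn by (intro sum_pos2[of _ k]) auto
    thus False using calculation \<open>d n = 0\<close> by simp
  qed
  moreover have "0 <= (\<Sum>k<n. (kappa n - kappa k) * (d k)\<^sup>2)" using nn by (intro sum_nonneg) auto
  ultimately have "0 <= (d n)\<^sup>2 * (ip g1 g1 - kappa n * ip g g)" by linarith
  hence 1: "kappa n * ip g g <= ip g1 g1" using dn by (simp add: zero_le_mult_iff)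
  have f1e: "ip f1 (fs e1 n c) = (\<Sum>k<n. kappa k * (c k * c k))" proof -
    have "ip f1 (e1 k) = kappa k * c k" for k
      using weak_form_ip[OF f, of k] ip_commute[of f1 "e1 k"] ip_commute[of f "e k"] by (simp add: c_def)
    thus ?thesis by (simp add: ip_fs_right bm_e f mult_ac)
  qed
  \<comment> \<open>Bessel's equality for the derivatives: removing the expansion only lowers the
    energy.\<close>
  have "ip g1 g1 = ip f1 f1 - (\<Sum>k<n. kappa k * (c k * c k))"
    unfolding g1_def[abs_def] by (simp add: ip_square_diff f bm_fs_e f1e ip_fs_e)
  moreover have "0 <= (\<Sum>k<n. kappa k * (c k * c k))" using kappa_nonneg by (intro sum_nonneg) auto
  ultimately show ?thesis using 1 by (simp add: g_def[abs_def])
qed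

lemma kappa_at_top: "filterlim kappa at_top sequentially"
  unfolding kappa_def[abs_def]
  using filterlim_tendsto_add_at_top[OF tendsto_const filterlim_pow_at_top[OF _ lam_at_top, of 2], of "- (lam 0)\<^sup>2"]
  by simp

lemma completeness:
  assumes f: "!!x. x \<in> I ==> DERIV f x :> f1 x" "bm f1" "bm f"
  defines "c \<equiv> %k. ip f (e k)"
  shows "(%n. ip (%x. f x - fs e n c x) (%x. f x - fs e n c x)) ----> 0"
proof (rule tendsto_sandwich[OF _ _ tendsto_const])
  show "(%n. ip f1 f1 / kappa n) ----> 0"
    by (intro real_tendsto_divide_at_top[OF tendsto_const] kappa_at_top)
  show "\<forall>\<^sub>F n in sequentially. ip (%x. f x - fs e n c x) (%x. f x - fs e n c x) <= ip f1 f1 / kappa n"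
    using completeness_bound[OF f] kappa_pos
    by (intro eventually_sequentiallyI[of 1]) (simp add: c_def pos_le_divide_eq mult.commute)
qed (auto intro: ip_nonneg always_eventually)

text \<open>Expand the primitive \<open>G\<close> of \<open>psi\<close> in \<open>e\<close>. With
  \<open>H\<close> the adjoint derivative applied to \<open>psi\<close>, the squared residual of
  \<open>psi\<close> equals the pairing of \<open>H\<close> with the residual of \<open>G\<close>,
  which tends to 0; \<open>H\<close> is bounded since \<open>psi\<close> vanishes near the ends. The
  bound on \<open>c\<close> is needed for the convergence of heat series.\<close>

lemma test_completeness_deriv:
  assumes psi: "test_function psi"
  shows "\<exists>c C. (\<forall>k. \<bar>c k\<bar> <= C * B k) &
    (%n. ip (%x. psi x - fs e1 n c x) (%x. psi x - fs e1 n c x)) ----> 0" proof -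
  obtain a' b' where ab: "0 < a'" "a' < b'" "b' < 1" "!!x. x \<notin> {a'..b'} ==> psi x = 0"
    using psi by (rule test_functionE) blast
  define G where "G x = integral {0..x} psi" for x
  have bpsi: "bm psi" "bm (deriv psi)" using psi by (auto intro: bm_test test_function_derivI)
  obtain C where C: "0 < C" "!!x. \<bar>psi x\<bar> <= C" using test_function_bounded[OF psi] by blast
  have Gd: "DERIV G x :> psi x" if x: "x \<in> I" for x proof -
    have "((%u. integral {0..u} psi) has_real_derivative psi x) (at x within {0..1})"
      using x test_function_cont[OF psi] by (intro integral_has_real_derivative) auto
    hence "((%u. integral {0..u} psi) has_real_derivative psi x) (at x within I)"
      by (rule has_field_derivative_subset) auto
    thus ?thesis using x by (simp add: G_def[abs_def] at_within_open[of x I])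
  qed
  have Gb: "\<bar>G x\<bar> <= C" if x: "x \<in> I" for x proof -
    have "norm (integral {0..x} psi) <= integral {0..x} (%_. C)" using C test_function_cont[OF psi]
      by (intro integral_norm_bound_integral integrable_continuous_real) auto
    also have "... <= C" using x C by (auto simp: mult_le_cancel_right1)
    finally show ?thesis by (simp add: G_def)
  qed
  have cG: "continuous_on I G" by (rule DERIV_cont_on[OF Gd]) auto
  have bG: "bm G" using Gb measurable_M_continuous[OF cG] by (intro bmI)
  define H where "H x = - (deriv psi x + b x * psi x)" for x
  have bH: "bm H" proof -
    have "bounded (b ` {a'..b'})"
      using ab by (intro compact_imp_bounded compact_continuous_image continuous_on_subset[OF continuous_b]) auto
    then obtain Cb where "\<forall>y\<in>b ` {a'..b'}. norm y <= Cb" unfolding bounded_iff by blast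
    hence Cb: "!!x. x \<in> {a'..b'} ==> \<bar>b x\<bar> <= Cb" by auto
    have "\<bar>b x * psi x\<bar> <= \<bar>Cb\<bar> * C" for x proof (cases "x \<in> {a'..b'}")
      case True
      hence "\<bar>b x\<bar> <= \<bar>Cb\<bar>" using Cb[of x] by simp
      thus ?thesis unfolding abs_mult using C by (intro mult_mono) auto
    next
      case False
      thus ?thesis using ab(4)[of x] C by simp
    qed
    hence "bm (%x. b x * psi x)"
      by (intro bmI borel_measurable_times measurable_M_continuous continuous_b measurable_M test_function_cont psi)
    hence "bm (%x. - 1 * (deriv psi x + b x * psi x))" using bpsi by (intro bm_cmult bm_add)
    thus ?thesis by (simp add: H_def[abs_def])
  qed
  have parts: "ip psi f1 = ip H f"
    if f: "!!x. x \<in> I ==> DERIV f x :> f1 x" "bm f1" "bm f" for f f1 proof -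
    have bd: "bm (%x. psi x * f1 x - H x * f x)" by (intro bm_diff bm_mult f bpsi bH)
    obtain Cd where Cd: "!!x. x \<in> I ==> \<bar>psi x * f1 x - H x * f x\<bar> <= Cd" using bmE[OF bd] by blast
    have "(LINT x|M. psi x * f1 x - H x * f x) = 0"
    proof (rule flux_eq[where A = "%x. w x * psi x * f x" and C = Cd])
      fix x assume x: "x \<in> I"
      have "((%x. w x * psi x * f x) has_real_derivative
          (b x * w x * psi x + deriv psi x * w x) * f x + f1 x * (w x * psi x)) (at x)"
        by (intro DERIV_mult w_deriv x f test_function_deriv psi)
      thus "DERIV (%x. w x * psi x * f x) x :> w x * (psi x * f1 x - H x * f x)"
        by (rule DERIV_cong) (simp add: H_def algebra_simps)
    next
      have "\<forall>\<^sub>F x in at_right 0. w x * psi x * f x = 0"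
        using ab by (auto simp: eventually_at_right[of 0 1] intro!: exI[of _ a'])
      thus "((%x. w x * psi x * f x) ---> 0) (at_right 0)" by (rule tendsto_eventually)
      have "\<forall>\<^sub>F x in at_left 1. w x * psi x * f x = 0"
        using ab by (auto simp: eventually_at_left[of 0 1] intro!: exI[of _ b'])
      thus "((%x. w x * psi x * f x) ---> 0) (at_left 1)" by (rule tendsto_eventually)
    qed (use bm_meas[OF bd] Cd in auto)
    thus ?thesis using bm_integrable[OF bm_mult[OF bpsi(1) f(2)]] bm_integrable[OF bm_mult[OF bH f(3)]]
      by (simp add: ip_def)
  qed
  define c where "c k = ip G (e k)" for k
  have psie1: "ip psi (e1 k) = kappa k * c k" for k
    using weak_form_ip[OF Gd bpsi(1) bG, of k] by (simp add: c_def ip_commute)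
  have He: "ip H (e k) = kappa k * c k" for k using parts[OF e_deriv bm_e(2,1), of k] psie1[of k] by simp
  have "(%n. ip (%x. G x - fs e n c x) (%x. G x - fs e n c x)) ----> 0"
    unfolding c_def[abs_def] by (rule completeness[OF Gd bpsi(1) bG])
  hence "(%n. ip H (%x. G x - fs e n c x)) ----> 0" by (intro ip_tendsto_0 bH bm_diff bG bm_fs_e)
  moreover have "ip H (%x. G x - fs e n c x) = ip (%x. psi x - fs e1 n c x) (%x. psi x - fs e1 n c x)" for n
  proof -
    have "ip H (%x. G x - fs e n c x) = ip H G - (\<Sum>k<n. c k * ip H (e k))"
      by (simp add: ip_diff_right bG bm_fs_e bH ip_fs_right bm_e)
    also have "... = ip psi psi - (\<Sum>k<n. kappa k * (c k * c k))"
      using parts[OF Gd bpsi(1) bG] by (simp add: He mult_ac)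
    also have "... = ip (%x. psi x - fs e1 n c x) (%x. psi x - fs e1 n c x)" proof -
      have "ip psi (fs e1 n c) = (\<Sum>k<n. kappa k * (c k * c k))"
        by (simp add: ip_fs_right bm_e bpsi psie1 mult_ac)
      thus ?thesis by (simp add: ip_square_diff bpsi bm_fs_e ip_fs_e)
    qed
    finally show ?thesis .
  qed
  ultimately have lim: "(%n. ip (%x. psi x - fs e1 n c x) (%x. psi x - fs e1 n c x)) ----> 0" by simp
  have "\<bar>c k\<bar> <= (C * measure M (space M)) * B k" for k
    unfolding c_def using C Gb bG by (intro coefficient_bound bm_meas) auto
  thus ?thesis using lim by blast
qed

end

section \<open>Maximum principle for the heat flow\<close>

text \<open>A truncation profile: twice differentiable, convex, nondecreasing and zero exactly for
  \<open>a <= 0\<close>, yet below \<open>a^2\<close>, so that squared L^2 errors control it. The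
  cubic behaviour at 0 provides the second derivative, the division by \<open>1 + a\<close> the
  quadratic growth.\<close>

definition phi :: "real => real" where "phi a = (if 0 < a then a ^ 3 / (1 + a) else 0)"
definition dphi :: "real => real" where "dphi a = (if 0 < a then (3 * a\<^sup>2 + 2 * a ^ 3) / (1 + a)\<^sup>2 else 0)"
definition ddphi :: "real => real" where
  "ddphi a = (if 0 < a then (6 * a + 6 * a\<^sup>2 + 2 * a ^ 3) / (1 + a) ^ 3 else 0)"

lemma phi_nonneg: "0 <= phi a" "0 <= dphi a" "0 <= ddphi a"
  by (auto simp: phi_def dphi_def ddphi_def)

lemma phi_eq_0: "phi a = 0 \<longleftrightarrow> a <= 0" by (auto simp: phi_def)

lemma dphi_eq_0: "a <= 0 ==> dphi a = 0" by (auto simp: dphi_def)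

lemma phi_le: "phi a <= a\<^sup>2"
proof (cases "0 < a")
  case True
  have "a ^ 3 / (1 + a) = a\<^sup>2 * (a / (1 + a))" by (simp add: power2_eq_square power3_eq_cube)
  also have "... <= a\<^sup>2 * 1" using True by (intro mult_left_mono) auto
  finally show ?thesis using True by (simp add: phi_def)
qed (simp add: phi_def)

lemma dphi_le: "dphi a <= 3 * a\<^sup>2" "dphi a <= 3 * \<bar>a\<bar>"
proof -
  have *: "dphi a <= 3 * a\<^sup>2 / (1 + a)" if "0 < a" proof -
    have "(3 * a\<^sup>2 + 2 * a ^ 3) / (1 + a)\<^sup>2 <= (3 * a\<^sup>2 + 3 * a ^ 3) / (1 + a)\<^sup>2"
      using that by (intro divide_right_mono) auto
    also have "... = 3 * a\<^sup>2 * (1 + a) / ((1 + a) * (1 + a))"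
      by (simp add: algebra_simps power2_eq_square power3_eq_cube)
    also have "... = 3 * a\<^sup>2 / (1 + a)" using that by simp
    finally show ?thesis using that by (simp add: dphi_def)
  qed
  show "dphi a <= 3 * a\<^sup>2" proof (cases "0 < a")
    case True
    have "3 * a\<^sup>2 / (1 + a) <= 3 * a\<^sup>2" using True by (simp add: divide_le_eq mult_le_cancel_left1)
    thus ?thesis using *[OF True] by linarith
  qed (simp add: dphi_def)
  show "dphi a <= 3 * \<bar>a\<bar>" proof (cases "0 < a")
    case True
    have "3 * a\<^sup>2 / (1 + a) <= 3 * a" using True by (simp add: divide_le_eq power2_eq_square algebra_simps)
    thus ?thesis using *[OF True] True by linarith
  qed (simp add: dphi_def)
qed

lemma deriv_0_of_square_bound:
  fixes f :: "real => real"
  assumes "!!h. \<bar>f h\<bar> <= C * h\<^sup>2"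
  shows "DERIV f 0 :> 0"
proof -
  have "f 0 = 0" using assms[of 0] by simp
  have "((%h. f h / h) ---> 0) (at 0)" proof (rule Lim_null_comparison)
    show "((%h. C * \<bar>h\<bar>) ---> 0) (at 0)" by (rule tendsto_eq_intros refl | simp)+
    have "norm (f h / h) <= C * \<bar>h\<bar>" for h
      using assms[of h] by (cases "h = 0") (auto simp: divide_simps abs_mult power2_eq_square)
    thus "\<forall>\<^sub>F h in at 0. norm (f h / h) <= C * \<bar>h\<bar>" by simp
  qed
  thus ?thesis using \<open>f 0 = 0\<close> by (simp add: DERIV_def)
qed

lemma phi_deriv: "DERIV phi a :> dphi a"
proof -
  consider "0 < a" | "a < 0" | "a = 0" by linarith
  thus ?thesis proof cases
    case 1
    have "DERIV (%a. a ^ 3 / (1 + a)) a :> (3 * a\<^sup>2 * (1 + a) - a ^ 3 * 1) / ((1 + a) * (1 + a))"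
      using 1 by (intro DERIV_divide) (auto intro!: derivative_eq_intros)
    moreover have "(3 * a\<^sup>2 * (1 + a) - a ^ 3 * 1) / ((1 + a) * (1 + a)) = dphi a"
      using 1 by (simp add: dphi_def algebra_simps power2_eq_square power3_eq_cube)
    ultimately have "DERIV (%a. a ^ 3 / (1 + a)) a :> dphi a" by simp
    thus ?thesis
      by (rule DERIV_transform_open[where S = "{0<..}"]) (use 1 in \<open>auto simp: phi_def\<close>)
  next
    case 2
    have "DERIV (%a. 0) a :> dphi a" using 2 by (simp add: dphi_def)
    thus ?thesis
      by (rule DERIV_transform_open[where S = "{..<0}"]) (use 2 in \<open>auto simp: phi_def\<close>)
  next
    case 3
    have "\<bar>phi h\<bar> <= 1 * h\<^sup>2" for h using phi_nonneg(1)[of h] phi_le[of h] by simp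
    from deriv_0_of_square_bound[OF this] show ?thesis using 3 by (simp add: dphi_def)
  qed
qed

lemma dphi_deriv: "DERIV dphi a :> ddphi a"
proof -
  consider "0 < a" | "a < 0" | "a = 0" by linarith
  thus ?thesis proof cases
    case 1
    have "((%a. (3 * a\<^sup>2 + 2 * a ^ 3) / (1 + a)\<^sup>2) has_real_derivative
      ((6 * a + 6 * a\<^sup>2) * (1 + a)\<^sup>2 - (3 * a\<^sup>2 + 2 * a ^ 3) * (2 * (1 + a))) / ((1 + a)\<^sup>2 * (1 + a)\<^sup>2)) (at a)"
      using 1 by (intro DERIV_divide) (auto intro!: derivative_eq_intros)
    moreover have "((6 * a + 6 * a\<^sup>2) * (1 + a)\<^sup>2 - (3 * a\<^sup>2 + 2 * a ^ 3) * (2 * (1 + a))) / ((1 + a)\<^sup>2 * (1 + a)\<^sup>2) = ddphi a"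
    proof -
      have "(6 * a + 6 * a\<^sup>2) * (1 + a)\<^sup>2 - (3 * a\<^sup>2 + 2 * a ^ 3) * (2 * (1 + a))
          = (1 + a) * (6 * a + 6 * a\<^sup>2 + 2 * a ^ 3)"
        by (simp add: algebra_simps power2_eq_square power3_eq_cube)
      moreover have "(1 + a)\<^sup>2 * (1 + a)\<^sup>2 = (1 + a) * (1 + a) ^ 3"
        by (simp add: power2_eq_square power3_eq_cube)
      ultimately show ?thesis using 1 by (simp add: ddphi_def)
    qed
    ultimately have "DERIV (%a. (3 * a\<^sup>2 + 2 * a ^ 3) / (1 + a)\<^sup>2) a :> ddphi a" by simp
    thus ?thesis
      by (rule DERIV_transform_open[where S = "{0<..}"]) (use 1 in \<open>auto simp: dphi_def\<close>)
  next
    case 2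
    have "DERIV (%a. 0) a :> ddphi a" using 2 by (simp add: ddphi_def)
    thus ?thesis
      by (rule DERIV_transform_open[where S = "{..<0}"]) (use 2 in \<open>auto simp: dphi_def\<close>)
  next
    case 3
    have "\<bar>dphi h\<bar> <= 3 * h\<^sup>2" for h using phi_nonneg(2)[of h] dphi_le(1)[of h] by simp
    from deriv_0_of_square_bound[OF this] show ?thesis using 3 by (simp add: ddphi_def)
  qed
qed

lemma continuous_phi: "continuous_on UNIV phi" "continuous_on UNIV dphi"
  using phi_deriv dphi_deriv by (auto intro!: DERIV_isCont continuous_at_imp_continuous_on)

lemma measurable_phi [measurable]: "phi \<in> borel_measurable borel" "dphi \<in> borel_measurable borel"
  using continuous_phi by (auto intro: borel_measurable_continuous_onI)

context sturm
begin

lemma deriv_integral: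
  fixes F F' :: "real => real => real"
  assumes d: "!!t x. \<bar>t - t0\<bar> < 1 ==> x \<in> I ==> DERIV (%t. F t x) t :> F' t x"
    and F: "!!t. bm (F t)" and F': "F' t0 \<in> borel_measurable M"
    and le: "!!t x. \<bar>t - t0\<bar> < 1 ==> x \<in> I ==> \<bar>F' t x\<bar> <= C"
  shows "DERIV (%t. LINT x|M. F t x) t0 :> (LINT x|M. F' t0 x)"
  unfolding has_field_derivative_iff tendsto_at_iff_sequentially proof (intro allI impI)
  fix X :: "nat => real" assume X: "\<forall>i. X i \<in> UNIV - {t0}" "X ----> t0"
  have C: "0 <= C" using le[of t0 "1/2"] by auto
  note [measurable] = bm_meas[OF F] F'
  define u where "u n x = (if \<bar>X n - t0\<bar> < 1 then (F (X n) x - F t0 x) / (X n - t0) else 0)" for n x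
  have ev: "\<forall>\<^sub>F n in sequentially. \<bar>X n - t0\<bar> < 1"
    using tendstoD[OF X(2), of 1] by (simp add: dist_real_def)
  have "(%n. LINT x|M. u n x) ----> (LINT x|M. F' t0 x)" proof (rule integral_tendsto_bounded)
    show "u n \<in> borel_measurable M" for n unfolding u_def by measurable
    show "\<bar>u n x\<bar> <= C" if x: "x \<in> I" for n x proof (cases "\<bar>X n - t0\<bar> < 1")
      case True
      have "norm (F (X n) x - F t0 x) <= C * norm (X n - t0)" proof (rule field_differentiable_bound)
        show "convex (ball t0 1 :: real set)" by simp
        show "((%t. F t x) has_real_derivative F' z x) (at z within ball t0 1)" if "z \<in> ball t0 1" for z
          using d[of z x] that x by (auto simp: dist_real_def intro: has_field_derivative_at_within)
        show "norm (F' z x) <= C" if "z \<in> ball t0 1" for z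
          using le[of z x] that x by (auto simp: dist_real_def)
      qed (use True in \<open>auto simp: dist_real_def\<close>)
      moreover have "X n ~= t0" using X(1) by auto
      ultimately show ?thesis using True by (simp add: u_def divide_le_eq)
    qed (simp add: u_def C)
    show "(%n. u n x) ----> F' t0 x" if x: "x \<in> I" for x proof -
      have "((%t. (F t x - F t0 x) / (t - t0)) ---> F' t0 x) (at t0)"
        using d[of t0 x] x by (simp add: has_field_derivative_iff)
      hence "(%n. (F (X n) x - F t0 x) / (X n - t0)) ----> F' t0 x"
        using X by (auto simp: tendsto_at_iff_sequentially o_def)
      thus ?thesis by (rule Lim_transform_eventually) (use ev in eventually_elim, auto simp: u_def)
    qed
  qed fact
  thus "((%t. ((LINT x|M. F t x) - (LINT x|M. F t0 x)) / (t - t0)) \<circ> X) ----> (LINT x|M. F' t0 x)"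
  proof (rule Lim_transform_eventually)
    show "\<forall>\<^sub>F n in sequentially. (LINT x|M. u n x) = ((%t. ((LINT x|M. F t x) - (LINT x|M. F t0 x)) / (t - t0)) \<circ> X) n"
      using ev proof eventually_elim
      fix n assume "\<bar>X n - t0\<bar> < 1"
      hence "(LINT x|M. u n x) = (LINT x|M. (F (X n) x - F t0 x) / (X n - t0))" by (simp add: u_def)
      thus "(LINT x|M. u n x) = ((%t. ((LINT x|M. F t x) - (LINT x|M. F t0 x)) / (t - t0)) \<circ> X) n"
        using bm_integrable[OF F] by simp
    qed
  qed
qed

text \<open>What the flow arguments need from \<open>e\<close> (with \<open>rho = 0\<close>) and
  from \<open>e1\<close> (with \<open>rho = r\<close>): the equation with a nonnegative potential,
  and a bound on \<open>Z m * Z1 n\<close> that kills the boundary terms whether the functions or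
  their derivatives vanish at the ends.\<close>

definition sys :: "(nat => real => real) => (nat => real => real) => (nat => real => real) => (real => real) => bool" where
  "sys Z Z1 Z2 rho \<longleftrightarrow>
     (\<forall>n. \<forall>x\<in>I. (Z n has_real_derivative Z1 n x) (at x) & (Z1 n has_real_derivative Z2 n x) (at x) &
        Z2 n x + b x * Z1 n x = (rho x - kappa n) * Z n x) &
     (\<forall>x\<in>I. 0 <= rho x) & (\<forall>n. bm (Z n) & bm (Z1 n)) &
     (\<forall>m n. \<exists>C. \<forall>x\<in>I. \<bar>Z m x * Z1 n x\<bar> <= C * (x * (1 - x)))"

text \<open>The third derivative, from differentiating the equation; the summand with
  \<open>r\<close> is \<open>- b' * e1 n\<close>.\<close>

definition e3 :: "nat => real => real" where
  "e3 n x = (r x - kappa n) * e1 n x - b x * e2 n x"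

lemma e2_eq: "x \<in> I ==> e2 n x = - kappa n * e n x - b x * e1 n x"
  using ode[of x n] by (simp add: kappa_def)

lemma e2_deriv: "x \<in> I ==> DERIV (e2 n) x :> e3 n x"
proof -
  assume x: "x \<in> I"
  have "((%x. - kappa n * e n x - b x * e1 n x) has_real_derivative
      - kappa n * e1 n x - (- r x * e1 n x + e2 n x * b x)) (at x)"
    by (intro DERIV_diff DERIV_cmult DERIV_mult e_deriv e1_deriv b_deriv x)
  hence "DERIV (%x. - kappa n * e n x - b x * e1 n x) x :> e3 n x"
    by (rule DERIV_cong) (simp add: e3_def algebra_simps)
  thus ?thesis by (rule DERIV_transform_open[where S = I]) (use x in \<open>auto simp: e2_eq\<close>)
qed

lemma sys_e: "sys e e1 e2 (%_. 0)"
proof -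
  have "\<bar>e m x * e1 n x\<bar> <= B m * D n * (x * (1 - x))" if "x \<in> I" for m n x
    using mult_mono[OF e_bound[OF that, of m] e1_bound[OF that, of n]] B_nonneg
    by (simp add: abs_mult mult.assoc)
  hence "\<exists>C. \<forall>x\<in>I. \<bar>e m x * e1 n x\<bar> <= C * (x * (1 - x))" for m n by blast
  thus ?thesis unfolding sys_def by (intro conjI allI ballI e_deriv e1_deriv bm_e) (simp_all add: e2_eq)
qed

lemma sys_e1: "sys e1 e2 e3 r"
proof -
  have "\<bar>e1 m x * e2 n x\<bar> <= D m * D n * (x * (1 - x))" if "x \<in> I" for m n x
    using mult_mono[OF e1_bound[OF that, of m] e2_bound[OF that, of n]] D_nonneg that
    by (simp add: abs_mult mult_ac)
  hence "\<exists>C. \<forall>x\<in>I. \<bar>e1 m x * e2 n x\<bar> <= C * (x * (1 - x))" for m n by blast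
  thus ?thesis
    unfolding sys_def by (intro conjI allI ballI e1_deriv e2_deriv bm_e r_nonneg) (simp_all add: e3_def)
qed

context
  fixes Z Z1 Z2 rho assumes sys: "sys Z Z1 Z2 rho"
begin

lemma sysD:
  "x \<in> I ==> DERIV (Z n) x :> Z1 n x" "x \<in> I ==> DERIV (Z1 n) x :> Z2 n x"
  "x \<in> I ==> Z2 n x + b x * Z1 n x = (rho x - kappa n) * Z n x"
  "x \<in> I ==> 0 <= rho x" "bm (Z n)" "bm (Z1 n)" using sys unfolding sys_def by blast+

lemma fs_ode:
  assumes x: "x \<in> I"
  shows "fs Z2 N c x + b x * fs Z1 N c x = rho x * fs Z N c x + fs Z N (%n. - kappa n * c n) x"
proof -
  have "fs Z2 N c x + b x * fs Z1 N c x = (\<Sum>n<N. c n * (Z2 n x + b x * Z1 n x))"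
    by (simp add: fs_def sum_distrib_left sum.distrib algebra_simps)
  also have "... = (\<Sum>n<N. c n * ((rho x - kappa n) * Z n x))" using sysD(3)[OF x] by simp
  also have "... = rho x * fs Z N c x + fs Z N (%n. - kappa n * c n) x"
    by (simp add: fs_def sum_distrib_left sum.distrib[symmetric] algebra_simps)
  finally show ?thesis .
qed

lemma fs_prod_bound: "\<exists>C\<ge>0. \<forall>x\<in>I. \<bar>fs Z N c x * fs Z1 N d x\<bar> <= C * (x * (1 - x))"
proof -
  have "\<forall>m n. \<exists>C. \<forall>x\<in>I. \<bar>Z m x * Z1 n x\<bar> <= C * (x * (1 - x))" using sys unfolding sys_def by blast
  then obtain C where C: "!!m n x. x \<in> I ==> \<bar>Z m x * Z1 n x\<bar> <= C m n * (x * (1 - x))" by metis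
  define E where "E = (\<Sum>m<N. \<Sum>n<N. \<bar>c m\<bar> * \<bar>d n\<bar> * \<bar>C m n\<bar>)"
  have "\<bar>fs Z N c x * fs Z1 N d x\<bar> <= E * (x * (1 - x))" if x: "x \<in> I" for x proof -
    have "fs Z N c x * fs Z1 N d x = (\<Sum>m<N. \<Sum>n<N. (c m * d n) * (Z m x * Z1 n x))"
      unfolding fs_def sum_product by (intro sum.cong refl) (simp add: mult_ac)
    also have "\<bar>...\<bar> <= (\<Sum>m<N. \<Sum>n<N. \<bar>(c m * d n) * (Z m x * Z1 n x)\<bar>)"
      by (intro order_trans[OF sum_abs] sum_mono sum_abs)
    also have "... <= (\<Sum>m<N. \<Sum>n<N. \<bar>c m\<bar> * \<bar>d n\<bar> * \<bar>C m n\<bar> * (x * (1 - x)))"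
    proof (intro sum_mono)
      fix m n
      have "\<bar>Z m x * Z1 n x\<bar> <= \<bar>C m n\<bar> * (x * (1 - x))"
        using x by (intro order_trans[OF C[OF x]] mult_right_mono) auto
      hence "\<bar>c m * d n\<bar> * \<bar>Z m x * Z1 n x\<bar> <= \<bar>c m * d n\<bar> * (\<bar>C m n\<bar> * (x * (1 - x)))"
        by (intro mult_left_mono) auto
      thus "\<bar>c m * d n * (Z m x * Z1 n x)\<bar> <= \<bar>c m\<bar> * \<bar>d n\<bar> * \<bar>C m n\<bar> * (x * (1 - x))"
        by (simp add: abs_mult mult.assoc)
    qed
    also have "... = E * (x * (1 - x))" by (simp add: E_def sum_distrib_right)
    finally show ?thesis .
  qed
  moreover have "0 <= E" unfolding E_def by (intro sum_nonneg) auto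
  ultimately show ?thesis by blast
qed

lemma fs_uniform_bound:
  assumes "!!t n. t \<in> T ==> \<bar>c t n\<bar> <= c' n"
  shows "\<exists>C\<ge>0. \<forall>t\<in>T. \<forall>x\<in>I. \<bar>fs Z N (c t) x\<bar> <= C"
proof -
  have "\<forall>n. \<exists>C. \<forall>x\<in>I. \<bar>Z n x\<bar> <= C" using sysD(5) unfolding bm_def by blast
  then obtain C where C: "!!n x. x \<in> I ==> \<bar>Z n x\<bar> <= C n" by metis
  have "\<bar>fs Z N (c t) x\<bar> <= (\<Sum>n<N. \<bar>c' n\<bar> * \<bar>C n\<bar>)" if "t \<in> T" "x \<in> I" for t x
  proof -
    have "\<bar>fs Z N (c t) x\<bar> <= (\<Sum>n<N. \<bar>c t n * Z n x\<bar>)" unfolding fs_def by (rule sum_abs)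
    also have "... <= (\<Sum>n<N. \<bar>c' n\<bar> * \<bar>C n\<bar>)"
      unfolding abs_mult using assms[OF that(1)] C[OF that(2)]
      by (intro sum_mono mult_mono) (auto intro: order_trans[OF _ abs_ge_self])
    finally show ?thesis .
  qed
  moreover have "0 <= (\<Sum>n<N. \<bar>c' n\<bar> * \<bar>C n\<bar>)" by (intro sum_nonneg) auto
  ultimately show ?thesis by blast
qed

abbreviation (input) "hc c t \<equiv> (%n. c n * exp (- kappa n * t))"

lemma heat_time_deriv:
  "DERIV (%t. fs Z N (hc c t) x) t :> fs Z N (%n. - kappa n * hc c t n) x"
  unfolding fs_def by (auto intro!: derivative_eq_intros sum.cong simp: algebra_simps)

text \<open>With \<open>u\<close> the flow, the time derivative of the integral is, by parts, minus
  the integral of \<open>ddphi (u - m) * ux^2 + dphi (u - m) * rho * u\<close>. Where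
  \<open>dphi (u - m)\<close> is nonzero one has \<open>u > m >= 0\<close>, so both terms are
  nonnegative.\<close>

lemma heat_energy:
  assumes m: "0 <= m" and t: "0 <= t"
  shows "(LINT x|M. phi (fs Z N (hc c t) x - m)) <= (LINT x|M. phi (fs Z N c x - m))"
proof -
  define u ut where "u t x = fs Z N (hc c t) x" and "ut t x = fs Z N (%n. - kappa n * hc c t n) x" for t x
  have bu: "bm (u t)" "bm (ut t)" for t unfolding u_def ut_def by (intro bm_fs sysD)+
  note [measurable] = bm_meas[OF bu(1)] bm_meas[OF bu(2)]
  define G where "G t = (LINT x|M. phi (u t x - m))" for t
  have Gd: "DERIV G t0 :> (LINT x|M. dphi (u t0 x - m) * ut t0 x)" for t0 proof -
    have ex: "\<bar>exp (- kappa n * t)\<bar> <= exp (kappa n * (\<bar>t0\<bar> + 1))" if "t \<in> {t. \<bar>t - t0\<bar> < 1}" for t n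
    proof -
      have "- t <= \<bar>t0\<bar> + 1" using that by auto
      hence "kappa n * (- t) <= kappa n * (\<bar>t0\<bar> + 1)" using kappa_nonneg by (rule mult_left_mono)
      thus ?thesis by simp
    qed
    obtain C1 where C1: "0 <= C1" "!!t x. \<bar>t - t0\<bar> < 1 ==> x \<in> I ==> \<bar>u t x\<bar> <= C1"
      using fs_uniform_bound[of "{t. \<bar>t - t0\<bar> < 1}" "hc c" "%n. \<bar>c n\<bar> * exp (kappa n * (\<bar>t0\<bar> + 1))" N]
        mult_left_mono[OF ex, of _ "\<bar>c _\<bar>"] by (auto simp: u_def abs_mult)
    obtain C2 where C2: "0 <= C2" "!!t x. \<bar>t - t0\<bar> < 1 ==> x \<in> I ==> \<bar>ut t x\<bar> <= C2"
      using fs_uniform_bound[of "{t. \<bar>t - t0\<bar> < 1}" "%t n. - kappa n * hc c t n" "%n. \<bar>kappa n * c n\<bar> * exp (kappa n * (\<bar>t0\<bar> + 1))" N]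
        mult_left_mono[OF ex, of _ "\<bar>kappa _ * c _\<bar>"] by (auto simp: ut_def abs_mult mult.assoc)
    show ?thesis unfolding G_def[abs_def]
    proof (rule deriv_integral[where F = "%t x. phi (u t x - m)" and F' = "%t x. dphi (u t x - m) * ut t x" and C = "3 * (C1 + m) * C2"])
      show "DERIV (%t. phi (u t x - m)) t :> dphi (u t x - m) * ut t x" for t x
      proof (rule DERIV_chain2[OF phi_deriv])
        show "DERIV (%t. u t x - m) t :> ut t x"
          using DERIV_diff[OF heat_time_deriv[of N c x t] DERIV_const[of m]] by (simp add: u_def ut_def)
      qed
      fix t
      obtain C where C: "0 < C" "!!x. x \<in> I ==> \<bar>u t x\<bar> <= C" using bmE[OF bu(1)[of t]] by blast
      show "bm (%x. phi (u t x - m))" proof (rule bmI)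
        show "\<bar>phi (u t x - m)\<bar> <= (C + m)\<^sup>2" if "x \<in> I" for x proof -
          have "\<bar>u t x - m\<bar> <= C + m" using C(2)[OF that] m by linarith
          hence "(u t x - m)\<^sup>2 <= (C + m)\<^sup>2" by (metis abs_ge_zero power2_abs power_mono)
          thus ?thesis using phi_nonneg(1)[of "u t x - m"] phi_le[of "u t x - m"] by linarith
        qed
      qed measurable
      show "\<bar>dphi (u t x - m) * ut t x\<bar> <= 3 * (C1 + m) * C2" if "\<bar>t - t0\<bar> < 1" "x \<in> I" for t x
      proof -
        have "\<bar>u t x - m\<bar> <= C1 + m" using C1(2)[OF that] m by linarith
        hence "3 * \<bar>u t x - m\<bar> <= 3 * (C1 + m)" by simp
        hence "\<bar>dphi (u t x - m)\<bar> <= 3 * (C1 + m)"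
          using phi_nonneg(2)[of "u t x - m"] order_trans[OF dphi_le(2)[of "u t x - m"]] by simp
        thus ?thesis unfolding abs_mult using C2(2)[OF that] C1(1) m by (intro mult_mono) auto
      qed
    qed measurable
  qed
  have "(LINT x|M. dphi (u t0 x - m) * ut t0 x) <= 0" for t0 proof -
    define ux uxx where "ux x = fs Z1 N (hc c t0) x" and "uxx x = fs Z2 N (hc c t0) x" for x
    obtain C1 where C1: "0 < C1" "!!x. x \<in> I ==> \<bar>u t0 x\<bar> <= C1" using bmE[OF bu(1)[of t0]] by blast
    obtain C2 where C2: "0 < C2" "!!x. x \<in> I ==> \<bar>ut t0 x\<bar> <= C2" using bmE[OF bu(2)[of t0]] by blast
    obtain C3 where C3: "0 <= C3" "!!x. x \<in> I ==> \<bar>u t0 x * ux x\<bar> <= C3 * (x * (1 - x))"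
      using fs_prod_bound[of N "hc c t0" "hc c t0"] unfolding u_def ux_def by blast
    have dle: "\<bar>dphi (u t0 x - m)\<bar> <= 3 * \<bar>u t0 x\<bar>" for x proof (cases "u t0 x <= m")
      case True
      thus ?thesis using dphi_eq_0[of "u t0 x - m"] by simp
    next
      case False
      hence "\<bar>u t0 x - m\<bar> <= \<bar>u t0 x\<bar>" using m by simp
      thus ?thesis
        using dphi_le(2)[of "u t0 x - m"] phi_nonneg(2)[of "u t0 x - m"] abs_of_nonneg[of "dphi (u t0 x - m)"] by simp
    qed
    \<comment> \<open>The term with \<open>rho\<close> belongs to \<open>D\<close> and not to the
      minorant, as \<open>rho\<close> may be unbounded.\<close>
    show ?thesis proof (rule flux[where S = "{}" and A = "%x. w x * (dphi (u t0 x - m) * ux x)"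
        and D = "%x. ddphi (u t0 x - m) * (ux x)\<^sup>2 + dphi (u t0 x - m) * (rho x * u t0 x + ut t0 x)"
        and C = "3 * C1 * C2"])
      have ud: "DERIV (u t0) x :> ux x" if "x \<in> I" for x
        unfolding u_def ux_def using that by (intro fs_deriv sysD)
      have uxd: "DERIV ux x :> uxx x" if "x \<in> I" for x
        unfolding ux_def[abs_def] uxx_def using that by (intro fs_deriv sysD)
      have Ad: "((%x. w x * (dphi (u t0 x - m) * ux x)) has_real_derivative
        w x * (ddphi (u t0 x - m) * (ux x)\<^sup>2 + dphi (u t0 x - m) * (rho x * u t0 x + ut t0 x))) (at x)"
        if x: "x \<in> I" for x proof -
        have "DERIV (%x. dphi (u t0 x - m)) x :> ddphi (u t0 x - m) * ux x"
          by (rule DERIV_chain2[OF dphi_deriv]) (use DERIV_diff[OF ud[OF x] DERIV_const[of m]] in simp)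
        hence "((%x. w x * (dphi (u t0 x - m) * ux x)) has_real_derivative
            b x * w x * (dphi (u t0 x - m) * ux x) + (ddphi (u t0 x - m) * ux x * ux x + uxx x * dphi (u t0 x - m)) * w x) (at x)"
          by (intro DERIV_mult w_deriv x uxd)
        moreover have "uxx x = rho x * u t0 x + ut t0 x - b x * ux x"
          using fs_ode[OF x, of N "hc c t0"] by (simp add: u_def ut_def ux_def uxx_def)
        ultimately show ?thesis by (auto elim!: DERIV_cong simp: algebra_simps power2_eq_square)
      qed
      thus "((%x. w x * (dphi (u t0 x - m) * ux x)) has_real_derivative
        w x * (ddphi (u t0 x - m) * (ux x)\<^sup>2 + dphi (u t0 x - m) * (rho x * u t0 x + ut t0 x))) (at x)"
        if "x \<in> I - {}" for x using that by blast
      show "continuous_on I (%x. w x * (dphi (u t0 x - m) * ux x))" by (rule DERIV_cont_on[OF Ad]) auto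
      have "\<bar>w x * (dphi (u t0 x - m) * ux x)\<bar> <= (W * (3 * C3)) * (x * (1 - x))" if x: "x \<in> I" for x
      proof -
        have "\<bar>dphi (u t0 x - m) * ux x\<bar> <= 3 * \<bar>u t0 x\<bar> * \<bar>ux x\<bar>"
          unfolding abs_mult using dle[of x] by (intro mult_right_mono) auto
        also have "... = 3 * \<bar>u t0 x * ux x\<bar>" by (simp add: abs_mult)
        also have "... <= 3 * (C3 * (x * (1 - x)))" using C3(2)[OF x] by simp
        finally have "\<bar>dphi (u t0 x - m) * ux x\<bar> <= 3 * (C3 * (x * (1 - x)))" .
        hence "\<bar>w x\<bar> * \<bar>dphi (u t0 x - m) * ux x\<bar> <= W * (3 * (C3 * (x * (1 - x))))"
          using w_le[OF x] w_pos[OF x] W_pos by (intro mult_mono) auto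
        thus ?thesis unfolding abs_mult[of "w x"] by (simp only: mult.assoc)
      qed
      from tendsto_ends[OF this] show "((%x. w x * (dphi (u t0 x - m) * ux x)) ---> 0) (at_right 0)"
        "((%x. w x * (dphi (u t0 x - m) * ux x)) ---> 0) (at_left 1)" by auto
      show "\<bar>dphi (u t0 x - m) * ut t0 x\<bar> <= 3 * C1 * C2" if "x \<in> I" for x
        unfolding abs_mult using dle[of x] C1 C2 that by (intro mult_mono) (auto intro: order_trans[OF dle])
      show "dphi (u t0 x - m) * ut t0 x <= ddphi (u t0 x - m) * (ux x)\<^sup>2 + dphi (u t0 x - m) * (rho x * u t0 x + ut t0 x)"
        if "x \<in> I - {}" for x proof -
        have "0 <= dphi (u t0 x - m) * (rho x * u t0 x)" proof (cases "u t0 x <= m")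
          case True
          thus ?thesis using dphi_eq_0[of "u t0 x - m"] by simp
        next
          case False
          thus ?thesis using m sysD(4)[of x] that phi_nonneg(2)[of "u t0 x - m"]
            by (intro mult_nonneg_nonneg) auto
        qed
        thus ?thesis using phi_nonneg(3)[of "u t0 x - m"] by (simp add: algebra_simps)
      qed
    qed (simp, measurable)
  qed
  hence "G t <= G 0" using Gd t by (intro DERIV_nonpos_imp_nonincreasing[of 0 t G]) blast+
  thus ?thesis by (simp add: G_def u_def)
qed

text \<open>Partial sums exceed the bound \<open>m\<close> of \<open>g\<close> only by their L^2
  error: where such a sum is above \<open>m\<close>, \<open>phi\<close> of the excess is at most the
  square of its distance to \<open>g\<close>. Energy decay carries this to time \<open>t\<close>,
  Fatou's lemma to the limit \<open>U\<close>.\<close>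

lemma heat_upper_bound:
  assumes m: "0 <= m" and t: "0 <= t"
    and g: "g \<in> borel_measurable M" "!!x. x \<in> I ==> \<bar>g x\<bar> <= m"
    and lim: "(%N. ip (%x. g x - fs Z N c x) (%x. g x - fs Z N c x)) ----> 0"
    and U: "!!x. x \<in> I ==> (%N. fs Z N (hc c t) x) ----> U x"
  shows "AE x in M. U x <= m"
proof -
  have bg: "bm g" using g by (rule bmI)
  have bu: "bm (fs Z N d)" for N d by (intro bm_fs sysD)
  note [measurable] = bm_meas[OF bu] g(1)
  have bphi: "bm (%x. phi (fs Z N d x - m))" for N d proof -
    obtain C where C: "0 < C" "!!x. x \<in> I ==> \<bar>fs Z N d x\<bar> <= C" using bmE[OF bu[of N d]] by blast
    show ?thesis proof (rule bmI)
    show "\<bar>phi (fs Z N d x - m)\<bar> <= (C + m)\<^sup>2" if "x \<in> I" for x proof -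
      have "\<bar>fs Z N d x - m\<bar> <= C + m" using C(2)[OF that] m by linarith
      hence "(fs Z N d x - m)\<^sup>2 <= (C + m)\<^sup>2" by (metis abs_ge_zero power2_abs power_mono)
      thus ?thesis using phi_nonneg(1)[of "fs Z N d x - m"] phi_le[of "fs Z N d x - m"] by linarith
    qed
    qed measurable
  qed
  define a where "a N = ip (%x. g x - fs Z N c x) (%x. g x - fs Z N c x)" for N
  have le: "(LINT x|M. phi (fs Z N (hc c t) x - m)) <= a N" for N proof -
    have "(LINT x|M. phi (fs Z N c x - m)) <= a N" unfolding a_def ip_def proof (rule integral_mono)
      show "phi (fs Z N c x - m) <= (g x - fs Z N c x) * (g x - fs Z N c x)" if "x \<in> space M" for x
      proof (cases "fs Z N c x <= m")
        case True
        thus ?thesis using phi_eq_0[of "fs Z N c x - m"] by simp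
      next
        case False
        have "g x <= m" using g(2)[of x] that by (auto simp: space_M)
        hence "(fs Z N c x - m)\<^sup>2 <= (fs Z N c x - g x)\<^sup>2" using False by (intro power_mono) auto
        thus ?thesis using phi_le[of "fs Z N c x - m"] by (simp add: power2_eq_square algebra_simps)
      qed
    qed (intro bm_integrable bphi bm_mult bm_diff bg bu)+
    thus ?thesis using heat_energy[OF m t, of N c] by linarith
  qed
  have meas_U: "U \<in> borel_measurable M"
    by (rule borel_measurable_LIMSEQ_real[where u = "%N. fs Z N (hc c t)"], rule U, simp add: space_M, rule bm_meas[OF bu])
  note [measurable] = meas_U
  have "(\<integral>\<^sup>+x. ennreal (phi (U x - m)) \<partial>M) = (\<integral>\<^sup>+x. liminf (%N. ennreal (phi (fs Z N (hc c t) x - m))) \<partial>M)"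
  proof (rule nn_integral_cong)
    fix x assume "x \<in> space M"
    hence "(%N. fs Z N (hc c t) x) ----> U x" by (intro U) (simp add: space_M)
    hence "(%N. phi (fs Z N (hc c t) x - m)) ----> phi (U x - m)"
      by (intro continuous_on_tendsto_compose[OF continuous_phi(1)] tendsto_diff tendsto_const) auto
    hence "(%N. ennreal (phi (fs Z N (hc c t) x - m))) ----> ennreal (phi (U x - m))"
      by (rule tendsto_ennrealI)
    thus "ennreal (phi (U x - m)) = liminf (%N. ennreal (phi (fs Z N (hc c t) x - m)))"
      by (rule lim_imp_Liminf[OF sequentially_bot, symmetric])
  qed
  also have "... <= liminf (%N. \<integral>\<^sup>+x. ennreal (phi (fs Z N (hc c t) x - m)) \<partial>M)"
    by (intro nn_integral_liminf) measurable
  also have "... <= liminf (%N. ennreal (a N))" proof (intro Liminf_mono always_eventually allI)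
    fix N
    have "(\<integral>\<^sup>+x. ennreal (phi (fs Z N (hc c t) x - m)) \<partial>M) = ennreal (LINT x|M. phi (fs Z N (hc c t) x - m))"
      by (intro nn_integral_eq_integral bm_integrable bphi) (auto simp: phi_nonneg)
    also have "... <= ennreal (a N)" by (intro ennreal_leI le)
    finally show "(\<integral>\<^sup>+x. ennreal (phi (fs Z N (hc c t) x - m)) \<partial>M) <= ennreal (a N)" .
  qed
  also have "... = 0"
    using tendsto_ennrealI[OF lim] by (auto simp: a_def[symmetric] intro: lim_imp_Liminf[OF sequentially_bot])
  finally have "(\<integral>\<^sup>+x. ennreal (phi (U x - m)) \<partial>M) = 0" by simp
  hence "AE x in M. ennreal (phi (U x - m)) = 0" by (subst (asm) nn_integral_0_iff_AE) auto
  thus ?thesis proof eventually_elim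
    case (elim x)
    hence "phi (U x - m) = 0" using phi_nonneg(1)[of "U x - m"] by simp
    thus ?case by (simp add: phi_eq_0)
  qed
qed

lemma heat_contraction:
  assumes m: "0 <= m" and t: "0 <= t"
    and g: "g \<in> borel_measurable M" "!!x. x \<in> I ==> \<bar>g x\<bar> <= m"
    and lim: "(%N. ip (%x. g x - fs Z N c x) (%x. g x - fs Z N c x)) ----> 0"
    and U: "!!x. x \<in> I ==> (%N. fs Z N (hc c t) x) ----> U x"
  shows "AE x in M. \<bar>U x\<bar> <= m"
proof -
  have "AE x in M. - U x <= m" proof (rule heat_upper_bound[OF m t])
    show "(%x. - g x) \<in> borel_measurable M" "!!x. x \<in> I ==> \<bar>- g x\<bar> <= m" using g by auto
    have eq: "fs Z N (%n. - c n * d n) x = - fs Z N (%n. c n * d n) x" for N x d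
      by (simp add: fs_def sum_negf)
    have "(- g x - fs Z N (%n. - c n) x) * (- g x - fs Z N (%n. - c n) x) = (g x - fs Z N c x) * (g x - fs Z N c x)" for N x
      using eq[of N "%_. 1" x] by (simp add: algebra_simps)
    thus "(%N. ip (%x. - g x - fs Z N (%n. - c n) x) (%x. - g x - fs Z N (%n. - c n) x)) ----> 0"
      using lim by (simp add: ip_def)
    have "fs Z N (hc (%n. - c n) t) x = - fs Z N (hc c t) x" for N x by (rule eq)
    thus "(%N. fs Z N (hc (%n. - c n) t) x) ----> - U x" if "x \<in> I" for x
      using tendsto_minus[OF U[OF that]] by simp
  qed
  moreover have "AE x in M. U x <= m" by (rule heat_upper_bound[OF m t g lim U])
  ultimately show ?thesis by eventually_elim auto
qed

end

end

section \<open>Density of the finite sums in L^p\<close>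

context sturm
begin

lemma exp_kappa: "exp (- kappa n * t) = exp ((lam 0)\<^sup>2 * t) * exp (- (lam n)\<^sup>2 * t)"
  by (simp add: kappa_def algebra_simps flip: exp_add)

lemma summable_heat_B: "0 < t ==> summable (%n. exp (- kappa n * t) * B n * B n)"
  using summable_mult[OF summable_B, of t "exp ((lam 0)\<^sup>2 * t)"]
  unfolding exp_kappa by (simp add: power2_eq_square mult.assoc)

text \<open>\<open>D n\<close> exceeds \<open>B n\<close> by a factor of order
  \<open>kappa n\<close>, absorbed by giving up half of the time: \<open>kappa n * exp (- kappa n *
  t) <= 2 / t * exp (- kappa n * (t / 2))\<close>.\<close>

lemma summable_heat_D: assumes t: "0 < t" shows "summable (%n. exp (- kappa n * t) * B n * D n)"
proof (rule summable_comparison_test')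
  show "summable (%n. (2 / t * (1 + 2 * K + 2 * K\<^sup>2)) * (exp (- kappa n * (t / 2)) * B n * B n))"
    using t by (intro summable_mult summable_heat_B) auto
  fix n
  have "kappa n * (t / 2) <= exp (kappa n * (t / 2))" using exp_ge_add_one_self[of "kappa n * (t / 2)"] by linarith
  hence "2 / t * (kappa n * (t / 2)) <= 2 / t * exp (kappa n * (t / 2))"
    using t by (intro mult_left_mono) auto
  hence "kappa n * exp (- kappa n * t) <= 2 / t * exp (kappa n * (t / 2)) * exp (- kappa n * t)"
    using t by (intro mult_right_mono) auto
  also have "... = 2 / t * exp (- kappa n * (t / 2))" by (simp add: mult.assoc exp_add[symmetric])
  finally have *: "kappa n * exp (- kappa n * t) <= 2 / t * exp (- kappa n * (t / 2))" .
  have K: "0 <= 1 + 2 * K + 2 * K\<^sup>2" using K_ge_1 by simp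
  have "norm (exp (- kappa n * t) * B n * D n) = (kappa n * exp (- kappa n * t)) * (B n * B n * (1 + 2 * K + 2 * K\<^sup>2))"
    using B_nonneg[of n] kappa_nonneg[of n] K by (simp add: abs_mult D_def mult_ac abs_of_nonneg)
  also have "... <= (2 / t * exp (- kappa n * (t / 2))) * (B n * B n * (1 + 2 * K + 2 * K\<^sup>2))"
    using K by (intro mult_right_mono * mult_nonneg_nonneg B_nonneg)
  finally show "norm (exp (- kappa n * t) * B n * D n) <= (2 / t * (1 + 2 * K + 2 * K\<^sup>2)) * (exp (- kappa n * (t / 2)) * B n * B n)"
    by (simp only: mult_ac)
qed

lemma heat_series:
  assumes c: "!!n. \<bar>c n\<bar> <= C * B n" and Z: "!!n x. x \<in> I ==> \<bar>Z n x\<bar> <= Bz n"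
    and sm: "summable (%n. exp (- kappa n * t) * B n * Bz n)"
  shows "uniform_limit I (%N x. fs Z N (hc c t) x) (%x. \<Sum>n. hc c t n * Z n x) sequentially"
  unfolding fs_def proof (rule Weierstrass_m_test[where M = "%n. C * (exp (- kappa n * t) * B n * Bz n)"])
  show "summable (%n. C * (exp (- kappa n * t) * B n * Bz n))" using sm by (rule summable_mult)
  fix n x assume x: "x \<in> I"
  have "norm (hc c t n * Z n x) = exp (- kappa n * t) * (\<bar>c n\<bar> * \<bar>Z n x\<bar>)" by (simp add: abs_mult mult_ac)
  also have "... <= exp (- kappa n * t) * (C * B n * Bz n)"
    using c[of n] Z[OF x, of n] by (intro mult_left_mono mult_mono) (auto intro: order_trans[OF abs_ge_zero])
  finally show "norm (hc c t n * Z n x) <= C * (exp (- kappa n * t) * B n * Bz n)" by (simp add: mult_ac)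
qed

text \<open>The expansion of \<open>psi\<close> is known to converge in L^2 only. After a short heat
  time it converges uniformly, and by contraction its sum stays below \<open>m\<close>; a long
  truncation is then bounded by \<open>m + 1\<close> and close to \<open>psi\<close> in L^2, which
  \<open>powr_le_delta_sq\<close> turns into closeness in L^p.\<close>

lemma test_span_approx:
  assumes sys: "sys Z Z1 Z2 rho" and orth: "!!m n. ip (Z m) (Z n) = (if m = n then gamma n else 0)"
    and Z: "!!n x. x \<in> I ==> \<bar>Z n x\<bar> <= Bz n"
    and sm: "!!t. 0 < t ==> summable (%n. exp (- kappa n * t) * B n * Bz n)"
    and psi: "psi \<in> borel_measurable M" "!!x. x \<in> I ==> \<bar>psi x\<bar> <= m" and m: "0 <= m"
    and c: "!!n. \<bar>c n\<bar> <= C * B n"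
    and lim: "(%N. ip (%x. psi x - fs Z N c x) (%x. psi x - fs Z N c x)) ----> 0"
    and p: "0 < p" and d: "0 < d"
  shows "\<exists>N c'. Lp_int M p (%x. fs Z N c' x - psi x) < d"
proof -
  have b: "bm psi" "bm (fs Z N c')" for N c'
    by (rule bmI[OF psi], assumption) (rule bm_fs[OF sysD(5)[OF sys]])
  define mu where "mu = measure M (space M) + 1"
  have mu: "0 < mu" by (simp add: mu_def add_nonneg_pos)
  define delta where "delta = (d / (2 * mu)) powr (1 / p)"
  have delta: "0 < delta" "delta powr p = d / (2 * mu)" using d mu p by (auto simp: delta_def powr_powr)
  define A where "A = 2 * m + 1"
  have A: "0 < A" using m by (simp add: A_def)
  \<comment> \<open>The squared L^2 distance will be at most \<open>18 * eps\<close>: pieces of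
    sizes \<open>4 * eps\<close>, \<open>eps\<close> and \<open>eps\<close>, times the factor 3 of
    \<open>q3\<close>. Its share of \<open>d\<close> is a quarter; \<open>delta\<close> takes a
    half.\<close>
  define eps where "eps = d / 4 / (A powr p / delta\<^sup>2) / 18"
  have eps: "0 < eps" using d A delta by (simp add: eps_def)
  define q where "q f = ip f f" for f
  have q3: "q (%x. f x + g x + h x) <= 3 * (q f + q g + q h)" if "bm f" "bm g" "bm h" for f g h proof -
    have "q (%x. f x + g x + h x) <= (LINT x|M. 3 * (f x * f x + g x * g x + h x * h x))"
      unfolding q_def ip_def proof (rule integral_mono)
      show "(f x + g x + h x) * (f x + g x + h x) <= 3 * (f x * f x + g x * g x + h x * h x)" for x proof -
        have "0 <= (f x - g x)\<^sup>2 + (g x - h x)\<^sup>2 + (f x - h x)\<^sup>2" by simp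
        thus ?thesis by (simp add: power2_eq_square algebra_simps)
      qed
    qed (intro bm_integrable bm_cmult bm_add bm_mult that)+
    also have "... = 3 * (q f + q g + q h)" using that by (simp add: q_def ip_def bm_integrable bm_mult)
    finally show ?thesis .
  qed
  have qfs: "q (fs Z N c) = (\<Sum>n<N. gamma n * (c n)\<^sup>2)" for N c
    unfolding q_def by (subst ip_fs_fs[where gamma = gamma]) (auto simp: sysD(5)[OF sys] orth power2_eq_square)
  have gamma: "0 <= gamma n" for n using ip_nonneg[of "Z n"] orth[of n n] by simp
  have "\<forall>\<^sub>F N in sequentially. ip (%x. psi x - fs Z N c x) (%x. psi x - fs Z N c x) < eps"
    using lim eps by (rule order_tendstoD)
  then obtain N0 where N0: "!!N. N >= N0 ==> q (%x. psi x - fs Z N c x) < eps"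
    by (auto simp: eventually_sequentially q_def)
  have "((%t. \<Sum>n<N0. gamma n * (c n * (exp (- kappa n * t) - 1))\<^sup>2) ---> (\<Sum>n<N0. gamma n * (c n * (exp (- kappa n * 0) - 1))\<^sup>2)) (at_right 0)"
    by (intro tendsto_intros)
  hence "((%t. \<Sum>n<N0. gamma n * (c n * (exp (- kappa n * t) - 1))\<^sup>2) ---> 0) (at_right 0)" by simp
  hence "\<forall>\<^sub>F t in at_right 0. (\<Sum>n<N0. gamma n * (c n * (exp (- kappa n * t) - 1))\<^sup>2) < eps"
    using eps by (rule order_tendstoD)
  moreover have "\<forall>\<^sub>F t::real in at_right 0. 0 < t" by (simp add: eventually_at_right_less)
  ultimately have "\<forall>\<^sub>F t in at_right 0. 0 < t & (\<Sum>n<N0. gamma n * (c n * (exp (- kappa n * t) - 1))\<^sup>2) < eps"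
    by eventually_elim auto
  then obtain t where t: "0 < t" "(\<Sum>n<N0. gamma n * (c n * (exp (- kappa n * t) - 1))\<^sup>2) < eps"
    using eventually_happens[of _ "at_right (0::real)"] by auto
  define U where "U x = (\<Sum>n. hc c t n * Z n x)" for x
  have ul: "uniform_limit I (%N x. fs Z N (hc c t) x) U sequentially"
    unfolding U_def by (rule heat_series[OF c Z sm[OF t(1)]])
  have UAE: "AE x in M. \<bar>U x\<bar> <= m"
    by (rule heat_contraction[OF sys m less_imp_le[OF t(1)] psi lim tendsto_uniform_limitI[OF ul]])
  have "\<forall>\<^sub>F N in sequentially. \<forall>x\<in>I. dist (fs Z N (hc c t) x) (U x) < 1"
    using ul by (auto simp: uniform_limit_iff)
  then obtain N1' where N1': "!!N x. N >= N1' ==> x \<in> I ==> dist (fs Z N (hc c t) x) (U x) < 1"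
    unfolding eventually_sequentially by blast
  define N1 where "N1 = max N0 N1'"
  have N1: "N0 <= N1" "!!x. x \<in> I ==> \<bar>fs Z N1 (hc c t) x - U x\<bar> < 1"
    using N1'[of N1] by (auto simp: N1_def dist_real_def)
  define h where "h = fs Z N1 (hc c t)"
  define h0 where "h0 = fs Z N0 (hc c t)"
  define f0 where "f0 = fs Z N0 c"
  have bh: "bm h" "bm h0" "bm f0" unfolding h_def h0_def f0_def by (rule b)+
  \<comment> \<open>The heat factors only shrink the tail between \<open>N0\<close> and
    \<open>N1\<close>, and the unshrunk tail is a difference of two residuals.\<close>
  have "q (%x. h x - h0 x) <= 4 * eps" proof -
    have diff: "fs Z N1 c' x - fs Z N0 c' x = fs Z N1 (%n. if n < N0 then 0 else c' n) x" for c' x proof -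
      have "fs Z N0 c' x = (\<Sum>n<N1. if n < N0 then c' n * Z n x else 0)"
        unfolding fs_def using N1(1) by (intro sum.mono_neutral_cong_left) auto
      hence "fs Z N1 c' x - fs Z N0 c' x = (\<Sum>n<N1. c' n * Z n x - (if n < N0 then c' n * Z n x else 0))"
        by (simp add: fs_def sum_subtractf)
      also have "... = fs Z N1 (%n. if n < N0 then 0 else c' n) x" unfolding fs_def by (intro sum.cong) auto
      finally show ?thesis .
    qed
    have "q (%x. h x - h0 x) = (\<Sum>n<N1. gamma n * (if n < N0 then 0 else hc c t n)\<^sup>2)"
      unfolding h_def h0_def diff qfs ..
    also have "... <= (\<Sum>n<N1. gamma n * (if n < N0 then 0 else c n)\<^sup>2)"
    proof (intro sum_mono mult_left_mono gamma)
      fix n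
      have "exp (- kappa n * t) <= 1" using kappa_nonneg[of n] t by simp
      hence "\<bar>c n * exp (- kappa n * t)\<bar> <= \<bar>c n\<bar>" by (simp add: abs_mult mult_left_le)
      hence "(c n * exp (- kappa n * t))\<^sup>2 <= (c n)\<^sup>2" by (simp only: abs_le_square_iff)
      thus "(if n < N0 then 0 else hc c t n)\<^sup>2 <= (if n < N0 then 0 else c n)\<^sup>2" by simp
    qed
    also have "... = q (%x. fs Z N1 c x - fs Z N0 c x)" unfolding diff qfs ..
    also have "... = q (%x. (psi x - fs Z N0 c x) - (psi x - fs Z N1 c x))" by simp
    also have "... <= 2 * (q (%x. psi x - fs Z N0 c x) + q (%x. psi x - fs Z N1 c x))" proof -
      let ?F = "%x. psi x - fs Z N0 c x" and ?G = "%x. psi x - fs Z N1 c x"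
      have bb: "bm ?F" "bm ?G" by (intro bm_diff b)+
      have "q (%x. ?F x - ?G x) + q (%x. ?F x + ?G x) = 2 * (q ?F + q ?G)"
        unfolding q_def by (simp only: ip_square_diff[OF bb] ip_square_add[OF bb]) simp
      moreover have "0 <= q (%x. ?F x + ?G x)" unfolding q_def by (rule ip_nonneg)
      ultimately show ?thesis by linarith
    qed
    also have "... <= 4 * eps" using N0[of N0] N0[OF N1(1)] by simp
    finally show ?thesis .
  qed
  moreover have "q (%x. h0 x - f0 x) < eps" proof -
    have "h0 x - f0 x = fs Z N0 (%n. c n * (exp (- kappa n * t) - 1)) x" for x
      by (simp add: h0_def f0_def fs_def sum_subtractf[symmetric] algebra_simps)
    thus ?thesis using t(2) by (simp add: qfs)
  qed
  moreover have "q (%x. f0 x - psi x) < eps" proof -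
    have "q (%x. f0 x - psi x) = q (%x. psi x - f0 x)" by (simp add: q_def ip_def algebra_simps)
    thus ?thesis using N0[of N0] by (simp add: f0_def)
  qed
  moreover have "q (%x. h x - psi x)
      <= 3 * (q (%x. h x - h0 x) + q (%x. h0 x - f0 x) + q (%x. f0 x - psi x))"
    using q3[OF bm_diff[OF bh(1,2)] bm_diff[OF bh(2,3)] bm_diff[OF bh(3) b(1)]] by simp
  moreover have "Q <= 18 * eps" if "q1 <= 4 * eps" "q2 < eps" "q3 < eps" "Q <= 3 * (q1 + q2 + q3)" for Q q1 q2 q3
    using that unfolding distrib_left by simp
  ultimately have qh: "q (%x. h x - psi x) <= 18 * eps" by blast
  have bhp: "bm (%x. h x - psi x)" by (intro bm_diff bh b)
  have le: "AE x in M. norm (h x - psi x) powr p <= delta powr p + A powr p / delta\<^sup>2 * ((h x - psi x) * (h x - psi x))"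
    using UAE AE_space proof eventually_elim
    fix x assume x: "\<bar>U x\<bar> <= m" "x \<in> space M"
    hence xI: "x \<in> I" by (simp add: space_M)
    have "\<bar>h x - psi x\<bar> <= A" using N1(2)[OF xI] x(1) psi(2)[OF xI] unfolding h_def A_def by linarith
    from powr_le_delta_sq[OF abs_ge_zero this delta(1) p]
    show "norm (h x - psi x) powr p <= delta powr p + A powr p / delta\<^sup>2 * ((h x - psi x) * (h x - psi x))"
      by (simp add: power2_eq_square)
  qed
  have "Lp_int M p (%x. h x - psi x) <= (LINT x|M. delta powr p + A powr p / delta\<^sup>2 * ((h x - psi x) * (h x - psi x)))"
    by (intro Lp_space_dominated(2) le bm_meas bhp bm_integrable bm_add bm_const bm_cmult bm_mult)
  also have "... = delta powr p * measure M (space M) + A powr p / delta\<^sup>2 * q (%x. h x - psi x)"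
    using bm_integrable[OF bm_mult[OF bhp bhp]] by (simp add: q_def ip_def)
  also have "... <= delta powr p * mu + A powr p / delta\<^sup>2 * (18 * eps)"
    using qh A delta(1) by (intro add_mono mult_left_mono) (auto simp: mu_def)
  also have "... = d / 2 + d / 4" using A delta mu by (simp add: eps_def)
  also have "... < d" using d by simp
  finally have "Lp_int M p (%x. h x - psi x) < d" .
  thus ?thesis unfolding h_def by blast
qed

lemma Lp_bm: "0 < p ==> bm f ==> f \<in> Lp_space M p"
proof -
  assume "0 < p" "bm f"
  then obtain C where "!!x. x \<in> I ==> \<bar>f x\<bar> <= C" using bmE by blast
  thus ?thesis using \<open>0 < p\<close> bm_meas[OF \<open>bm f\<close>]
    by (intro Lp_bounded[where C = C]) (auto simp: space_M)
qed

lemma Lp_dense_trans: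
  assumes p: "0 < p" and f: "f \<in> Lp_space M p" and d: "0 < d"
    and test: "!!psi d. test_function psi ==> 0 < d ==> \<exists>N c. Lp_int M p (%x. fs Z N c x - psi x) < d"
    and Z: "!!n. bm (Z n)"
  shows "\<exists>N c. Lp_int M p (%x. fs Z N c x - f x) < d"
proof -
  define eps where "eps = d / (2 * 2 powr p)"
  have eps: "0 < eps" using d by (simp add: eps_def)
  obtain psi where psi: "test_function psi" "Lp_int M p (%x. psi x - f x) < eps"
    using test_dense[OF p f] eps unfolding test_approx_def by blast
  obtain N c where c: "Lp_int M p (%x. fs Z N c x - psi x) < eps" using test[OF psi(1) eps] by blast
  have "Lp_int M p (%x. fs Z N c x - f x) = Lp_int M p (%x. (fs Z N c x - psi x) + (psi x - f x))" by simp
  also have "... <= 2 powr p * (Lp_int M p (%x. fs Z N c x - psi x) + Lp_int M p (%x. psi x - f x))"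
    by (intro Lp_add Lp_diff p f Lp_test psi Lp_bm bm_fs Z)
  also have "... < 2 powr p * (eps + eps)" using psi c by (intro mult_strict_left_mono) auto
  also have "... = d" by (simp add: eps_def)
  finally show ?thesis by blast
qed

lemma span_dense_e:
  assumes p: "0 < p" and f: "f \<in> Lp_space M p" and d: "0 < d"
  shows "\<exists>N c. Lp_int M p (%x. fs e N c x - f x) < d"
proof (rule Lp_dense_trans[OF p f d])
  fix psi :: "real => real" and d :: real assume psi: "test_function psi" and d: "0 < d"
  obtain m where m: "0 < m" "!!x. \<bar>psi x\<bar> <= m" using test_function_bounded[OF psi] by blast
  show "\<exists>N c. Lp_int M p (%x. fs e N c x - psi x) < d"
  proof (rule test_span_approx[where c = "%k. ip psi (e k)"])
    show "sys e e1 e2 (%_. 0)" by (rule sys_e)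
    show "ip (e m) (e n) = (if m = n then 1 else 0)" for m n by (rule ip_e)
    show "\<bar>ip psi (e n)\<bar> <= m * measure M (space M) * B n" for n
      using m psi by (intro coefficient_bound bm_meas bm_test) auto
    show "(%N. ip (%x. psi x - fs e N (%k. ip psi (e k)) x) (%x. psi x - fs e N (%k. ip psi (e k)) x)) ----> 0"
      by (rule completeness[OF test_function_deriv[OF psi] bm_test[OF test_function_derivI[OF psi]] bm_test[OF psi]])
  qed (use m psi p d bm_meas[OF bm_test[OF psi]] e_bound summable_heat_B in auto)
qed (rule bm_e)

lemma span_dense_e1:
  assumes p: "0 < p" and f: "f \<in> Lp_space M p" and d: "0 < d"
  shows "\<exists>N c. Lp_int M p (%x. fs e1 N c x - f x) < d"
proof (rule Lp_dense_trans[OF p f d])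
  fix psi :: "real => real" and d :: real assume psi: "test_function psi" and d: "0 < d"
  obtain m where m: "0 < m" "!!x. \<bar>psi x\<bar> <= m" using test_function_bounded[OF psi] by blast
  obtain c C where c: "!!k. \<bar>c k\<bar> <= C * B k"
    "(%n. ip (%x. psi x - fs e1 n c x) (%x. psi x - fs e1 n c x)) ----> 0"
    using test_completeness_deriv[OF psi] by blast
  show "\<exists>N c. Lp_int M p (%x. fs e1 N c x - psi x) < d" proof (rule test_span_approx[where c = c])
    show "sys e1 e2 e3 r" by (rule sys_e1)
    show "ip (e1 m) (e1 n) = (if m = n then kappa n else 0)" for m n by (rule ip_e)
  qed (use m psi p d c bm_meas[OF bm_test[OF psi]] e1_bound' summable_heat_D in auto)
qed (rule bm_e)

end

section \<open>The Bellman function along the Poisson flows\<close>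

lemma continuous_bounded_on_square:
  fixes g :: "real => real => real"
  assumes "continuous_on UNIV (%(u, v). g u v)"
  shows "\<exists>C\<ge>0. \<forall>u v. \<bar>u\<bar> <= R --> \<bar>v\<bar> <= R --> \<bar>g u v\<bar> <= C"
proof -
  have "compact ((%(u, v). g u v) ` ({-R..R} \<times> {-R..R}))"
    by (intro compact_continuous_image continuous_on_subset[OF assms] compact_Times) auto
  hence "bounded ((%(u, v). g u v) ` ({-R..R} \<times> {-R..R}))" by (rule compact_imp_bounded)
  then obtain C where "0 < C" "\<forall>y\<in>(%(u, v). g u v) ` ({-R..R} \<times> {-R..R}). norm y <= C"
    unfolding bounded_pos by blast
  thus ?thesis by (intro exI[of _ C]) (auto simp: abs_le_iff)
qed

context bellman
begin

lemma continuous_factors: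
  "continuous_on UNIV (%(u, v). BB u v * (p * (SS u * UU u) + 2 * (SS v * RR v)))"
  "continuous_on UNIV (%(u, v). q * RR v * (a * SS u * BB u v + K))" proof -
  have S: "continuous_on UNIV (%z::real \<times> real. SS (fst z))" "continuous_on UNIV (%z::real \<times> real. SS (snd z))"
    unfolding SS_def by (intro continuous_intros)+
  have U: "continuous_on UNIV (%z::real \<times> real. UU (fst z))" "continuous_on UNIV (%z::real \<times> real. RR (snd z))"
    unfolding UU_def RR_def using nz by (intro continuous_on_powr S continuous_on_const ballI; simp)+
  have N: "continuous_on UNIV (%z::real \<times> real. NN (fst z) (snd z))"
    unfolding NN_def by (intro continuous_intros S U)
  have B: "continuous_on UNIV (%z::real \<times> real. BB (fst z) (snd z))"
    unfolding BB_def using nz by (intro continuous_on_powr N continuous_on_const ballI; simp)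
  show "continuous_on UNIV (%(u, v). BB u v * (p * (SS u * UU u) + 2 * (SS v * RR v)))"
    "continuous_on UNIV (%(u, v). q * RR v * (a * SS u * BB u v + K))"
    unfolding case_prod_beta by (intro continuous_intros S U N B)+
qed

lemma measurable_Q:
  assumes [measurable]: "f \<in> borel_measurable N" "g \<in> borel_measurable N"
  shows "(%x. Q (f x) (g x)) \<in> borel_measurable N" "(%x. Qu (f x) (g x)) \<in> borel_measurable N"
    "(%x. Qv (f x) (g x)) \<in> borel_measurable N" "(%x. Quu (f x) (g x)) \<in> borel_measurable N"
    "(%x. Quv (f x) (g x)) \<in> borel_measurable N" "(%x. Qvv (f x) (g x)) \<in> borel_measurable N"
proof -
  have *: "(%x. h (f x) (g x)) \<in> borel_measurable N"
    if "continuous_on UNIV (%(u, v). h u v)" for h :: "real => real => real" proof -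
    have "(%(u, v). h u v) \<in> borel_measurable (borel \<Otimes>\<^sub>M borel)"
      using borel_measurable_continuous_onI[OF that] by (simp add: borel_prod)
    from measurable_compose[OF measurable_Pair[OF assms] this] show ?thesis by simp
  qed
  show "(%x. Q (f x) (g x)) \<in> borel_measurable N" "(%x. Qu (f x) (g x)) \<in> borel_measurable N"
    "(%x. Qv (f x) (g x)) \<in> borel_measurable N" "(%x. Quu (f x) (g x)) \<in> borel_measurable N"
    "(%x. Quv (f x) (g x)) \<in> borel_measurable N" "(%x. Qvv (f x) (g x)) \<in> borel_measurable N"
    by (intro * continuous_Q)+
qed

end

context sturm
begin

text \<open>The multiplier \<open>k\<close> encodes time derivatives of the Poisson flow: 1 for the
  flow, \<open>- lam n\<close> for the first and \<open>(lam n)^2\<close> for the second.\<close>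

abbreviation (input) "pc k c t \<equiv> (%n. k n * (c n * exp (- lam n * t)))"

lemma poisson_deriv:
  "DERIV (%t. fs Z N (pc k c t) x) t :> fs Z N (pc (%n. - lam n * k n) c t) x"
  unfolding fs_def by (auto intro!: derivative_eq_intros sum.cong simp: algebra_simps)

definition ub :: "real set => (real => real => real) => bool" where
  "ub T f \<longleftrightarrow> (\<exists>C. \<forall>t\<in>T. \<forall>x\<in>I. \<bar>f t x\<bar> <= C)"

lemma ubI: "(!!t x. t \<in> T ==> x \<in> I ==> \<bar>f t x\<bar> <= C) ==> ub T f"
  unfolding ub_def by blast

lemma ubE:
  assumes "ub T f" obtains C where "0 < C" "!!t x. t \<in> T ==> x \<in> I ==> \<bar>f t x\<bar> <= C"
proof -
  obtain C where C: "!!t x. t \<in> T ==> x \<in> I ==> \<bar>f t x\<bar> <= C" using assms unfolding ub_def by blast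
  show thesis by (rule that[of "max 1 C"]) (use C in \<open>auto simp: le_max_iff_disj\<close>)
qed

lemma ub_add: assumes "ub T f" "ub T g" shows "ub T (%t x. f t x + g t x)"
proof -
  obtain C where C: "0 < C" "!!t x. t \<in> T ==> x \<in> I ==> \<bar>f t x\<bar> <= C" by (rule ubE[OF assms(1)]) blast
  obtain D where D: "0 < D" "!!t x. t \<in> T ==> x \<in> I ==> \<bar>g t x\<bar> <= D" by (rule ubE[OF assms(2)]) blast
  show ?thesis by (rule ubI[of _ _ "C + D"]) (rule order_trans[OF abs_triangle_ineq add_mono[OF C(2) D(2)]])
qed

lemma ub_mult: assumes "ub T f" "ub T g" shows "ub T (%t x. f t x * g t x)"
proof -
  obtain C where C: "0 < C" "!!t x. t \<in> T ==> x \<in> I ==> \<bar>f t x\<bar> <= C" by (rule ubE[OF assms(1)]) blast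
  obtain D where D: "0 < D" "!!t x. t \<in> T ==> x \<in> I ==> \<bar>g t x\<bar> <= D" by (rule ubE[OF assms(2)]) blast
  show ?thesis by (rule ubI[of _ _ "C * D"]) (unfold abs_mult, rule mult_mono[OF C(2) D(2)], use C(1) in auto)
qed

lemma ub_comp:
  assumes g: "continuous_on UNIV (%(u, v). g u v)" and "ub T f" "ub T h"
  shows "ub T (%t x. g (f t x) (h t x))"
proof -
  obtain C where C: "0 < C" "!!t x. t \<in> T ==> x \<in> I ==> \<bar>f t x\<bar> <= C" by (rule ubE[OF assms(2)]) blast
  obtain D where D: "0 < D" "!!t x. t \<in> T ==> x \<in> I ==> \<bar>h t x\<bar> <= D" by (rule ubE[OF assms(3)]) blast
  obtain E where E: "!!u v. \<bar>u\<bar> <= C + D ==> \<bar>v\<bar> <= C + D ==> \<bar>g u v\<bar> <= E"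
    using continuous_bounded_on_square[OF g, of "C + D"] by blast
  show ?thesis proof (rule ubI[of _ _ E], rule E)
    fix t x assume tx: "t \<in> T" "x \<in> I"
    show "\<bar>f t x\<bar> <= C + D" "\<bar>h t x\<bar> <= C + D" using C(2)[OF tx] D(2)[OF tx] C(1) D(1) by linarith+
  qed
qed

lemma ub_poisson:
  assumes "sys Z Z1 Z2 rho" and s: "!!t n. t \<in> T ==> \<bar>exp (- lam n * t) * s t\<bar> <= B' n"
  shows "ub T (%t x. fs Z N (pc k c t) x * s t)"
proof -
  have "\<bar>pc k c t n * s t\<bar> <= \<bar>k n * c n\<bar> * B' n" if "t \<in> T" for t n
    using mult_left_mono[OF s[OF that], of "\<bar>k n * c n\<bar>" n] by (simp add: abs_mult mult_ac)
  from fs_uniform_bound[where T = T and N = N and c = "%t n. pc k c t n * s t", OF assms(1) this]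
  obtain C where C: "!!t x. t \<in> T ==> x \<in> I ==> \<bar>fs Z N (%n. pc k c t n * s t) x\<bar> <= C" by blast
  have "fs Z N (%n. pc k c t n * s t) x = fs Z N (pc k c t) x * s t" for t x
    by (simp add: fs_def sum_distrib_left sum_distrib_right mult_ac)
  with C show ?thesis unfolding ub_def by metis
qed

lemma ub_poisson_local: assumes "sys Z Z1 Z2 rho" shows "ub {t. \<bar>t - t0\<bar> < 1} (%t. fs Z N (pc k c t))"
proof -
  have "\<bar>exp (- lam n * t) * 1\<bar> <= exp (lam n * (\<bar>t0\<bar> + 1))" if "t \<in> {t. \<bar>t - t0\<bar> < 1}" for t n
  proof -
    have "- t <= \<bar>t0\<bar> + 1" using that by auto
    hence "lam n * (- t) <= lam n * (\<bar>t0\<bar> + 1)" using lam_pos[of n] by (intro mult_left_mono) auto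
    thus ?thesis by simp
  qed
  hence "ub {t. \<bar>t - t0\<bar> < 1} (%t x. fs Z N (pc k c t) x * 1)" by (rule ub_poisson[OF assms])
  thus ?thesis by simp
qed

lemma ub_poisson_decay:
  assumes "sys Z Z1 Z2 rho"
  shows "ub {0..} (%t. fs Z N (pc k c t))" "ub {0..} (%t x. fs Z N (pc k c t) x * exp (lam 0 * t))"
proof -
  have "\<bar>exp (- lam n * t) * 1\<bar> <= 1" if "t \<in> {0..}" for t n using lam_pos[of n] that by simp
  hence "ub {0..} (%t x. fs Z N (pc k c t) x * 1)" by (rule ub_poisson[OF assms])
  thus "ub {0..} (%t. fs Z N (pc k c t))" by simp
  show "ub {0..} (%t x. fs Z N (pc k c t) x * exp (lam 0 * t))" proof (rule ub_poisson[OF assms])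
    fix t n assume "t \<in> {0::real..}"
    moreover have "lam 0 <= lam n" using lam_mono by (simp add: strict_mono_less_eq)
    ultimately have "lam 0 * t <= lam n * t" by (intro mult_right_mono) auto
    thus "\<bar>exp (- lam n * t) * exp (lam 0 * t)\<bar> <= 1" by (simp add: exp_add[symmetric])
  qed
qed

text \<open>As \<open>kappa n = (lam n)^2 - (lam 0)^2\<close>, the flow satisfies
  \<open>u_xx + b * u_x + u_tt = (rho + (lam 0)^2) * u\<close>: the exponent \<open>lam n\<close>
  adds a constant to the potential.\<close>

lemma poisson_ode:
  assumes "sys Z Z1 Z2 rho" "x \<in> I"
  shows "fs Z2 N (pc (%_. 1) c t) x = (rho x + (lam 0)\<^sup>2) * fs Z N (pc (%_. 1) c t) x
    - fs Z N (pc (%n. (lam n)\<^sup>2) c t) x - b x * fs Z1 N (pc (%_. 1) c t) x" proof -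
  have "fs Z N (%n. - kappa n * pc (%_. 1) c t n) x
    = (lam 0)\<^sup>2 * fs Z N (pc (%_. 1) c t) x - fs Z N (pc (%n. (lam n)\<^sup>2) c t) x"
    by (simp add: fs_def sum_distrib_left sum_subtractf[symmetric] kappa_def algebra_simps)
  thus ?thesis using fs_ode[OF assms, of N "pc (%_. 1) c t"] by (simp add: algebra_simps)
qed

lemma exp_decay:
  assumes "0 < (a :: real)"
  shows "((%t. exp (- a * t)) ---> 0) at_top" "((%t. t * exp (- a * t)) ---> 0) at_top"
proof -
  have f: "filterlim (%t. a * t) at_top at_top"
    using assms by (intro filterlim_tendsto_pos_mult_at_top[OF tendsto_const] filterlim_ident)
  have l: "((%t. (a * t) ^ k / exp (a * t)) ---> 0) at_top" for k
    by (rule filterlim_compose[OF tendsto_power_div_exp_0 f])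
  show "((%t. exp (- a * t)) ---> 0) at_top" using l[of 0] by (simp add: exp_minus inverse_eq_divide)
  show "((%t. t * exp (- a * t)) ---> 0) at_top"
    using tendsto_mult_right_zero[OF l[of 1], of "1 / a"] assms by (simp add: exp_minus field_simps)
qed

text \<open>\<open>m t\<close> is the integral of the Bellman function of the two flows. Its second
  derivative contains the time Hessian and the terms with \<open>utt\<close> and \<open>vtt\<close>.
  Adding the divergence of \<open>w * (Qu * ux + Qv * vx)\<close> brings in the space Hessian and
  turns these terms into \<open>(rho + (lam 0)^2) * Qu * u\<close> and its analogue for
  \<open>v\<close>, nonnegative by the sign lemmas. The two Hessians dominate the products by
  \<open>hess_pair\<close>.\<close>

lemma bellman_flow:
  fixes c d :: "nat => real" and N :: nat
  assumes Z: "sys Z Z1 Z2 rho" and Y: "sys Y Y1 Y2 rho'" and bel: "bellman p q eps"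
  defines "u \<equiv> %t. fs Z N (pc (%_. 1) c t)" and "v \<equiv> %t. fs Y N (pc (%_. 1) d t)"
    and "ux \<equiv> %t. fs Z1 N (pc (%_. 1) c t)" and "vx \<equiv> %t. fs Y1 N (pc (%_. 1) d t)"
    and "ut \<equiv> %t. fs Z N (pc (%n. - lam n) c t)" and "vt \<equiv> %t. fs Y N (pc (%n. - lam n) d t)"
  obtains m m' m'' where "!!t. DERIV m t :> m' t" "!!t. DERIV m' t :> m'' t"
    "!!t. 2 * \<bar>ip (ux t) (vt t)\<bar> <= m'' t" "!!t. 2 * \<bar>ip (ut t) (vx t)\<bar> <= m'' t"
    "!!t. 0 <= m t" "m 0 = (LINT x|M. bellman.Q p q eps (fs Z N c x) (fs Y N d x))"
    "((%t. t * m' t) ---> 0) at_top" proof -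
  interpret bl: bellman p q eps by (rule bel)
  define utt vtt where "utt t = fs Z N (pc (%n. (lam n)\<^sup>2) c t)" and "vtt t = fs Y N (pc (%n. (lam n)\<^sup>2) d t)" for t
  note defs = u_def v_def ut_def vt_def utt_def vtt_def
  have td: "DERIV (%t. u t x) t :> ut t x" "DERIV (%t. v t x) t :> vt t x"
    "DERIV (%t. ut t x) t :> utt t x" "DERIV (%t. vt t x) t :> vtt t x" for t x
    unfolding defs using poisson_deriv[of Z N "%_. 1" c x t] poisson_deriv[of Y N "%_. 1" d x t]
      poisson_deriv[of Z N "%n. - lam n" c x t] poisson_deriv[of Y N "%n. - lam n" d x t]
    by (simp_all add: power2_eq_square)
  note bmZ = sysD(5)[OF Z] sysD(6)[OF Z] and bmY = sysD(5)[OF Y] sysD(6)[OF Y]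
  have bms: "bm (u t)" "bm (v t)" "bm (ut t)" "bm (vt t)" "bm (utt t)" "bm (vtt t)" "bm (ux t)" "bm (vx t)" for t
    unfolding defs ux_def vx_def by (intro bm_fs bmZ bmY)+
  note [measurable] = bms[THEN bm_meas] bl.measurable_Q[OF bms(1,2)[THEN bm_meas]]
  let ?Q = "%t x. bl.Q (u t x) (v t x)" and ?Qu = "%t x. bl.Qu (u t x) (v t x)" and ?Qv = "%t x. bl.Qv (u t x) (v t x)"
  let ?Quu = "%t x. bl.Quu (u t x) (v t x)" and ?Quv = "%t x. bl.Quv (u t x) (v t x)" and ?Qvv = "%t x. bl.Qvv (u t x) (v t x)"
  let ?H = "%f g t x. (?Quu t x * f t x + ?Quv t x * g t x) * f t x + (?Quv t x * f t x + ?Qvv t x * g t x) * g t x"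
  define E1 where "E1 t x = ?Qu t x * ut t x + ?Qv t x * vt t x" for t x
  define E2 where "E2 t x = ?H ut vt t x + (utt t x * ?Qu t x + vtt t x * ?Qv t x)" for t x
  define m m' m'' where "m t = (LINT x|M. ?Q t x)" and "m' t = (LINT x|M. E1 t x)" and "m'' t = (LINT x|M. E2 t x)" for t
  have E: "ub T ?Q" "ub T E1" "ub T E2" if T: "T = {t. \<bar>t - t0\<bar> < 1}" for T t0 proof -
    have 1: "ub T u" "ub T v" "ub T ut" "ub T vt" "ub T utt" "ub T vtt"
      unfolding T defs by (rule ub_poisson_local[OF Z] ub_poisson_local[OF Y])+
    note 2 = bl.continuous_Q[THEN ub_comp, OF 1(1,2)]
    show "ub T ?Q" by (rule 2)
    show "ub T E1" "ub T E2" unfolding E1_def[abs_def] E2_def[abs_def] by (intro ub_add ub_mult 1 2)+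
  qed
  have bnd: "\<exists>C. \<forall>t x. \<bar>t - t0\<bar> < 1 --> x \<in> I --> \<bar>f t x\<bar> <= C" if "ub {t. \<bar>t - t0\<bar> < 1} f" for f t0
    using that unfolding ub_def by blast
  have measE: "E1 t \<in> borel_measurable M" "E2 t \<in> borel_measurable M" "?Q t \<in> borel_measurable M" for t
    unfolding E1_def[abs_def] E2_def[abs_def] by measurable
  have bmI': "bm (f t)" if fu: "ub {s. \<bar>s - t\<bar> < 1} f" and fm: "f t \<in> borel_measurable M" for f t
  proof -
    obtain C where "\<forall>s x. \<bar>s - t\<bar> < 1 --> x \<in> I --> \<bar>f s x\<bar> <= C" using bnd[OF fu] by blast
    thus ?thesis by (intro bmI[OF fm, of C]) simp
  qed
  have bmEs: "bm (?Q t)" "bm (E1 t)" "bm (E2 t)" for t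
    by (rule bmI'[where f = ?Q, OF E(1)[OF refl] measE(3)] bmI'[OF E(2)[OF refl] measE(1)] bmI'[OF E(3)[OF refl] measE(2)])+
  have md: "DERIV m t :> m' t" for t proof -
    obtain C where C: "\<forall>s x. \<bar>s - t\<bar> < 1 --> x \<in> I --> \<bar>E1 s x\<bar> <= C" using bnd[OF E(2)[OF refl]] by blast
    have "DERIV (%t. ?Q t x) t :> E1 t x" for t x unfolding E1_def by (rule bl.Q_deriv[OF td(1,2)])
    thus ?thesis unfolding m_def[abs_def] m'_def
      by (rule deriv_integral[where C = C, OF _ bmEs(1) measE(1)]) (use C in blast)
  qed
  have m'd: "DERIV m' t :> m'' t" for t proof -
    obtain C where C: "\<forall>s x. \<bar>s - t\<bar> < 1 --> x \<in> I --> \<bar>E2 s x\<bar> <= C" using bnd[OF E(3)[OF refl]] by blast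
    have "DERIV (%t. E1 t x) t :> E2 t x" for t x proof -
      have "((%t. E1 t x) has_real_derivative
         ((?Quu t x * ut t x + ?Quv t x * vt t x) * ut t x + utt t x * ?Qu t x)
       + ((?Quv t x * ut t x + ?Qvv t x * vt t x) * vt t x + vtt t x * ?Qv t x)) (at t)"
        unfolding E1_def by (intro DERIV_add DERIV_mult bl.Qu_deriv bl.Qv_deriv td)
      thus ?thesis by (rule DERIV_cong) (simp add: E2_def)
    qed
    thus ?thesis unfolding m'_def[abs_def] m''_def
      by (rule deriv_integral[where C = C, OF _ bmEs(2) measE(2)]) (use C in blast)
  qed
  have key: "2 * \<bar>ip f g\<bar> <= m'' t"
    if fg: "bm f" "bm g" and H: "!!x. 2 * \<bar>f x * g x\<bar> <= ?H ut vt t x + ?H ux vx t x" for f g t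
  proof -
    define k where "k x = 2 * \<bar>f x * g x\<bar>" for x
    have k: "bm k" using bm_mult[OF fg] unfolding k_def by (intro bm_cmult) (auto simp: bm_def)
    \<comment> \<open>\<open>Qu\<close> and \<open>Qv\<close> carry the factors \<open>u\<close> and
      \<open>v\<close>; splitting these off reduces the boundary flux to the products
      \<open>u * ux\<close> and \<open>v * vx\<close>, which vanish at the ends.\<close>
    define F1 F2 where "F1 = (%u v. bl.BB u v * (p * (bl.SS u * bl.UU u) + 2 * (bl.SS v * bl.RR v)))"
      and "F2 = (%u v. q * bl.RR v * (bl.a * bl.SS u * bl.BB u v + bl.K))"
    have F: "bl.Qu x y = F1 x y * x" "bl.Qv x y = F2 x y * y" for x y
      by (simp_all add: F1_def F2_def bl.Qu_def bl.Qv_def)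
    have ut: "ub {t} u" "ub {t} v" using bms(1,2)[of t] by (auto simp: ub_def bm_def)
    note uF = bl.continuous_factors[folded F1_def F2_def, THEN ub_comp, OF ut]
    obtain D1 where D1: "0 < D1" "!!x. x \<in> I ==> \<bar>F1 (u t x) (v t x)\<bar> <= D1" by (rule ubE[OF uF(1)]) blast
    obtain D2 where D2: "0 < D2" "!!x. x \<in> I ==> \<bar>F2 (u t x) (v t x)\<bar> <= D2" by (rule ubE[OF uF(2)]) blast
    obtain Cu where Cu: "!!x. x \<in> I ==> \<bar>u t x * ux t x\<bar> <= Cu * (x * (1 - x))"
      unfolding u_def ux_def using fs_prod_bound[OF Z] by blast
    obtain Cv where Cv: "!!x. x \<in> I ==> \<bar>v t x * vx t x\<bar> <= Cv * (x * (1 - x))"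
      unfolding v_def vx_def using fs_prod_bound[OF Y] by blast
    define uxx vxx where "uxx = fs Z2 N (pc (%_. 1) c t)" and "vxx = fs Y2 N (pc (%_. 1) d t)"
    define A where "A x = w x * (?Qu t x * ux t x + ?Qv t x * vx t x)" for x
    define D' where "D' x = ?H ux vx t x + ?Qu t x * ((rho x + (lam 0)\<^sup>2) * u t x - utt t x)
      + ?Qv t x * ((rho' x + (lam 0)\<^sup>2) * v t x - vtt t x)" for x
    have bk: "bm (%x. k x - E2 t x)" by (intro bm_diff k bmEs)
    obtain Ck where Ck: "!!x. x \<in> I ==> \<bar>k x - E2 t x\<bar> <= Ck" using bmE[OF bk] by blast
    have xd: "DERIV (u t) x :> ux t x" "DERIV (v t) x :> vx t x"
      "DERIV (ux t) x :> uxx x" "DERIV (vx t) x :> vxx x" if "x \<in> I" for x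
      unfolding u_def v_def ux_def vx_def uxx_def vxx_def using that by (intro fs_deriv sysD[OF Z] sysD[OF Y]; assumption)+
    have Ad: "DERIV A x :> w x * D' x" if x: "x \<in> I" for x proof -
      have "DERIV A x :> b x * w x * (?Qu t x * ux t x + ?Qv t x * vx t x)
        + (((?Quu t x * ux t x + ?Quv t x * vx t x) * ux t x + uxx x * ?Qu t x)
         + ((?Quv t x * ux t x + ?Qvv t x * vx t x) * vx t x + vxx x * ?Qv t x)) * w x"
        unfolding A_def[abs_def] by (intro DERIV_mult DERIV_add bl.Qu_deriv bl.Qv_deriv xd w_deriv x)
      moreover have "uxx x = (rho x + (lam 0)\<^sup>2) * u t x - utt t x - b x * ux t x"
        "vxx x = (rho' x + (lam 0)\<^sup>2) * v t x - vtt t x - b x * vx t x"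
        using poisson_ode[OF Z x, of N c t] poisson_ode[OF Y x, of N d t]
        by (simp_all add: defs ux_def uxx_def vx_def vxx_def)
      ultimately show ?thesis by (auto elim!: DERIV_cong simp: D'_def algebra_simps)
    qed
    have Ab: "\<bar>A x\<bar> <= W * (D1 * Cu + D2 * Cv) * (x * (1 - x))" if x: "x \<in> I" for x proof -
      have "?Qu t x * ux t x + ?Qv t x * vx t x = F1 (u t x) (v t x) * (u t x * ux t x) + F2 (u t x) (v t x) * (v t x * vx t x)"
        by (simp add: F mult.assoc)
      also have "\<bar>...\<bar> <= D1 * (Cu * (x * (1 - x))) + D2 * (Cv * (x * (1 - x)))"
        by (intro order_trans[OF abs_triangle_ineq add_mono]; unfold abs_mult[of "F1 _ _"] abs_mult[of "F2 _ _"])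
          (intro mult_mono D1 D2 Cu Cv x less_imp_le abs_ge_zero)+
      finally have "\<bar>?Qu t x * ux t x + ?Qv t x * vx t x\<bar> <= D1 * (Cu * (x * (1 - x))) + D2 * (Cv * (x * (1 - x)))" .
      hence "\<bar>w x\<bar> * \<bar>?Qu t x * ux t x + ?Qv t x * vx t x\<bar> <= W * (D1 * (Cu * (x * (1 - x))) + D2 * (Cv * (x * (1 - x))))"
        using w_le[OF x] w_pos[OF x] W_pos by (intro mult_mono) auto
      thus ?thesis unfolding A_def abs_mult[of "w x"] by (simp add: algebra_simps)
    qed
    have "(LINT x|M. k x - E2 t x) <= 0" proof (rule flux[where S = "{}" and A = A and D = D' and C = Ck])
      show "continuous_on I A" by (rule DERIV_cont_on[OF Ad]) auto
      show "(A ---> 0) (at_right 0)" "(A ---> 0) (at_left 1)" using tendsto_ends[OF Ab] by auto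
      show "k x - E2 t x <= D' x" if "x \<in> I - {}" for x proof -
        have x: "x \<in> I" using that by simp
        have "0 <= ?Qu t x * u t x * (rho x + (lam 0)\<^sup>2)" "0 <= ?Qv t x * v t x * (rho' x + (lam 0)\<^sup>2)"
          using sysD(4)[OF Z x] sysD(4)[OF Y x] by (intro mult_nonneg_nonneg[OF bl.Qu_sign] mult_nonneg_nonneg[OF bl.Qv_sign]; simp)+
        thus ?thesis using H[of x] by (simp add: k_def D'_def E2_def algebra_simps)
      qed
    qed (use Ad Ck bm_meas[OF bk] in auto)
    hence "(LINT x|M. k x) <= m'' t" using bm_integrable[OF k] bm_integrable[OF bmEs(3)] by (simp add: m''_def)
    moreover have "\<bar>ip f g\<bar> <= (LINT x|M. \<bar>f x * g x\<bar>)" unfolding ip_def by (rule integral_abs_bound)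
    ultimately show ?thesis by (simp add: k_def)
  qed
  \<comment> \<open>Taking space or time as the first direction of \<open>hess_pair\<close> gives
    one pairing each.\<close>
  have le: "2 * \<bar>ip (ux t) (vt t)\<bar> <= m'' t" "2 * \<bar>ip (ut t) (vx t)\<bar> <= m'' t" for t
    using bl.hess_pair[of "ux t x" "vt t x" "u t x" "v t x" "vx t x" "ut t x" for x]
      bl.hess_pair[of "ut t x" "vx t x" "u t x" "v t x" "vt t x" "ux t x" for x]
    by (intro key bms; simp add: power2_eq_square algebra_simps)+
  have m_nonneg: "0 <= m t" for t unfolding m_def by (intro Bochner_Integration.integral_nonneg bl.Q_bounds)
  have m0: "m 0 = (LINT x|M. bellman.Q p q eps (fs Z N c x) (fs Y N d x))" by (simp add: m_def u_def v_def)
  \<comment> \<open>Every mode, the one of index 0 included, decays at least like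
    \<open>exp (- lam 0 * t)\<close>, which outweighs the factor \<open>t\<close>.\<close>
  have lim: "((%t. t * m' t) ---> 0) at_top" proof -
    have 1: "ub {0..} u" "ub {0..} v" "ub {0..} (%t x. ut t x * exp (lam 0 * t))" "ub {0..} (%t x. vt t x * exp (lam 0 * t))"
      unfolding defs by (rule ub_poisson_decay[OF Z] ub_poisson_decay[OF Y])+
    have "ub {0..} (%t x. ?Qu t x * (ut t x * exp (lam 0 * t)) + ?Qv t x * (vt t x * exp (lam 0 * t)))"
      by (intro ub_add ub_mult 1 bl.continuous_Q[THEN ub_comp, OF 1(1,2)])
    then obtain C where C: "0 < C" "!!t x. t \<in> {0..} ==> x \<in> I ==>
      \<bar>?Qu t x * (ut t x * exp (lam 0 * t)) + ?Qv t x * (vt t x * exp (lam 0 * t))\<bar> <= C" by (rule ubE) blast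
    define C' where "C' = C * measure M (space M)"
    have bd: "\<bar>m' t\<bar> <= C' * exp (- lam 0 * t)" if t: "0 <= t" for t proof -
      have "\<bar>E1 t x\<bar> <= C * exp (- lam 0 * t)" if x: "x \<in> I" for x proof -
        have "?Qu t x * (ut t x * exp (lam 0 * t)) + ?Qv t x * (vt t x * exp (lam 0 * t)) = E1 t x * exp (lam 0 * t)"
          by (simp add: E1_def algebra_simps)
        thus ?thesis using C(2)[of t x] t x by (simp add: abs_mult exp_minus field_simps)
      qed
      hence "(LINT x|M. \<bar>E1 t x\<bar>) <= (LINT x|M. C * exp (- lam 0 * t))"
        using bm_integrable[OF bmEs(2)[of t]] by (intro integral_mono) (auto simp: space_M)
      thus ?thesis
        using order_trans[OF integral_abs_bound[of M "E1 t"]] by (simp add: m'_def C'_def mult_ac)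
    qed
    show ?thesis
    proof (rule Lim_null_comparison[OF _ tendsto_mult_right_zero[OF exp_decay(2)[OF lam_pos[of 0]]]])
      show "\<forall>\<^sub>F t in at_top. norm (t * m' t) <= C' * (t * exp (- lam 0 * t))"
        using eventually_ge_at_top[of 0] proof eventually_elim
        fix t :: real assume t: "0 <= t"
        have "t * \<bar>m' t\<bar> <= t * (C' * exp (- lam 0 * t))" using bd[OF t] t by (intro mult_left_mono)
        thus "norm (t * m' t) <= C' * (t * exp (- lam 0 * t))" using t by (simp add: abs_mult mult_ac)
      qed
    qed
  qed
  show thesis by (rule that[OF md m'd le m_nonneg m0 lim])
qed

end

section \<open>The Riesz transform on finite sums\<close>

context sturm
begin

text \<open>By parts the integral of \<open>t * m'' t\<close> over the half-line is at most
  \<open>m 0\<close>, while \<open>t * exp (- 2 * lam n * t)\<close> has integral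
  \<open>1 / (4 * (lam n)^2)\<close>. The comparison is made through the monotone function
  \<open>G\<close>, without improper integrals.\<close>

lemma riesz_core:
  fixes m m' m'' :: "real => real" and al :: "nat => real"
  assumes m: "!!t. DERIV m t :> m' t" "!!t. DERIV m' t :> m'' t"
    and le: "!!t. 2 * \<bar>\<Sum>n<N. al n * lam n * exp (- 2 * lam n * t)\<bar> <= m'' t"
    and m0: "!!t. 0 <= m t" and lim: "((%t. t * m' t) ---> 0) at_top"
  shows "\<bar>\<Sum>n<N. al n / lam n\<bar> <= 2 * m 0"
proof -
  have main: "sigma * (\<Sum>n<N. al n / lam n) <= 2 * m 0" if sigma: "\<bar>sigma\<bar> = 1" for sigma :: real
  proof -
    \<comment> \<open>A primitive of \<open>2 * sigma * t\<close> times the exponential sum,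
      normalised to vanish at infinity; \<open>sigma\<close> stands for either sign.\<close>
    define Psi where "Psi t = (\<Sum>n<N. - 2 * sigma * al n * lam n * ((t / (2 * lam n) + 1 / (4 * (lam n)\<^sup>2)) * exp (- 2 * lam n * t)))" for t
    have lam0: "lam n ~= 0" for n using lam_pos[of n] by simp
    have Psid: "DERIV Psi t :> t * (2 * sigma * (\<Sum>n<N. al n * lam n * exp (- 2 * lam n * t)))" for t
    proof -
      have "((%t. (t / (2 * lam n) + 1 / (4 * (lam n)\<^sup>2)) * exp (- 2 * lam n * t)) has_real_derivative
          - (t * exp (- 2 * lam n * t))) (at t)" for n proof (rule DERIV_cong, rule DERIV_mult)
        show "DERIV (%t. t / (2 * lam n) + 1 / (4 * (lam n)\<^sup>2)) t :> 1 / (2 * lam n)"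
          using lam0[of n] by (auto intro!: derivative_eq_intros)
        show "DERIV (%t. exp (- 2 * lam n * t)) t :> exp (- 2 * lam n * t) * (- 2 * lam n)"
          by (auto intro!: derivative_eq_intros)
        show "1 / (2 * lam n) * exp (- 2 * lam n * t) + exp (- 2 * lam n * t) * (- 2 * lam n) * (t / (2 * lam n) + 1 / (4 * (lam n)\<^sup>2))
            = - (t * exp (- 2 * lam n * t))" using lam0[of n] by (simp add: field_simps power2_eq_square)
      qed
      hence "DERIV Psi t :> (\<Sum>n<N. - 2 * sigma * al n * lam n * - (t * exp (- 2 * lam n * t)))"
        unfolding Psi_def[abs_def] by (intro DERIV_sum DERIV_cmult)
      thus ?thesis by (rule DERIV_cong) (simp add: sum_distrib_left mult_ac)
    qed
    define G where "G t = t * m' t - m t - Psi t" for t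
    have Gd: "DERIV G t :> t * m'' t - t * (2 * sigma * (\<Sum>n<N. al n * lam n * exp (- 2 * lam n * t)))" for t
    proof -
      have "DERIV G t :> (1 * m' t + m'' t * t) - m' t - t * (2 * sigma * (\<Sum>n<N. al n * lam n * exp (- 2 * lam n * t)))"
        unfolding G_def[abs_def] by (intro DERIV_diff DERIV_mult DERIV_ident m Psid)
      thus ?thesis by (rule DERIV_cong) (simp add: algebra_simps)
    qed
    have nn: "0 <= t * m'' t - t * (2 * sigma * (\<Sum>n<N. al n * lam n * exp (- 2 * lam n * t)))" if t: "0 <= t" for t
    proof -
      let ?s = "\<Sum>n<N. al n * lam n * exp (- 2 * lam n * t)"
      have "sigma * ?s <= \<bar>sigma\<bar> * \<bar>?s\<bar>" unfolding abs_mult[symmetric] by (rule abs_ge_self)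
      hence "2 * sigma * ?s <= m'' t" using le[of t] unfolding sigma by linarith
      hence "t * (2 * sigma * ?s) <= t * m'' t" using t by (rule mult_left_mono)
      thus ?thesis by simp
    qed
    have mono: "G 0 <= G T" if "0 <= T" for T
      using that Gd nn by (intro DERIV_nonneg_imp_nondecreasing[of 0 T G]) blast+
    have Psi0: "Psi 0 = - (sigma / 2) * (\<Sum>n<N. al n / lam n)"
      unfolding Psi_def sum_distrib_left by (intro sum.cong refl) (simp add: lam0 power2_eq_square)
    have exp0: "((%t. (t / (2 * lam n) + 1 / (4 * (lam n)\<^sup>2)) * exp (- 2 * lam n * t)) ---> 0) at_top" for n
    proof -
      have "((%t. 1 / (2 * lam n) * (t * exp (- (2 * lam n) * t)) + 1 / (4 * (lam n)\<^sup>2) * exp (- (2 * lam n) * t))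
          ---> 1 / (2 * lam n) * 0 + 1 / (4 * (lam n)\<^sup>2) * 0) at_top"
        using lam_pos[of n] by (intro tendsto_intros exp_decay) auto
      thus ?thesis by (simp add: algebra_simps)
    qed
    have "((%t. Psi t) ---> (\<Sum>n<N. - 2 * sigma * al n * lam n * 0)) at_top"
      unfolding Psi_def by (intro tendsto_sum tendsto_mult tendsto_const exp0)
    hence Psilim: "(Psi ---> 0) at_top" by simp
    have "((%T. T * m' T - Psi T) ---> 0 - 0) at_top" by (intro tendsto_diff lim Psilim)
    hence "G 0 <= 0 - 0" proof (rule tendsto_lowerbound)
      show "\<forall>\<^sub>F T in at_top. G 0 <= T * m' T - Psi T" using eventually_ge_at_top[of 0]
      proof eventually_elim
        fix T :: real assume "0 <= T"
        from mono[OF this] m0[of T] show "G 0 <= T * m' T - Psi T" by (simp add: G_def)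
      qed
    qed simp
    thus ?thesis by (simp add: G_def Psi0)
  qed
  show ?thesis using main[of 1] main[of "-1"] by (simp add: abs_le_iff)
qed

text \<open>Let \<open>eps\<close> tend to 0 in \<open>Q <= (1 + K) * NN\<close>. The powers of 2
  come from splitting \<open>(x^2 + eps) powr (p / 2)\<close> and its analogue for
  \<open>q\<close>.\<close>

lemma bellman_initial:
  assumes p: "2 <= p" and pq: "1 / p + 1 / q = 1" and f: "bm f" "bm g"
    and le: "!!eps. 0 < eps ==> X <= (LINT x|M. bellman.Q p q eps (f x) (g x))"
  shows "X <= (1 + 24 / (q * (q - 1))) * (2 powr (p / 2) + 2 powr (q / 2)) * (Lp_int M p f + Lp_int M q g)"
proof -
  have q: "1 < q" using bellman.q(1)[of p q 1] p pq by (simp add: bellman_def)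
  have Lp: "f \<in> Lp_space M p" "g \<in> Lp_space M q" using p q f by (auto intro: Lp_bm)
  define K' D where "K' = 1 + 24 / (q * (q - 1))" and "D = 2 powr (p / 2) + 2 powr (q / 2)"
  have K': "0 < K'" using q by (simp add: K'_def add_pos_nonneg)
  have D: "2 powr (p / 2) <= D" "2 powr (q / 2) <= D" by (auto simp: D_def)
  let ?\<eta> = "%eps. eps powr (p / 2) + eps powr (q / 2)"
  have bound: "X <= K' * D * (Lp_int M p f + Lp_int M q g + ?\<eta> eps * measure M (space M))" if eps: "0 < eps" for eps
  proof -
    interpret bl: bellman p q eps using p pq eps by unfold_locales
    have sq: "(x\<^sup>2 + eps) powr (s / 2) <= D * (\<bar>x\<bar> powr s + eps powr (s / 2))" if "0 < s" "2 powr (s / 2) <= D" for x s :: real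
    proof -
      have "(x\<^sup>2 + eps) powr (s / 2) <= 2 powr (s / 2) * ((x\<^sup>2) powr (s / 2) + eps powr (s / 2))"
        using eps that by (intro powr_add_le) auto
      also have "... <= D * ((x\<^sup>2) powr (s / 2) + eps powr (s / 2))" using that by (intro mult_right_mono) auto
      also have "(x\<^sup>2) powr (s / 2) = (\<bar>x\<bar> powr 2) powr (s / 2)" by simp
      also have "... = \<bar>x\<bar> powr s" by (simp only: powr_powr) simp
      finally show ?thesis .
    qed
    let ?h = "%x. K' * (D * (\<bar>f x\<bar> powr p + \<bar>g x\<bar> powr q + ?\<eta> eps))"
    have L: "integrable M (%x. \<bar>f x\<bar> powr p)" "integrable M (%x. \<bar>g x\<bar> powr q)" using Lp[THEN Lp_spaceD(2)] by simp_all
    have i: "integrable M ?h" using L by (intro integrable_mult_right Bochner_Integration.integrable_add) auto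
    have "X <= (LINT x|M. bl.Q (f x) (g x))" by (rule le[OF eps])
    also have "... <= (LINT x|M. ?h x)" proof (rule integral_mono'[OF i])
      fix x
      have "bl.Q (f x) (g x) <= K' * bl.NN (f x) (g x)"
        using bl.Q_bounds(2)[of "f x" "g x"] by (simp add: K'_def bl.K_def)
      also have "... <= K' * (D * (\<bar>f x\<bar> powr p + eps powr (p / 2)) + D * (\<bar>g x\<bar> powr q + eps powr (q / 2)))"
        unfolding bl.NN_def bl.powr_half unfolding bl.SS_def using K' p q D by (intro mult_left_mono add_mono sq) auto
      finally show "bl.Q (f x) (g x) <= ?h x" by (simp only: distrib_left add_ac)
      show "0 <= ?h x" using K' by (intro mult_nonneg_nonneg add_nonneg_nonneg) (auto simp: D_def)
    qed
    also have "... = K' * D * (Lp_int M p f + Lp_int M q g + ?\<eta> eps * measure M (space M))"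
      using L by (simp add: mult.commute)
    finally show ?thesis .
  qed
  have z: "((%eps::real. eps powr s) ---> 0) (at_right 0)" if "0 < s" for s proof -
    have "((%eps::real. eps powr s) ---> 0 powr s) (at_right 0)"
      using that by (intro tendsto_powr') (auto simp: eventually_at_right_less eventually_at_filter)
    thus ?thesis by simp
  qed
  have "((%eps. K' * D * (Lp_int M p f + Lp_int M q g + ?\<eta> eps * measure M (space M)))
     ---> K' * D * (Lp_int M p f + Lp_int M q g + (0 + 0) * measure M (space M))) (at_right 0)"
    using p q by (intro tendsto_intros z) auto
  hence "X <= K' * D * (Lp_int M p f + Lp_int M q g + (0 + 0) * measure M (space M))"
    by (rule tendsto_lowerbound) (use bound in \<open>auto simp: eventually_at_filter\<close>)
  thus ?thesis by (simp add: K'_def D_def)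
qed

lemma ip_poisson_e1:
  "ip (fs e1 N (pc k c t)) (fs e1 N (pc k' d t)) = (\<Sum>n<N. kappa n * (c n * d n) * (k n * k' n) * exp (- 2 * lam n * t))"
  unfolding ip_fs_e(2) proof (intro sum.cong refl)
  fix n
  have "exp (- 2 * lam n * t) = exp (- lam n * t) * exp (- lam n * t)" by (simp add: exp_add[symmetric])
  thus "kappa n * (pc k c t n * pc k' d t n) = kappa n * (c n * d n) * (k n * k' n) * exp (- 2 * lam n * t)"
    by (simp only: mult_ac)
qed

text \<open>The Bellman function wants the exponent at least 2 on its first argument. The two
  alternatives in \<open>eq\<close> let \<open>e\<close> and \<open>e1\<close> take either place, so
  that \<open>p >= 2\<close> and \<open>p < 2\<close> are both covered.\<close>

lemma bellman_pairing:
  assumes Z: "sys Z Z1 Z2 rho" and Y: "sys Y Y1 Y2 rho'" and p: "2 <= p" and pq: "1 / p + 1 / q = 1"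
    and eq: "!!t. \<bar>\<Sum>n<N. al n * lam n * exp (- 2 * lam n * t)\<bar>
      \<in> {\<bar>ip (fs Z1 N (pc (%_. 1) c t)) (fs Y N (pc (%n. - lam n) d t))\<bar>,
         \<bar>ip (fs Z N (pc (%n. - lam n) c t)) (fs Y1 N (pc (%_. 1) d t))\<bar>}"
  shows "\<bar>\<Sum>n<N. al n / lam n\<bar> / 2
    <= (1 + 24 / (q * (q - 1))) * (2 powr (p / 2) + 2 powr (q / 2)) * (Lp_int M p (fs Z N c) + Lp_int M q (fs Y N d))"
proof (rule bellman_initial[OF p pq bm_fs[OF sysD(5)[OF Z]] bm_fs[OF sysD(5)[OF Y]]])
  fix eps :: real assume "0 < eps"
  hence bel: "bellman p q eps" using p pq by unfold_locales
  obtain m m' m'' where m: "!!t. DERIV m t :> m' t" "!!t. DERIV m' t :> m'' t"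
    "!!t. 2 * \<bar>ip (fs Z1 N (pc (%_. 1) c t)) (fs Y N (pc (%n. - lam n) d t))\<bar> <= m'' t"
    "!!t. 2 * \<bar>ip (fs Z N (pc (%n. - lam n) c t)) (fs Y1 N (pc (%_. 1) d t))\<bar> <= m'' t"
    "!!t. 0 <= m t" "m 0 = (LINT x|M. bellman.Q p q eps (fs Z N c x) (fs Y N d x))"
    "((%t. t * m' t) ---> 0) at_top" by (rule bellman_flow[OF Z Y bel, of N c d]) (rule that; assumption)
  have "\<bar>\<Sum>n<N. al n / lam n\<bar> <= 2 * m 0" proof (rule riesz_core[OF m(1,2) _ m(5,7)])
    show "2 * \<bar>\<Sum>n<N. al n * lam n * exp (- 2 * lam n * t)\<bar> <= m'' t" for t
      using eq[of t] m(3)[of t] m(4)[of t] by (elim insertE emptyE) (simp_all only:)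
  qed
  thus "\<bar>\<Sum>n<N. al n / lam n\<bar> / 2 <= (LINT x|M. bellman.Q p q eps (fs Z N c x) (fs Y N d x))"
    using m(6) by simp
qed

text \<open>As \<open>e1 n\<close> has squared norm \<open>kappa n\<close>, the sum pairs the
  derivative of the potential of \<open>fs e N c\<close> with \<open>fs e1 N d\<close>: it is the
  bilinear form of the Riesz transform.\<close>

lemma riesz_bilinear:
  assumes p: "1 < p" and q: "1 < q" and pq: "1 / p + 1 / q = 1"
  shows "\<exists>C>0. \<forall>N c d. \<bar>\<Sum>n<N. kappa n * (c n * d n) / lam n\<bar> <= C * (Lp_int M p (fs e N c) + Lp_int M q (fs e1 N d))"
proof -
  define A where "A r = (1 + 24 / (r * (r - 1))) * (2 powr (p / 2) + 2 powr (q / 2))" for r :: real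
  have A: "0 < A r" if "1 < r" for r using that by (simp add: A_def add_pos_nonneg)
  have "\<bar>\<Sum>n<N. kappa n * (c n * d n) / lam n\<bar> <= (2 * (A p + A q)) * (Lp_int M p (fs e N c) + Lp_int M q (fs e1 N d))" for N c d
  proof -
    let ?L = "Lp_int M p (fs e N c) + Lp_int M q (fs e1 N d)"
    have L: "0 <= ?L" by (intro add_nonneg_nonneg Lp_int_nonneg)
    have neg: "(\<Sum>n<N. kappa n * (c n * d n) * (1 * - lam n) * exp (- 2 * lam n * t))
        = - (\<Sum>n<N. kappa n * (c n * d n) * lam n * exp (- 2 * lam n * t))"
      "(\<Sum>n<N. kappa n * (d n * c n) * (- lam n * 1) * exp (- 2 * lam n * t))
        = - (\<Sum>n<N. kappa n * (c n * d n) * lam n * exp (- 2 * lam n * t))" for t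
      by (simp_all add: sum_negf mult_ac)
    have "\<bar>\<Sum>n<N. kappa n * (c n * d n) / lam n\<bar> / 2 <= A q * ?L \<or> \<bar>\<Sum>n<N. kappa n * (c n * d n) / lam n\<bar> / 2 <= A p * ?L"
    proof (cases "2 <= p")
      case True
      have "\<bar>\<Sum>n<N. kappa n * (c n * d n) / lam n\<bar> / 2
        <= (1 + 24 / (q * (q - 1))) * (2 powr (p / 2) + 2 powr (q / 2)) * ?L"
        by (rule bellman_pairing[OF sys_e sys_e1 True pq]) (simp only: ip_poisson_e1 neg abs_minus_cancel insert_iff simp_thms)
      thus ?thesis by (simp only: A_def simp_thms)
    next
      case False
      have q2: "2 <= q" proof (rule ccontr)
        assume "\<not> 2 <= q"
        hence "1 / 2 < 1 / q" "1 / 2 < 1 / p" using False p q by (auto simp: field_simps)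
        thus False using pq by linarith
      qed
      have qp: "1 / q + 1 / p = 1" using pq by simp
      have "\<bar>\<Sum>n<N. kappa n * (c n * d n) / lam n\<bar> / 2
        <= (1 + 24 / (p * (p - 1))) * (2 powr (q / 2) + 2 powr (p / 2)) * (Lp_int M q (fs e1 N d) + Lp_int M p (fs e N c))"
        by (rule bellman_pairing[OF sys_e1 sys_e q2 qp]) (simp only: ip_poisson_e1 neg abs_minus_cancel insert_iff simp_thms)
      thus ?thesis
        by (simp only: A_def add.commute[of "2 powr (q / 2)"] add.commute[of "Lp_int M q (fs e1 N d)"] simp_thms)
    qed
    moreover have "A q * ?L <= (A p + A q) * ?L" "A p * ?L <= (A p + A q) * ?L"
      using A[OF p] A[OF q] L by (auto intro!: mult_right_mono)
    ultimately show ?thesis unfolding mult.assoc by linarith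
  qed
  moreover have "0 < 2 * (A p + A q)" using A[OF p] A[OF q] by simp
  ultimately show ?thesis by blast
qed

lemma fs_ext: "N <= N' ==> fs Z N c = fs Z N' (%n. if n < N then c n else 0)"
  unfolding fs_def by (intro ext sum.mono_neutral_cong_left) auto

lemma fs_ext':
  assumes "N <= N'" obtains c' where "!!Z. fs Z N c = fs Z N' c'" "!!Z. fs Z N (%n. f n * c n) = fs Z N' (%n. f n * c' n)"
proof -
  have "(%n. if n < N then f n * c n else 0) = (%n. f n * (if n < N then c n else 0))" by auto
  thus thesis using that fs_ext[OF assms, of _ c] fs_ext[OF assms, of _ "%n. f n * c n"] by simp
qed

text \<open>\<open>duality_bound\<close> with test functions from a dense span. Shorter sums are
  padded with zeros, so the bound is asked only for lengths \<open>L >= N\<close>, to which the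
  coefficients of \<open>F\<close> itself can be extended.\<close>

lemma span_duality:
  assumes pq: "1 < p" "1 < q" "1 / p + 1 / q = 1" and C: "0 < C" and Z: "!!n. bm (Z n)"
    and dense: "!!G d. G \<in> Lp_space M q ==> 0 < d ==> \<exists>N c. Lp_int M q (%x. fs Z N c x - G x) < d"
  obtains K' where "0 < K'" "!!F N A. F \<in> Lp_space M p ==>
    (!!L d. N <= L ==> \<bar>ip F (fs Z L d)\<bar> <= A + C * Lp_int M q (fs Z L d)) ==> Lp_int M p F <= K' * A"
proof -
  obtain K' where K': "0 < K'" and dual: "!!(M :: real measure) (F :: real => real) A. F \<in> Lp_space M p ==>
      (!!G d. G \<in> Lp_space M q ==> 0 < d ==> \<exists>g\<in>Lp_space M q.
        Lp_int M q (%x. g x - G x) < d & \<bar>LINT x|M. F x * g x\<bar> <= A + C * Lp_int M q g) ==>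
      Lp_int M p F <= K' * A" using duality_bound[OF pq C, where 'b = real] by blast
  show thesis proof (rule that[OF K'], rule dual)
    fix F :: "real => real" and A :: real and N :: nat and G :: "real => real" and d :: real
    assume F: "!!L d. N <= L ==> \<bar>ip F (fs Z L d)\<bar> <= A + C * Lp_int M q (fs Z L d)" and G: "G \<in> Lp_space M q" "0 < d"
    obtain N' d' where d': "Lp_int M q (%x. fs Z N' d' x - G x) < d" using dense[OF G] by blast
    define L d2 where "L = max N N'" and "d2 = (%n. if n < N' then d' n else 0)"
    have eq: "fs Z N' d' = fs Z L d2" using fs_ext[of N' L Z d'] by (simp add: L_def d2_def)
    have "fs Z L d2 \<in> Lp_space M q" by (rule Lp_bm[OF _ bm_fs[OF Z]]) (use pq in simp)
    moreover have "\<bar>LINT x|M. F x * fs Z L d2 x\<bar> <= A + C * Lp_int M q (fs Z L d2)"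
      using F[of L d2] by (simp only: ip_def L_def max.cobounded1 simp_thms)
    ultimately show "\<exists>g\<in>Lp_space M q. Lp_int M q (%x. g x - G x) < d & \<bar>LINT x|M. F x * g x\<bar> <= A + C * Lp_int M q g"
      using d' unfolding eq by blast
  qed
qed

lemma riesz_bound:
  assumes p: "1 < p"
  shows "\<exists>C>0. \<forall>N c. Lp_int M p (fs e1 N (%n. c n / lam n)) <= C * Lp_int M p (fs e N c)"
proof -
  define q where "q = p / (p - 1)"
  have q: "1 < q" "1 / p + 1 / q = 1" using p by (auto simp: q_def field_simps)
  obtain C where C: "0 < C" "!!N c d. \<bar>\<Sum>n<N. kappa n * (c n * d n) / lam n\<bar> <= C * (Lp_int M p (fs e N c) + Lp_int M q (fs e1 N d))"
    using riesz_bilinear[OF p q] by blast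
  have q0: "0 < q" using q by simp
  obtain K' where K': "0 < K'" and dual: "!!F N A. F \<in> Lp_space M p ==>
    (!!L d. N <= L ==> \<bar>ip F (fs e1 L d)\<bar> <= A + C * Lp_int M q (fs e1 L d)) ==> Lp_int M p F <= K' * A"
    by (rule span_duality[OF p q C(1) bm_e(2) span_dense_e1[OF q0]]) blast+
  have "Lp_int M p (fs e1 N (%n. c n / lam n)) <= K' * (C * Lp_int M p (fs e N c))" for N c
  proof (rule dual[where N = N])
    show "fs e1 N (%n. c n / lam n) \<in> Lp_space M p" by (rule Lp_bm[OF _ bm_fs_e(2)]) (use p in simp)
    fix L d assume "N <= L"
    then obtain c' where c': "!!Z. fs Z N c = fs Z L c'"
      "!!Z. fs Z N (%n. 1 / lam n * c n) = fs Z L (%n. 1 / lam n * c' n)" by (rule fs_ext'[of N L c "%n. 1 / lam n"]) blast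
    have "ip (fs e1 N (%n. c n / lam n)) (fs e1 L d) = (\<Sum>n<L. kappa n * (c' n * d n) / lam n)"
      using c'(2)[of e1] by (simp add: ip_fs_e)
    thus "\<bar>ip (fs e1 N (%n. c n / lam n)) (fs e1 L d)\<bar> <= C * Lp_int M p (fs e N c) + C * Lp_int M q (fs e1 L d)"
      using C(2)[where N = L and c = c' and d = d] unfolding c'(1) by (simp only: distrib_left)
  qed
  hence "\<forall>N c. Lp_int M p (fs e1 N (%n. c n / lam n)) <= (K' * C) * Lp_int M p (fs e N c)"
    by (simp only: mult.assoc) blast
  moreover have "0 < K' * C" using K' C(1) by simp
  ultimately show ?thesis by blast
qed

end

section \<open>The heat kernel and its positivity\<close>

lemma has_bochner_integral_Gamma:
  fixes a s :: real
  assumes "0 < a" "0 < s"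
  shows "has_bochner_integral lborel (%t. indicator {0<..} t * (exp (- a * t) * t powr (s - 1))) (Gamma s / a powr s)"
proof -
  define f where "f t = indicator {0..} t * t powr (s - 1) / exp t" for t :: real
  have "has_bochner_integral lborel f (Gamma s)" proof (rule has_bochner_integral_nn_integral)
    show "f \<in> borel_measurable lborel" unfolding f_def by measurable
    show "(\<integral>\<^sup>+t. ennreal (f t) \<partial>lborel) = ennreal (Gamma s)"
      unfolding f_def by (rule Gamma_conv_nn_integral_real[OF assms(2), symmetric])
    show "0 <= Gamma s" using Gamma_real_pos[OF assms(2)] by simp
  qed (auto simp: f_def)
  hence "has_bochner_integral lborel (%t. f (0 + a * t)) (Gamma s /\<^sub>R \<bar>a\<bar>)"
    using assms by (subst (asm) lborel_has_bochner_integral_real_affine_iff[of a _ _ 0]) auto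
  hence "has_bochner_integral lborel (%t. a powr (1 - s) * f (0 + a * t)) (a powr (1 - s) * (Gamma s /\<^sub>R \<bar>a\<bar>))"
    by (rule has_bochner_integral_mult_right) 
  moreover have "a powr (1 - s) * f (0 + a * t) = indicator {0<..} t * (exp (- a * t) * t powr (s - 1))" for t
  proof (cases "0 < t")
    case True
    hence "a powr (1 - s) * (a * t) powr (s - 1) = t powr (s - 1)"
      using assms powr_minus[of a "s - 1"] by (simp add: powr_mult)
    thus ?thesis using True assms by (simp add: f_def exp_minus field_simps)
  qed (use assms in \<open>auto simp: f_def indicator_def not_less zero_le_mult_iff\<close>)
  moreover have "a powr (1 - s) * (Gamma s /\<^sub>R \<bar>a\<bar>) = Gamma s / a powr s"
    using assms by (simp add: powr_diff field_simps)
  ultimately show ?thesis by simp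
qed

lemma isCont_neg_nbhd:
  fixes h :: "real => real"
  assumes "\<not> 0 <= h x" "isCont h x"
  obtains d where "0 < d" "!!y. \<bar>y - x\<bar> < d ==> h y < 0" proof -
  have "\<forall>\<^sub>F y in at x. h y < 0"
    using assms unfolding isCont_def by (intro order_tendstoD) auto
  then obtain d where d: "0 < d" "!!y. y ~= x ==> dist y x < d ==> h y < 0" unfolding eventually_at by blast
  have "h y < 0" if "\<bar>y - x\<bar> < d" for y
    using assms(1) d(2)[of y] that by (cases "y = x") (auto simp: dist_real_def)
  thus thesis using that d(1) by blast
qed

context sturm
begin

lemma AE_M_interval:
  assumes "AE x in M. P x" "0 <= u" "u < v" "v <= 1"
  shows "\<exists>x\<in>{u<..<v}. P x"
proof (rule ccontr)
  assume "\<not> ?thesis"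
  hence "AE x in lborel. x \<notin> {u<..<v}"
    by (intro eventually_mono[OF assms(1)[unfolded AE_M_iff]]) (use assms in auto)
  hence "emeasure lborel {u<..<v} = 0" by (subst (asm) AE_iff_measurable[of "{u<..<v}"]) auto
  thus False using assms by simp
qed

lemma AE_M_continuous:
  fixes h :: "real => real"
  assumes "AE x in M. 0 <= h x" "continuous_on I h" "x \<in> I"
  shows "0 <= h x"
proof (rule ccontr)
  assume "\<not> 0 <= h x"
  moreover have "isCont h x" using assms continuous_on_eq_continuous_at[of I h] by auto
  ultimately obtain d where d: "0 < d" "!!y. \<bar>y - x\<bar> < d ==> h y < 0"
    by (rule isCont_neg_nbhd) blast
  obtain y where "y \<in> {max 0 (x - d)<..<min 1 (x + d)}" "0 <= h y"
    using AE_M_interval[OF assms(1), of "max 0 (x - d)" "min 1 (x + d)"] d assms(3) by auto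
  thus False using d(2)[of y] by (simp add: abs_less_iff)
qed

definition hk :: "real => real => real => real" where
  "hk t x y = (\<Sum>n. exp (- (lam n)\<^sup>2 * t) * e n x * e n y)"

lemma hk_commute: "hk t x y = hk t y x"
  by (simp add: hk_def mult.assoc mult.commute[of "e _ x"])

lemma hk_uniform:
  assumes t: "0 < t" and x: "x \<in> I"
  shows "uniform_limit I (%N. fs e N (%n. exp (- (lam n)\<^sup>2 * t) * e n x)) (hk t x) sequentially"
  unfolding fs_def hk_def proof (rule Weierstrass_m_test[OF _ summable_B[OF t]])
  fix n y assume y: "y \<in> I"
  have "\<bar>e n x * e n y\<bar> <= B n * B n"
    unfolding abs_mult using e_bound[OF x, of n] e_bound[OF y, of n] B_nonneg[of n] by (intro mult_mono) auto
  hence "exp (- (lam n)\<^sup>2 * t) * \<bar>e n x * e n y\<bar> <= exp (- (lam n)\<^sup>2 * t) * (B n * B n)"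
    by (intro mult_left_mono) auto
  thus "norm (exp (- (lam n)\<^sup>2 * t) * e n x * e n y) <= exp (- (lam n)\<^sup>2 * t) * (B n)\<^sup>2"
    by (simp add: abs_mult power2_eq_square mult.assoc)
qed

lemma continuous_hk: "0 < t ==> x \<in> I ==> continuous_on I (hk t x)"
  by (rule uniform_limit_theorem[OF _ hk_uniform])
     (auto simp: fs_def intro!: always_eventually continuous_intros cont_e)

lemma bm_hk: assumes "0 < t" "x \<in> I" shows "bm (hk t x)"
proof -
  have "\<forall>\<^sub>F N in sequentially. \<forall>y\<in>I. dist (fs e N (%n. exp (- (lam n)\<^sup>2 * t) * e n x) y) (hk t x y) < 1"
    using uniform_limitD[OF hk_uniform[OF assms], of 1] by simp
  then obtain N where N: "!!y. y \<in> I ==> dist (fs e N (%n. exp (- (lam n)\<^sup>2 * t) * e n x) y) (hk t x y) < 1"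
    unfolding eventually_sequentially by blast
  obtain C where C: "!!y. y \<in> I ==> \<bar>fs e N (%n. exp (- (lam n)\<^sup>2 * t) * e n x) y\<bar> <= C"
    using bmE[OF bm_fs_e(1)] by blast
  show ?thesis proof (rule bmI)
    show "hk t x \<in> borel_measurable M" using assms by (intro measurable_M_continuous continuous_hk)
    show "\<bar>hk t x y\<bar> <= C + 1" if "y \<in> I" for y using N[OF that] C[OF that] by (simp add: dist_real_def)
  qed
qed

lemma ip_hk:
  assumes t: "0 < t" and x: "x \<in> I" and f: "bm f"
  shows "(%n. exp (- (lam n)\<^sup>2 * t) * e n x * ip (e n) f) sums ip (hk t x) f"
proof -
  define S where "S N = fs e N (%n. exp (- (lam n)\<^sup>2 * t) * e n x)" for N
  obtain Cf where Cf: "0 < Cf" "!!y. y \<in> I ==> \<bar>f y\<bar> <= Cf" using bmE[OF f] by blast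
  have bS: "bm (S N)" for N by (simp add: S_def bm_fs_e)
  have "(%N. ip (S N) f) ----> ip (hk t x) f" unfolding ip_def
  proof (rule integral_tendsto_bounded[where C = "(\<Sum>n. exp (- (lam n)\<^sup>2 * t) * (B n)\<^sup>2) * Cf"])
    show "(%y. S N y * f y) \<in> borel_measurable M" for N by (intro bm_meas bm_mult bS f)
    show "(%y. hk t x y * f y) \<in> borel_measurable M" by (intro bm_meas bm_mult bm_hk t x f)
    fix y assume y: "y \<in> I"
    show "(%N. S N y * f y) ----> hk t x y * f y"
      unfolding S_def by (intro tendsto_mult tendsto_const tendsto_uniform_limitI[OF hk_uniform] t x y)
    fix N
    have "\<bar>S N y\<bar> <= (\<Sum>n<N. exp (- (lam n)\<^sup>2 * t) * (B n)\<^sup>2)"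
      unfolding S_def fs_def proof (rule order_trans[OF sum_abs sum_mono])
      fix n
      have "\<bar>e n x * e n y\<bar> <= B n * B n"
        unfolding abs_mult using e_bound[OF x, of n] e_bound[OF y, of n] B_nonneg[of n] by (intro mult_mono) auto
      hence "exp (- (lam n)\<^sup>2 * t) * \<bar>e n x * e n y\<bar> <= exp (- (lam n)\<^sup>2 * t) * (B n * B n)"
        by (intro mult_left_mono) auto
      thus "\<bar>exp (- (lam n)\<^sup>2 * t) * e n x * e n y\<bar> <= exp (- (lam n)\<^sup>2 * t) * (B n)\<^sup>2"
        by (simp add: abs_mult power2_eq_square mult.assoc)
    qed
    also have "... <= (\<Sum>n. exp (- (lam n)\<^sup>2 * t) * (B n)\<^sup>2)"
      by (rule sum_le_suminf[OF summable_B[OF t]]) auto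
    finally show "\<bar>S N y * f y\<bar> <= (\<Sum>n. exp (- (lam n)\<^sup>2 * t) * (B n)\<^sup>2) * Cf"
      unfolding abs_mult using Cf(2)[OF y] by (intro mult_mono) auto
  qed
  moreover have "ip (S N) f = (\<Sum>n<N. exp (- (lam n)\<^sup>2 * t) * e n x * ip (e n) f)" for N
    unfolding S_def by (rule ip_fs[OF bm_e(1) f])
  ultimately show ?thesis by (simp add: sums_def)
qed

lemma ip_hk_e:
  assumes "0 < t" "x \<in> I"
  shows "ip (hk t x) (e m) = exp (- (lam m)\<^sup>2 * t) * e m x"
proof -
  have "(%n. exp (- (lam n)\<^sup>2 * t) * e n x * ip (e n) (e m)) sums ip (hk t x) (e m)"
    by (rule ip_hk[OF assms bm_e(1)])
  moreover have "(%n. exp (- (lam n)\<^sup>2 * t) * e n x * ip (e n) (e m)) sums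
      (exp (- (lam m)\<^sup>2 * t) * e m x * ip (e m) (e m))"
    using sums_single[of m "%n. exp (- (lam n)\<^sup>2 * t) * e n x * ip (e n) (e m)"]
    by (rule sums_cong[THEN iffD1, rotated]) (auto simp: ip_e)
  ultimately show ?thesis using sums_unique2 by (fastforce simp: ip_e)
qed

lemma ip_e_0: "ip f (e 0) = integral\<^sup>L M f"
  unfolding ip_def by (rule Bochner_Integration.integral_cong) (auto simp: space_M e_0)

text \<open>Contraction and preservation of constants give positivity: \<open>psi - m / 2\<close> is
  bounded by \<open>m / 2\<close>, so its evolution is at least \<open>- m / 2\<close>, and the
  constant can be added back. The kernel decays with \<open>(lam n)^2\<close>, the flow with
  \<open>kappa n\<close>; the factor \<open>exp ((lam 0)^2 * t)\<close> converts between
  them.\<close>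

lemma ip_hk_test_nonneg:
  assumes t: "0 < t" and x: "x \<in> I" and psi: "test_function psi" "!!y. 0 <= psi y"
  shows "0 <= ip (hk t x) psi"
proof -
  obtain m where m: "0 < m" "!!y. \<bar>psi y\<bar> <= m" using test_function_bounded[OF psi(1)] by blast
  define g where "g y = psi y - m / 2" for y
  have gm: "\<bar>g y\<bar> <= m / 2" for y using m(2)[of y] psi(2)[of y] by (simp add: g_def abs_if field_simps split: if_splits)
  have bg: "bm g" unfolding g_def by (intro bm_diff bm_const bm_test psi)
  define c where "c k = ip g (e k)" for k
  define U where "U x = (\<Sum>n. hc c t n * e n x)" for x
  have lim: "(%N. ip (%x. g x - fs e N c x) (%x. g x - fs e N c x)) ----> 0" unfolding c_def
  proof (rule completeness)
    show "DERIV g x :> deriv psi x" for x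
      unfolding g_def using test_function_deriv[OF psi(1), of x] by (auto intro!: derivative_eq_intros)
  qed (intro bg bm_test test_function_derivI psi)+
  have ser: "uniform_limit I (%N x. fs e N (hc c t) x) U sequentially" unfolding U_def
  proof (rule heat_series)
    show "\<bar>c n\<bar> <= m / 2 * measure M (space M) * B n" for n
      unfolding c_def by (intro coefficient_bound bm_meas[OF bg] gm) (use m(1) in simp)
    show "summable (%n. exp (- kappa n * t) * B n * B n)" using t by (rule summable_heat_B)
  qed (rule e_bound)
  have "AE x in M. \<bar>U x\<bar> <= m / 2"
    by (rule heat_contraction[OF sys_e _ _ bm_meas[OF bg] gm lim tendsto_uniform_limitI[OF ser]])
       (use m(1) t in simp_all)
  hence "AE x in M. 0 <= U x + m / 2" by eventually_elim auto
  moreover have "continuous_on I U" by (rule uniform_limit_theorem[OF _ ser])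
       (auto simp: fs_def intro!: always_eventually continuous_intros cont_e)
  hence "continuous_on I (%x. U x + m / 2)" by (intro continuous_intros)
  ultimately have U: "0 <= U x + m / 2" using x by (intro AE_M_continuous)
  have "(%n. exp ((lam 0)\<^sup>2 * t) * (exp (- (lam n)\<^sup>2 * t) * e n x * ip (e n) g)) sums (exp ((lam 0)\<^sup>2 * t) * ip (hk t x) g)"
    by (rule sums_mult[OF ip_hk[OF t x bg]])
  moreover have "exp ((lam 0)\<^sup>2 * t) * (exp (- (lam n)\<^sup>2 * t) * e n x * ip (e n) g) = hc c t n * e n x" for n
    unfolding exp_kappa c_def ip_commute[of g] by (simp only: mult_ac)
  ultimately have "(%n. hc c t n * e n x) sums (exp ((lam 0)\<^sup>2 * t) * ip (hk t x) g)" by (simp only:)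
  hence "U x = exp ((lam 0)\<^sup>2 * t) * ip (hk t x) g" unfolding U_def by (rule sums_unique[symmetric])
  also have "ip (hk t x) g = ip (hk t x) psi - m / 2 * ip (hk t x) (e 0)"
    unfolding g_def ip_diff_right[OF bm_test[OF psi(1)] bm_const bm_hk[OF t x]] ip_e_0 by (simp add: ip_def)
  also have "exp ((lam 0)\<^sup>2 * t) * (ip (hk t x) psi - m / 2 * ip (hk t x) (e 0)) = exp ((lam 0)\<^sup>2 * t) * ip (hk t x) psi - m / 2"
    using x by (simp add: ip_hk_e[OF t x] e_0 exp_minus algebra_simps)
  finally have "0 <= exp ((lam 0)\<^sup>2 * t) * ip (hk t x) psi" using U by simp
  thus ?thesis by (simp add: zero_le_mult_iff)
qed

text \<open>A negative value would persist on an interval around \<open>y\<close> by continuity, and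
  a bump supported there would have a negative pairing.\<close>

lemma hk_nonneg:
  assumes t: "0 < t" and x: "x \<in> I" and y: "y \<in> I"
  shows "0 <= hk t x y"
proof (rule ccontr)
  assume neg: "\<not> 0 <= hk t x y"
  have "isCont (hk t x) y" using continuous_hk[OF t x] y continuous_on_eq_continuous_at[of I "hk t x"] by auto
  then obtain d where d: "0 < d" "!!z. \<bar>z - y\<bar> < d ==> hk t x z < 0"
    by (rule isCont_neg_nbhd[of "hk t x" y, OF neg]) blast
  define u v where "u = max (y / 2) (y - d)" and "v = min ((1 + y) / 2) (y + d)"
  have ab: "0 < u" "u < v" "v < 1" "y - d <= u" "v <= y + d" using y d(1) by (auto simp: u_def v_def max_def min_def)
  define psi where "psi = bump 1 u v"
  have psi: "test_function psi" "!!z. 0 <= psi z" "!!z. z \<notin> {u<..<v} ==> psi z = 0" "!!z. u < z ==> z < v ==> 0 < psi z"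
    using ab bump_bounds(1)[of 1 u v] unfolding psi_def
    by (simp_all add: test_function_bump bump_outside bump_pos)
  have hn: "hk t x z < 0" if "z \<in> {u<..<v}" for z using d(2)[of z] that ab by (simp add: abs_less_iff)
  have nn: "0 <= - (hk t x z * psi z)" for z
    using hn[of z] psi(2)[of z] psi(3)[of z] by (cases "z \<in> {u<..<v}") (auto simp: mult_le_0_iff)
  have int: "integrable M (%z. - (hk t x z * psi z))"
    by (intro Bochner_Integration.integrable_minus bm_integrable bm_mult bm_hk t x bm_test psi)
  have "(LINT z|M. - (hk t x z * psi z)) <= 0"
    using ip_hk_test_nonneg[OF t x psi(1,2)] by (simp add: ip_def)
  moreover have "0 <= (LINT z|M. - (hk t x z * psi z))" by (rule Bochner_Integration.integral_nonneg) (rule nn)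
  ultimately have "(LINT z|M. - (hk t x z * psi z)) = 0" by linarith
  hence "AE z in M. - (hk t x z * psi z) = 0" using integral_nonneg_eq_0_iff_AE[OF int] nn by simp
  then obtain z where "z \<in> {u<..<v}" "- (hk t x z * psi z) = 0"
    using AE_M_interval[of _ u v] ab by (meson less_imp_le)
  thus False using hn[of z] psi(4)[of z] by auto
qed

end

section \<open>The potential operator on L^p\<close>

context sturm
begin

sublocale MM: pair_sigma_finite M M ..
sublocale TM: pair_sigma_finite lborel M ..

lemma measurable_hk:
  "(%z. hk (snd z) (fst (fst z)) (snd (fst z))) \<in> borel_measurable ((M \<Otimes>\<^sub>M M) \<Otimes>\<^sub>M lborel)"
  unfolding hk_def by measurable

definition tk :: "real => real => real => real" where
  "tk x t y = indicator {0<..} t * (hk t x y * t powr (1/2 - 1))"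

text \<open>Order 1/2, so that the operator multiplies \<open>e n\<close> by
  \<open>((lam n)^2) powr (- 1/2) = 1 / lam n\<close>.\<close>

definition pk :: "real => real => real" where
  "pk x y = 1 / Gamma (1/2) * (LINT t:{0<..}|lborel. hk t x y * t powr (1/2 - 1))"

lemma pk_eq: "pk x y = 1 / Gamma (1/2) * (LINT t|lborel. tk x t y)"
  by (simp add: pk_def tk_def set_lebesgue_integral_def)

lemma pk_commute: "pk x y = pk y x"
  by (simp add: pk_def hk_commute[of _ x])

lemma tk_nonneg: "x \<in> I ==> y \<in> I ==> 0 <= tk x t y"
  by (auto simp: tk_def indicator_def intro!: mult_nonneg_nonneg hk_nonneg)

lemma pk_nonneg: "x \<in> I ==> y \<in> I ==> 0 <= pk x y"
  unfolding pk_eq using Gamma_real_pos[of "1/2"]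
  by (intro mult_nonneg_nonneg Bochner_Integration.integral_nonneg tk_nonneg) auto

lemma measurable_pk: "(%(x, y). pk x y) \<in> borel_measurable (M \<Otimes>\<^sub>M M)"
proof -
  have "(%z. tk (fst (fst z)) (snd z) (snd (fst z))) \<in> borel_measurable ((M \<Otimes>\<^sub>M M) \<Otimes>\<^sub>M lborel)"
    unfolding tk_def using measurable_hk by measurable
  hence "(%z. 1 / Gamma (1/2) * (LINT t|lborel. tk (fst z) t (snd z))) \<in> borel_measurable (M \<Otimes>\<^sub>M M)"
    by (intro borel_measurable_times borel_measurable_const lborel.borel_measurable_lebesgue_integral)
       (simp add: case_prod_beta')
  thus ?thesis by (simp add: pk_eq[abs_def] case_prod_beta')
qed

lemma measurable_pk' [measurable]: "x \<in> I ==> pk x \<in> borel_measurable M"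
  using measurable_Pair2[OF measurable_pk, of x] by (simp add: space_M)

lemma tk_integral:
  assumes x: "x \<in> I"
  shows "has_bochner_integral lborel (%t. LINT y|M. tk x t y * e m y) (Gamma (1/2) * (e m x / lam m))"
proof -
  have "has_bochner_integral lborel (%t. indicator {0<..} t * (exp (- (lam m)\<^sup>2 * t) * t powr (1/2 - 1)) * e m x)
      (Gamma (1/2) / ((lam m)\<^sup>2) powr (1/2) * e m x)"
    using lam_pos[of m] by (intro has_bochner_integral_mult_left has_bochner_integral_Gamma) auto
  moreover have "indicator {0<..} t * (exp (- (lam m)\<^sup>2 * t) * t powr (1/2 - 1)) * e m x = (LINT y|M. tk x t y * e m y)" for t
  proof (cases "0 < t")
    case True
    have "(LINT y|M. tk x t y * e m y) = t powr (1/2 - 1) * ip (hk t x) (e m)"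
      unfolding tk_def ip_def using True by (subst integral_mult_right_zero[symmetric]) (simp add: mult_ac)
    thus ?thesis using True by (simp only: ip_hk_e[OF True x]) (simp add: mult_ac)
  qed (simp add: tk_def)
  moreover have "((lam m)\<^sup>2) powr (1/2) = lam m" using lam_pos[of m] by (simp add: powr_half_sqrt)
  ultimately show ?thesis by simp
qed

text \<open>\<open>tk\<close> is nonnegative and \<open>e 0 = 1\<close>, so the inner integral of
  its absolute value is the one that \<open>tk_integral\<close> computes for the mode 0.\<close>

lemma integrable_tk:
  assumes x: "x \<in> I"
  shows "integrable (lborel \<Otimes>\<^sub>M M) (%(t, y). tk x t y)"
proof (rule TM.Fubini_integrable)
  have "(%(t, y). hk t x y) \<in> borel_measurable (lborel \<Otimes>\<^sub>M M)"
    unfolding hk_def by measurable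
  thus meas: "(%(t, y). tk x t y) \<in> borel_measurable (lborel \<Otimes>\<^sub>M M)"
    unfolding tk_def by measurable
  have "(LINT y|M. norm (case (t, y) of (t, y) => tk x t y)) = (LINT y|M. tk x t y * e 0 y)" for t
    using tk_nonneg[OF x] by (intro Bochner_Integration.integral_cong) (auto simp: space_M e_0)
  thus "integrable lborel (%t. LINT y|M. norm (case (t, y) of (t, y) => tk x t y))"
    using tk_integral[OF x, of 0] by (simp add: has_bochner_integral_iff)
  have "integrable M (tk x t)" for t proof (cases "0 < t")
    case True
    thus ?thesis using bm_integrable[OF bm_hk[OF True x]] by (simp add: tk_def[abs_def])
  qed (simp add: tk_def[abs_def])
  thus "AE t in lborel. integrable M (%y. case (t, y) of (t, y) => tk x t y)" by simp
qed

lemma integrable_tk_mult: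
  assumes x: "x \<in> I" and f: "bm f"
  shows "integrable (lborel \<Otimes>\<^sub>M M) (%(t, y). tk x t y * f y)"
proof -
  obtain C where C: "0 < C" "!!y. y \<in> I ==> \<bar>f y\<bar> <= C" using bmE[OF f] by blast
  note [measurable] = bm_meas[OF f] borel_measurable_integrable[OF integrable_tk[OF x]]
  show ?thesis proof (rule Bochner_Integration.integrable_bound)
    show "integrable (lborel \<Otimes>\<^sub>M M) (%z. C * (case z of (t, y) => tk x t y))"
      by (intro integrable_mult_right integrable_tk x)
    show "(%(t, y). tk x t y * f y) \<in> borel_measurable (lborel \<Otimes>\<^sub>M M)" proof -
      have "(%z :: real \<times> real. (case z of (t, y) => tk x t y) * f (snd z)) \<in> borel_measurable (lborel \<Otimes>\<^sub>M M)" by measurable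
      thus ?thesis by (simp add: case_prod_beta')
    qed
    show "AE z in lborel \<Otimes>\<^sub>M M. norm (case z of (t, y) => tk x t y * f y) <= norm (C * (case z of (t, y) => tk x t y))"
    proof (rule AE_I2)
      fix z :: "real \<times> real" assume "z \<in> space (lborel \<Otimes>\<^sub>M M)"
      then obtain t y where z: "z = (t, y)" "y \<in> I" by (auto simp: space_pair_measure space_M)
      have "\<bar>tk x t y\<bar> * \<bar>f y\<bar> <= \<bar>tk x t y\<bar> * C" by (intro mult_left_mono C(2) z) auto
      thus "norm (case z of (t, y) => tk x t y * f y) <= norm (C * (case z of (t, y) => tk x t y))"
        using C(1) by (simp add: z abs_mult mult.commute)
    qed
  qed
qed

lemma pk_bm:
  assumes x: "x \<in> I" and f: "bm f"
  shows "integrable M (%y. pk x y * f y)"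
    and "(LINT y|M. pk x y * f y) = 1 / Gamma (1/2) * (LINT t|lborel. (LINT y|M. tk x t y * f y))"
proof -
  note i = integrable_tk_mult[OF x f]
  have eq: "pk x y * f y = 1 / Gamma (1/2) * (LINT t|lborel. tk x t y * f y)" for y by (simp add: pk_eq)
  show "integrable M (%y. pk x y * f y)"
    unfolding eq using TM.integrable_snd[OF i] by (rule integrable_mult_right)
  show "(LINT y|M. pk x y * f y) = 1 / Gamma (1/2) * (LINT t|lborel. (LINT y|M. tk x t y * f y))"
    unfolding eq integral_mult_right_zero TM.Fubini_integral[OF i] ..
qed

lemma pk_e: assumes "x \<in> I" shows "(LINT y|M. pk x y * e n y) = e n x / lam n"
proof -
  have "Gamma (1/2 :: real) ~= 0" using Gamma_real_pos[of "1/2"] by linarith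
  thus ?thesis
    unfolding pk_bm(2)[OF assms bm_e(1)] has_bochner_integral_integral_eq[OF tk_integral[OF assms]] by simp
qed

lemma pk_mass: assumes "x \<in> I" shows "integrable M (pk x)" "integral\<^sup>L M (pk x) = 1 / lam 0"
proof -
  show "integrable M (pk x)" using pk_bm(1)[OF assms bm_const[of 1]] by simp
  show "integral\<^sup>L M (pk x) = 1 / lam 0"
    using pk_e[OF assms, of 0] ip_e_0[of "pk x"] assms by (simp add: ip_def e_0)
qed

definition Io :: "(real => real) => real => real" where
  "Io f x = (LINT y|M. pk x y * f y)"

lemma Io_fs: assumes "x \<in> I" shows "Io (fs e N c) x = fs e N (%n. c n / lam n) x"
proof -
  have "Io (fs e N c) x = (LINT y|M. (\<Sum>n<N. c n * (pk x y * e n y)))"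
    by (simp add: Io_def fs_def sum_distrib_left mult_ac)
  also have "... = (\<Sum>n<N. c n * (LINT y|M. pk x y * e n y))"
    using pk_bm(1)[OF assms bm_e(1)] by (subst Bochner_Integration.integral_sum) auto
  finally show ?thesis using assms by (simp add: pk_e fs_def)
qed

text \<open>As in Schur's test: \<open>pk\<close> is nonnegative and symmetric and every row has
  mass \<open>1 / lam 0\<close>, hence so has every column, and the double integral is evaluated by
  integrating over \<open>x\<close> first.\<close>

lemma pk_Lp:
  assumes f: "f \<in> Lp_space M p" and p: "1 < p"
  shows "AE x in M. integrable M (%y. pk x y * \<bar>f y\<bar> powr p)"
    and "integrable M (%x. LINT y|M. pk x y * \<bar>f y\<bar> powr p)"
    and "(LINT x|M. (LINT y|M. pk x y * \<bar>f y\<bar> powr p)) = Lp_int M p f / lam 0"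
proof -
  note [measurable] = Lp_spaceD(1)[OF f] measurable_pk
  define J where "J x y = pk y x" for x y
  have J: "J = pk" unfolding J_def by (intro ext) (rule pk_commute)
  have mass: "(LINT x|M. J x y * \<bar>f y\<bar> powr p) = 1 / lam 0 * \<bar>f y\<bar> powr p" if "y \<in> I" for y
    using pk_mass[OF that] by (simp add: J_def)
  have i: "integrable (M \<Otimes>\<^sub>M M) (%(y, x). J x y * \<bar>f y\<bar> powr p)"
  proof (rule MM.Fubini_integrable)
    show "(%(y, x). J x y * \<bar>f y\<bar> powr p) \<in> borel_measurable (M \<Otimes>\<^sub>M M)"
      unfolding J_def by measurable
    have "integrable M (%y. 1 / lam 0 * \<bar>f y\<bar> powr p)"
      using Lp_spaceD(2)[OF f] by (intro integrable_mult_right) simp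
    moreover have "(LINT x|M. norm (case (y, x) of (y, x) => J x y * \<bar>f y\<bar> powr p)) = 1 / lam 0 * \<bar>f y\<bar> powr p"
      if "y \<in> I" for y unfolding mass[OF that, symmetric]
      using that by (intro Bochner_Integration.integral_cong) (auto simp: J_def space_M pk_nonneg abs_mult)
    ultimately show "integrable M (%y. LINT x|M. norm (case (y, x) of (y, x) => J x y * \<bar>f y\<bar> powr p))"
      by (subst Bochner_Integration.integrable_cong[OF refl, of M _ "%y. 1 / lam 0 * \<bar>f y\<bar> powr p"]) (auto simp: space_M)
    show "AE y in M. integrable M (%x. case (y, x) of (y, x) => J x y * \<bar>f y\<bar> powr p)"
      by (rule AE_I2) (simp add: space_M J_def pk_mass)
  qed
  note i = i[unfolded J] and mass = mass[unfolded J]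
  show "AE x in M. integrable M (%y. pk x y * \<bar>f y\<bar> powr p)" by (rule MM.AE_integrable_snd[OF i])
  show "integrable M (%x. LINT y|M. pk x y * \<bar>f y\<bar> powr p)" by (rule MM.integrable_snd[OF i])
  have "(LINT x|M. (LINT y|M. pk x y * \<bar>f y\<bar> powr p)) = (LINT y|M. (LINT x|M. pk x y * \<bar>f y\<bar> powr p))"
    by (rule MM.Fubini_integral[OF i])
  also have "... = (LINT y|M. 1 / lam 0 * \<bar>f y\<bar> powr p)"
    by (rule Bochner_Integration.integral_cong[OF refl mass]) (simp only: space_M)
  finally show "(LINT x|M. (LINT y|M. pk x y * \<bar>f y\<bar> powr p)) = Lp_int M p f / lam 0" by simp
qed

lemma Io_integrable:
  assumes f: "f \<in> Lp_space M p" and p: "1 < p"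
  shows "AE x in M. integrable M (%y. pk x y * f y)"
  using pk_Lp(1)[OF assms] AE_space proof eventually_elim
  case (elim x)
  hence x: "x \<in> I" by (simp add: space_M)
  note [measurable] = Lp_spaceD(1)[OF f] measurable_pk'[OF x]
  show ?case proof (rule Bochner_Integration.integrable_bound)
    show "integrable M (%y. pk x y + pk x y * \<bar>f y\<bar> powr p)"
      by (intro Bochner_Integration.integrable_add pk_mass x elim)
    show "AE y in M. norm (pk x y * f y) <= norm (pk x y + pk x y * \<bar>f y\<bar> powr p)"
    proof (rule AE_I2)
      fix y assume "y \<in> space M"
      hence n: "0 <= pk x y" using x by (simp add: pk_nonneg space_M)
      have "pk x y * \<bar>f y\<bar> <= pk x y * (1 + \<bar>f y\<bar> powr p)"
        using le_delta_powr[of "\<bar>f y\<bar>" 1 p] p n by (intro mult_left_mono) auto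
      thus "norm (pk x y * f y) <= norm (pk x y + pk x y * \<bar>f y\<bar> powr p)"
        using n by (simp add: abs_mult distrib_left)
    qed
  qed measurable
qed

text \<open>Jensen's inequality up to a constant for the kernel \<open>pk x\<close> of mass
  \<open>1 / lam 0\<close>: \<open>le_delta_powr\<close> with \<open>d = A powr (1 / p)\<close>, and
  with \<open>d\<close> tending to 0 if \<open>A = 0\<close>.\<close>

lemma Io_pointwise:
  assumes f: "f \<in> Lp_space M p" and p: "1 < p" and x: "x \<in> I"
    and i: "integrable M (%y. pk x y * \<bar>f y\<bar> powr p)" "integrable M (%y. pk x y * f y)"
  shows "\<bar>Io f x\<bar> powr p <= (1 / lam 0 + 1) powr p * (LINT y|M. pk x y * \<bar>f y\<bar> powr p)"
proof -
  define A where "A = (LINT y|M. pk x y * \<bar>f y\<bar> powr p)"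
  have A: "0 <= A" unfolding A_def
    by (rule Bochner_Integration.integral_nonneg_AE[OF AE_I2]) (use x in \<open>simp add: space_M pk_nonneg\<close>)
  have le: "\<bar>Io f x\<bar> <= d / lam 0 + d powr (1 - p) * A" if d: "0 < d" for d proof -
    have "\<bar>Io f x\<bar> <= (LINT y|M. \<bar>pk x y * f y\<bar>)" unfolding Io_def by (rule integral_abs_bound)
    also have "... <= (LINT y|M. d * pk x y + d powr (1 - p) * (pk x y * \<bar>f y\<bar> powr p))"
    proof (rule integral_mono)
      show "integrable M (%y. \<bar>pk x y * f y\<bar>)" using i(2) by (rule integrable_abs)
      show "integrable M (%y. d * pk x y + d powr (1 - p) * (pk x y * \<bar>f y\<bar> powr p))"
        by (intro Bochner_Integration.integrable_add integrable_mult_right pk_mass x i)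
      fix y assume "y \<in> space M"
      hence n: "0 <= pk x y" using x by (simp add: pk_nonneg space_M)
      have "pk x y * \<bar>f y\<bar> <= pk x y * (d + d powr (1 - p) * \<bar>f y\<bar> powr p)"
        using le_delta_powr[of "\<bar>f y\<bar>" d p] p n d by (intro mult_left_mono) auto
      thus "\<bar>pk x y * f y\<bar> <= d * pk x y + d powr (1 - p) * (pk x y * \<bar>f y\<bar> powr p)"
        using n by (simp add: abs_mult algebra_simps)
    qed
    also have "... = d * (1 / lam 0) + d powr (1 - p) * A"
      unfolding A_def using pk_mass[OF x] i(1) by (subst Bochner_Integration.integral_add) auto
    finally show ?thesis by simp
  qed
  show ?thesis proof (cases "A = 0")
    case True
    have "\<bar>Io f x\<bar> <= 0" proof (rule field_le_epsilon)
      fix eps :: real assume "0 < eps"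
      thus "\<bar>Io f x\<bar> <= 0 + eps" using le[of "eps * lam 0"] lam_pos[of 0] True by simp
    qed
    thus ?thesis using A p unfolding A_def[symmetric] by simp
  next
    case False
    with A have A: "0 < A" by simp
    define d where "d = A powr (1 / p)"
    have d: "0 < d" "d powr p = A" using A p by (auto simp: d_def powr_powr)
    have "d powr (1 - p) * A = d" unfolding d(2)[symmetric] powr_add[symmetric] using d(1) by simp
    hence "\<bar>Io f x\<bar> <= (1 / lam 0 + 1) * d" using le[OF d(1)] by (simp add: algebra_simps)
    hence "\<bar>Io f x\<bar> powr p <= ((1 / lam 0 + 1) * d) powr p" using p by (intro powr_mono2) auto
    also have "... = (1 / lam 0 + 1) powr p * A" using d lam_pos[of 0] by (simp add: powr_mult)
    finally show ?thesis by (simp add: A_def)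
  qed
qed

lemma Io_Lp:
  assumes f: "f \<in> Lp_space M p" and p: "1 < p"
  shows "Io f \<in> Lp_space M p"
    and "Lp_int M p (Io f) <= ((1 / lam 0 + 1) powr p / lam 0) * Lp_int M p f"
proof -
  note [measurable] = Lp_spaceD(1)[OF f] measurable_pk
  have meas: "Io f \<in> borel_measurable M"
    unfolding Io_def[abs_def] by (intro borel_measurable_lebesgue_integral) measurable
  have "AE x in M. norm (Io f x) powr p <= (1 / lam 0 + 1) powr p * (LINT y|M. pk x y * \<bar>f y\<bar> powr p)"
    using pk_Lp(1)[OF assms] Io_integrable[OF assms] AE_space
    by eventually_elim (simp add: Io_pointwise[OF assms] space_M)
  note * = Lp_space_dominated[OF meas _ this]
  show "Io f \<in> Lp_space M p" by (rule *(1)) (intro integrable_mult_right pk_Lp(2)[OF assms])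
  have "Lp_int M p (Io f) <= (LINT x|M. (1 / lam 0 + 1) powr p * (LINT y|M. pk x y * \<bar>f y\<bar> powr p))"
    by (rule *(2)) (intro integrable_mult_right pk_Lp(2)[OF assms])
  also have "... = (1 / lam 0 + 1) powr p * (Lp_int M p f / lam 0)" by (simp add: pk_Lp(3)[OF assms])
  finally show "Lp_int M p (Io f) <= ((1 / lam 0 + 1) powr p / lam 0) * Lp_int M p f" by simp
qed

lemma Io_lin:
  assumes f: "f \<in> Lp_space M p" and g: "g \<in> Lp_space M p" and p: "1 < p"
  shows "AE x in M. Io (%y. s * f y + t * g y) x = s * Io f x + t * Io g x"
  using Io_integrable[OF f p] Io_integrable[OF g p] proof eventually_elim
  case (elim x)
  have "Io (%y. s * f y + t * g y) x = (LINT y|M. s * (pk x y * f y) + t * (pk x y * g y))"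
    unfolding Io_def by (simp add: algebra_simps)
  also have "... = s * Io f x + t * Io g x" unfolding Io_def using elim by simp
  finally show ?case .
qed

lemma Io_tendsto:
  assumes u: "!!k. u k \<in> Lp_space M p" and f: "f \<in> Lp_space M p" and p: "1 < p"
    and lim: "Lp_lim M p u f"
  shows "Lp_lim M p (%k. Io (u k)) (Io f)"
proof (rule tendsto_sandwich[OF _ _ tendsto_const])
  show "(%k. ((1 / lam 0 + 1) powr p / lam 0) * Lp_int M p (%x. u k x - f x)) ----> 0"
    by (rule tendsto_mult_right_zero[OF lim])
  have "Lp_int M p (%x. Io (u k) x - Io f x) <= ((1 / lam 0 + 1) powr p / lam 0) * Lp_int M p (%x. u k x - f x)" for k
  proof -
    have d: "(%x. u k x - f x) \<in> Lp_space M p" using p by (intro Lp_diff u f) auto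
    have "Lp_int M p (%x. Io (u k) x - Io f x) = Lp_int M p (Io (%x. u k x - f x))"
    proof (rule Lp_cong_AE(2))
      show "Io (%x. u k x - f x) \<in> Lp_space M p" by (rule Io_Lp[OF d p])
      show "(%x. Io (u k) x - Io f x) \<in> borel_measurable M"
        by (intro borel_measurable_diff Lp_spaceD(1)[OF Io_Lp(1)[OF u p]] Lp_spaceD(1)[OF Io_Lp(1)[OF f p]])
      show "AE x in M. Io (%x. u k x - f x) x = Io (u k) x - Io f x"
        using Io_lin[OF u[of k] f p, of 1 "-1"] by simp
    qed
    thus ?thesis using Io_Lp(2)[OF d p] by simp
  qed
  thus "\<forall>\<^sub>F k in sequentially. Lp_int M p (%x. Io (u k) x - Io f x)
      <= ((1 / lam 0 + 1) powr p / lam 0) * Lp_int M p (%x. u k x - f x)" by simp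
qed (auto intro!: always_eventually Lp_int_nonneg)

lemma span_sequence:
  assumes "!!d. 0 < d ==> \<exists>N c. Lp_int M p (%x. fs Z N c x - f x) < d"
  shows "\<exists>N c. Lp_lim M p (%k. fs Z (N k) (c k)) f"
proof -
  have "\<exists>z. Lp_int M p (%x. fs Z (fst z) (snd z) x - f x) < inverse (real (Suc k))" for k
    using assms[of "inverse (real (Suc k))"] by simp
  hence "\<forall>k. \<exists>z. Lp_int M p (%x. fs Z (fst z) (snd z) x - f x) < inverse (real (Suc k))" by blast
  from choice[OF this] obtain z
    where z: "\<forall>k. Lp_int M p (%x. fs Z (fst (z k)) (snd (z k)) x - f x) < inverse (real (Suc k))" ..
  have "Lp_lim M p (%k. fs Z (fst (z k)) (snd (z k))) f"
  proof (rule tendsto_sandwich[OF always_eventually always_eventually tendsto_const LIMSEQ_inverse_real_of_nat])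
    show "\<forall>k. 0 <= Lp_int M p (%x. fs Z (fst (z k)) (snd (z k)) x - f x)" by (intro allI Lp_int_nonneg)
    show "\<forall>k. Lp_int M p (%x. fs Z (fst (z k)) (snd (z k)) x - f x) <= inverse (real (Suc k))"
      using z less_imp_le by blast
  qed
  thus ?thesis by (intro exI[of _ "%k. fst (z k)"] exI[of _ "%k. snd (z k)"])
qed

text \<open>Clear on finite sums by orthogonality; both sides are continuous in L^p, where these
  sums are dense.\<close>

lemma ip_Io_e:
  assumes f: "f \<in> Lp_space M p" and p: "1 < p"
  shows "ip (Io f) (e n) = ip f (e n) / lam n"
proof -
  define q where "q = p / (p - 1)"
  have q: "1 < q" "1 / p + 1 / q = 1" using p by (auto simp: q_def field_simps)
  obtain N c where lim: "Lp_lim M p (%k. fs e (N k) (c k)) f"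
    using span_sequence[OF span_dense_e[OF _ f]] p by (meson less_trans zero_less_one)
  define u where "u k = fs e (N k) (c k)" for k
  have u: "u k \<in> Lp_space M p" for k unfolding u_def by (rule Lp_bm[OF _ bm_fs_e(1)]) (use p in simp)
  have lim: "Lp_lim M p u f" using lim by (simp only: u_def)
  have en: "e n \<in> Lp_space M q" by (rule Lp_bm[OF _ bm_e(1)]) (use q in simp)
  have 1: "(%k. ip (Io (u k)) (e n)) ----> ip (Io f) (e n)" unfolding ip_def
    by (rule Lp_pairing_tendsto[OF Io_Lp(1)[OF u p] Io_Lp(1)[OF f p] en p q Io_tendsto[OF u f p lim]])
  have "(%k. ip (u k) (e n) / lam n) ----> ip f (e n) / lam n"
    unfolding ip_def using Lp_pairing_tendsto[OF u f en p q lim] lam_pos[of n] by (intro tendsto_divide) auto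
  moreover have "ip (Io (u k)) (e n) = ip (u k) (e n) / lam n" for k proof -
    have "ip (Io (u k)) (e n) = ip (fs e (N k) (%n. c k n / lam n)) (e n)"
      unfolding ip_def u_def by (rule Bochner_Integration.integral_cong) (auto simp: space_M Io_fs)
    also have "... = ip (u k) (e n) / lam n"
      unfolding u_def ip_fs[OF bm_e(1) bm_e(1)] sum_divide_distrib by (intro sum.cong) (auto simp: ip_e)
    finally show ?thesis .
  qed
  ultimately show ?thesis using 1 LIMSEQ_unique by simp
qed

text \<open>All pairings with the span vanish, so the hypothesis of \<open>span_duality\<close>
  holds with \<open>A = 0\<close>.\<close>

lemma Lp_zero_of_ip:
  assumes f: "f \<in> Lp_space M p" and p: "1 < p" and z: "!!n. ip f (e n) = 0"
  shows "AE x in M. f x = 0"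
proof -
  define q where "q = p / (p - 1)"
  have q: "1 < q" "1 / p + 1 / q = 1" using p by (auto simp: q_def field_simps)
  have q0: "0 < q" using q by simp
  obtain K' where "0 < K'" and dual: "!!F N A. F \<in> Lp_space M p ==>
    (!!L d. N <= L ==> \<bar>ip F (fs e L d)\<bar> <= A + 1 * Lp_int M q (fs e L d)) ==> Lp_int M p F <= K' * A"
    by (rule span_duality[OF p q zero_less_one bm_e(1) span_dense_e[OF q0]]) blast+
  have "Lp_int M p f <= K' * 0" proof (rule dual[OF f, where N = 0])
    fix L c
    have "ip f (fs e L c) = (LINT x|M. (\<Sum>n<L. c n * (f x * e n x)))"
      by (simp add: ip_def fs_def sum_distrib_left mult_ac)
    also have "... = (\<Sum>n<L. c n * ip f (e n))" unfolding ip_def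
    proof (subst Bochner_Integration.integral_sum)
      show "integrable M (%x. c n * (f x * e n x))" for n
        using Lp_pairing(1)[OF f Lp_bm[OF q0 bm_e(1)] p q, of 1] by (intro integrable_mult_right) auto
    qed simp
    finally show "\<bar>ip f (fs e L c)\<bar> <= 0 + 1 * Lp_int M q (fs e L c)"
      using Lp_int_nonneg[of M "fs e L c" q] by (simp add: z)
  qed
  hence "Lp_int M p f = 0" by (intro antisym Lp_int_nonneg) simp
  hence "AE x in M. norm (f x) powr p = 0" using integral_nonneg_eq_0_iff_AE[OF Lp_spaceD(2)[OF f]] by simp
  thus ?thesis by eventually_elim (simp split: if_splits)
qed

lemma Io_injective:
  assumes f: "f \<in> Lp_space M p" and g: "g \<in> Lp_space M p" and p: "1 < p"
    and eq: "AE x in M. Io f x = Io g x"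
  shows "AE x in M. f x = g x"
proof -
  have d: "(%x. f x - g x) \<in> Lp_space M p" using p by (intro Lp_diff f g) auto
  have "AE x in M. Io (%x. f x - g x) x = 0" using Io_lin[OF f g p, of 1 "-1"] eq by eventually_elim simp
  hence "ip (Io (%x. f x - g x)) (e n) = ip (%x. 0) (e n)" for n
    unfolding ip_def using Lp_spaceD(1)[OF Io_Lp(1)[OF d p]] by (intro integral_cong_AE) auto
  hence "ip (%x. f x - g x) (e n) = 0" for n using ip_Io_e[OF d p, of n] lam_pos[of n] by (simp add: ip_def)
  from Lp_zero_of_ip[OF d p this] show ?thesis by simp
qed

end

text \<open>Extension of a bounded linear map by density: \<open>u k\<close> approximates
  \<open>f\<close>, \<open>v k\<close> is the image of \<open>u k\<close>, and \<open>diff\<close>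
  is boundedness applied to differences. Working with sequences avoids naming the map on all of
  L^p.\<close>

lemma Lp_transfer:
  fixes u v :: "nat => 'b => real"
  assumes u: "!!k. u k \<in> Lp_space M p" and f: "f \<in> Lp_space M p" and v: "!!k. v k \<in> Lp_space M p"
    and p: "0 < p" and C: "0 <= C" and lim: "Lp_lim M p u f"
    and diff: "!!m n. Lp_int M p (%x. v m x - v n x) <= C * Lp_int M p (%x. u m x - u n x)"
    and bound: "!!k. Lp_int M p (v k) <= C * Lp_int M p (u k)"
  shows "\<exists>g\<in>Lp_space M p. (%k. Lp_int M p (%x. v k x - g x)) ----> 0 &
    Lp_int M p g <= (2 powr p * (C * 2 powr p)) * Lp_int M p f" proof -
  have "\<exists>N. \<forall>m\<ge>N. \<forall>n\<ge>N. Lp_int M p (%x. v m x - v n x) < d" if d: "0 < d" for d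
  proof -
    define eps where "eps = d / (C + 1) / 2 powr p / 2"
    have eps: "0 < eps" using d C by (simp add: eps_def)
    obtain N where N: "!!n. N <= n ==> Lp_int M p (%x. u n x - f x) < eps"
      using order_tendstoD(2)[OF lim eps] unfolding eventually_sequentially by blast
    have "Lp_int M p (%x. v m x - v n x) < d" if mn: "N <= m" "N <= n" for m n proof -
      have "Lp_int M p (%x. u m x - u n x) = Lp_int M p (%x. (u m x - f x) - (u n x - f x))" by simp
      also have "... <= 2 powr p * (Lp_int M p (%x. u m x - f x) + Lp_int M p (%x. u n x - f x))"
        by (intro Lp_diff u f p)
      also have "... < 2 powr p * (eps + eps)" using N[OF mn(1)] N[OF mn(2)] by (intro mult_strict_left_mono) auto
      also have "... = d / (C + 1)" by (simp add: eps_def)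
      finally have "C * Lp_int M p (%x. u m x - u n x) <= C * (d / (C + 1))"
        using C by (intro mult_left_mono) auto
      also have "... < d" using C d by (simp add: field_simps)
      finally show ?thesis using diff[of m n] by linarith
    qed
    thus ?thesis by blast
  qed
  from Lp_complete[OF v p this] obtain g
    where g: "g \<in> Lp_space M p" "Lp_lim M p v g" by blast
  have "Lp_int M p g <= (2 powr p * (C * 2 powr p)) * Lp_int M p f + eps" if eps: "0 < eps" for eps proof -
    define d where "d = eps / (2 powr p * ((C + 1) * 2 powr p))"
    have d: "0 < d" using eps C by (simp add: d_def)
    obtain N where N: "!!n. N <= n ==> Lp_int M p (u n) <= 2 powr p * (Lp_int M p f + d)"
      using Lp_int_bounded_of_tendsto[OF u f p lim d] unfolding eventually_sequentially by blast
    have "Lp_int M p g <= 2 powr p * (C * (2 powr p * (Lp_int M p f + d)))"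
    proof (rule Lp_int_le_of_tendsto[OF v g(1) p])
      show "Lp_lim M p (%k. v (k + N)) g" using g(2) by (rule LIMSEQ_ignore_initial_segment)
      show "Lp_int M p (v (k + N)) <= C * (2 powr p * (Lp_int M p f + d))" for k
        by (rule order_trans[OF bound mult_left_mono[OF N C]]) simp
    qed
    also have "... = (2 powr p * (C * 2 powr p)) * Lp_int M p f + 2 powr p * (C * 2 powr p) * d"
      by (simp add: algebra_simps)
    also have "2 powr p * (C * 2 powr p) * d <= 2 powr p * ((C + 1) * 2 powr p) * d"
      using d by (intro mult_right_mono mult_left_mono) auto
    also have "... = eps" using C by (simp add: d_def)
    finally show ?thesis by simp
  qed
  hence "Lp_int M p g <= (2 powr p * (C * 2 powr p)) * Lp_int M p f" by (rule field_le_epsilon)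
  with g show ?thesis by blast
qed

text \<open>Jensen's inequality on an interval of length at most 1, by \<open>le_delta_powr\<close>
  with \<open>d\<close> the p-th root of the integral.\<close>

lemma increment_bound:
  fixes u u1 :: "real => real"
  assumes u: "!!x. x \<in> {a..b} ==> DERIV u x :> u1 x" and u1: "continuous_on {a..b} u1"
    and ab: "a <= b" "b - a <= 1" and p: "1 <= p"
  shows "\<bar>u b - u a\<bar> powr p <= 2 powr p * integral {a..b} (%x. \<bar>u1 x\<bar> powr p)"
proof -
  define J where "J = integral {a..b} (%x. \<bar>u1 x\<bar> powr p)"
  have c: "continuous_on {a..b} (%x. \<bar>u1 x\<bar> powr p)"
    using u1 p by (intro continuous_on_powr' continuous_intros) auto
  have i: "(%x. \<bar>u1 x\<bar> powr p) integrable_on {a..b}" by (rule integrable_continuous_real[OF c])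
  have J: "0 <= J" unfolding J_def by (rule integral_nonneg[OF i]) simp
  have ftc: "(u1 has_integral (u b - u a)) {a..b}" using ab(1) u by (intro fundamental_theorem_of_calculus)
      (auto simp: has_real_derivative_iff_has_vector_derivative[symmetric] intro: has_field_derivative_at_within)
  have le: "\<bar>u b - u a\<bar> <= d + d powr (1 - p) * J" if d: "0 < d" for d proof -
    have "\<bar>u b - u a\<bar> = norm (integral {a..b} u1)" using ftc by (simp add: integral_unique)
    also have "... <= integral {a..b} (%x. d + d powr (1 - p) * \<bar>u1 x\<bar> powr p)"
    proof (rule integral_norm_bound_integral)
      show "u1 integrable_on {a..b}" using ftc by blast
      show "(%x. d + d powr (1 - p) * \<bar>u1 x\<bar> powr p) integrable_on {a..b}"
        by (intro integrable_continuous_real continuous_intros c)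
      show "norm (u1 x) <= d + d powr (1 - p) * \<bar>u1 x\<bar> powr p" for x
        using le_delta_powr[of "\<bar>u1 x\<bar>" d p] d p by simp
    qed
    also have "... = (b - a) * d + d powr (1 - p) * J"
      unfolding J_def using i ab by (subst integral_add) (auto intro!: integrable_continuous_real continuous_intros c)
    also have "... <= d + d powr (1 - p) * J" using ab d by (simp add: mult_le_cancel_right1)
    finally show ?thesis .
  qed
  show ?thesis proof (cases "J = 0")
    case True
    have "\<bar>u b - u a\<bar> <= 0" by (rule field_le_epsilon) (use le True in auto)
    thus ?thesis using J by (simp add: J_def[symmetric])
  next
    case False
    with J have J: "0 < J" by simp
    define d where "d = J powr (1 / p)"
    have d: "0 < d" "d powr p = J" using J p by (auto simp: d_def powr_powr)
    have "d powr (1 - p) * J = d" unfolding d(2)[symmetric] powr_add[symmetric] using d(1) by simp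
    hence "\<bar>u b - u a\<bar> <= 2 * d" using le[OF d(1)] by simp
    hence "\<bar>u b - u a\<bar> powr p <= (2 * d) powr p" using p by (intro powr_mono2) auto
    also have "... = 2 powr p * J" using d by (simp add: powr_mult)
    finally show ?thesis by (simp add: J_def)
  qed
qed

section \<open>The reverse Riesz inequality and a Poincare inequality on finite sums\<close>

context sturm
begin

lemma fs_add: "N <= L ==> N' <= L ==>
    fs Z N c x - fs Z N' c' x = fs Z L (%n. (if n < N then c n else 0) - (if n < N' then c' n else 0)) x"
  unfolding fs_ext[of N L] fs_ext[of N' L] by (simp add: fs_def left_diff_distrib sum_subtractf)

lemma Lp_fs: "0 < p ==> fs e N c \<in> Lp_space M p" "0 < p ==> fs e1 N c \<in> Lp_space M p"
  by (rule Lp_bm[OF _ bm_fs_e(1)], assumption) (rule Lp_bm[OF _ bm_fs_e(2)])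

lemma Lp_int_cong: "(!!x. x \<in> I ==> f x = g x) ==> Lp_int M p f = Lp_int M p g"
  by (rule Bochner_Integration.integral_cong) (auto simp: space_M)

text \<open>The identity \<open>lam n = kappa n / lam n + (lam 0)^2 / lam n\<close> splits the
  pairing with a test sum into one of derivatives and one of functions, the division by
  \<open>lam n\<close> falling on the test sum. The Riesz bound and the boundedness of
  \<open>Io\<close>, both for the dual exponent \<open>q\<close>, then estimate it.\<close>

lemma reverse_riesz:
  assumes p: "1 < p"
  shows "\<exists>C>0. \<forall>N c. Lp_int M p (fs e N (%n. lam n * c n)) <= C * (Lp_int M p (fs e N c) + Lp_int M p (fs e1 N c))"
proof -
  define q where "q = p / (p - 1)"
  have q: "1 < q" "1 / p + 1 / q = 1" using p by (auto simp: q_def field_simps)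
  obtain C1 where C1: "0 < C1" "!!N c. Lp_int M q (fs e1 N (%n. c n / lam n)) <= C1 * Lp_int M q (fs e N c)"
    using riesz_bound[OF q(1)] by blast
  define C2 where "C2 = (1 / lam 0 + 1) powr q / lam 0"
  have l0: "0 < lam 0" by (rule lam_pos)
  have C2: "0 <= C2" using l0 by (simp add: C2_def)
  have C2': "Lp_int M q (fs e N (%n. c n / lam n)) <= C2 * Lp_int M q (fs e N c)" for N c
    using Io_Lp(2)[OF Lp_fs(1) q(1), of N c] Lp_int_cong[of "Io (fs e N c)" "fs e N (%n. c n / lam n)" q] q(1)
    by (simp add: C2_def Io_fs)
  define C where "C = C1 + (lam 0)\<^sup>2 * C2"
  have C: "0 < C" using C1(1) C2 by (simp add: C_def add_pos_nonneg)
  have q0: "0 < q" and p0: "0 < p" using p q by auto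
  obtain K' where K': "0 < K'" and dual: "!!F N A. F \<in> Lp_space M p ==>
    (!!L d. N <= L ==> \<bar>ip F (fs e L d)\<bar> <= A + C * Lp_int M q (fs e L d)) ==> Lp_int M p F <= K' * A"
    by (rule span_duality[OF p q C bm_e(1) span_dense_e[OF q0]]) blast+
  have pair: "\<bar>ip f g\<bar> <= Lp_int M p f + Lp_int M q g" if "f \<in> Lp_space M p" "g \<in> Lp_space M q" for f g
    using Lp_pairing(3)[OF that p q zero_less_one] by (simp add: ip_def)
  have main: "Lp_int M p (fs e N (%n. lam n * c n)) <= K' * (Lp_int M p (fs e1 N c) + (lam 0)\<^sup>2 * Lp_int M p (fs e N c))" for N c
  proof (rule dual[OF Lp_fs(1)[OF p0], where N = N])
    fix L d assume "N <= L"
    then obtain c' where c': "!!Z. fs Z N c = fs Z L c'" "!!Z. fs Z N (%n. lam n * c n) = fs Z L (%n. lam n * c' n)"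
      by (rule fs_ext'[of N L c lam]) blast
    have split: "ip (fs e L (%n. lam n * c' n)) (fs e L d) =
        ip (fs e1 L c') (fs e1 L (%n. d n / lam n)) + (lam 0)\<^sup>2 * ip (fs e L c') (fs e L (%n. d n / lam n))"
      unfolding ip_fs_e sum_distrib_left sum.distrib[symmetric] proof (rule sum.cong[OF refl])
      fix n
      have "lam n ~= 0" using lam_pos[of n] by simp
      thus "lam n * c' n * d n = kappa n * (c' n * (d n / lam n)) + (lam 0)\<^sup>2 * (c' n * (d n / lam n))"
        by (simp add: kappa_def field_simps power2_eq_square)
    qed
    have "\<bar>ip (fs e L (%n. lam n * c' n)) (fs e L d)\<bar>
        <= \<bar>ip (fs e1 L c') (fs e1 L (%n. d n / lam n))\<bar> + (lam 0)\<^sup>2 * \<bar>ip (fs e L c') (fs e L (%n. d n / lam n))\<bar>"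
      unfolding split by (rule order_trans[OF abs_triangle_ineq]) (simp add: abs_mult)
    also have "... <= (Lp_int M p (fs e1 L c') + C1 * Lp_int M q (fs e L d))
        + (lam 0)\<^sup>2 * (Lp_int M p (fs e L c') + C2 * Lp_int M q (fs e L d))"
      using pair[OF Lp_fs(2)[OF p0] Lp_fs(2)[OF q0]] pair[OF Lp_fs(1)[OF p0] Lp_fs(1)[OF q0]]
      by (intro add_mono mult_left_mono order_trans[OF _ add_left_mono[OF C1(2)]] order_trans[OF _ add_left_mono[OF C2']]) auto
    also have "... = Lp_int M p (fs e1 L c') + (lam 0)\<^sup>2 * Lp_int M p (fs e L c') + C * Lp_int M q (fs e L d)"
      by (simp only: C_def algebra_simps)
    finally show "\<bar>ip (fs e N (%n. lam n * c n)) (fs e L d)\<bar>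
        <= Lp_int M p (fs e1 N c) + (lam 0)\<^sup>2 * Lp_int M p (fs e N c) + C * Lp_int M q (fs e L d)"
      unfolding c' .
  qed
  have "Lp_int M p (fs e N (%n. lam n * c n)) <= (K' * (1 + (lam 0)\<^sup>2)) * (Lp_int M p (fs e N c) + Lp_int M p (fs e1 N c))" for N c
  proof -
    have n: "0 <= Lp_int M p (fs e N c)" "0 <= (lam 0)\<^sup>2 * Lp_int M p (fs e1 N c)"
      by (rule Lp_int_nonneg) (intro mult_nonneg_nonneg Lp_int_nonneg zero_le_power2)
    have "K' * (Lp_int M p (fs e1 N c) + (lam 0)\<^sup>2 * Lp_int M p (fs e N c))
        <= K' * ((1 + (lam 0)\<^sup>2) * (Lp_int M p (fs e N c) + Lp_int M p (fs e1 N c)))"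
      using K' n by (intro mult_left_mono) (auto simp: algebra_simps)
    thus ?thesis using main[of N c] by (simp only: mult.assoc)
  qed
  moreover have "0 < K' * (1 + (lam 0)\<^sup>2)" using K' by (simp add: add_pos_nonneg)
  ultimately show ?thesis by blast
qed

text \<open>Between \<open>x\<close> and the midpoint the weight is at least \<open>w x / K\<close>,
  so it can be moved inside the integral that bounds the increment from the zero at 1/2. The
  resulting bound for \<open>w x * |u x| powr p\<close> is independent of \<open>x\<close> and is
  integrated over (0,1).\<close>

lemma poincare:
  assumes p: "1 < p" and z: "fs e N c (1/2) = 0"
  shows "Lp_int M p (fs e N c) <= (2 powr p * K) * Lp_int M p (fs e1 N c)"
proof -
  define u u1 where "u = fs e N c" and "u1 = fs e1 N c"
  have u: "DERIV u x :> u1 x" if "x \<in> I" for x unfolding u_def u1_def by (intro fs_deriv e_deriv that)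
  have u1: "continuous_on I u1" unfolding u1_def fs_def by (intro continuous_intros cont_e)
  have p0: "0 < p" using p by simp
  note L = Lp_spaceD[OF Lp_fs(2)[OF p0], of N c, folded u1_def]
  have si: "set_integrable lborel I (%x. w x * \<bar>u1 x\<bar> powr p)"
    using integral_M(2)[OF borel_measurable_integrable[OF L(2)]] L(2) by simp
  have Lu1: "Lp_int M p u1 = (LINT x:I|lborel. w x * \<bar>u1 x\<bar> powr p)"
    using integral_M(1)[OF borel_measurable_integrable[OF L(2)]] by simp
  have key: "w x * (integral {a..b'} (%y. \<bar>u1 y\<bar> powr p)) <= K * Lp_int M p u1"
    if ab: "{a..b'} \<subseteq> I" and ww: "!!y. y \<in> {a..b'} ==> w x <= K * w y" for x a b' proof -
    have c1: "continuous_on {a..b'} (%y. \<bar>u1 y\<bar> powr p)"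
      using continuous_on_subset[OF u1 ab] p by (intro continuous_on_powr' continuous_intros) auto
    have c2: "continuous_on {a..b'} (%y. K * (w y * \<bar>u1 y\<bar> powr p))"
      by (intro continuous_on_mult continuous_on_const continuous_on_subset[OF continuous_w ab] c1)
    have si': "set_integrable lborel {a..b'} (%y. w y * \<bar>u1 y\<bar> powr p)"
      by (rule set_integrable_subset[OF si _ ab]) simp
    have "w x * integral {a..b'} (%y. \<bar>u1 y\<bar> powr p) = integral {a..b'} (%y. w x * \<bar>u1 y\<bar> powr p)" by simp
    also have "... <= integral {a..b'} (%y. K * (w y * \<bar>u1 y\<bar> powr p))" proof (rule integral_le)
      show "(%y. w x * \<bar>u1 y\<bar> powr p) integrable_on {a..b'}"
        by (intro integrable_continuous_real continuous_intros c1)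
      show "(%y. K * (w y * \<bar>u1 y\<bar> powr p)) integrable_on {a..b'}"
        by (rule integrable_continuous_real[OF c2])
      show "w x * \<bar>u1 y\<bar> powr p <= K * (w y * \<bar>u1 y\<bar> powr p)" if "y \<in> {a..b'}" for y
        using mult_right_mono[OF ww[OF that], of "\<bar>u1 y\<bar> powr p"] by (simp add: mult.assoc)
    qed
    also have "... = K * integral {a..b'} (%y. w y * \<bar>u1 y\<bar> powr p)" by simp
    also have "integral {a..b'} (%y. w y * \<bar>u1 y\<bar> powr p) = (LINT y:{a..b'}|lborel. w y * \<bar>u1 y\<bar> powr p)"
      by (rule set_borel_integral_eq_integral(2)[OF si', symmetric])
    also have "(LINT y:{a..b'}|lborel. w y * \<bar>u1 y\<bar> powr p) <= Lp_int M p u1"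
      unfolding Lu1 set_lebesgue_integral_def proof (rule integral_mono)
      show "indicat_real {a..b'} y *\<^sub>R (w y * \<bar>u1 y\<bar> powr p) <= indicat_real I y *\<^sub>R (w y * \<bar>u1 y\<bar> powr p)" for y
        using ab w_pos[of y] by (auto simp: indicator_def)
    qed (use si si' in \<open>auto simp: set_integrable_def\<close>)
    finally show ?thesis using K_ge_1 by (simp add: mult_left_mono)
  qed
  have pt: "w x * \<bar>u x\<bar> powr p <= 2 powr p * (K * Lp_int M p u1)" if x: "x \<in> I" for x proof -
    have "\<exists>a b'. {a..b'} \<subseteq> I & a <= b' & \<bar>u x\<bar> = \<bar>u b' - u a\<bar> & (\<forall>y\<in>{a..b'}. w x <= K * w y)"
    proof (cases "x <= 1/2")
      case True
      thus ?thesis using x z w_left[of x] by (intro exI[of _ x] exI[of _ "1/2"]) (auto simp: u_def)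
    next
      case False
      thus ?thesis using x z w_right[of _ x] by (intro exI[of _ "1/2"] exI[of _ x]) (auto simp: u_def)
    qed
    then obtain a b' where ab: "{a..b'} \<subseteq> I" "a <= b'" "\<bar>u x\<bar> = \<bar>u b' - u a\<bar>" "!!y. y \<in> {a..b'} ==> w x <= K * w y"
      by blast
    have "a \<in> I" "b' \<in> I" using ab by auto
    hence "b' - a <= 1" by auto
    hence "\<bar>u x\<bar> powr p <= 2 powr p * integral {a..b'} (%x. \<bar>u1 x\<bar> powr p)"
      unfolding ab(3) using ab p by (intro increment_bound u continuous_on_subset[OF u1]) auto
    hence "w x * \<bar>u x\<bar> powr p <= w x * (2 powr p * integral {a..b'} (%x. \<bar>u1 x\<bar> powr p))"
      using w_pos[OF x] by (intro mult_left_mono) auto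
    also have "... = 2 powr p * (w x * integral {a..b'} (%x. \<bar>u1 x\<bar> powr p))" by simp
    also have "... <= 2 powr p * (K * Lp_int M p u1)" by (intro mult_left_mono key ab) auto
    finally show ?thesis .
  qed
  note Lu = Lp_spaceD[OF Lp_fs(1)[OF p0], of N c, folded u_def]
  have "Lp_int M p u = (LINT x:I|lborel. w x * \<bar>u x\<bar> powr p)"
    using integral_M(1)[OF borel_measurable_integrable[OF Lu(2)]] by simp
  also have "... <= (LINT x:I|lborel. 2 powr p * (K * Lp_int M p u1))" proof (rule set_integral_mono)
    show "set_integrable lborel I (%x. w x * \<bar>u x\<bar> powr p)"
      using integral_M(2)[OF borel_measurable_integrable[OF Lu(2)]] Lu(2) by simp
    show "set_integrable lborel I (%x. 2 powr p * (K * Lp_int M p u1))"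
      unfolding set_integrable_def by (intro integrable_scaleR_left) simp
  qed (rule pt)
  also have "... = 2 powr p * (K * Lp_int M p u1)" by (simp add: set_lebesgue_integral_def)
  finally show ?thesis by (simp add: u_def u1_def mult.assoc)
qed

end

section \<open>Weak derivatives and potentials in L^p\<close>

context sturm
begin

lemma w_lower: assumes "0 < u" "v < 1" shows "\<exists>m>0. \<forall>x\<in>{u..v}. m <= w x"
proof (cases "u <= v")
  case True
  hence "continuous_on {u..v} w" using assms by (intro continuous_on_subset[OF continuous_w]) auto
  then obtain x where x: "x \<in> {u..v}" "\<forall>y\<in>{u..v}. w x <= w y"
    using continuous_attains_inf[of "{u..v}" w] True by auto
  thus ?thesis using w_pos[of x] assms by (intro exI[of _ "w x"]) auto
qed (auto intro: exI[of _ 1])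

lemma Lp_integrable: assumes "f \<in> Lp_space M p" "1 < p" shows "integrable M f"
proof (rule Bochner_Integration.integrable_bound)
  show "integrable M (%x. 1 + norm (f x) powr p)"
    by (intro Bochner_Integration.integrable_add integrable_const Lp_spaceD(2)[OF assms(1)])
  show "f \<in> borel_measurable M" by (rule Lp_spaceD(1)[OF assms(1)])
  show "AE x in M. norm (f x) <= norm (1 + norm (f x) powr p)"
    using le_delta_powr[of "norm (f x)" 1 p for x] assms(2) by (intro AE_I2) simp
qed

lemma Lp_locally_integrable:
  fixes f :: "real => real"
  assumes f: "f \<in> Lp_space M p" and p: "1 < p"
  shows "locally_integrable f"
  unfolding locally_integrable_def proof (intro allI impI)
  fix u v :: real assume uv: "0 < u & v < 1"
  obtain m where m: "0 < m" "!!x. x \<in> {u..v} ==> m <= w x" using w_lower uv by blast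
  have sub: "{u..v} \<subseteq> I" using uv by auto
  have fi: "integrable M f" by (rule Lp_integrable[OF assms])
  have "set_integrable lborel I (%x. w x * f x)"
    using integral_M(2)[OF borel_measurable_integrable[OF fi]] fi by simp
  hence 1: "set_integrable lborel {u..v} (%x. w x * f x)" by (rule set_integrable_subset) (use sub in auto)
  have "(%x. indicator I x *\<^sub>R f x) \<in> borel_measurable borel"
    using Lp_spaceD(1)[OF f] unfolding measurable_M_iff by (simp add: borel_measurable_restrict_space_iff)
  hence "(%x. indicator {u..v} x *\<^sub>R (indicator I x *\<^sub>R f x)) \<in> borel_measurable borel" by measurable
  also have "(%x. indicator {u..v} x *\<^sub>R (indicator I x *\<^sub>R f x)) = (%x. indicator {u..v} x *\<^sub>R f x)"
    using sub by (auto simp: indicator_def fun_eq_iff)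
  finally have meas: "(%x. indicator {u..v} x *\<^sub>R f x) \<in> borel_measurable borel" .
  show "set_integrable lborel {u..v} f" unfolding set_integrable_def
  proof (rule Bochner_Integration.integrable_bound)
    show "integrable lborel (%x. 1 / m * (indicator {u..v} x *\<^sub>R (w x * f x)))"
      using 1 unfolding set_integrable_def by (rule integrable_mult_right)
    show "(%x. indicator {u..v} x *\<^sub>R f x) \<in> borel_measurable lborel" using meas by simp
    have "\<bar>f x\<bar> <= \<bar>1 / m * (w x * f x)\<bar>" if "x \<in> {u..v}" for x proof -
      have "m * \<bar>f x\<bar> <= w x * \<bar>f x\<bar>" using m(2)[OF that] by (intro mult_right_mono) auto
      thus ?thesis using m(1) m(2)[OF that] by (simp add: abs_mult field_simps)
    qed
    thus "AE x in lborel. norm (indicator {u..v} x *\<^sub>R f x) <= norm (1 / m * (indicator {u..v} x *\<^sub>R (w x * f x)))"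
      by (auto simp: indicator_def)
  qed
qed

lemma bm_test_div: assumes psi: "test_function psi" shows "bm (%x. psi x / w x)"
proof -
  obtain u v where uv: "0 < u" "u < v" "v < 1" "!!x. x \<notin> {u..v} ==> psi x = 0"
    using test_functionE[OF psi] by blast
  obtain m where m: "0 < m" "!!x. x \<in> {u..v} ==> m <= w x" using w_lower uv by blast
  obtain C where C: "0 < C" "!!x. \<bar>psi x\<bar> <= C" using test_function_bounded[OF psi] by blast
  show ?thesis proof (rule bmI)
    have "w x ~= 0" if "x \<in> I" for x using w_pos[OF that] by simp
    thus "(%x. psi x / w x) \<in> borel_measurable M"
      by (intro measurable_M_continuous continuous_on_divide test_function_cont psi continuous_w) blast
    show "\<bar>psi x / w x\<bar> <= C / m" if "x \<in> I" for x proof (cases "x \<in> {u..v}")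
      case True
      thus ?thesis using m(1) m(2)[OF True] C(2)[of x] C(1) unfolding abs_divide by (intro frac_le) auto
    qed (use uv(4)[of x] C m in simp)
  qed
qed

text \<open>Weak derivatives are defined by Lebesgue measure, convergence by \<open>M\<close>. The
  quotient \<open>psi / w\<close> is bounded, \<open>psi\<close> having compact support in (0,1), so
  this form of the pairing passes to limits in L^p of \<open>M\<close>.\<close>

lemma test_pairing:
  fixes f :: "real => real"
  assumes f: "f \<in> borel_measurable M"
  shows "test_function psi ==> (LINT x:I|lborel. psi x *\<^sub>R f x) = (LINT x|M. f x * (psi x / w x))"
proof -
  assume psi: "test_function psi"
  have "(LINT x|M. f x * (psi x / w x)) = (LINT x:I|lborel. w x * (f x * (psi x / w x)))"
    by (intro integral_M borel_measurable_times f bm_meas[OF bm_test_div[OF psi]])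
  also have "... = (LINT x:I|lborel. psi x *\<^sub>R f x)" proof (rule set_lebesgue_integral_cong)
    have "w x * (f x * (psi x / w x)) = psi x *\<^sub>R f x" if "x \<in> I" for x using w_pos[OF that] by simp
    thus "\<forall>x. x \<in> I --> w x * (f x * (psi x / w x)) = psi x *\<^sub>R f x" by blast
  qed simp
  finally show ?thesis by simp
qed

lemma weak_deriv_limit:
  assumes u: "!!k. u k \<in> Lp_space M p" and f: "f \<in> Lp_space M p"
    and v: "!!k. v k \<in> Lp_space M p" and g: "g \<in> Lp_space M p" and p: "1 < p"
    and lim: "Lp_lim M p u f" "Lp_lim M p v g"
    and wd: "!!k. has_weak_deriv (u k) (v k)"
  shows "has_weak_deriv f (g :: real => real)"
  unfolding has_weak_deriv_def proof (intro conjI allI impI)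
  show "locally_integrable f" "locally_integrable g" using f g p by (auto intro: Lp_locally_integrable)
  fix psi assume psi: "test_function psi"
  define q where "q = p / (p - 1)"
  have q: "1 < q" "1 / p + 1 / q = 1" using p by (auto simp: q_def field_simps)
  have conv: "(%k. LINT x:I|lborel. theta x *\<^sub>R h k x) ----> (LINT x:I|lborel. theta x *\<^sub>R h0 x)"
    if "!!k. h k \<in> Lp_space M p" "h0 \<in> Lp_space M p" "Lp_lim M p h h0"
      "test_function theta" for h and h0 :: "real => real" and theta proof -
    have q0: "0 < q" using q by simp
    show ?thesis
      unfolding test_pairing[OF Lp_spaceD(1)[OF that(1)] that(4)] test_pairing[OF Lp_spaceD(1)[OF that(2)] that(4)]
      by (rule Lp_pairing_tendsto[OF that(1,2) Lp_bm[OF q0 bm_test_div[OF that(4)]] p q that(3)])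
  qed
  have 1: "(%k. LINT x:I|lborel. deriv psi x *\<^sub>R u k x) ----> (LINT x:I|lborel. deriv psi x *\<^sub>R f x)"
    by (rule conv[OF u f lim(1) test_function_derivI[OF psi]])
  have "(%k. - (LINT x:I|lborel. psi x *\<^sub>R v k x)) ----> - (LINT x:I|lborel. psi x *\<^sub>R g x)"
    by (rule tendsto_minus[OF conv[OF v g lim(2) psi]])
  moreover have "(LINT x:I|lborel. deriv psi x *\<^sub>R u k x) = - (LINT x:I|lborel. psi x *\<^sub>R v k x)" for k
    using wd[of k] psi unfolding has_weak_deriv_def by blast
  ultimately show "(LINT x:I|lborel. deriv psi x *\<^sub>R f x) = - (LINT x:I|lborel. psi x *\<^sub>R g x)"
    using 1 LIMSEQ_unique by simp
qed

lemma classical_weak_deriv: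
  assumes u: "!!x. x \<in> I ==> DERIV u x :> u1 x" and b: "bm u" "bm u1"
  shows "has_weak_deriv u u1"
  unfolding has_weak_deriv_def proof (intro conjI allI impI)
  have L2: "u \<in> Lp_space M 2" "u1 \<in> Lp_space M 2" using b by (auto intro: Lp_bm)
  thus "locally_integrable u" "locally_integrable u1" by (auto intro: Lp_locally_integrable)
  fix psi assume psi: "test_function psi"
  obtain l r where lr: "0 < l" "l < r" "r < 1" "!!x. x \<notin> {l..r} ==> psi x = 0"
    using test_functionE[OF psi] by blast
  note dpsi = test_function_derivI[OF psi]
  define D where "D x = u x * (deriv psi x / w x) + u1 x * (psi x / w x)" for x
  have bD: "bm D" unfolding D_def by (intro bm_add bm_mult b bm_test_div psi dpsi)
  obtain C where C: "0 < C" "!!x. x \<in> I ==> \<bar>D x\<bar> <= C" using bmE[OF bD] by blast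
  have ev: "\<forall>\<^sub>F x in at_right 0. psi x * u x = 0" "\<forall>\<^sub>F x in at_left 1. psi x * u x = 0"
    using lr by (auto simp: eventually_at_right[of 0 1] intro!: exI[of _ l])
      (use lr in \<open>auto simp: eventually_at_left[of 0 1] intro!: exI[of _ r]\<close>)
  have "(LINT x|M. D x) = 0" proof (rule flux_eq[where A = "%x. psi x * u x" and C = C])
    show "DERIV (%x. psi x * u x) x :> w x * D x" if "x \<in> I" for x using w_pos[OF that]
      by (auto intro!: derivative_eq_intros u that test_function_deriv[OF psi] simp: D_def field_simps)
    show "((%x. psi x * u x) ---> 0) (at_right 0)" "((%x. psi x * u x) ---> 0) (at_left 1)"
      using tendsto_eventually ev by fast+
  qed (use bm_meas[OF bD] C in auto)
  moreover have "(LINT x|M. D x) = (LINT x:I|lborel. deriv psi x *\<^sub>R u x) + (LINT x:I|lborel. psi x *\<^sub>R u1 x)"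
    unfolding D_def test_pairing[OF bm_meas[OF b(1)] dpsi] test_pairing[OF bm_meas[OF b(2)] psi]
    by (intro Bochner_Integration.integral_add bm_integrable bm_mult b bm_test_div psi dpsi)
  ultimately show "(LINT x:I|lborel. deriv psi x *\<^sub>R u x) = - (LINT x:I|lborel. psi x *\<^sub>R u1 x)" by simp
qed

lemma has_weak_deriv_cong:
  fixes f g :: "real => real"
  assumes fg: "has_weak_deriv f g" and p: "1 < p" and f': "f' \<in> Lp_space M p" and g': "g' \<in> Lp_space M p"
    and eq: "AE x in M. f x = f' x" "AE x in M. g x = g' x" and m: "f \<in> borel_measurable M" "g \<in> borel_measurable M"
  shows "has_weak_deriv f' g'"
  unfolding has_weak_deriv_def proof (intro conjI allI impI)
  show "locally_integrable f'" "locally_integrable g'" using f' g' p by (auto intro: Lp_locally_integrable)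
  fix psi assume psi: "test_function psi"
  have *: "(LINT x:I|lborel. theta x *\<^sub>R h x) = (LINT x:I|lborel. theta x *\<^sub>R h' x)"
    if "test_function theta" "AE x in M. h x = h' x" "h \<in> borel_measurable M" "h' \<in> borel_measurable M" for theta and h h' :: "real => real"
    unfolding test_pairing[OF that(3,1)] test_pairing[OF that(4,1)] using that(2)
    by (intro integral_cong_AE borel_measurable_times that bm_meas[OF bm_test_div[OF that(1)]]) auto
  show "(LINT x:I|lborel. deriv psi x *\<^sub>R f' x) = - (LINT x:I|lborel. psi x *\<^sub>R g' x)"
    using fg psi *[OF test_function_derivI[OF psi] eq(1) m(1) Lp_spaceD(1)[OF f']] *[OF psi eq(2) m(2) Lp_spaceD(1)[OF g']]
    unfolding has_weak_deriv_def by simp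
qed

lemma fs_weak_deriv: "has_weak_deriv (fs e N c) (fs e1 N c)"
  by (rule classical_weak_deriv) (auto intro!: fs_deriv e_deriv bm_fs_e)

text \<open>On finite sums the derivative of the potential has the coefficients
  \<open>c n / lam n\<close> in \<open>e1\<close>, so \<open>riesz_bound\<close> applies;
  \<open>Lp_transfer\<close> extends it and \<open>weak_deriv_limit\<close> identifies the
  limit.\<close>

theorem Io_weak_deriv:
  assumes p: "1 < p"
  shows "\<exists>C>0. \<forall>g\<in>Lp_space M p. \<exists>d\<in>Lp_space M p. has_weak_deriv (Io g) d & Lp_int M p d <= C * Lp_int M p g"
proof -
  obtain C where C: "0 < C" "!!N c. Lp_int M p (fs e1 N (%n. c n / lam n)) <= C * Lp_int M p (fs e N c)"
    using riesz_bound[OF p] by blast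
  have p0: "0 < p" using p by simp
  have "\<exists>d\<in>Lp_space M p. has_weak_deriv (Io g) d & Lp_int M p d <= (2 powr p * (C * 2 powr p)) * Lp_int M p g"
    if g: "g \<in> Lp_space M p" for g proof -
    obtain N c where lim: "Lp_lim M p (%k. fs e (N k) (c k)) g"
      using span_sequence[OF span_dense_e[OF p0 g]] by blast
    define u v y where "u k = fs e (N k) (c k)" and "v k = fs e1 (N k) (%n. c k n / lam n)"
      and "y k = fs e (N k) (%n. c k n / lam n)" for k
    have L: "u k \<in> Lp_space M p" "v k \<in> Lp_space M p" "y k \<in> Lp_space M p" for k
      unfolding u_def v_def y_def by (rule Lp_fs[OF p0])+
    have lim: "Lp_lim M p u g" using lim by (simp only: u_def)
    have diff: "Lp_int M p (%x. v m x - v n x) <= C * Lp_int M p (%x. u m x - u n x)" for m n proof -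
      define l where "l = max (N m) (N n)"
      define a where "a i = (if i < N m then c m i else 0) - (if i < N n then c n i else 0)" for i
      have "(%i. (if i < N m then c m i / lam i else 0) - (if i < N n then c n i / lam i else 0)) = (%i. a i / lam i)"
        by (auto simp: a_def diff_divide_distrib)
      hence "v m x - v n x = fs e1 l (%i. a i / lam i) x" for x
        unfolding v_def by (subst fs_add[where L = l]) (simp_all add: l_def)
      moreover have "u m x - u n x = fs e l a x" for x
        unfolding u_def by (subst fs_add[where L = l]) (simp_all add: l_def a_def[abs_def])
      ultimately show ?thesis using C(2)[where N = l and c = a] by (simp only:)
    qed
    obtain d where d: "d \<in> Lp_space M p" "Lp_lim M p v d"
      "Lp_int M p d <= (2 powr p * (C * 2 powr p)) * Lp_int M p g"
      using Lp_transfer[OF L(1) g L(2) p0 less_imp_le[OF C(1)] lim diff] C(2) unfolding u_def v_def by blast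
    have "Lp_int M p (%x. y k x - Io g x) = Lp_int M p (%x. Io (u k) x - Io g x)" for k
      unfolding y_def u_def by (rule Lp_int_cong) (simp add: Io_fs)
    hence "Lp_lim M p y (Io g)" using Io_tendsto[OF L(1) g p lim] by (simp only:)
    hence "has_weak_deriv (Io g) d"
      using fs_weak_deriv by (intro weak_deriv_limit[OF L(3) Io_Lp(1)[OF g p] L(2) d(1) p _ d(2)])
        (auto simp: y_def v_def)
    with d show ?thesis by blast
  qed
  moreover have "0 < 2 powr p * (C * 2 powr p)" using C(1) by simp
  ultimately show ?thesis by blast
qed

lemma e1_0: assumes "x \<in> I" shows "e1 0 x = 0"
proof -
  have "DERIV (%_. 1) x :> e1 0 x"
    by (rule DERIV_transform_open[OF e_deriv[OF assms, of 0], of I]) (use assms e_0 in auto)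
  thus ?thesis using DERIV_unique[OF _ DERIV_const] by blast
qed

lemma fs_upd: "fs Z (Suc N) (c(0 := c 0 - t)) x = fs Z (Suc N) c x - t * Z 0 x"
  unfolding fs_def sum.lessThan_Suc_shift by (simp add: algebra_simps)

text \<open>The derivative does not see the coefficient of \<open>e 0 = 1\<close>, which is
  therefore free to make the sum vanish at 1/2, as \<open>poincare\<close> requires.\<close>

lemma span_sequence_normalized:
  assumes p: "1 < p" and g: "g \<in> Lp_space M p"
  shows "\<exists>N c. (\<forall>k. fs e (N k) (c k) (1/2) = 0) & Lp_lim M p (%k. fs e1 (N k) (c k)) g"
proof -
  have p0: "0 < p" using p by simp
  obtain N c where lim: "Lp_lim M p (%k. fs e1 (N k) (c k)) g"
    using span_sequence[OF span_dense_e1[OF p0 g]] by blast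
  \<comment> \<open>\<open>N k\<close> may be 0; the padded sum of length \<open>Suc (N k)\<close>
    always contains the index 0.\<close>
  define c0 where "c0 k n = (if n < N k then c k n else 0)" for k n
  define t where "t k = fs e (Suc (N k)) (c0 k) (1/2)" for k
  define c' where "c' k = (c0 k)(0 := c0 k 0 - t k)" for k
  have e0: "e 0 (1/2) = 1" by (rule e_0) simp
  have "fs e (Suc (N k)) (c' k) (1/2) = 0" for k unfolding c'_def fs_upd by (simp add: e0 t_def)
  moreover have "fs e1 (Suc (N k)) (c' k) x = fs e1 (N k) (c k) x" if "x \<in> I" for k x proof -
    have "fs e1 (N k) (c k) = fs e1 (Suc (N k)) (c0 k)" using fs_ext[of "N k" "Suc (N k)"] by (simp add: c0_def[abs_def])
    thus ?thesis unfolding c'_def fs_upd e1_0[OF that] by simp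
  qed
  hence "Lp_int M p (%x. fs e1 (Suc (N k)) (c' k) x - g x) = Lp_int M p (%x. fs e1 (N k) (c k) x - g x)" for k
    by (intro Lp_int_cong) simp
  hence "Lp_lim M p (%k. fs e1 (Suc (N k)) (c' k)) g" using lim by (simp only:)
  ultimately show ?thesis by (intro exI[of _ "%k. Suc (N k)"] exI[of _ c']) simp
qed

lemma Io_const: "x \<in> I ==> Io (%_. s) x = s / lam 0"
  using pk_mass[of x] by (simp add: Io_def)

text \<open>For finite sums vanishing at 1/2, \<open>poincare\<close> removes the function itself
  from the right side of \<open>reverse_riesz\<close>. So the sum with coefficients
  \<open>lam n * c n\<close>, whose potential is the given sum, is controlled by the derivative
  alone.\<close>

lemma weak_deriv_primitive:
  assumes p: "1 < p"
  shows "\<exists>C\<ge>0. \<forall>g\<in>Lp_space M p. \<exists>h\<in>Lp_space M p. has_weak_deriv (Io h) g & Lp_int M p h <= C * Lp_int M p g"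
proof -
  have p0: "0 < p" using p by simp
  obtain C1 where C1: "0 < C1"
    "!!N c. Lp_int M p (fs e N (%n. lam n * c n)) <= C1 * (Lp_int M p (fs e N c) + Lp_int M p (fs e1 N c))"
    using reverse_riesz[OF p] by blast
  define C2 where "C2 = 2 powr p * K"
  define C where "C = C1 * (C2 + 1)"
  have C2: "0 <= C2" using K_ge_1 by (simp add: C2_def)
  have C: "0 <= C" using C1(1) C2 by (simp add: C_def)
  have key: "Lp_int M p (fs e N (%n. lam n * c n)) <= C * Lp_int M p (fs e1 N c)" if "fs e N c (1/2) = 0" for N c
  proof -
    have "Lp_int M p (fs e N c) + Lp_int M p (fs e1 N c) <= (C2 + 1) * Lp_int M p (fs e1 N c)"
      using poincare[OF p that] unfolding C2_def distrib_right by simp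
    hence "C1 * (Lp_int M p (fs e N c) + Lp_int M p (fs e1 N c)) <= C1 * ((C2 + 1) * Lp_int M p (fs e1 N c))"
      using C1(1) by (intro mult_left_mono) auto
    thus ?thesis using C1(2)[of N c] unfolding C_def by (simp only: mult.assoc)
  qed
  have "\<exists>h\<in>Lp_space M p. has_weak_deriv (Io h) g & Lp_int M p h <= (2 powr p * (C * 2 powr p)) * Lp_int M p g"
    if g: "g \<in> Lp_space M p" for g proof -
    obtain N c where z: "!!k. fs e (N k) (c k) (1/2) = 0"
      and lim: "Lp_lim M p (%k. fs e1 (N k) (c k)) g"
      using span_sequence_normalized[OF p g] by blast
    define u v y where "u k = fs e (N k) (c k)" and "v k = fs e1 (N k) (c k)"
      and "y k = fs e (N k) (%n. lam n * c k n)" for k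
    have L: "u k \<in> Lp_space M p" "v k \<in> Lp_space M p" "y k \<in> Lp_space M p" for k
      unfolding u_def v_def y_def by (rule Lp_fs[OF p0])+
    have lim: "Lp_lim M p v g" using lim by (simp only: v_def)
    have diff: "Lp_int M p (%x. y m x - y n x) <= C * Lp_int M p (%x. v m x - v n x)" for m n proof -
      define l where "l = max (N m) (N n)"
      define a where "a i = (if i < N m then c m i else 0) - (if i < N n then c n i else 0)" for i
      have "(%i. (if i < N m then lam i * c m i else 0) - (if i < N n then lam i * c n i else 0)) = (%i. lam i * a i)"
        by (auto simp: a_def right_diff_distrib)
      hence "y m x - y n x = fs e l (%i. lam i * a i) x" for x
        unfolding y_def by (subst fs_add[where L = l]) (simp_all add: l_def)
      moreover have "v m x - v n x = fs e1 l a x" for x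
        unfolding v_def by (subst fs_add[where L = l]) (simp_all add: l_def a_def[abs_def])
      moreover have "fs e l a (1/2) = fs e (N m) (c m) (1/2) - fs e (N n) (c n) (1/2)"
        by (subst fs_add[where L = l]) (simp_all add: l_def a_def[abs_def])
      ultimately show ?thesis using key[where N = l and c = a] z by simp
    qed
    have bound: "Lp_int M p (y k) <= C * Lp_int M p (v k)" for k unfolding y_def v_def by (rule key[OF z])
    obtain h where h: "h \<in> Lp_space M p" "Lp_lim M p y h"
      "Lp_int M p h <= (2 powr p * (C * 2 powr p)) * Lp_int M p g"
      using Lp_transfer[OF L(2) g L(3) p0 C lim diff bound] by blast
    have "Io (y k) x = u k x" if "x \<in> I" for k x proof -
      have "lam n * c k n / lam n = c k n" for n using lam_pos[of n] by simp
      thus ?thesis unfolding y_def u_def Io_fs[OF that] by simp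
    qed
    hence "Lp_int M p (%x. u k x - Io h x) = Lp_int M p (%x. Io (y k) x - Io h x)" for k
      by (intro Lp_int_cong) simp
    hence "Lp_lim M p u (Io h)" using Io_tendsto[OF L(3) h(1) p h(2)] by (simp only:)
    hence "has_weak_deriv (Io h) g"
      using fs_weak_deriv by (intro weak_deriv_limit[OF L(1) Io_Lp(1)[OF h(1) p] L(2) g p _ lim])
        (auto simp: u_def v_def)
    with h show ?thesis by blast
  qed
  moreover have "0 <= 2 powr p * (C * 2 powr p)" using C by simp
  ultimately show ?thesis by blast
qed

text \<open>Subtract from \<open>f\<close> the potential supplied by
  \<open>weak_deriv_primitive\<close> for the derivative \<open>g\<close>: what is left has weak
  derivative 0, so it is a constant \<open>s\<close>, and \<open>s\<close> is the potential of
  \<open>lam 0 * s\<close>.\<close>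

theorem weak_deriv_Io:
  assumes p: "1 < p"
  shows "\<exists>C>0. \<forall>f\<in>Lp_space M p. \<forall>g\<in>Lp_space M p. has_weak_deriv f g -->
    (\<exists>h\<in>Lp_space M p. (AE x in M. f x = Io h x) & Lp_int M p h <= C * (Lp_int M p f + Lp_int M p g))"
proof -
  have p0: "0 < p" using p by simp
  obtain C4 where C4: "0 <= C4" "!!g. g \<in> Lp_space M p ==>
      \<exists>h\<in>Lp_space M p. has_weak_deriv (Io h) g & Lp_int M p h <= C4 * Lp_int M p g"
    using weak_deriv_primitive[OF p] by blast
  define C3 where "C3 = (1 / lam 0 + 1) powr p / lam 0"
  have C3: "0 <= C3" using lam_pos[of 0] by (simp add: C3_def)
  define a where "a = lam 0 powr p * 2 powr p"
  have a: "0 < a" using lam_pos[of 0] by (simp add: a_def)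
  define C where "C = 2 powr p * (C4 + a * (1 + C3 * C4))"
  have "0 < 1 + C3 * C4" using C3 C4(1) by (simp add: add_pos_nonneg)
  hence "0 < a * (1 + C3 * C4)" by (rule mult_pos_pos[OF a])
  with C4(1) have "0 < C4 + a * (1 + C3 * C4)" by (rule add_nonneg_pos)
  hence C: "0 < C" unfolding C_def by (rule mult_pos_pos[rotated]) simp
  have "\<exists>h\<in>Lp_space M p. (AE x in M. f x = Io h x) & Lp_int M p h <= C * (Lp_int M p f + Lp_int M p g)"
    if f: "f \<in> Lp_space M p" and g: "g \<in> Lp_space M p" and wd: "has_weak_deriv f g" for f g proof -
    obtain h0 where h0: "h0 \<in> Lp_space M p" "has_weak_deriv (Io h0) g" "Lp_int M p h0 <= C4 * Lp_int M p g"
      using C4(2)[OF g] by blast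
    define F where "F x = f x - Io h0 x" for x
    have F: "F \<in> Lp_space M p" unfolding F_def by (intro Lp_diff f Io_Lp h0 p p0)
    have "(LINT x:I|lborel. deriv psi x *\<^sub>R F x) = 0" if psi: "test_function psi" for psi proof -
      have i: "set_integrable lborel I (%x. deriv psi x *\<^sub>R f x)" "set_integrable lborel I (%x. deriv psi x *\<^sub>R Io h0 x)"
        using wd h0(2) locally_integrable_test[OF _ test_function_derivI[OF psi]] unfolding has_weak_deriv_def by blast+
      have "(LINT x:I|lborel. deriv psi x *\<^sub>R F x) =
          (LINT x:I|lborel. deriv psi x *\<^sub>R f x) - (LINT x:I|lborel. deriv psi x *\<^sub>R Io h0 x)"
        unfolding F_def scaleR_diff_right by (rule set_integral_diff(2)[OF i])
      thus ?thesis using wd h0(2) psi unfolding has_weak_deriv_def by simp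
    qed
    then obtain s where s: "AE x in lborel. x \<in> I --> F x = s"
      using AE_const_of_test[OF Lp_locally_integrable[OF F p]] by blast
    have sM: "AE x in M. F x = s" using s by (simp only: AE_M_iff)
    have sL: "(%_. s) \<in> Lp_space M p" "(%_. lam 0 * s) \<in> Lp_space M p" by (intro Lp_bm p0 bm_const)+
    have one: "(%_. 1 :: real) \<in> Lp_space M p" by (intro Lp_bm p0 bm_const)
    define h where "h x = h0 x + lam 0 * s" for x
    have h: "h \<in> Lp_space M p" unfolding h_def by (intro Lp_add(1) h0 p0 sL)
    have "AE x in M. f x = Io h x" using Io_lin[OF h0(1) one p, of 1 "lam 0 * s"] sM AE_space
    proof eventually_elim
      case (elim x)
      hence "Io h x = Io h0 x + lam 0 * s * (1 / lam 0)" by (simp add: h_def[abs_def] space_M Io_const)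
      thus ?case using elim(2) lam_pos[of 0] by (simp add: F_def)
    qed
    moreover have "Lp_int M p h <= C * (Lp_int M p f + Lp_int M p g)" proof -
      have G: "0 <= Lp_int M p f" "0 <= Lp_int M p g" by (rule Lp_int_nonneg)+
      have 1: "Lp_int M p (Io h0) <= C3 * (C4 * Lp_int M p g)"
        unfolding C3_def by (rule order_trans[OF Io_Lp(2)[OF h0(1) p] mult_left_mono[OF h0(3)]]) (use lam_pos[of 0] in simp)
      have "Lp_int M p (%_. s) = Lp_int M p F"
        using sM Lp_spaceD(1)[OF sL(1)] by (intro Lp_cong_AE(2)[OF F]) auto
      also have "... <= 2 powr p * (Lp_int M p f + Lp_int M p (Io h0))"
        unfolding F_def by (intro Lp_diff(2) f Io_Lp h0 p p0)
      also have "... <= 2 powr p * (Lp_int M p f + C3 * (C4 * Lp_int M p g))"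
        using 1 by (intro mult_left_mono add_left_mono) auto
      finally have 2: "Lp_int M p (%_. s) <= 2 powr p * (Lp_int M p f + C3 * (C4 * Lp_int M p g))" .
      have 3: "Lp_int M p (%_. lam 0 * s) = lam 0 powr p * Lp_int M p (%_. s)"
        using Lp_scale(2)[OF sL(1), of "lam 0"] lam_pos[of 0] by simp
      have "Lp_int M p h <= 2 powr p * (Lp_int M p h0 + Lp_int M p (%_. lam 0 * s))"
        unfolding h_def by (intro Lp_add(2) h0 p0 sL)
      also have "... <= 2 powr p * (C4 * Lp_int M p g + lam 0 powr p * (2 powr p * (Lp_int M p f + C3 * (C4 * Lp_int M p g))))"
        unfolding 3 by (intro mult_left_mono add_mono h0 2) auto
      also have "... = 2 powr p * (C4 * Lp_int M p g + a * Lp_int M p f + a * (C3 * C4) * Lp_int M p g)"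
        by (simp only: a_def algebra_simps)
      also have "... <= 2 powr p * ((C4 + a * (1 + C3 * C4)) * (Lp_int M p f + Lp_int M p g))"
      proof (rule mult_left_mono)
        have "0 <= C4 * Lp_int M p f" "0 <= a * (C3 * C4) * Lp_int M p f" "0 <= a * Lp_int M p g"
          using C4(1) a C3 G by (intro mult_nonneg_nonneg; simp)+
        thus "C4 * Lp_int M p g + a * Lp_int M p f + a * (C3 * C4) * Lp_int M p g
            <= (C4 + a * (1 + C3 * C4)) * (Lp_int M p f + Lp_int M p g)" by (simp add: algebra_simps)
      qed simp
      finally show ?thesis by (simp only: C_def mult.assoc)
    qed
    ultimately show ?thesis using h by blast
  qed
  thus ?thesis using C by blast
qed

end

section \<open>Bessel functions\<close>

locale bessel =
  fixes \<nu> :: real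
  assumes nu: "-1/2 <= \<nu>"
begin

text \<open>The exponent in the weight and the coefficient of the damping term
  \<open>alpha / x\<close> in the Bessel equation. It is nonnegative exactly for
  \<open>\<nu> >= -1/2\<close>, and its sign drives the monotonicity arguments below.\<close>

definition alpha where "alpha = 2 * \<nu> + 1"

lemma alpha_nonneg: "0 <= alpha" using nu by (simp add: alpha_def)

definition ja :: "nat => real" where
  "ja m = (-1) ^ m / (fact m * Gamma (real m + \<nu> + 1) * 4 ^ m)"

lemma Gamma_pos: "0 < Gamma (real m + \<nu> + 1)" using nu by (intro Gamma_real_pos) simp

text \<open>The functional equation of Gamma as a two-term recursion. It gives the convergence of
  the series and, compared coefficientwise, the differential equation.\<close>

lemma ja_Suc: "4 * (real m + 1) * (real m + \<nu> + 1) * ja (Suc m) = - ja m"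
proof -
  define c s G where "c = real m + \<nu> + 1" and "s = real m + 1" and "G = Gamma (real m + \<nu> + 1)"
  have c: "0 < c" "0 < s" "0 < G" using nu Gamma_pos[of m] by (auto simp: c_def s_def G_def)
  have "c \<notin> nonpos_Ints" using c(1) by (auto elim!: nonpos_Ints_cases)
  hence "Gamma (real (Suc m) + \<nu> + 1) = c * G" using Gamma_plus1[of c] by (simp add: c_def G_def add_ac)
  hence "ja (Suc m) = - ((-1) ^ m) / ((s * fact m) * (c * G) * (4 * 4 ^ m))"
    by (simp add: ja_def s_def add.commute)
  moreover have "ja m = (-1) ^ m / (fact m * G * 4 ^ m)" by (simp add: ja_def G_def)
  ultimately show ?thesis using c unfolding c_def[symmetric] s_def[symmetric] by simp
qed

lemma summable_ja: "summable (%m. ja m * y ^ m)" for y :: real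
proof (rule summable_ratio_test)
  define N where "N = nat \<lceil>\<bar>y\<bar>\<rceil> + 1"
  show "norm (ja (Suc m) * y ^ Suc m) <= 1/2 * norm (ja m * y ^ m)" if m: "N <= m" for m proof -
    have ym: "\<bar>y\<bar> <= real m" using m unfolding N_def by linarith
    have s: "1/2 <= real m + \<nu> + 1" using nu by simp
    have "\<bar>ja m\<bar> = 4 * (real m + 1) * (real m + \<nu> + 1) * \<bar>ja (Suc m)\<bar>"
      using arg_cong[OF ja_Suc[of m], of abs] s by (simp add: abs_mult)
    moreover have "2 * \<bar>y\<bar> * \<bar>ja (Suc m)\<bar> <= 4 * (real m + 1) * (real m + \<nu> + 1) * \<bar>ja (Suc m)\<bar>"
    proof (rule mult_right_mono)
      have "2 * \<bar>y\<bar> <= 4 * (real m + 1) * (1/2)" using ym by simp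
      also have "... <= 4 * (real m + 1) * (real m + \<nu> + 1)" using s by (intro mult_left_mono) auto
      finally show "2 * \<bar>y\<bar> <= 4 * (real m + 1) * (real m + \<nu> + 1)" .
    qed simp
    ultimately have "2 * \<bar>y\<bar> * \<bar>ja (Suc m)\<bar> <= \<bar>ja m\<bar>" by simp
    hence "(2 * \<bar>y\<bar> * \<bar>ja (Suc m)\<bar>) * \<bar>y\<bar> ^ m <= \<bar>ja m\<bar> * \<bar>y\<bar> ^ m" by (rule mult_right_mono) simp
    thus ?thesis by (simp add: abs_mult power_abs mult_ac)
  qed
qed simp

definition jg :: "real => real" where "jg y = (\<Sum>m. ja m * y ^ m)"
definition jg1 :: "real => real" where "jg1 y = (\<Sum>m. diffs ja m * y ^ m)"
definition jg2 :: "real => real" where "jg2 y = (\<Sum>m. diffs (diffs ja) m * y ^ m)"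

lemma summable_diffs: "summable (%m. diffs ja m * y ^ m)" "summable (%m. diffs (diffs ja) m * y ^ m)" for y :: real
proof -
  show 1: "summable (%m. diffs ja m * y ^ m)" for y :: real
    by (rule termdiff_converges_all) (rule summable_ja)
  show "summable (%m. diffs (diffs ja) m * y ^ m)" by (rule termdiff_converges_all) (rule 1)
qed

lemma jg_deriv: "DERIV jg y :> jg1 y" "DERIV jg1 y :> jg2 y"
  unfolding jg_def[abs_def] jg1_def[abs_def] jg2_def
  by (rule termdiffs_strong_converges_everywhere, rule summable_ja summable_diffs)+

lemma jg_ode: "4 * y * jg2 y + 4 * (\<nu> + 1) * jg1 y + jg y = 0"
proof -
  have s0: "(%m. ja m * y ^ m) sums jg y" unfolding jg_def by (rule summable_sums[OF summable_ja])
  have s1: "(%m. diffs ja m * y ^ m) sums jg1 y" unfolding jg1_def by (rule summable_sums[OF summable_diffs(1)])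
  have s2: "(%m. diffs (diffs ja) m * y ^ m) sums jg2 y" unfolding jg2_def by (rule summable_sums[OF summable_diffs(2)])
  have "(%m. real m * diffs ja m * y ^ m) sums (y * jg2 y)" proof -
    have "(%m. real (Suc m) * diffs ja (Suc m) * y ^ Suc m) sums (y * jg2 y)"
      using sums_mult[OF s2, of y] by (simp add: diffs_def mult_ac)
    thus ?thesis by (subst (asm) sums_Suc_iff) simp
  qed
  hence "(%m. 4 * (real m * diffs ja m * y ^ m) + 4 * (\<nu> + 1) * (diffs ja m * y ^ m) + ja m * y ^ m)
      sums (4 * (y * jg2 y) + 4 * (\<nu> + 1) * jg1 y + jg y)" by (intro sums_add sums_mult s0 s1)
  moreover have "4 * (real m * diffs ja m * y ^ m) + 4 * (\<nu> + 1) * (diffs ja m * y ^ m) + ja m * y ^ m = 0" for m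
  proof -
    have "4 * (real m * diffs ja m * y ^ m) + 4 * (\<nu> + 1) * (diffs ja m * y ^ m) + ja m * y ^ m
        = (4 * (real m + 1) * (real m + \<nu> + 1) * ja (Suc m) + ja m) * y ^ m"
      by (simp add: diffs_def algebra_simps)
    thus ?thesis unfolding ja_Suc by simp
  qed
  ultimately show ?thesis using sums_unique2[OF sums_zero] by fastforce
qed

text \<open>The Bessel function with its branch factor removed: \<open>J\<^sub>\<nu> x = (x / 2)\<^sup>\<nu> j x\<close>.\<close>

definition j :: "real => real" where "j x = jg (x\<^sup>2)"
definition j1 :: "real => real" where "j1 x = 2 * x * jg1 (x\<^sup>2)"
definition j2 :: "real => real" where "j2 x = 2 * jg1 (x\<^sup>2) + 4 * x\<^sup>2 * jg2 (x\<^sup>2)"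

lemma j_deriv: "DERIV j x :> j1 x" "DERIV j1 x :> j2 x"
proof -
  have sq: "DERIV (%x. x\<^sup>2) x :> 2 * x" for x :: real by (auto intro!: derivative_eq_intros)
  have c: "DERIV (%x. jg (x\<^sup>2)) x :> jg1 (x\<^sup>2) * (2 * x)"
    "DERIV (%x. jg1 (x\<^sup>2)) x :> jg2 (x\<^sup>2) * (2 * x)" for x
    by (rule DERIV_chain2[OF jg_deriv(1) sq]) (rule DERIV_chain2[OF jg_deriv(2) sq])
  show "DERIV j x :> j1 x" using c(1)[of x] by (simp add: j_def[abs_def] j1_def mult.commute)
  have "DERIV (%x. (2 * x) * jg1 (x\<^sup>2)) x :> 2 * jg1 (x\<^sup>2) + jg2 (x\<^sup>2) * (2 * x) * (2 * x)"
    by (rule DERIV_mult[OF _ c(2)]) (auto intro!: derivative_eq_intros)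
  thus "DERIV j1 x :> j2 x" by (simp add: j1_def[abs_def] j2_def power2_eq_square mult_ac)
qed

lemma j_ode: "x ~= 0 ==> j2 x = - (alpha / x) * j1 x - j x"
proof -
  assume "x ~= 0"
  hence "alpha / x * j1 x = 2 * (2 * \<nu> + 1) * jg1 (x\<^sup>2)" by (simp add: j1_def alpha_def)
  thus ?thesis using jg_ode[of "x\<^sup>2"] unfolding j_def j2_def by (simp add: algebra_simps)
qed

lemma continuous_j: "continuous_on A j" "continuous_on A j1" "continuous_on A j2"
proof -
  show "continuous_on A j" "continuous_on A j1" by (rule DERIV_cont_on[OF j_deriv(1)], simp)
     (rule DERIV_cont_on[OF j_deriv(2)], simp)
  have "continuous_on UNIV jg1" by (rule DERIV_continuous_on[OF jg_deriv(2)])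
  hence 1: "continuous_on A (%x. jg1 (x\<^sup>2))"
    by (rule continuous_on_compose2) (auto intro!: continuous_intros)
  have "DERIV jg2 y :> (\<Sum>m. diffs (diffs (diffs ja)) m * y ^ m)" for y unfolding jg2_def[abs_def]
    by (rule termdiffs_strong_converges_everywhere[where c = "diffs (diffs ja)"]) (rule summable_diffs)
  hence "continuous_on UNIV jg2" by (rule DERIV_continuous_on)
  hence "continuous_on A (%x. jg2 (x\<^sup>2))"
    by (rule continuous_on_compose2) (auto intro!: continuous_intros)
  with 1 show "continuous_on A j2"
    unfolding j2_def[abs_def] by (intro continuous_on_add continuous_on_mult continuous_on_power continuous_on_const continuous_on_id)
qed

lemma j_0: "0 < j 0" "j1 0 = 0" "j2 0 < 0"
proof -
  have "jg 0 = ja 0" unfolding jg_def by (rule powser_zero)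
  thus "0 < j 0" using Gamma_pos[of 0] by (simp add: j_def ja_def)
  show "j1 0 = 0" by (simp add: j1_def)
  have "jg1 0 = diffs ja 0" unfolding jg1_def by (rule powser_zero)
  hence "jg1 0 < 0" using Gamma_pos[of 1] by (simp add: diffs_def ja_def add_ac)
  thus "j2 0 < 0" by (simp add: j2_def)
qed

lemma bessel_J_eq: assumes x: "0 < x" shows "bessel_J \<nu> x = (x / 2) powr \<nu> * j x"
proof -
  have "(-1) ^ m / (fact m * Gamma (real m + \<nu> + 1)) * (x / 2) powr (2 * real m + \<nu>) = (x / 2) powr \<nu> * (ja m * (x\<^sup>2) ^ m)" for m
  proof -
    have "(x / 2) powr (2 * real m + \<nu>) = (x / 2) ^ (2 * m) * (x / 2) powr \<nu>"
      using x powr_realpow[of "x / 2" "2 * m"] by (simp add: powr_add)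
    also have "(x / 2) ^ (2 * m) = (x\<^sup>2) ^ m / 4 ^ m" by (simp add: power_mult power_divide)
    finally show ?thesis by (simp add: ja_def)
  qed
  thus ?thesis unfolding bessel_J_def j_def jg_def by (simp add: suminf_mult[OF summable_ja])
qed

text \<open>Termwise form of the rule that x to the power -\<nu> times J of order \<nu> has the
  derivative minus x to the power -\<nu> times J of order \<nu> + 1. It expresses the normalising
  constants through \<open>j1\<close> at the zeros.\<close>

lemma bessel_J_Suc_eq: assumes x: "0 < x" shows "bessel_J (\<nu> + 1) x = - ((x / 2) powr \<nu> * j1 x)"
proof -
  have "(-1) ^ m / (fact m * Gamma (real m + (\<nu> + 1) + 1)) * (x / 2) powr (2 * real m + (\<nu> + 1))
      = (- (2 * x) * (x / 2) powr \<nu>) * (diffs ja m * (x\<^sup>2) ^ m)" for m proof -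
    have "(x / 2) powr (2 * real m + (\<nu> + 1)) = (x / 2) ^ (2 * m + 1) * (x / 2) powr \<nu>" proof -
      have "2 * real m + (\<nu> + 1) = real (2 * m + 1) + \<nu>" by simp
      thus ?thesis using x powr_realpow[of "x / 2" "2 * m + 1"] by (simp only: powr_add)
    qed
    also have "(x / 2) ^ (2 * m + 1) = (x\<^sup>2) ^ m / 4 ^ m * (x / 2)"
      unfolding power_add power_mult by (simp only: power_divide power_one_right) simp
    finally have 1: "(x / 2) powr (2 * real m + (\<nu> + 1)) = (x\<^sup>2) ^ m / 4 ^ m * (x / 2) * (x / 2) powr \<nu>" .
    define G s where "G = Gamma (real m + (\<nu> + 1) + 1)" and "s = 1 + real m"
    have s: "0 < s" by (simp add: s_def)
    have "diffs ja m = s * ((-1) ^ Suc m / ((s * fact m) * G * (4 * 4 ^ m)))"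
      by (simp add: diffs_def ja_def G_def s_def add_ac)
    hence 2: "diffs ja m = - ((-1) ^ m / (fact m * G * (4 * 4 ^ m)))" using s by simp
    show ?thesis unfolding 1 2 G_def[symmetric] by (simp add: mult_ac)
  qed
  hence "bessel_J (\<nu> + 1) x = (- (2 * x) * (x / 2) powr \<nu>) * jg1 (x\<^sup>2)"
    unfolding bessel_J_def jg1_def by (simp only: suminf_mult[OF summable_diffs(1)])
  thus ?thesis by (simp add: j1_def)
qed

end

section \<open>Zeros of the Bessel function\<close>

lemma finite_separated:
  fixes S :: "real set"
  assumes g: "0 < g" and pos: "!!z. z \<in> S ==> 0 < z"
    and gap: "!!y z. y \<in> S ==> z \<in> S ==> y < z ==> g <= z - y"
  shows "finite {y \<in> S. y <= c}"
proof (rule finite_imageD)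
  show "finite ((%y. \<lfloor>y / g\<rfloor>) ` {y \<in> S. y <= c})" proof (rule finite_subset)
    show "(%y. \<lfloor>y / g\<rfloor>) ` {y \<in> S. y <= c} \<subseteq> {0..\<lfloor>c / g\<rfloor>}"
      using pos g by (auto intro!: floor_mono divide_right_mono simp: less_imp_le)
  qed simp
  have "\<lfloor>y / g\<rfloor> < \<lfloor>z / g\<rfloor>" if "y \<in> S" "z \<in> S" "y < z" for y z
  proof -
    have "(y + g) / g <= z / g" using gap[OF that] g by (intro divide_right_mono) auto
    hence "y / g + 1 <= z / g" using g by (simp add: add_divide_distrib)
    thus ?thesis by linarith
  qed
  thus "inj_on (%y. \<lfloor>y / g\<rfloor>) {y \<in> S. y <= c}"
    by (intro inj_onI) (metis (mono_tags, lifting) less_irrefl linorder_neqE mem_Collect_eq)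
qed

text \<open>Existence by passing to the next element, uniqueness because the count grows strictly
  along the set. It makes the definite description in \<open>bessel_zero\<close> meaningful.\<close>

lemma card_enumeration:
  fixes S :: "real set"
  assumes fin: "!!c. finite {y \<in> S. y <= c}" and unb: "!!c. \<exists>z\<in>S. c < z"
  shows "\<exists>!z. z \<in> S & card {y \<in> S. y <= z} = Suc n"
proof (rule ex_ex1I)
  show "\<exists>z. z \<in> S & card {y \<in> S. y <= z} = Suc n" proof (induction n)
    case 0
    obtain s where s: "s \<in> S" using unb[of 0] by blast
    define z where "z = Min {y \<in> S. y <= s}"
    have z: "z \<in> S" "z <= s" using Min_in[OF fin[of s]] s by (auto simp: z_def)
    have "z <= y" if "y \<in> S" "y <= s" for y using that unfolding z_def by (intro Min_le fin) auto
    hence "{y \<in> S. y <= z} = {z}" using z by force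
    thus ?case using z by (intro exI[of _ z]) simp
  next
    case (Suc n)
    then obtain x where x: "x \<in> S" "card {y \<in> S. y <= x} = Suc n" by blast
    obtain s where s: "s \<in> S" "x < s" using unb[of x] by blast
    define T where "T = {y \<in> S. x < y & y <= s}"
    have T: "finite T" "T ~= {}" using finite_subset[OF _ fin[of s], of T] s by (auto simp: T_def)
    define z where "z = Min T"
    have z: "z \<in> S" "x < z" "z <= s" using Min_in[OF T] by (auto simp: z_def T_def)
    have "z <= y" if "y \<in> S" "x < y" "y <= s" for y
      using that unfolding z_def by (intro Min_le T) (auto simp: T_def)
    hence "{y \<in> S. y <= z} = insert z {y \<in> S. y <= x}" using z by force
    hence "card {y \<in> S. y <= z} = Suc (Suc n)" using x(2) fin[of x] z(2) by simp
    thus ?case using z by blast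
  qed
  have less: "card {y \<in> S. y <= a} < card {y \<in> S. y <= b}" if "a < b" "b \<in> S" for a b
    using that by (intro psubset_card_mono fin) force
  fix a b assume "a \<in> S & card {y \<in> S. y <= a} = Suc n" "b \<in> S & card {y \<in> S. y <= b} = Suc n"
  thus "a = b" using less[of a b] less[of b a] by (cases a b rule: linorder_cases) auto
qed

context bessel
begin

text \<open>Energy of an oscillator with damping \<open>alpha / x\<close>. It decreases while
  \<open>x powr (2 * alpha) * En x\<close> increases; the first bounds \<open>j\<close> and
  \<open>j1\<close> above, the second bounds \<open>j1\<close> below at the zeros.\<close>

definition En :: "real => real" where "En x = (j x)\<^sup>2 + (j1 x)\<^sup>2"

lemma En_deriv: "DERIV En x :> 2 * j1 x * (j x + j2 x)"
  unfolding En_def[abs_def] using j_deriv[of x]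
  by (auto intro!: derivative_eq_intros simp: power2_eq_square algebra_simps)

lemma En_antimono: assumes "0 <= x" "x <= y" shows "En y <= En x"
proof (rule DERIV_nonpos_imp_nonincreasing[OF assms(2)])
  fix z assume z: "x <= z" "z <= y"
  have "2 * j1 z * (j z + j2 z) <= 0" proof (cases "z = 0")
    case True thus ?thesis by (simp add: j_0)
  next
    case False
    hence "2 * j1 z * (j z + j2 z) = - (2 * alpha / z * (j1 z)\<^sup>2)" by (simp add: j_ode power2_eq_square)
    also have "... <= 0" using alpha_nonneg z assms by simp
    finally show ?thesis .
  qed
  thus "\<exists>d. (En has_real_derivative d) (at z) & d <= 0" using En_deriv by blast
qed

lemma j_bounds: assumes "0 <= x" shows "\<bar>j x\<bar> <= j 0" "\<bar>j1 x\<bar> <= j 0"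
proof -
  have "En x <= (j 0)\<^sup>2" using En_antimono[of 0 x] assms by (simp add: En_def j_0)
  hence "(j x)\<^sup>2 <= (j 0)\<^sup>2" "(j1 x)\<^sup>2 <= (j 0)\<^sup>2" unfolding En_def by (smt (verit) zero_le_power2)+
  thus "\<bar>j x\<bar> <= j 0" "\<bar>j1 x\<bar> <= j 0" using j_0(1) by (simp_all add: abs_le_square_iff[symmetric])
qed

lemma j_lipschitz: assumes "0 <= x" "x <= y" shows "\<bar>j y - j x\<bar> <= j 0 * (y - x)"
proof (cases "x = y")
  case False
  then obtain z where z: "x < z" "z < y" "j y - j x = (y - x) * j1 z"
    using MVT2[of x y j j1] j_deriv(1) assms by auto
  hence "\<bar>j y - j x\<bar> = (y - x) * \<bar>j1 z\<bar>" using assms by (simp add: abs_mult)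
  also have "... <= (y - x) * j 0" using j_bounds(2)[of z] z assms by (intro mult_left_mono) auto
  finally show ?thesis by (simp add: mult.commute)
qed simp

lemma j_pos_small: assumes "0 <= x" "x < 1" shows "0 < j x"
proof -
  have "j 0 * x < j 0" using assms j_0(1) by simp
  thus ?thesis using j_lipschitz[of 0 x] assms by simp
qed

lemma powr_En_mono: assumes "0 < x" "x <= y" shows "x powr (2 * alpha) * En x <= y powr (2 * alpha) * En y"
proof (rule DERIV_nonneg_imp_nondecreasing[OF assms(2)])
  fix z assume z: "x <= z" "z <= y"
  have z0: "0 < z" using z assms by simp
  have "((%x. x powr (2 * alpha) * En x) has_real_derivative
      2 * alpha * z powr (2 * alpha - 1) * En z + z powr (2 * alpha) * (2 * j1 z * (j z + j2 z))) (at z)"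
    using En_deriv[of z] z0 by (auto intro!: derivative_eq_intros)
  moreover have "z powr (2 * alpha) = z powr (2 * alpha - 1) * z" using z0 by (simp add: powr_diff)
  hence "2 * alpha * z powr (2 * alpha - 1) * En z + z powr (2 * alpha) * (2 * j1 z * (j z + j2 z))
      = 2 * alpha * z powr (2 * alpha - 1) * (j z)\<^sup>2"
    using z0 by (simp add: j_ode En_def power2_eq_square field_simps)
  moreover have "0 <= 2 * alpha * z powr (2 * alpha - 1) * (j z)\<^sup>2" using alpha_nonneg by simp
  ultimately show "\<exists>d. ((%x. x powr (2 * alpha) * En x) has_real_derivative d) (at z) & 0 <= d" by auto
qed

lemma En_pos: assumes "0 <= x" shows "0 < En x"
proof (cases "x < 1")
  case True
  thus ?thesis using j_pos_small[OF assms] unfolding En_def by (simp add: add_pos_nonneg)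
next
  case False
  have "0 < (1/2) powr (2 * alpha) * En (1/2)"
    using j_pos_small[of "1/2"] unfolding En_def by (simp add: add_pos_nonneg)
  also have "... <= x powr (2 * alpha) * En x" using False by (intro powr_En_mono) auto
  finally show ?thesis by (simp add: zero_less_mult_iff)
qed

definition zs :: "real set" where "zs = {z. 0 < z & j z = 0}"

lemma zs_ge_1: "z \<in> zs ==> 1 <= z" using j_pos_small[of z] by (fastforce simp: zs_def)

lemma zs_simple: "z \<in> zs ==> j1 z ~= 0" using En_pos[of z] by (auto simp: zs_def En_def)

text \<open>Between two zeros lies a critical point \<open>x\<close>, where all energy sits in
  \<open>j\<close>. Starting from 0 at \<open>y\<close> with slope at most the root of
  \<open>En y\<close>, \<open>j\<close> can reach this energy only if
  \<open>y powr (2 * alpha) <= x powr (2 * alpha) * (x - y)^2\<close>. For \<open>x < 2 * y\<close>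
  this gives \<open>x - y >= 2 powr - alpha\<close>; otherwise
  \<open>x - y >= y >= 1\<close>.\<close>

lemma zs_gap: assumes y: "y \<in> zs" and z: "z \<in> zs" and "y < z" shows "2 powr - alpha <= z - y"
proof -
  have y1: "1 <= y" using y by (rule zs_ge_1)
  obtain x where x: "y < x" "x < z" "j z - j y = (z - y) * j1 x"
    using MVT2[of y z j j1] j_deriv(1) \<open>y < z\<close> by auto
  hence x0: "j1 x = 0" using y z by (simp add: zs_def)
  obtain u where u: "y < u" "u < x" "j x - j y = (x - y) * j1 u"
    using MVT2[of y x j j1] j_deriv(1) x by auto
  have "(j x)\<^sup>2 = (x - y)\<^sup>2 * (j1 u)\<^sup>2" using u(3) y by (simp add: zs_def power_mult_distrib)
  also have "... <= (x - y)\<^sup>2 * En y" proof (rule mult_left_mono)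
    have "(j1 u)\<^sup>2 <= En u" by (simp add: En_def)
    thus "(j1 u)\<^sup>2 <= En y" using En_antimono[of y u] u y1 by simp
  qed simp
  finally have "x powr (2 * alpha) * En x <= x powr (2 * alpha) * ((x - y)\<^sup>2 * En y)"
    by (intro mult_left_mono) (simp_all add: En_def x0)
  hence "y powr (2 * alpha) * En y <= x powr (2 * alpha) * ((x - y)\<^sup>2 * En y)"
    using powr_En_mono[of y x] x y1 by (meson less_imp_le less_le_trans order_trans zero_less_one)
  hence le: "y powr (2 * alpha) <= x powr (2 * alpha) * (x - y)\<^sup>2"
    using En_pos[of y] y1 unfolding mult.assoc[symmetric] by (subst (asm) mult_le_cancel_right) auto
  have "2 powr - alpha <= x - y" proof (cases "2 * y <= x")
    case True
    have "2 powr - alpha <= 2 powr (0 :: real)" using alpha_nonneg by (intro powr_mono) auto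
    thus ?thesis using True y1 by simp
  next
    case False
    have "x powr (2 * alpha) <= (2 * y) powr (2 * alpha)" using False x y1 alpha_nonneg by (intro powr_mono2) auto
    also have "... = 2 powr (2 * alpha) * y powr (2 * alpha)" using y1 by (simp add: powr_mult)
    finally have "y powr (2 * alpha) <= (2 powr (2 * alpha) * y powr (2 * alpha)) * (x - y)\<^sup>2"
      using le mult_right_mono[of _ _ "(x - y)\<^sup>2"] by (meson order_trans zero_le_power2)
    hence "1 <= 2 powr (2 * alpha) * (x - y)\<^sup>2" using y1 by simp
    moreover have "2 powr (2 * alpha) = (2 powr alpha)\<^sup>2" by (simp add: power2_eq_square powr_add[symmetric])
    ultimately have "1\<^sup>2 <= (2 powr alpha * (x - y))\<^sup>2" by (simp add: power_mult_distrib)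
    hence "1 <= 2 powr alpha * (x - y)" using x by (intro power2_le_imp_le[of 1]) auto
    thus ?thesis by (simp add: powr_minus field_simps)
  qed
  thus ?thesis using x by simp
qed

text \<open>Sturm comparison of \<open>x powr (alpha/2) * j x\<close> with \<open>sin ((x - c) / 2)\<close>.\<close>

lemma zs_unbounded: "\<exists>z\<in>zs. c < z"
proof -
  define beta where "beta = alpha / 2"
  have beta: "0 <= beta" using alpha_nonneg by (simp add: beta_def)
  \<comment> \<open>From \<open>a\<close> on, \<open>x >= 2 * beta\<close> keeps
    \<open>x powr beta * j x\<close> oscillating faster than \<open>sin (x / 2)\<close>, and the
    interval up to \<open>d\<close> is a half wave of \<open>sin ((x - a) / 2)\<close>.\<close>
  define a where "a = \<bar>c\<bar> + 2 * beta + 1"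
  define d where "d = a + 2 * pi"
  have a: "c < a" "0 < a" "2 * beta <= a" "a < d" using beta by (auto simp: a_def d_def add_pos_nonneg abs_if)
  have "\<exists>z\<in>{a..d}. j z = 0" proof (rule ccontr)
    assume "\<not> ?thesis"
    hence nz: "!!z. z \<in> {a..d} ==> j z ~= 0" by blast
    define sigma where "sigma = sgn (j a)"
    have sigma: "0 < sigma * j z" if z: "z \<in> {a..d}" for z proof (rule ccontr)
      assume n: "\<not> 0 < sigma * j z"
      have 0: "0 < sigma * j a" using nz[of a] a by (simp add: sigma_def mult.commute abs_sgn[symmetric])
      have "\<exists>x. a <= x & x <= z & sigma * j x = 0"
        by (rule IVT2') (use n 0 z in \<open>auto intro!: continuous_intros continuous_j\<close>)
      then obtain x where x: "a <= x" "x <= z" "sigma * j x = 0" by blast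
      moreover have "sigma ~= 0" using 0 by auto
      ultimately show False using nz[of x] z by auto
    qed
    define Y Y1 where "Y x = x powr beta * j x" and "Y1 x = beta * x powr (beta - 1) * j x + x powr beta * j1 x" for x
    \<comment> \<open>The Wronskian of \<open>Y\<close> and the sine, up to sign conventions. It is
      nonincreasing if \<open>j\<close> keeps its sign, yet negative at \<open>a\<close> and
      positive at \<open>d\<close>.\<close>
    define V where "V x = sigma * (Y1 x * sin ((x - a) / 2) - Y x * (cos ((x - a) / 2) / 2))" for x
    have "V d <= V a" proof (rule DERIV_nonpos_imp_nonincreasing[of a d V])
      show "a <= d" using a by simp
      fix x assume x: "a <= x" "x <= d"
      have x0: "0 < x" using x a by simp
      define P where "P = x powr beta"
      have P: "x powr (beta - 1) = P / x" "x powr (beta - 1 - 1) = P / x\<^sup>2"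
        using x0 by (simp_all add: P_def powr_diff power2_eq_square)
      have dY: "DERIV Y x :> Y1 x"
        unfolding Y_def Y1_def using x0 j_deriv[of x] by (auto intro!: derivative_eq_intros)
      have "DERIV Y1 x :> (beta * ((beta - 1) * x powr (beta - 1 - 1)) * j x + beta * x powr (beta - 1) * j1 x)
          + (beta * x powr (beta - 1) * j1 x + x powr beta * j2 x)"
        unfolding Y1_def using x0 j_deriv[of x] by (auto intro!: derivative_eq_intros)
      moreover have "(beta * ((beta - 1) * x powr (beta - 1 - 1)) * j x + beta * x powr (beta - 1) * j1 x)
          + (beta * x powr (beta - 1) * j1 x + x powr beta * j2 x) = Y x * (beta * (beta - 1) / x\<^sup>2 - 1)"
        unfolding P P_def[symmetric] Y_def using x0 by (simp add: j_ode beta_def field_simps power2_eq_square)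
      ultimately have dY1: "DERIV Y1 x :> Y x * (beta * (beta - 1) / x\<^sup>2 - 1)" by simp
      have "DERIV V x :> (sigma * Y x) * sin ((x - a) / 2) * (beta * (beta - 1) / x\<^sup>2 - 3/4)"
        unfolding V_def by (auto intro!: derivative_eq_intros dY dY1 simp: algebra_simps diff_divide_distrib)
      moreover have "(sigma * Y x) * sin ((x - a) / 2) * (beta * (beta - 1) / x\<^sup>2 - 3/4) <= 0"
      proof (rule mult_nonneg_nonpos)
        have "sigma * Y x = (sigma * j x) * x powr beta" by (simp add: Y_def)
        moreover have "0 <= (sigma * j x) * x powr beta" using sigma[of x] x by (intro mult_nonneg_nonneg[OF less_imp_le]) auto
        ultimately have "0 <= sigma * Y x" by (simp only:)
        moreover have "0 <= sin ((x - a) / 2)" using x by (intro sin_ge_zero) (auto simp: d_def)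
        ultimately show "0 <= sigma * Y x * sin ((x - a) / 2)" by simp
        have "beta * (beta - 1) <= beta * beta" using beta by (intro mult_left_mono) auto
        also have "... <= (x / 2) * (x / 2)" using beta x a by (intro mult_mono) auto
        also have "... <= 3/4 * x\<^sup>2" by (simp add: power2_eq_square)
        finally show "beta * (beta - 1) / x\<^sup>2 - 3/4 <= 0" using x0 by (simp add: pos_divide_le_eq)
      qed
      ultimately show "\<exists>d. (V has_real_derivative d) (at x) & d <= 0" by blast
    qed
    moreover have "V a = - ((sigma * j a) * a powr beta / 2)" by (simp add: V_def Y_def)
    moreover have "V d = (sigma * j d) * d powr beta / 2" by (simp add: V_def Y_def d_def)
    moreover have "0 < (sigma * j a) * a powr beta / 2" "0 < (sigma * j d) * d powr beta / 2"
      using sigma[of a] sigma[of d] a by simp_all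
    ultimately show False by linarith
  qed
  then obtain z where "a <= z" "j z = 0" by auto
  thus ?thesis using a by (intro bexI[of _ z]) (auto simp: zs_def)
qed

lemma zs_finite: "finite {y \<in> zs. y <= c}"
  by (rule finite_separated[of "2 powr - alpha"]) (use zs_gap in \<open>auto simp: zs_def\<close>)

definition lm :: "nat => real" where "lm n = bessel_zero \<nu> (Suc n)"

lemma bessel_J_zero_iff: "0 < z ==> bessel_J \<nu> z = 0 \<longleftrightarrow> j z = 0"
  by (simp add: bessel_J_eq)

lemma lm: "lm n \<in> zs" "card {y \<in> zs. y <= lm n} = Suc n"
proof -
  have "{y. 0 < y & y <= z & bessel_J \<nu> y = 0} = {y \<in> zs. y <= z}" for z
    by (auto simp: zs_def bessel_J_zero_iff)
  hence "lm n = (THE z. z \<in> zs & card {y \<in> zs. y <= z} = Suc n)" unfolding lm_def bessel_zero_def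
    by (intro arg_cong[where f = The] ext) (auto simp: zs_def bessel_J_zero_iff)
  moreover have "\<exists>!z. z \<in> zs & card {y \<in> zs. y <= z} = Suc n"
    by (rule card_enumeration[OF zs_finite zs_unbounded])
  ultimately show "lm n \<in> zs" "card {y \<in> zs. y <= lm n} = Suc n" using theI'[of "%z. z \<in> zs & card {y \<in> zs. y <= z} = Suc n"] by auto
qed

lemma card_below_lm: "card {y \<in> zs. y < lm n} = n"
proof -
  have "{y \<in> zs. y <= lm n} = insert (lm n) {y \<in> zs. y < lm n}" using lm(1)[of n] by auto
  moreover have "finite {y \<in> zs. y < lm n}" by (rule finite_subset[OF _ zs_finite[of "lm n"]]) auto
  ultimately show ?thesis using lm(2)[of n] by simp
qed

lemma lm_less: "lm n < lm (Suc n)"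
proof (rule ccontr)
  assume "\<not> ?thesis"
  hence "card {y \<in> zs. y <= lm (Suc n)} <= card {y \<in> zs. y <= lm n}" by (intro card_mono zs_finite) auto
  thus False by (simp add: lm)
qed

lemma lm_strict_mono: "strict_mono lm" using lm_less by (simp add: strict_mono_Suc_iff)

lemma lm_growth: "2 powr - alpha * real (Suc n) <= lm n"
proof (induction n)
  case 0
  have "2 powr - alpha <= 2 powr (0 :: real)" using alpha_nonneg by (intro powr_mono) auto
  thus ?case using zs_ge_1[OF lm(1)[of 0]] by simp
next
  case (Suc n)
  thus ?case using zs_gap[OF lm(1) lm(1) lm_less, of n] by (simp add: algebra_simps)
qed

lemma lm_pos: "0 < lm n" "1 <= lm n" using zs_ge_1[OF lm(1)[of n]] by simp_all

lemma j_lm: "j (lm n) = 0" using lm(1)[of n] by (simp add: zs_def)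

lemma j1_lm: "j1 (lm n) ~= 0" by (rule zs_simple[OF lm(1)])

text \<open>At a zero \<open>En\<close> is the square of \<open>j1\<close>, so the growth of
  \<open>x powr (2 * alpha) * En x\<close> bounds \<open>j1\<close> below. Hence the normalising
  constants grow at most like a power of \<open>lm n\<close>.\<close>

lemma j1_lm_lower: "\<bar>j1 (lm 0)\<bar> * (lm 0 / lm n) powr alpha <= \<bar>j1 (lm n)\<bar>"
proof -
  have "lm 0 <= lm n" using lm_strict_mono by (simp add: strict_mono_less_eq)
  hence "lm 0 powr (2 * alpha) * En (lm 0) <= lm n powr (2 * alpha) * En (lm n)"
    using lm_pos by (intro powr_En_mono)
  moreover have "x powr (2 * alpha) = (x powr alpha)\<^sup>2" for x :: real
    by (simp add: power2_eq_square powr_add[symmetric])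
  ultimately have "(lm 0 powr alpha * j1 (lm 0))\<^sup>2 <= (lm n powr alpha * j1 (lm n))\<^sup>2"
    by (simp add: En_def j_lm power_mult_distrib)
  hence "\<bar>lm 0 powr alpha * j1 (lm 0)\<bar> <= \<bar>lm n powr alpha * j1 (lm n)\<bar>" by (simp add: abs_le_square_iff)
  thus ?thesis using lm_pos[of n] lm_pos[of 0] by (simp add: abs_mult powr_divide field_simps)
qed

lemma j_pos_lm: assumes "0 <= x" "x < lm 0" shows "0 < j x"
proof (rule ccontr)
  assume n: "\<not> 0 < j x"
  have "\<exists>y. 0 <= y & y <= x & j y = 0"
    by (rule IVT2') (use n j_0 assms in \<open>auto intro!: continuous_j\<close>)
  then obtain y where y: "0 <= y" "y <= x" "j y = 0" by blast
  have "y ~= 0" using y j_0 by auto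
  hence "y \<in> {y \<in> zs. y < lm 0}" using y assms by (auto simp: zs_def)
  moreover have "finite {y \<in> zs. y < lm 0}" by (rule finite_subset[OF _ zs_finite[of "lm 0"]]) auto
  ultimately show False using card_below_lm[of 0] by auto
qed

end

section \<open>Log-concavity of the ground state and normalisation of the eigenfunctions\<close>

context bessel
begin

text \<open>\<open>x powr alpha * j1 x\<close> has the derivative
  \<open>- (x powr alpha * j x)\<close>, nonpositive up to the first zero, and it is negative close
  to 0, where \<open>j1\<close> starts at 0 with slope \<open>j2 0 < 0\<close>.\<close>

lemma j1_neg: assumes x: "0 < x" "x <= lm 0" shows "j1 x < 0"
proof -
  obtain d where d: "0 < d" "!!h. 0 < h ==> h < d ==> j1 h < 0"
    using DERIV_neg_dec_right[OF j_deriv(2)[of 0] j_0(3)] j_0(2) by auto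
  define a where "a = min (x / 2) (d / 2)"
  have a: "0 < a" "a < d" "a <= x" using x d(1) by (auto simp: a_def min_def)
  have "x powr alpha * j1 x <= a powr alpha * j1 a"
  proof (rule DERIV_nonpos_imp_nonincreasing[of a x "%x. x powr alpha * j1 x"])
    show "a <= x" by (rule a)
    fix z assume z: "a <= z" "z <= x"
    have z0: "0 < z" using z a by simp
    have "DERIV (%x. x powr alpha * j1 x) z :> alpha * z powr (alpha - 1) * j1 z + z powr alpha * j2 z"
      using z0 j_deriv(2)[of z] by (auto intro!: derivative_eq_intros)
    moreover have "alpha * z powr (alpha - 1) * j1 z + z powr alpha * j2 z = - (z powr alpha * j z)"
      using z0 by (simp add: j_ode powr_diff field_simps)
    moreover have "0 <= j z" using j_pos_lm[of z] j_lm[of 0] z x z0 by (cases "z = lm 0") auto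
    ultimately show "\<exists>d. ((%x. x powr alpha * j1 x) has_real_derivative d) (at z) & d <= 0" by auto
  qed
  also have "... < 0" using d(2)[of a] a by (simp add: mult_less_0_iff)
  finally show ?thesis using x by (simp add: mult_less_0_iff)
qed

lemma j_antimono: assumes "0 < x" "x <= y" "y <= lm 0" shows "j y <= j x"
proof (rule DERIV_nonpos_imp_nonincreasing[OF assms(2)])
  fix z assume "x <= z" "z <= y"
  hence "j1 z <= 0" using j1_neg[of z] assms by simp
  thus "\<exists>d. (j has_real_derivative d) (at z) & d <= 0" using j_deriv(1)[of z] by blast
qed

text \<open>\<open>Q\<close> is \<open>x powr alpha * ((j1 x)^2 - j2 x * j x)\<close> with
  \<open>j2\<close> eliminated by the equation. It is nonnegative close to 0 since
  \<open>j2 0 * j 0 < 0\<close>, and up to the first zero its derivative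
  \<open>alpha * x powr (alpha - 2) * j x * (- j1 x)\<close> is nonnegative. This is the source of
  the nonnegative potential.\<close>

lemma j_log_concave: assumes x: "0 < x" "x < lm 0" shows "j2 x * j x <= (j1 x)\<^sup>2"
proof -
  define Q where "Q x = alpha * x powr (alpha - 1) * j x * j1 x + x powr alpha * En x" for x
  have Q: "Q x = - (x powr alpha * (j2 x * j x - (j1 x)\<^sup>2))" if "0 < x" for x
    using that by (simp add: Q_def En_def j_ode powr_diff power2_eq_square field_simps)
  have ic: "isCont (%x. j2 x * j x - (j1 x)\<^sup>2) 0"
    using continuous_j[of UNIV] by (intro continuous_intros) (simp_all add: continuous_on_eq_continuous_at)
  have "\<not> 0 <= j2 0 * j 0 - (j1 0)\<^sup>2" using mult_neg_pos[OF j_0(3,1)] j_0(2) by simp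
  then obtain d where d: "0 < d" "!!y. \<bar>y - 0\<bar> < d ==> j2 y * j y - (j1 y)\<^sup>2 < 0"
    by (rule isCont_neg_nbhd[of "%x. j2 x * j x - (j1 x)\<^sup>2" 0, OF _ ic]) blast
  define a where "a = min (x / 2) (d / 2)"
  have a: "0 < a" "a < d" "a <= x" using x d(1) by (auto simp: a_def min_def)
  have "a powr alpha * (j2 a * j a - (j1 a)\<^sup>2) <= 0" using d(2)[of a] a by (intro mult_nonneg_nonpos) auto
  hence "0 <= Q a" using Q[OF a(1)] by simp
  also have "Q a <= Q x" proof (rule DERIV_nonneg_imp_nondecreasing[of a x Q])
    show "a <= x" by (rule a)
    fix z assume z: "a <= z" "z <= x"
    have z0: "0 < z" "z < lm 0" using z a x by auto
    define P where "P = z powr alpha"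
    have P: "z powr (alpha - 1) = P / z" "z powr (alpha - 1 - 1) = P / z\<^sup>2"
      using z0 by (simp_all add: P_def powr_diff power2_eq_square)
    have "DERIV Q z :> ((alpha * ((alpha - 1) * z powr (alpha - 1 - 1))) * j z + alpha * z powr (alpha - 1) * j1 z) * j1 z
        + alpha * z powr (alpha - 1) * j z * j2 z
        + (alpha * z powr (alpha - 1) * En z + z powr alpha * (2 * j1 z * (j z + j2 z)))"
      unfolding Q_def[abs_def] using z0 j_deriv[of z] En_deriv[of z]
      by (auto intro!: derivative_eq_intros simp: algebra_simps)
    moreover have "((alpha * ((alpha - 1) * z powr (alpha - 1 - 1))) * j z + alpha * z powr (alpha - 1) * j1 z) * j1 z
        + alpha * z powr (alpha - 1) * j z * j2 z
        + (alpha * z powr (alpha - 1) * En z + z powr alpha * (2 * j1 z * (j z + j2 z)))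
        = (alpha * P / z\<^sup>2 * j z) * (- j1 z)"
      unfolding P P_def[symmetric] En_def using z0 by (simp add: j_ode field_simps power2_eq_square)
    moreover have "0 <= (alpha * P / z\<^sup>2 * j z) * (- j1 z)" proof (rule mult_nonneg_nonneg)
      show "0 <= - j1 z" using j1_neg[of z] z0 by simp
      have "0 <= j z" using j_pos_lm[of z] z0 by simp
      thus "0 <= alpha * P / z\<^sup>2 * j z" using alpha_nonneg by (simp add: P_def)
    qed
    ultimately show "\<exists>d. (Q has_real_derivative d) (at z) & 0 <= d" by auto
  qed
  finally show ?thesis using Q[OF x(1)] x by (simp add: mult_le_0_iff)
qed

text \<open>On the second half of the interval the slope is bounded away from 0 by compactness; on
  the first half \<open>j\<close> stays above its value at the midpoint, which the halved constant
  accommodates.\<close>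

lemma j_lower: "\<exists>c>0. \<forall>y. 0 <= y & y < lm 0 --> c * (lm 0 - y) <= j y"
proof -
  define L where "L = lm 0"
  have L: "0 < L" "j L = 0" using lm_pos[of 0] j_lm[of 0] by (auto simp: L_def)
  have "{L/2..L} ~= {}" using L by simp
  from continuous_attains_sup[OF compact_Icc this continuous_j(2)]
  obtain z where z: "z \<in> {L/2..L}" "\<forall>y\<in>{L/2..L}. j1 y <= j1 z" ..
  define m where "m = - j1 z"
  have m: "0 < m" "!!y. y \<in> {L/2..L} ==> j1 y <= - m" using z j1_neg[of z] L by (auto simp: m_def L_def)
  have 1: "m * (L - y) <= j y" if y: "L/2 <= y" "y < L" for y proof -
    obtain u where u: "y < u" "u < L" "j L - j y = (L - y) * j1 u"
      using MVT2[of y L j j1] j_deriv(1) y by auto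
    have "(L - y) * j1 u <= (L - y) * (- m)" using u y by (intro mult_left_mono m) auto
    thus ?thesis using u L by (simp add: mult.commute)
  qed
  have "m / 2 * (L - y) <= j y" if y: "0 <= y" "y < L" for y proof (cases "L / 2 <= y")
    case True
    have "m / 2 * (L - y) <= m * (L - y)" using m y by (intro mult_right_mono) auto
    thus ?thesis using 1[OF True y(2)] by simp
  next
    case False
    have "m / 2 * (L - y) <= m / 2 * L" using m y by (intro mult_left_mono) auto
    also have "... = m * (L - L / 2)" by (simp add: field_simps)
    also have "... <= j (L / 2)" using L by (intro 1) auto
    also have "... <= j y" proof (cases "y = 0")
      case True
      thus ?thesis using j_bounds(1)[of "L / 2"] L by simp
    qed (use j_antimono[of y "L / 2"] False y L in \<open>auto simp: L_def\<close>)
    finally show ?thesis .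
  qed
  thus ?thesis using m by (intro exI[of _ "m / 2"]) (auto simp: L_def)
qed

definition nc :: "nat => real" where "nc n = sqrt 2 / \<bar>j1 (lm n)\<bar>"
definition ph :: "nat => real => real" where "ph n x = nc n * j (lm n * x)"
definition ph1 :: "nat => real => real" where "ph1 n x = nc n * lm n * j1 (lm n * x)"
definition ph2 :: "nat => real => real" where "ph2 n x = nc n * (lm n)\<^sup>2 * j2 (lm n * x)"

lemma nc_pos: "0 < nc n" using j1_lm[of n] by (simp add: nc_def)

lemma ph_eq: assumes x: "0 < x" shows "fb_phi \<nu> (Suc n) x = ph n x"
proof -
  have l: "0 < lm n" by (rule lm_pos)
  have "\<bar>bessel_J (\<nu> + 1) (lm n)\<bar> = (lm n / 2) powr \<nu> * \<bar>j1 (lm n)\<bar>"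
    by (simp add: bessel_J_Suc_eq[OF l] abs_mult)
  moreover have "bessel_J \<nu> (lm n * x) = ((lm n / 2) powr \<nu> * x powr \<nu>) * j (lm n * x)"
    using l x bessel_J_eq[of "lm n * x"] by (simp add: powr_mult[symmetric])
  moreover have "x powr (- \<nu>) * x powr \<nu> = 1" using x by (simp add: powr_add[symmetric])
  ultimately show ?thesis
    using l x by (simp add: fb_phi_def lm_def[symmetric] ph_def nc_def powr_minus field_simps)
qed

lemma ph_deriv: "DERIV (ph n) x :> ph1 n x" "DERIV (ph1 n) x :> ph2 n x"
  unfolding ph_def[abs_def] ph1_def[abs_def] ph2_def
  by (auto intro!: derivative_eq_intros DERIV_chain2[OF j_deriv(1)] DERIV_chain2[OF j_deriv(2)] simp: power2_eq_square)

lemma ph_ode: "0 < x ==> ph2 n x = - (alpha / x) * ph1 n x - (lm n)\<^sup>2 * ph n x"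
  using lm_pos[of n] by (simp add: ph_def ph1_def ph2_def j_ode power2_eq_square field_simps)

lemma ph_0: "ph1 n 0 = 0" "0 < ph n 0" using nc_pos[of n] j_0 by (simp_all add: ph1_def ph_def)

lemma ph_1: "ph n 1 = 0" "ph1 n 1 ~= 0"
  using nc_pos[of n] lm_pos[of n] j_lm j1_lm by (simp_all add: ph1_def ph_def)

lemma continuous_ph: "continuous_on A (ph n)" "continuous_on A (ph1 n)"
  by (rule DERIV_cont_on[OF ph_deriv(1)], simp)
     (rule DERIV_cont_on[OF ph_deriv(2)], simp)

lemma ph_pos: "x \<in> {0<..<1} ==> 0 < ph 0 x"
  using nc_pos[of 0] lm_pos[of 0] j_pos_lm[of "lm 0 * x"] by (simp add: ph_def)

text \<open>\<open>G\<close> is an explicit primitive of the integrand, a form of Lommel's integral.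
  It tends to 0 at 0, and at 1 only \<open>ph1 n 1\<close> contributes, whose square is
  \<open>2 * (lm n)^2\<close> by the choice of \<open>nc\<close>.\<close>

lemma ph_integral: "(LINT x:{0<..<1}|lborel. x powr alpha * (ph n x)\<^sup>2) = 1"
proof -
  define L where "L = lm n"
  have L: "0 < L" using lm_pos by (simp add: L_def)
  define G where "G x = (x powr (alpha + 1) * ((ph1 n x)\<^sup>2 + L\<^sup>2 * (ph n x)\<^sup>2) + (alpha - 1) * (x powr alpha * ph n x * ph1 n x)) / (2 * L\<^sup>2)" for x
  have dG: "DERIV G x :> x powr alpha * (ph n x)\<^sup>2" if x: "0 < x" for x proof -
    define P where "P = x powr alpha"
    have P: "x powr (alpha + 1) = P * x" "x powr (alpha - 1) = P / x" "x powr (alpha + 1 - 1) = P"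
      using x by (simp_all add: P_def powr_diff powr_add)
    have "((%x. x powr (alpha + 1) * ((ph1 n x)\<^sup>2 + L\<^sup>2 * (ph n x)\<^sup>2) + (alpha - 1) * (x powr alpha * ph n x * ph1 n x)) has_real_derivative
       ((alpha + 1) * x powr (alpha + 1 - 1) * ((ph1 n x)\<^sup>2 + L\<^sup>2 * (ph n x)\<^sup>2)
        + x powr (alpha + 1) * (2 * ph1 n x * ph2 n x + L\<^sup>2 * (2 * ph n x * ph1 n x))
        + (alpha - 1) * ((alpha * x powr (alpha - 1) * ph n x + x powr alpha * ph1 n x) * ph1 n x + x powr alpha * ph n x * ph2 n x))) (at x)"
      using x ph_deriv[of n x] by (auto intro!: derivative_eq_intros simp: algebra_simps)
    hence "(G has_real_derivative
       ((alpha + 1) * x powr (alpha + 1 - 1) * ((ph1 n x)\<^sup>2 + L\<^sup>2 * (ph n x)\<^sup>2)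
        + x powr (alpha + 1) * (2 * ph1 n x * ph2 n x + L\<^sup>2 * (2 * ph n x * ph1 n x))
        + (alpha - 1) * ((alpha * x powr (alpha - 1) * ph n x + x powr alpha * ph1 n x) * ph1 n x + x powr alpha * ph n x * ph2 n x)) / (2 * L\<^sup>2)) (at x)"
      unfolding G_def[abs_def] by (rule DERIV_cdivide)
    moreover have "((alpha + 1) * x powr (alpha + 1 - 1) * ((ph1 n x)\<^sup>2 + L\<^sup>2 * (ph n x)\<^sup>2)
        + x powr (alpha + 1) * (2 * ph1 n x * ph2 n x + L\<^sup>2 * (2 * ph n x * ph1 n x))
        + (alpha - 1) * ((alpha * x powr (alpha - 1) * ph n x + x powr alpha * ph1 n x) * ph1 n x + x powr alpha * ph n x * ph2 n x)) / (2 * L\<^sup>2)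
        = P * (ph n x)\<^sup>2" unfolding P P_def[symmetric] ph_ode[OF x] L_def[symmetric] using x L
      by (simp add: field_simps power2_eq_square)
    ultimately show ?thesis by (simp add: P_def)
  qed
  have G0: "(G ---> 0) (at_right 0)" proof (rule Lim_null_comparison)
    define H where "H x = (x * ((ph1 n x)\<^sup>2 + L\<^sup>2 * (ph n x)\<^sup>2) + \<bar>alpha - 1\<bar> * \<bar>ph n x * ph1 n x\<bar>) / (2 * L\<^sup>2)" for x
    have "isCont H 0" unfolding H_def using continuous_ph[of UNIV n] L
      by (intro continuous_intros) (simp_all add: continuous_on_eq_continuous_at)
    thus "(H ---> 0) (at_right 0)" using L by (simp add: isCont_def H_def ph_0 filterlim_at_split)
    show "\<forall>\<^sub>F x in at_right 0. norm (G x) <= H x"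
      unfolding eventually_at_right[OF zero_less_one] proof (intro exI[of _ 1] conjI allI impI)
      fix x :: real assume x: "0 < x" "x < 1"
      have p: "x powr alpha <= 1" using x alpha_nonneg powr_mono2[of alpha x 1] by simp
      have A: "\<bar>x powr (alpha + 1) * ((ph1 n x)\<^sup>2 + L\<^sup>2 * (ph n x)\<^sup>2)\<bar> <= x * ((ph1 n x)\<^sup>2 + L\<^sup>2 * (ph n x)\<^sup>2)"
        using p x by (simp add: powr_add abs_mult mult_right_mono)
      have "x powr alpha * \<bar>ph n x * ph1 n x\<bar> <= 1 * \<bar>ph n x * ph1 n x\<bar>" using p by (intro mult_right_mono) auto
      hence B: "\<bar>(alpha - 1) * (x powr alpha * ph n x * ph1 n x)\<bar> <= \<bar>alpha - 1\<bar> * \<bar>ph n x * ph1 n x\<bar>"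
        by (simp add: abs_mult mult.assoc mult_left_mono)
      have "\<bar>x powr (alpha + 1) * ((ph1 n x)\<^sup>2 + L\<^sup>2 * (ph n x)\<^sup>2) + (alpha - 1) * (x powr alpha * ph n x * ph1 n x)\<bar>
          <= x * ((ph1 n x)\<^sup>2 + L\<^sup>2 * (ph n x)\<^sup>2) + \<bar>alpha - 1\<bar> * \<bar>ph n x * ph1 n x\<bar>"
        by (rule order_trans[OF abs_triangle_ineq add_mono[OF A B]])
      thus "norm (G x) <= H x" using L by (simp add: G_def H_def abs_divide divide_right_mono)
    qed simp
  qed
  have "isCont G 1" using dG[of 1] DERIV_isCont by simp
  hence "(G ---> G 1) (at_left 1)" by (simp add: isCont_def filterlim_at_split)
  moreover have "(ph1 n 1)\<^sup>2 = 2 * L\<^sup>2"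
    using j1_lm[of n] by (simp add: ph1_def nc_def L_def power_mult_distrib power_divide)
  hence "G 1 = 1" using L by (simp add: G_def ph_1)
  ultimately have G1: "(G ---> 1) (at_left 1)" by simp
  have "(LBINT x=0..1. x powr alpha * (ph n x)\<^sup>2) = 1 - 0"
  proof (rule interval_integral_FTC_nonneg(2))
    show "DERIV G x :> x powr alpha * (ph n x)\<^sup>2" if "0 < ereal x" for x using that by (intro dG) simp
    show "isCont (%x. x powr alpha * (ph n x)\<^sup>2) x" if "0 < ereal x" for x
      using that ph_deriv(1)[of n x, THEN DERIV_isCont] by (intro continuous_intros) auto
    show "((G \<circ> real_of_ereal) ---> 0) (at_right 0)" using G0 by (simp add: zero_ereal_def ereal_tendsto_simps)
    show "((G \<circ> real_of_ereal) ---> 1) (at_left 1)" using G1 by (simp add: one_ereal_def ereal_tendsto_simps)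
  qed auto
  thus ?thesis by (simp add: interval_lebesgue_integral_def zero_ereal_def one_ereal_def einterval_eq)
qed

end

section \<open>The Fourier-Bessel system as an instance of the abstract system\<close>

context bessel
begin

definition wt :: "real => real" where "wt x = x powr (2 * \<nu> + 1) * (fb_phi \<nu> 1 x)\<^sup>2"
text \<open>The logarithmic derivative of \<open>wt\<close>; \<open>rt\<close> is minus the
  derivative of \<open>bt\<close>.\<close>

definition bt :: "real => real" where "bt x = alpha / x + 2 * (ph1 0 x / ph 0 x)"
definition rt :: "real => real" where "rt x = alpha / x\<^sup>2 - 2 * ((ph2 0 x * ph 0 x - (ph1 0 x)\<^sup>2) / (ph 0 x)\<^sup>2)"
text \<open>The Wronskian of \<open>ph n\<close> and the ground state \<open>ph 0\<close>, so that
  \<open>f1 n\<close> is the derivative of the quotient \<open>f0 n\<close>.\<close>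

definition wr :: "nat => real => real" where "wr n x = ph1 n x * ph 0 x - ph n x * ph1 0 x"
definition f0 :: "nat => real => real" where "f0 n = fb_varphi \<nu> (Suc n)"
definition f1 :: "nat => real => real" where "f1 n x = wr n x / (ph 0 x)\<^sup>2"
definition f2 :: "nat => real => real" where
  "f2 n x = - ((lm n)\<^sup>2 - (lm 0)\<^sup>2) * f0 n x - bt x * f1 n x"

lemma wt_eq: "0 < x ==> wt x = x powr alpha * (ph 0 x)\<^sup>2"
  using ph_eq[of x 0] by (simp add: wt_def alpha_def)

lemma f0_eq: "0 < x ==> f0 n x = ph n x / ph 0 x"
  using ph_eq[of x 0] ph_eq[of x n] by (simp add: f0_def fb_varphi_def)

lemma wt_deriv: assumes x: "x \<in> {0<..<1}" shows "DERIV wt x :> bt x * wt x"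
proof -
  have x0: "0 < x" and p: "0 < ph 0 x" using x ph_pos[OF x] by auto
  have "DERIV (%x. x powr alpha * (ph 0 x)\<^sup>2) x :> bt x * wt x"
    unfolding wt_eq[OF x0] bt_def using x0 p ph_deriv(1)[of 0 x]
    by (auto intro!: derivative_eq_intros simp: powr_diff field_simps power2_eq_square)
  thus ?thesis by (rule DERIV_transform_open[of _ _ _ "{0<..}"]) (use x0 in \<open>auto simp: wt_eq\<close>)
qed

lemma bt_deriv: assumes x: "x \<in> {0<..<1}" shows "DERIV bt x :> - rt x"
proof -
  have x0: "x ~= 0" and p: "ph 0 x ~= 0" using x ph_pos[OF x] by auto
  have "DERIV (%x. alpha / x) x :> - (alpha / x\<^sup>2)"
    using x0 by (auto intro!: derivative_eq_intros simp: power2_eq_square)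
  moreover have "DERIV (%x. ph1 0 x / ph 0 x) x :> (ph2 0 x * ph 0 x - ph1 0 x * ph1 0 x) / (ph 0 x * ph 0 x)"
    by (rule DERIV_divide[OF ph_deriv(2) ph_deriv(1) p])
  hence "((%x. 2 * (ph1 0 x / ph 0 x)) has_real_derivative
      2 * ((ph2 0 x * ph 0 x - ph1 0 x * ph1 0 x) / (ph 0 x * ph 0 x))) (at x)" by (rule DERIV_cmult)
  ultimately have "(bt has_real_derivative
      - (alpha / x\<^sup>2) + 2 * ((ph2 0 x * ph 0 x - ph1 0 x * ph1 0 x) / (ph 0 x * ph 0 x))) (at x)"
    unfolding bt_def[abs_def] by (rule DERIV_add)
  thus ?thesis by (simp add: rt_def power2_eq_square)
qed

lemma rt_nonneg: assumes x: "x \<in> {0<..<1}" shows "0 <= rt x"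
proof -
  have l: "0 < lm 0" by (rule lm_pos)
  have "j2 (lm 0 * x) * j (lm 0 * x) <= (j1 (lm 0 * x))\<^sup>2" using x l by (intro j_log_concave) auto
  hence "(nc 0 * lm 0)\<^sup>2 * (j2 (lm 0 * x) * j (lm 0 * x)) <= (nc 0 * lm 0)\<^sup>2 * (j1 (lm 0 * x))\<^sup>2"
    by (rule mult_left_mono) simp
  hence "ph2 0 x * ph 0 x - (ph1 0 x)\<^sup>2 <= 0"
    by (simp add: ph_def ph1_def ph2_def power2_eq_square mult_ac)
  hence "(ph2 0 x * ph 0 x - (ph1 0 x)\<^sup>2) / (ph 0 x)\<^sup>2 <= 0" by (simp add: divide_nonpos_nonneg)
  moreover have "0 <= alpha / x\<^sup>2" using alpha_nonneg by simp
  ultimately show ?thesis unfolding rt_def by linarith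
qed

lemma f0_deriv: assumes x: "x \<in> {0<..<1}" shows "DERIV (f0 n) x :> f1 n x"
proof -
  have x0: "0 < x" and p: "ph 0 x ~= 0" using x ph_pos[OF x] by auto
  have "DERIV (%x. ph n x / ph 0 x) x :> f1 n x"
    using DERIV_divide[OF ph_deriv(1) ph_deriv(1) p, of n] by (simp add: f1_def wr_def power2_eq_square)
  thus ?thesis by (rule DERIV_transform_open[of _ _ _ "{0<..}"]) (use x0 in \<open>auto simp: f0_eq\<close>)
qed

lemma wr_deriv: assumes x: "0 < x"
  shows "DERIV (wr n) x :> - (alpha / x) * wr n x - ((lm n)\<^sup>2 - (lm 0)\<^sup>2) * (ph n x * ph 0 x)"
proof -
  have "DERIV (wr n) x :> (ph2 n x * ph 0 x + ph1 0 x * ph1 n x) - (ph1 n x * ph1 0 x + ph2 0 x * ph n x)"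
    unfolding wr_def[abs_def] by (rule DERIV_diff[OF DERIV_mult[OF ph_deriv(2) ph_deriv(1)] DERIV_mult[OF ph_deriv(1) ph_deriv(2)]])
  thus ?thesis by (simp add: wr_def ph_ode[OF x] algebra_simps)
qed

lemma f1_deriv: assumes x: "x \<in> {0<..<1}" shows "DERIV (f1 n) x :> f2 n x"
proof -
  have x0: "0 < x" and p: "ph 0 x ~= 0" using x ph_pos[OF x] by auto
  define k where "k = (lm n)\<^sup>2 - (lm 0)\<^sup>2"
  have "DERIV (f1 n) x :> ((- (alpha / x) * wr n x - k * (ph n x * ph 0 x)) * (ph 0 x)\<^sup>2
      - wr n x * (2 * ph 0 x * ph1 0 x)) / ((ph 0 x)\<^sup>2 * (ph 0 x)\<^sup>2)"
    unfolding f1_def[abs_def] k_def using p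
    by (intro DERIV_divide wr_deriv x0) (auto intro!: derivative_eq_intros ph_deriv simp: power2_eq_square)
  moreover have "((- (alpha / x) * wr n x - k * (ph n x * ph 0 x)) * (ph 0 x)\<^sup>2
      - wr n x * (2 * ph 0 x * ph1 0 x)) / ((ph 0 x)\<^sup>2 * (ph 0 x)\<^sup>2) = f2 n x"
    unfolding f2_def k_def[symmetric] bt_def f1_def f0_eq[OF x0] using p x0
    by (simp add: field_simps power2_eq_square)
  ultimately show ?thesis by simp
qed

definition c0 :: real where "c0 = (SOME c. 0 < c & (\<forall>y. 0 <= y & y < lm 0 --> c * (lm 0 - y) <= j y))"

lemma c0: "0 < c0" "!!y. 0 <= y ==> y < lm 0 ==> c0 * (lm 0 - y) <= j y"
proof -
  have "0 < c0 & (\<forall>y. 0 <= y & y < lm 0 --> c0 * (lm 0 - y) <= j y)"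
    unfolding c0_def using j_lower by (rule someI_ex)
  thus "0 < c0" "!!y. 0 <= y ==> y < lm 0 ==> c0 * (lm 0 - y) <= j y" by auto
qed

lemma ph_0_lower: assumes x: "x \<in> {0<..<1}" shows "nc 0 * (c0 * (lm 0 * (1 - x))) <= ph 0 x"
proof -
  have "c0 * (lm 0 - lm 0 * x) <= j (lm 0 * x)" using x lm_pos[of 0] by (intro c0) auto
  hence "nc 0 * (c0 * (lm 0 - lm 0 * x)) <= nc 0 * j (lm 0 * x)" using nc_pos[of 0] by (intro mult_left_mono) auto
  thus ?thesis by (simp add: ph_def right_diff_distrib)
qed

lemma ph_upper: assumes x: "x \<in> {0<..<1}" shows "\<bar>ph n x\<bar> <= nc n * (j 0 * (lm n * (1 - x)))"
proof -
  have "\<bar>j (lm n) - j (lm n * x)\<bar> <= j 0 * (lm n - lm n * x)" using x lm_pos[of n] by (intro j_lipschitz) auto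
  hence "nc n * \<bar>j (lm n * x)\<bar> <= nc n * (j 0 * (lm n - lm n * x))"
    unfolding j_lm using nc_pos[of n] by (intro mult_left_mono) auto
  thus ?thesis using nc_pos[of n] by (simp add: ph_def abs_mult right_diff_distrib)
qed

text \<open>One constant for three hypotheses: the first summand serves \<open>wt_left\<close>, the
  second \<open>wt_right\<close>, and the last, in parentheses, \<open>bt_bound\<close>.\<close>

definition Kt :: real where
  "Kt = (j 0 / j (lm 0 / 2))\<^sup>2 + 2 powr alpha + (alpha + 2 * (j 0 / c0))"

lemma Kt_ge: "(j 0 / j (lm 0 / 2))\<^sup>2 <= Kt" "2 powr alpha <= Kt" "alpha + 2 * (j 0 / c0) <= Kt"
proof -
  have "0 <= (j 0 / j (lm 0 / 2))\<^sup>2" "0 <= 2 powr alpha" "0 <= alpha + 2 * (j 0 / c0)"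
    using alpha_nonneg j_0(1) c0(1) by simp_all
  thus "(j 0 / j (lm 0 / 2))\<^sup>2 <= Kt" "2 powr alpha <= Kt" "alpha + 2 * (j 0 / c0) <= Kt"
    unfolding Kt_def by linarith+
qed

lemma wt_left: assumes "0 < x" "x <= y" "y <= 1/2" shows "wt x <= Kt * wt y"
proof -
  have l: "0 < lm 0" by (rule lm_pos)
  have h: "0 < j (lm 0 / 2)" using l by (intro j_pos_lm) auto
  have "j (lm 0 / 2) <= j (lm 0 * y)" using assms l by (intro j_antimono) auto
  hence 1: "1 <= j (lm 0 * y) / j (lm 0 / 2)" using h by simp
  have "\<bar>j (lm 0 * x)\<bar> <= j 0 * 1" using j_bounds(1)[of "lm 0 * x"] assms l by simp
  also have "... <= j 0 * (j (lm 0 * y) / j (lm 0 / 2))" using 1 j_0(1) by (intro mult_left_mono) auto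
  finally have "\<bar>j (lm 0 * x)\<bar> <= j 0 / j (lm 0 / 2) * j (lm 0 * y)" by simp
  hence "\<bar>j (lm 0 * x)\<bar>\<^sup>2 <= (j 0 / j (lm 0 / 2) * j (lm 0 * y))\<^sup>2" by (rule power_mono) simp
  hence "(nc 0)\<^sup>2 * \<bar>j (lm 0 * x)\<bar>\<^sup>2 <= (nc 0)\<^sup>2 * (j 0 / j (lm 0 / 2) * j (lm 0 * y))\<^sup>2"
    by (rule mult_left_mono) simp
  hence "(ph 0 x)\<^sup>2 <= (j 0 / j (lm 0 / 2))\<^sup>2 * (ph 0 y)\<^sup>2"
    by (simp only: ph_def power_mult_distrib power2_abs mult_ac)
  also have "... <= Kt * (ph 0 y)\<^sup>2" by (intro mult_right_mono Kt_ge) simp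
  finally have "x powr alpha * (ph 0 x)\<^sup>2 <= y powr alpha * (Kt * (ph 0 y)\<^sup>2)"
    using assms alpha_nonneg by (intro mult_mono powr_mono2) auto
  thus ?thesis using assms by (simp add: wt_eq mult_ac)
qed

lemma wt_right: assumes "1/2 <= x" "x <= y" "y < 1" shows "wt y <= Kt * wt x"
proof -
  have l: "0 < lm 0" by (rule lm_pos)
  have "j (lm 0 * y) <= j (lm 0 * x)" using assms l by (intro j_antimono) auto
  moreover have "0 < ph 0 y" using assms by (intro ph_pos) auto
  ultimately have 1: "ph 0 y <= ph 0 x" "0 <= ph 0 y" using nc_pos[of 0] by (auto simp: ph_def)
  have "y powr alpha <= (2 * x) powr alpha" using assms alpha_nonneg by (intro powr_mono2) auto
  also have "... = 2 powr alpha * x powr alpha" using assms by (simp add: powr_mult)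
  also have "... <= Kt * x powr alpha" by (intro mult_right_mono Kt_ge) simp
  finally have "y powr alpha * (ph 0 y)\<^sup>2 <= (Kt * x powr alpha) * (ph 0 x)\<^sup>2"
    using 1 by (intro mult_mono power_mono) (auto intro: order_trans[OF powr_ge_zero])
  thus ?thesis using assms by (simp add: wt_eq)
qed

text \<open>By \<open>ph_0_lower\<close> the ground state is at least a multiple of
  \<open>1 - x\<close>, so its logarithmic derivative has at most a simple pole at 1; the pole at 0
  is that of \<open>alpha / x\<close>.\<close>

lemma bt_bound: assumes x: "x \<in> {0<..<1}" shows "\<bar>bt x\<bar> * (x * (1 - x)) <= Kt"
proof -
  have x0: "0 < x" "x < 1" and p: "0 < ph 0 x" using x ph_pos[OF x] by auto
  have l: "0 < lm 0" and n: "0 < nc 0" using lm_pos nc_pos by auto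
  have "\<bar>ph1 0 x\<bar> <= nc 0 * lm 0 * j 0"
    unfolding ph1_def abs_mult using l n j_bounds(2)[of "lm 0 * x"] x0 by (simp add: mult_left_mono)
  hence "\<bar>ph1 0 x\<bar> * (c0 * (1 - x)) <= nc 0 * lm 0 * j 0 * (c0 * (1 - x))"
    using x0 c0(1) by (intro mult_right_mono) auto
  also have "... = nc 0 * (c0 * (lm 0 * (1 - x))) * j 0" by simp
  also have "... <= ph 0 x * j 0" using j_0(1) by (intro mult_right_mono ph_0_lower x) simp
  finally have A: "\<bar>ph1 0 x / ph 0 x\<bar> * (1 - x) <= j 0 / c0"
    using p c0(1) by (simp add: abs_divide field_simps)
  have "\<bar>ph1 0 x / ph 0 x\<bar> * (x * (1 - x)) <= \<bar>ph1 0 x / ph 0 x\<bar> * (1 - x)"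
    using x0 by (intro mult_left_mono) (auto simp: mult_le_cancel_right1)
  with A have A': "\<bar>ph1 0 x / ph 0 x\<bar> * (x * (1 - x)) <= j 0 / c0" by linarith
  have B: "\<bar>alpha / x\<bar> * (x * (1 - x)) <= alpha" using x0 alpha_nonneg by (simp add: mult_left_le)
  have "\<bar>bt x\<bar> <= \<bar>alpha / x\<bar> + 2 * \<bar>ph1 0 x / ph 0 x\<bar>" unfolding bt_def by (rule order_trans[OF abs_triangle_ineq]) (simp add: abs_mult)
  hence "\<bar>bt x\<bar> * (x * (1 - x)) <= (\<bar>alpha / x\<bar> + 2 * \<bar>ph1 0 x / ph 0 x\<bar>) * (x * (1 - x))"
    using x0 by (intro mult_right_mono) auto
  also have "... = \<bar>alpha / x\<bar> * (x * (1 - x)) + 2 * (\<bar>ph1 0 x / ph 0 x\<bar> * (x * (1 - x)))"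
    by (simp only: distrib_right mult.assoc)
  also have "... <= alpha + 2 * (j 0 / c0)" by (rule add_mono[OF B mult_left_mono[OF A']]) simp
  also have "... <= Kt" by (rule Kt_ge)
  finally show ?thesis .
qed

definition Bt :: "nat => real" where "Bt n = j 0 / (c0 * lm 0 * lm 0 powr alpha) * lm n powr (alpha + 1)"

lemma nc_le: "nc n <= nc 0 * (lm n / lm 0) powr alpha"
proof -
  have l: "0 < lm 0" "0 < lm n" using lm_pos by auto
  define s where "s = (lm 0 / lm n) powr alpha"
  have s: "0 < s" "(lm n / lm 0) powr alpha = 1 / s" using l by (simp_all add: s_def powr_divide)
  have "sqrt 2 / \<bar>j1 (lm n)\<bar> <= sqrt 2 / (\<bar>j1 (lm 0)\<bar> * s)"
    using j1_lm_lower[of n] s(1) j1_lm[of 0] j1_lm[of n] unfolding s_def[symmetric]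
    by (intro divide_left_mono mult_pos_pos) auto
  thus ?thesis using s by (simp add: nc_def)
qed

text \<open>Numerator and denominator are compared with multiples of \<open>1 - x\<close>, which
  cancels. Of the exponent of \<open>lm n\<close>, 1 comes from the Lipschitz bound of
  \<open>j\<close> and \<open>alpha\<close> from the normalising constant.\<close>

lemma f0_bound: assumes x: "x \<in> {0<..<1}" shows "\<bar>f0 n x\<bar> <= Bt n"
proof -
  have x0: "0 < x" "x < 1" and p: "0 < ph 0 x" using x ph_pos[OF x] by auto
  have l: "0 < lm 0" "0 < lm n" and nn: "0 < nc 0" using lm_pos nc_pos by auto
  have q: "lm n powr (alpha + 1) = lm n powr alpha * lm n" using l by (simp add: powr_add)
  have "\<bar>f0 n x\<bar> = \<bar>ph n x\<bar> / ph 0 x" using f0_eq[OF x0(1)] p by (simp add: abs_divide)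
  also have "... <= (nc n * (j 0 * (lm n * (1 - x)))) / (nc 0 * (c0 * (lm 0 * (1 - x))))"
    using ph_upper[OF x, of n] ph_0_lower[OF x] x0 l nn c0(1) by (intro frac_le) (auto intro: order_trans[OF abs_ge_zero])
  also have "... = nc n * (j 0 * lm n / (nc 0 * (c0 * lm 0)))" using x0 by simp
  also have "... <= (nc 0 * (lm n / lm 0) powr alpha) * (j 0 * lm n / (nc 0 * (c0 * lm 0)))"
    using l nn c0(1) j_0(1) by (intro mult_right_mono nc_le) auto
  also have "... = Bt n" using l nn by (simp add: Bt_def q powr_divide mult_ac)
  finally show ?thesis .
qed

lemma wt_f1: assumes "0 < x" "x < 1" shows "wt x * f1 n x = x powr alpha * wr n x"
  using assms ph_pos[of x] by (simp add: wt_eq f1_def)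

lemma wt_f1_le: assumes "0 < x" "x < 1" shows "\<bar>wt x * f1 n x\<bar> <= \<bar>wr n x\<bar>"
proof -
  have "x powr alpha <= 1" using assms alpha_nonneg powr_mono2[of alpha x 1] by simp
  hence "x powr alpha * \<bar>wr n x\<bar> <= 1 * \<bar>wr n x\<bar>" by (rule mult_right_mono) simp
  thus ?thesis unfolding wt_f1[OF assms] by (simp add: abs_mult)
qed

lemma isCont_ph: "isCont (ph n) x" "isCont (ph1 n) x"
  using ph_deriv[THEN DERIV_isCont] by auto

text \<open>The ground state cancels in \<open>wt * f1 n\<close>, leaving
  \<open>x powr alpha\<close> times the Wronskian. The latter is 0 at both ends, since
  \<open>ph1\<close> vanishes at 0 and \<open>ph\<close> at 1.\<close>

lemma wt_f1_tendsto: "((%x. wt x * f1 n x) ---> 0) (at_right 0)" "((%x. wt x * f1 n x) ---> 0) (at_left 1)"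
proof -
  have "isCont (%x. \<bar>wr n x\<bar>) x" for x unfolding wr_def[abs_def] by (intro continuous_intros isCont_ph)
  from this[of 0] this[of 1] have c: "((%x. \<bar>wr n x\<bar>) ---> 0) (at_right 0)" "((%x. \<bar>wr n x\<bar>) ---> 0) (at_left 1)"
    by (simp_all add: isCont_def filterlim_at_split wr_def ph_0 ph_1)
  show "((%x. wt x * f1 n x) ---> 0) (at_right 0)" by (rule Lim_null_comparison[OF _ c(1)])
       (auto simp: eventually_at_right[of 0 1] wt_f1_le intro!: exI[of _ "1::real"])
  show "((%x. wt x * f1 n x) ---> 0) (at_left 1)" by (rule Lim_null_comparison[OF _ c(2)])
       (auto simp: eventually_at_left[of 0 1] wt_f1_le intro!: exI[of _ "0::real"])
qed

lemma lm_at_top: "filterlim lm at_top sequentially"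
proof (rule filterlim_at_top_mono)
  show "filterlim (%n. 2 powr - alpha * real (Suc n)) at_top sequentially"
    by (intro filterlim_tendsto_pos_mult_at_top[OF tendsto_const] filterlim_compose[OF filterlim_real_sequentially filterlim_Suc]) simp
qed (simp add: lm_growth del: of_nat_Suc)

lemma summable_Bt: assumes t: "0 < t" shows "summable (%n. exp (- (lm n)\<^sup>2 * t) * (Bt n)\<^sup>2)"
proof -
  \<comment> \<open>An integer exponent that covers \<open>(lm n powr (alpha + 1))^2\<close> with
    one factor \<open>(lm n)^2\<close> to spare; dividing by this factor leaves a multiple of the
    summable \<open>1 / (n + 1)^2\<close>, by \<open>lm_growth\<close>.\<close>
  define k where "k = nat \<lceil>alpha + 2\<rceil>"
  have k: "alpha + 2 <= real k" "0 < k" using alpha_nonneg unfolding k_def by linarith+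
  define A where "A = (j 0 / (c0 * lm 0 * lm 0 powr alpha))\<^sup>2"
  define C where "C = A * (real k / t) ^ k / (2 powr - alpha)\<^sup>2"
  have le: "exp (- (lm n)\<^sup>2 * t) * (Bt n)\<^sup>2 <= C * (1 / real (Suc n) ^ 2)" for n proof -
    have l: "1 <= lm n" by (rule lm_pos)
    define s where "s = (lm n)\<^sup>2"
    have s: "1 <= s" using l by (simp add: s_def one_le_power)
    have "(lm n powr (alpha + 1))\<^sup>2 = s powr (alpha + 1)"
      unfolding s_def using l powr_powr[of "lm n" 2 "alpha + 1"] powr_powr[of "lm n" "alpha + 1" 2] by (simp add: mult.commute)
    also have "... * s = s powr (alpha + 2)" using s powr_add[of s "alpha + 1" 1] by (simp add: add.assoc)
    also have "... <= s powr real k" using s k by (intro powr_mono) auto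
    also have "... = s ^ k" using s by (simp add: powr_realpow)
    finally have 1: "(lm n powr (alpha + 1))\<^sup>2 * s <= s ^ k" by simp
    have "(s * t / real k) ^ k <= (exp (s * t / real k)) ^ k" proof (rule power_mono)
      show "s * t / real k <= exp (s * t / real k)" using exp_ge_add_one_self[of "s * t / real k"] by linarith
      show "0 <= s * t / real k" using s t by simp
    qed
    also have "... = exp (s * t)" using k by (simp add: exp_of_nat_mult[symmetric])
    finally have "s ^ k * (t / real k) ^ k <= exp (s * t)" by (simp add: power_mult_distrib power_divide)
    hence "exp (- (s * t)) * s ^ k <= (real k / t) ^ k"
      using t k by (simp add: exp_minus power_divide field_simps)
    moreover have "exp (- (s * t)) * ((lm n powr (alpha + 1))\<^sup>2 * s) <= exp (- (s * t)) * s ^ k"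
      by (rule mult_left_mono[OF 1]) simp
    ultimately have "exp (- (s * t)) * (lm n powr (alpha + 1))\<^sup>2 * s <= (real k / t) ^ k" unfolding mult.assoc by (rule order_trans[rotated])
    hence "exp (- (s * t)) * (lm n powr (alpha + 1))\<^sup>2 <= (real k / t) ^ k / s"
      by (subst pos_le_divide_eq) (use s in simp_all)
    also have "... <= (real k / t) ^ k / (2 powr - alpha * real (Suc n))\<^sup>2"
    proof (rule divide_left_mono)
      show "(2 powr - alpha * real (Suc n))\<^sup>2 <= s" unfolding s_def by (rule power_mono[OF lm_growth]) simp
      have "0 < 2 powr - alpha * real (Suc n)" by simp
      thus "0 < s * (2 powr - alpha * real (Suc n))\<^sup>2" using s by simp
    qed (use t in simp)
    finally have "A * (exp (- (s * t)) * (lm n powr (alpha + 1))\<^sup>2) <= A * ((real k / t) ^ k / (2 powr - alpha * real (Suc n))\<^sup>2)"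
      by (rule mult_left_mono) (simp add: A_def)
    moreover have "exp (- (lm n)\<^sup>2 * t) * (Bt n)\<^sup>2 = A * (exp (- (s * t)) * (lm n powr (alpha + 1))\<^sup>2)"
      unfolding Bt_def power_mult_distrib A_def[symmetric] s_def by simp
    moreover have "A * ((real k / t) ^ k / (2 powr - alpha * real (Suc n))\<^sup>2) = C * (1 / real (Suc n) ^ 2)"
      by (simp add: C_def power_mult_distrib)
    ultimately show ?thesis by simp
  qed
  have "summable (%n. 1 / real n ^ 2)" using inverse_power_summable[of 2, where 'a = real] by (simp add: inverse_eq_divide)
  hence "summable (%n. 1 / real (Suc n) ^ 2)" by (subst summable_Suc_iff[where f = "%n. 1 / real n ^ 2"])
  hence "summable (%n. C * (1 / real (Suc n) ^ 2))" by (rule summable_mult)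
  thus ?thesis by (rule summable_comparison_test'[where N = 0]) (use le in simp)
qed

lemma f0_zeros: "bij_betw (%y. y / lm n) {y \<in> zs. y < lm n} {x \<in> {0<..<1}. f0 n x = 0}"
proof (rule bij_betw_byWitness[where f' = "%x. lm n * x"])
  have l: "0 < lm n" by (rule lm_pos)
  have z: "f0 n x = 0 \<longleftrightarrow> j (lm n * x) = 0" if "0 < x" "x < 1" for x proof -
    have "ph 0 x ~= 0" "nc n ~= 0" using ph_pos[of x] that nc_pos[of n] by auto
    thus ?thesis unfolding f0_eq[OF that(1)] by (simp add: ph_def[of n])
  qed
  show "\<forall>y\<in>{y \<in> zs. y < lm n}. lm n * (y / lm n) = y" "\<forall>x\<in>{x \<in> {0<..<1}. f0 n x = 0}. lm n * x / lm n = x"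
    using l by auto
  show "(%y. y / lm n) ` {y \<in> zs. y < lm n} \<subseteq> {x \<in> {0<..<1}. f0 n x = 0}"
    using l by (auto simp: zs_def z)
  show "(%x. lm n * x) ` {x \<in> {0<..<1}. f0 n x = 0} \<subseteq> {y \<in> zs. y < lm n}"
    using l by (auto simp: zs_def z)
qed

lemma f0_zeros_simple: assumes "x \<in> {0<..<1}" "f0 n x = 0" shows "f1 n x ~= 0"
proof -
  have x: "0 < x" "x < 1" and p: "0 < ph 0 x" using assms ph_pos by auto
  have z: "ph n x = 0" using f0_eq[OF x(1)] assms p by simp
  hence "lm n * x \<in> zs" using nc_pos[of n] lm_pos[of n] x by (simp add: zs_def ph_def)
  hence "ph1 n x ~= 0" using zs_simple nc_pos[of n] lm_pos[of n] by (simp add: ph1_def)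
  thus ?thesis using p z by (simp add: f1_def wr_def)
qed

lemma tendsto_nonzero_lower:
  fixes f :: "real => real"
  assumes "(f ---> L) F" "L ~= 0" shows "\<exists>c>0. \<forall>\<^sub>F x in F. c <= \<bar>f x\<bar>"
proof -
  have "\<forall>\<^sub>F x in F. \<bar>L\<bar> / 2 < \<bar>f x\<bar>" using tendsto_rabs[OF assms(1)] by (rule order_tendstoD) (use assms in simp)
  hence "\<forall>\<^sub>F x in F. \<bar>L\<bar> / 2 <= \<bar>f x\<bar>" by eventually_elim simp
  thus ?thesis using assms(2) by (intro exI[of _ "\<bar>L\<bar> / 2"]) simp
qed

lemma f0_ends: "\<exists>c>0. \<forall>\<^sub>F x in at_right 0. c <= \<bar>f0 n x\<bar>" "\<exists>c>0. \<forall>\<^sub>F x in at_left 1. c <= \<bar>f0 n x\<bar>"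
proof -
  have r: "(ph m ---> ph m 0) (at_right 0)" for m
    using isCont_ph(1)[where n = m and x = 0] by (simp add: isCont_def filterlim_at_split)
  have "((%x. ph n x / ph 0 x) ---> ph n 0 / ph 0 0) (at_right 0)"
    by (rule tendsto_divide[OF r r]) (use ph_0(2)[of 0] in simp)
  hence "(f0 n ---> ph n 0 / ph 0 0) (at_right 0)"
    by (rule Lim_transform_eventually) (auto simp: eventually_at_right[of 0 1] f0_eq intro!: exI[of _ "1::real"])
  thus "\<exists>c>0. \<forall>\<^sub>F x in at_right 0. c <= \<bar>f0 n x\<bar>"
    by (rule tendsto_nonzero_lower) (use ph_0(2)[of n] ph_0(2)[of 0] in simp)
  \<comment> \<open>At 1 both functions vanish, so the quotient is taken through difference
    quotients and tends to a ratio of nonzero slopes.\<close>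
  have d: "((%x. ph m x / (x - 1)) ---> ph1 m 1) (at_left 1)" for m
    using ph_deriv(1)[of m 1] by (simp add: has_field_derivative_iff filterlim_at_split ph_1)
  have "((%x. (ph n x / (x - 1)) / (ph 0 x / (x - 1))) ---> ph1 n 1 / ph1 0 1) (at_left 1)"
    by (rule tendsto_divide[OF d d ph_1(2)])
  hence "(f0 n ---> ph1 n 1 / ph1 0 1) (at_left 1)"
    by (rule Lim_transform_eventually) (auto simp: eventually_at_left[of 0 1] f0_eq intro!: exI[of _ "0::real"])
  thus "\<exists>c>0. \<forall>\<^sub>F x in at_left 1. c <= \<bar>f0 n x\<bar>"
    by (rule tendsto_nonzero_lower) (use ph_1(2) in simp)
qed

lemma f0_norm: "(\<integral>x. (f0 n x)\<^sup>2 \<partial>density (restrict_space lborel {0<..<1}) (%x. ennreal (wt x))) = 1"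
proof -
  have m: "f \<in> borel_measurable (restrict_space lborel {0<..<1})" if "continuous_on {0<..<1} f" for f :: "real => real"
    using borel_measurable_continuous_on_restrict[OF that]
    by (simp add: measurable_def sets_restrict_space space_restrict_space)
  have cw: "continuous_on {0<..<1} wt" by (rule DERIV_cont_on[OF wt_deriv]) auto
  have cf: "continuous_on {0<..<1} (%x. (f0 n x)\<^sup>2)"
    by (intro continuous_on_power DERIV_cont_on[OF f0_deriv]) auto
  have nn: "AE x in restrict_space lborel {0<..<1}. 0 <= wt x"
    by (intro AE_I2) (auto simp: space_restrict_space wt_eq)
  have "(\<integral>x. (f0 n x)\<^sup>2 \<partial>density (restrict_space lborel {0<..<1}) (%x. ennreal (wt x)))
      = (LINT x:{0<..<1}|lborel. wt x * (f0 n x)\<^sup>2)" unfolding set_lebesgue_integral_def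
    by (subst integral_density[OF m[OF cf] m[OF cw] nn]) (simp add: integral_restrict_space)
  also have "... = (LINT x:{0<..<1}|lborel. x powr alpha * (ph n x)\<^sup>2)"
  proof (rule set_lebesgue_integral_cong)
    have "wt x * (f0 n x)\<^sup>2 = x powr alpha * (ph n x)\<^sup>2" if "x \<in> {0<..<1}" for x
      using that ph_pos[OF that] by (simp add: wt_eq f0_eq power_divide)
    thus "\<forall>x. x \<in> {0<..<1} --> wt x * (f0 n x)\<^sup>2 = x powr alpha * (ph n x)\<^sup>2" by blast
  qed simp
  finally show ?thesis by (simp only: ph_integral)
qed

lemma wt_pos: "x \<in> {0<..<1} ==> 0 < wt x" using ph_pos[of x] by (simp add: wt_eq)

lemma f_ode: "x \<in> {0<..<1} ==> f2 n x + bt x * f1 n x = - ((lm n)\<^sup>2 - (lm 0)\<^sup>2) * f0 n x"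
  by (simp add: f2_def)

lemma f0_0: "x \<in> {0<..<1} ==> f0 0 x = 1" using ph_pos[of x] by (simp add: f0_eq)

lemma f0_zeros_card: "finite {x \<in> {0<..<1}. f0 n x = 0}" "card {x \<in> {0<..<1}. f0 n x = 0} = n"
proof -
  have "finite {y \<in> zs. y < lm n}" by (rule finite_subset[OF _ zs_finite[of "lm n"]]) auto
  thus "finite {x \<in> {0<..<1}. f0 n x = 0}" using bij_betw_finite[OF f0_zeros] by blast
  show "card {x \<in> {0<..<1}. f0 n x = 0} = n"
    using bij_betw_same_card[OF f0_zeros, of n] card_below_lm[of n] by simp
qed

sublocale sturm wt bt rt f0 f1 f2 lm Bt Kt
  by unfold_locales (fact wt_pos wt_deriv bt_deriv rt_nonneg wt_left wt_right bt_bound f0_deriv f1_deriv f_ode f0_0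
    f0_bound wt_f1_tendsto lm_pos(1) lm_strict_mono lm_at_top summable_Bt f0_zeros_card f0_zeros_simple f0_ends f0_norm)+

lemma M_eq: "M = fb_eta \<nu>" unfolding M_def fb_eta_def wt_def ..

lemma pk_eq_potential_kernel: "pk x y = potential_kernel \<nu> (1/2) x y"
  by (simp add: pk_def potential_kernel_def hk_def heat_kernel_def f0_def lm_def)

end

section \<open>Vector values and the main theorem\<close>

lemma integrable_componentwise:
  fixes f :: "'b => 'a::euclidean_space"
  shows "integrable M f \<longleftrightarrow> (\<forall>i\<in>Basis. integrable M (%x. f x \<bullet> i))"
proof
  assume "\<forall>i\<in>Basis. integrable M (%x. f x \<bullet> i)"
  hence "integrable M (%x. \<Sum>i\<in>Basis. (f x \<bullet> i) *\<^sub>R i)"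
    by (intro Bochner_Integration.integrable_sum integrable_scaleR_left) auto
  thus "integrable M f" by (simp add: euclidean_representation)
qed auto

lemma norm_powr_le_components:
  fixes v :: "'a::euclidean_space"
  assumes p: "0 < p"
  shows "norm v powr p <= real DIM('a) powr p * (\<Sum>i\<in>Basis. \<bar>v \<bullet> i\<bar> powr p)"
proof -
  obtain m :: 'a where m: "m \<in> Basis" "!!i. i \<in> Basis ==> \<bar>v \<bullet> i\<bar> <= \<bar>v \<bullet> m\<bar>"
  proof -
    have "Max ((%i. \<bar>v \<bullet> i\<bar>) ` Basis) \<in> (%i. \<bar>v \<bullet> i\<bar>) ` Basis" by (intro Max_in) auto
    then obtain m where m: "m \<in> Basis" "Max ((%i. \<bar>v \<bullet> i\<bar>) ` Basis) = \<bar>v \<bullet> m\<bar>" by blast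
    have "\<bar>v \<bullet> i\<bar> <= \<bar>v \<bullet> m\<bar>" if "i \<in> Basis" for i using that by (subst m(2)[symmetric]) auto
    thus thesis using that m(1) by blast
  qed
  have "norm v <= (\<Sum>i\<in>Basis. \<bar>v \<bullet> i\<bar>)" by (rule norm_le_l1)
  also have "... <= real DIM('a) * \<bar>v \<bullet> m\<bar>" using m(2) by (rule sum_bounded_above)
  finally have "norm v powr p <= (real DIM('a) * \<bar>v \<bullet> m\<bar>) powr p" using p by (intro powr_mono2) auto
  also have "... = real DIM('a) powr p * \<bar>v \<bullet> m\<bar> powr p" by (simp add: powr_mult)
  also have "... <= real DIM('a) powr p * (\<Sum>i\<in>Basis. \<bar>v \<bullet> i\<bar> powr p)"
    using m(1) by (intro mult_left_mono member_le_sum[of m Basis "%i. \<bar>v \<bullet> i\<bar> powr p"]) auto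
  finally show ?thesis .
qed

lemma Lp_component:
  fixes f :: "'b => 'a::euclidean_space"
  assumes f: "f \<in> Lp_space M p" and p: "0 < p" and i: "i \<in> Basis"
  shows "(%x. f x \<bullet> i) \<in> Lp_space M p" "Lp_int M p (%x. f x \<bullet> i) <= Lp_int M p f"
proof -
  have m: "(%x. f x \<bullet> i) \<in> borel_measurable M"
    using Lp_spaceD(1)[OF f] i borel_measurable_euclidean_space by blast
  have "AE x in M. norm (f x \<bullet> i) powr p <= norm (f x) powr p"
    using i p by (intro AE_I2 powr_mono2) (auto simp: Basis_le_norm)
  from Lp_space_dominated[OF m Lp_spaceD(2)[OF f] this]
  show "(%x. f x \<bullet> i) \<in> Lp_space M p" "Lp_int M p (%x. f x \<bullet> i) <= Lp_int M p f" .
qed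

lemma Lp_componentI:
  fixes f :: "'b => 'a::euclidean_space"
  assumes f: "!!i. i \<in> Basis ==> (%x. f x \<bullet> i) \<in> Lp_space M p" and p: "0 < p"
    and le: "!!i. i \<in> Basis ==> Lp_int M p (%x. f x \<bullet> i) <= C"
  shows "f \<in> Lp_space M p" "Lp_int M p f <= real DIM('a) powr p * (real DIM('a) * C)"
proof -
  have m: "f \<in> borel_measurable M" using Lp_spaceD(1)[OF f] borel_measurable_euclidean_space by blast
  have i: "integrable M (%x. real DIM('a) powr p * (\<Sum>i\<in>Basis. \<bar>f x \<bullet> i\<bar> powr p))"
    using Lp_spaceD(2)[OF f] by (intro integrable_mult_right Bochner_Integration.integrable_sum) simp
  have ae: "AE x in M. norm (f x) powr p <= real DIM('a) powr p * (\<Sum>i\<in>Basis. \<bar>f x \<bullet> i\<bar> powr p)"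
    by (intro AE_I2 norm_powr_le_components p)
  show "f \<in> Lp_space M p" by (rule Lp_space_dominated(1)[OF m i ae])
  have "Lp_int M p f <= (LINT x|M. real DIM('a) powr p * (\<Sum>i\<in>Basis. \<bar>f x \<bullet> i\<bar> powr p))"
    by (rule Lp_space_dominated(2)[OF m i ae])
  also have "... = real DIM('a) powr p * (\<Sum>i\<in>Basis. Lp_int M p (%x. f x \<bullet> i))"
    using Lp_spaceD(2)[OF f] by (simp add: Bochner_Integration.integral_sum)
  also have "... <= real DIM('a) powr p * (real DIM('a) * C)"
    by (intro mult_left_mono sum_bounded_above le) auto
  finally show "Lp_int M p f <= real DIM('a) powr p * (real DIM('a) * C)" .
qed

lemma locally_integrable_componentwise:
  fixes f :: "real => 'a::euclidean_space"
  shows "locally_integrable f \<longleftrightarrow> (\<forall>i\<in>Basis. locally_integrable (%x. f x \<bullet> i))"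
proof -
  have "set_integrable lborel A f \<longleftrightarrow> (\<forall>i\<in>Basis. set_integrable lborel A (%x. f x \<bullet> i))" for A
    unfolding set_integrable_def by (subst integrable_componentwise) simp
  thus ?thesis unfolding locally_integrable_def by blast
qed

lemma set_integral_inner:
  fixes f :: "real => 'a::euclidean_space"
  assumes "set_integrable lborel A f"
  shows "(LINT x:A|lborel. f x \<bullet> i) = (LINT x:A|lborel. f x) \<bullet> i"
  using integral_inner_left[of i lborel "%x. indicator A x *\<^sub>R f x"] assms
  unfolding set_integrable_def set_lebesgue_integral_def by simp

lemma has_weak_deriv_componentwise:
  fixes f g :: "real => 'a::euclidean_space"
  shows "has_weak_deriv f g \<longleftrightarrow> (\<forall>i\<in>Basis. has_weak_deriv (%x. f x \<bullet> i) (%x. g x \<bullet> i))"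
proof -
  have eq: "(LINT x:{0<..<1}|lborel. deriv psi x *\<^sub>R f x) = - (LINT x:{0<..<1}|lborel. psi x *\<^sub>R g x) \<longleftrightarrow>
      (\<forall>i\<in>Basis. (LINT x:{0<..<1}|lborel. deriv psi x *\<^sub>R (f x \<bullet> i)) = - (LINT x:{0<..<1}|lborel. psi x *\<^sub>R (g x \<bullet> i)))"
    if f: "locally_integrable f" and g: "locally_integrable g" and psi: "test_function psi" for psi
    using set_integral_inner[OF locally_integrable_test[OF f test_function_derivI[OF psi]]]
      set_integral_inner[OF locally_integrable_test[OF g psi]] by (subst euclidean_eq_iff) simp
  show ?thesis proof
    assume "has_weak_deriv f g"
    thus "\<forall>i\<in>Basis. has_weak_deriv (%x. f x \<bullet> i) (%x. g x \<bullet> i)"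
      unfolding has_weak_deriv_def using eq locally_integrable_componentwise[of f] locally_integrable_componentwise[of g]
      by blast
  next
    assume wd: "\<forall>i\<in>Basis. has_weak_deriv (%x. f x \<bullet> i) (%x. g x \<bullet> i)"
    hence l: "locally_integrable f" "locally_integrable g"
      unfolding has_weak_deriv_def using locally_integrable_componentwise[of f] locally_integrable_componentwise[of g]
      by blast+
    show "has_weak_deriv f g"
      unfolding has_weak_deriv_def using l wd eq[OF l] unfolding has_weak_deriv_def by blast
  qed
qed

lemma AE_componentwise:
  fixes f g :: "'b => 'a::euclidean_space"
  assumes "!!i. i \<in> Basis ==> AE x in M. f x \<bullet> i = g x \<bullet> i"
  shows "AE x in M. f x = g x"
proof -
  have "AE x in M. \<forall>i\<in>Basis. f x \<bullet> i = g x \<bullet> i" using assms by (intro AE_finite_allI) auto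
  thus ?thesis by eventually_elim (rule euclidean_eqI, blast)
qed

lemma has_weak_deriv_unique:
  fixes f g g' :: "real => 'a::euclidean_space"
  assumes "has_weak_deriv f g" "has_weak_deriv f g'"
  shows "AE x in lborel. x \<in> {0<..<1} --> g x = g' x"
proof -
  have "AE x in lborel. x \<in> {0<..<1} --> g x \<bullet> i - g' x \<bullet> i = 0" if i: "i \<in> Basis" for i
  proof (rule AE_zero_of_test)
    have wd: "has_weak_deriv (%x. f x \<bullet> i) (%x. g x \<bullet> i)" "has_weak_deriv (%x. f x \<bullet> i) (%x. g' x \<bullet> i)"
      using assms i unfolding has_weak_deriv_componentwise[of f] by auto
    hence l: "locally_integrable (%x. g x \<bullet> i)" "locally_integrable (%x. g' x \<bullet> i)"
      unfolding has_weak_deriv_def by auto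
    thus "locally_integrable (%x. g x \<bullet> i - g' x \<bullet> i)"
      unfolding locally_integrable_def by auto
    fix psi assume psi: "test_function psi"
    have "(LINT x:{0<..<1}|lborel. psi x *\<^sub>R (g x \<bullet> i - g' x \<bullet> i))
        = (LINT x:{0<..<1}|lborel. psi x *\<^sub>R (g x \<bullet> i)) - (LINT x:{0<..<1}|lborel. psi x *\<^sub>R (g' x \<bullet> i))"
      unfolding scaleR_diff_right
      by (rule set_integral_diff(2)[OF locally_integrable_test[OF l(1) psi] locally_integrable_test[OF l(2) psi]])
    thus "(LINT x:{0<..<1}|lborel. psi x *\<^sub>R (g x \<bullet> i - g' x \<bullet> i)) = 0"
      using wd psi unfolding has_weak_deriv_def by simp
  qed
  hence "AE x in lborel. \<forall>i\<in>Basis. x \<in> {0<..<1} --> g x \<bullet> i - g' x \<bullet> i = 0"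
    by (intro AE_finite_allI) auto
  thus ?thesis by eventually_elim (rule impI, rule euclidean_eqI, simp)
qed

text \<open>A pointwise limit of restrictions to compact subintervals. It is applied to
  \<open>weak_deriv f\<close>, an arbitrary choice of which only local integrability is
  known.\<close>

lemma (in unit_interval_measure) locally_integrable_measurable:
  fixes f :: "real => 'a::euclidean_space"
  assumes "locally_integrable f" shows "f \<in> borel_measurable M"
proof -
  define A where "A n = {inverse (real n + 2)..1 - inverse (real n + 2)}" for n :: nat
  have "(%x. indicator {0<..<1} x *\<^sub>R f x) \<in> borel_measurable borel"
  proof (rule borel_measurable_LIMSEQ_metric)
    show "(%x. indicator (A n) x *\<^sub>R f x) \<in> borel_measurable borel" for n proof -
      have "set_integrable lborel (A n) f" using assms unfolding locally_integrable_def A_def by simp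
      from borel_measurable_integrable[OF this[unfolded set_integrable_def]] show ?thesis by simp
    qed
    show "(%n. indicator (A n) x *\<^sub>R f x) ----> indicator {0<..<1} x *\<^sub>R f x" for x
    proof (cases "x \<in> {0<..<1}")
      case True
      have t: "(%n. inverse (real n + 2)) ----> 0"
        using LIMSEQ_ignore_initial_segment[OF LIMSEQ_inverse_real_of_nat, of 1] by (simp add: add.commute)
      have "\<forall>\<^sub>F n in sequentially. inverse (real n + 2) < min x (1 - x)"
        using True by (intro order_tendstoD(2)[OF t]) auto
      hence "\<forall>\<^sub>F n in sequentially. indicator (A n) x *\<^sub>R f x = indicator {0<..<1} x *\<^sub>R f x"
        by eventually_elim (use True in \<open>auto simp: A_def indicator_def\<close>)
      thus ?thesis by (rule tendsto_eventually)
    next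
      case False
      have "x \<notin> A n" for n proof
        assume "x \<in> A n"
        hence "inverse (real n + 2) <= x" "x <= 1 - inverse (real n + 2)" by (auto simp: A_def)
        moreover have "0 < inverse (real n + 2)" by simp
        ultimately have "0 < x" "x < 1" by linarith+
        thus False using False by simp
      qed
      thus ?thesis using False by (auto simp: indicator_def)
    qed
  qed
  hence "f \<in> borel_measurable (restrict_space borel {0<..<1})"
    by (subst borel_measurable_restrict_space_iff) auto
  thus ?thesis unfolding measurable_cong_sets[OF sets_M refl] .
qed

section \<open>The two spaces for vector-valued functions\<close>

context bessel
begin

text \<open>The components may be taken inside only where the vector integrand is integrable, which
  holds almost everywhere. Elsewhere the vector integral has the default value 0, while the integral
  of a component may be anything.\<close>

lemma potential_op_component:
  fixes g :: "real => 'a::euclidean_space"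
  assumes g: "g \<in> Lp_space M p" and p: "1 < p"
  shows "AE x in M. \<forall>i\<in>Basis. potential_op \<nu> (1 / 2) g x \<bullet> i = Io (%y. g y \<bullet> i) x"
proof -
  have "AE x in M. \<forall>i\<in>Basis. integrable M (%y. pk x y * (g y \<bullet> i))"
    using p g by (intro AE_finite_allI Io_integrable Lp_component) auto
  thus ?thesis proof eventually_elim
    case (elim x)
    hence "integrable M (%y. pk x y *\<^sub>R g y)" by (subst integrable_componentwise) simp
    from integral_inner_left[OF this]
    have "(LINT y|M. pk x y *\<^sub>R g y) \<bullet> i = (LINT y|M. pk x y *\<^sub>R g y \<bullet> i)" for i by (rule sym)
    thus ?case by (simp add: potential_op_def Io_def pk_eq_potential_kernel M_eq)
  qed
qed

lemma is_potential_of_iff: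
  fixes f h :: "real => 'a::euclidean_space"
  assumes p: "1 < p"
  shows "is_potential_of \<nu> p 1 f h \<longleftrightarrow>
    h \<in> Lp_space M p & (\<forall>i\<in>Basis. AE x in M. f x \<bullet> i = Io (%y. h y \<bullet> i) x)"
proof (cases "h \<in> Lp_space M p")
  case True
  note * = potential_op_component[OF True p]
  have "(AE x in M. f x = potential_op \<nu> (1 / 2) h x) \<longleftrightarrow>
      (\<forall>i\<in>Basis. AE x in M. f x \<bullet> i = Io (%y. h y \<bullet> i) x)" proof
    assume "AE x in M. f x = potential_op \<nu> (1 / 2) h x"
    hence "AE x in M. \<forall>i\<in>Basis. f x \<bullet> i = Io (%y. h y \<bullet> i) x" using * by eventually_elim simp
    thus "\<forall>i\<in>Basis. AE x in M. f x \<bullet> i = Io (%y. h y \<bullet> i) x"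
      by (auto elim: eventually_mono)
  next
    assume "\<forall>i\<in>Basis. AE x in M. f x \<bullet> i = Io (%y. h y \<bullet> i) x"
    hence "AE x in M. \<forall>i\<in>Basis. f x \<bullet> i = Io (%y. h y \<bullet> i) x" by (intro AE_finite_allI) auto
    thus "AE x in M. f x = potential_op \<nu> (1 / 2) h x"
      using * by eventually_elim (rule euclidean_eqI, simp)
  qed
  with True show ?thesis unfolding is_potential_of_def M_eq[symmetric] by simp
qed (simp add: is_potential_of_def M_eq[symmetric])

lemma is_potential_of_unique:
  fixes f h h' :: "real => 'a::euclidean_space"
  assumes p: "1 < p" and h: "is_potential_of \<nu> p 1 f h" "is_potential_of \<nu> p 1 f h'"
  shows "AE x in M. h x = h' x"
proof (rule AE_componentwise)
  fix i :: 'a assume i: "i \<in> Basis"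
  have L: "h \<in> Lp_space M p" "h' \<in> Lp_space M p"
    and e: "AE x in M. f x \<bullet> i = Io (%y. h y \<bullet> i) x" "AE x in M. f x \<bullet> i = Io (%y. h' y \<bullet> i) x"
    using h i unfolding is_potential_of_iff[OF p] by auto
  show "AE x in M. h x \<bullet> i = h' x \<bullet> i" proof (rule Io_injective[OF _ _ p])
    show "(%x. h x \<bullet> i) \<in> Lp_space M p" "(%x. h' x \<bullet> i) \<in> Lp_space M p" using L i p by (auto intro: Lp_component)
    show "AE x in M. Io (%x. h x \<bullet> i) x = Io (%x. h' x \<bullet> i) x" using e by eventually_elim simp
  qed
qed

text \<open>The preimage picked by \<open>SOME\<close> agrees with \<open>h\<close> almost
  everywhere, by injectivity of the potential operator.\<close>

lemma potential_norm_eq: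
  fixes f h :: "real => 'a::euclidean_space"
  assumes p: "1 < p" and h: "is_potential_of \<nu> p 1 f h"
  shows "potential_norm \<nu> p 1 f = Lp_int M p h powr (1 / p)"
proof -
  define h' where "h' = (SOME h. is_potential_of \<nu> p 1 f h)"
  have h': "is_potential_of \<nu> p 1 f h'" unfolding h'_def using h by (rule someI[where P = "is_potential_of \<nu> p 1 f"])
  have "h \<in> Lp_space M p" "h' \<in> borel_measurable M"
    using h h' Lp_spaceD(1) unfolding is_potential_of_iff[OF p] by auto
  from Lp_cong_AE(2)[OF this is_potential_of_unique[OF p h h']]
  show ?thesis by (simp add: potential_norm_def Lp_norm_def h'_def M_eq)
qed

text \<open>The weak derivative picked by \<open>SOME\<close> is measurable and agrees with
  \<open>g\<close> almost everywhere.\<close>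

lemma sobolev_norm_eq:
  fixes f g :: "real => 'a::euclidean_space"
  assumes g: "g \<in> Lp_space M p" and wd: "has_weak_deriv f g"
  shows "sobolev_norm \<nu> p f = Lp_int M p f powr (1 / p) + Lp_int M p g powr (1 / p)"
proof -
  have wd': "has_weak_deriv f (weak_deriv f)" unfolding weak_deriv_def using wd by (rule someI[where P = "has_weak_deriv f"])
  hence "weak_deriv f \<in> borel_measurable M"
    unfolding has_weak_deriv_def using locally_integrable_measurable by blast
  moreover have "AE x in M. g x = weak_deriv f x"
    using has_weak_deriv_unique[OF wd wd'] by (simp only: AE_M_iff)
  ultimately have "Lp_int M p (weak_deriv f) = Lp_int M p g" by (rule Lp_cong_AE(2)[OF g])
  thus ?thesis by (simp add: sobolev_norm_def Lp_norm_def M_eq)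
qed

lemma sobolev_to_potential:
  assumes p: "1 < p"
  shows "\<exists>C>0. \<forall>f g :: real => 'a::euclidean_space. f \<in> Lp_space M p --> g \<in> Lp_space M p --> has_weak_deriv f g -->
    (\<exists>h. is_potential_of \<nu> p 1 f h & Lp_int M p h <= C * (Lp_int M p f + Lp_int M p g))" proof -
  have p0: "0 < p" using p by simp
  obtain C where C: "0 < C" "!!f g. f \<in> Lp_space M p ==> g \<in> Lp_space M p ==> has_weak_deriv f g ==>
    \<exists>h\<in>Lp_space M p. (AE x in M. f x = Io h x) & Lp_int M p h <= C * (Lp_int M p f + Lp_int M p g)"
    using weak_deriv_Io[OF p] by blast
  \<comment> \<open>The dimension enters through \<open>Lp_componentI\<close>, which reassembles the
    components.\<close>
  define D where "D = real DIM('a) powr p * (real DIM('a) * C)"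
  have D: "0 < D" using C(1) by (simp add: D_def)
  have "\<exists>h. is_potential_of \<nu> p 1 f h & Lp_int M p h <= D * (Lp_int M p f + Lp_int M p g)"
    if f: "f \<in> Lp_space M p" and g: "g \<in> Lp_space M p" and wd: "has_weak_deriv f g" for f g :: "real => 'a"
  proof -
    define T where "T = C * (Lp_int M p f + Lp_int M p g)"
    have "\<exists>h. h \<in> Lp_space M p & (AE x in M. f x \<bullet> i = Io h x) & Lp_int M p h <= T" if i: "i \<in> Basis" for i
    proof -
      have "has_weak_deriv (%x. f x \<bullet> i) (%x. g x \<bullet> i)" using wd i unfolding has_weak_deriv_componentwise[of f] by blast
      then obtain h where h: "h \<in> Lp_space M p" "AE x in M. f x \<bullet> i = Io h x"
        "Lp_int M p h <= C * (Lp_int M p (%x. f x \<bullet> i) + Lp_int M p (%x. g x \<bullet> i))"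
        using C(2)[OF Lp_component(1)[OF f p0 i] Lp_component(1)[OF g p0 i]] by blast
      have "C * (Lp_int M p (%x. f x \<bullet> i) + Lp_int M p (%x. g x \<bullet> i)) <= T"
        unfolding T_def using C(1) by (intro mult_left_mono add_mono Lp_component(2)[OF f p0 i] Lp_component(2)[OF g p0 i]) auto
      thus ?thesis using h by (intro exI[of _ h] conjI) (assumption | linarith)+
    qed
    hence "\<forall>i\<in>Basis. \<exists>h. h \<in> Lp_space M p & (AE x in M. f x \<bullet> i = Io h x) & Lp_int M p h <= T" by blast
    from bchoice[OF this] obtain k where k: "!!i. i \<in> Basis ==> k i \<in> Lp_space M p"
      "!!i. i \<in> Basis ==> AE x in M. f x \<bullet> i = Io (k i) x" "!!i. i \<in> Basis ==> Lp_int M p (k i) <= T" by blast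
    define h where "h x = (\<Sum>i\<in>Basis. k i x *\<^sub>R i)" for x
    have hc: "(%x. h x \<bullet> i) = k i" if "i \<in> Basis" for i
      using that by (simp add: h_def fun_eq_iff)
    have hi: "(%x. h x \<bullet> i) \<in> Lp_space M p" "Lp_int M p (%x. h x \<bullet> i) <= T" if "i \<in> Basis" for i
      using k(1,3)[OF that] fun_cong[OF hc[OF that]] hc[OF that] by simp_all
    have "h \<in> Lp_space M p" by (rule Lp_componentI(1)[OF hi(1) p0 hi(2)])
    hence "is_potential_of \<nu> p 1 f h" unfolding is_potential_of_iff[OF p] using k(2) by (simp add: hc)
    moreover have "Lp_int M p h <= real DIM('a) powr p * (real DIM('a) * T)"
      by (rule Lp_componentI(2)[OF hi(1) p0 hi(2)])
    hence "Lp_int M p h <= D * (Lp_int M p f + Lp_int M p g)" by (simp only: D_def T_def mult.assoc)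
    ultimately show ?thesis by blast
  qed
  thus ?thesis using D by blast
qed

lemma potential_to_sobolev:
  assumes p: "1 < p"
  shows "\<exists>C>0. \<forall>f h :: real => 'a::euclidean_space. f \<in> borel_measurable M --> is_potential_of \<nu> p 1 f h -->
    f \<in> Lp_space M p & Lp_int M p f <= C * Lp_int M p h &
    (\<exists>g\<in>Lp_space M p. has_weak_deriv f g & Lp_int M p g <= C * Lp_int M p h)" proof -
  have p0: "0 < p" using p by simp
  obtain C1 where C1: "0 < C1" "!!g. g \<in> Lp_space M p ==> \<exists>d\<in>Lp_space M p. has_weak_deriv (Io g) d & Lp_int M p d <= C1 * Lp_int M p g"
    using Io_weak_deriv[OF p] by blast
  define C2 where "C2 = (1 / lm 0 + 1) powr p / lm 0"
  have C2: "0 <= C2" using lm_pos[of 0] by (simp add: C2_def)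
  define C where "C = C1 + C2"
  have C: "0 < C" "C1 <= C" "C2 <= C" using C1(1) C2 by (auto simp: C_def)
  define D where "D = real DIM('a) powr p * (real DIM('a) * C)"
  have D: "0 < D" using C(1) by (simp add: D_def)
  have "f \<in> Lp_space M p & Lp_int M p f <= D * Lp_int M p h &
      (\<exists>g\<in>Lp_space M p. has_weak_deriv f g & Lp_int M p g <= D * Lp_int M p h)"
    if m: "f \<in> borel_measurable M" and pot: "is_potential_of \<nu> p 1 f h" for f h :: "real => 'a"
  proof -
    define T where "T = C * Lp_int M p h"
    have h: "h \<in> Lp_space M p" and eq: "!!i. i \<in> Basis ==> AE x in M. f x \<bullet> i = Io (%y. h y \<bullet> i) x"
      using pot unfolding is_potential_of_iff[OF p] by auto
    have DT: "real DIM('a) powr p * (real DIM('a) * T) = D * Lp_int M p h" by (simp only: D_def T_def mult.assoc)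
    have fm: "(%x. f x \<bullet> i) \<in> borel_measurable M" if "i \<in> Basis" for i using m that borel_measurable_euclidean_space by blast
    have fi: "(%x. f x \<bullet> i) \<in> Lp_space M p" "Lp_int M p (%x. f x \<bullet> i) <= T"
      "\<exists>d. d \<in> Lp_space M p & has_weak_deriv (%x. f x \<bullet> i) d & Lp_int M p d <= T" if i: "i \<in> Basis" for i
    proof -
      note hi = Lp_component[OF h p0 i]
      note L = Io_Lp[OF hi(1) p]
      have eq': "AE x in M. Io (%y. h y \<bullet> i) x = f x \<bullet> i" using eq[OF i] by eventually_elim simp
      show fL: "(%x. f x \<bullet> i) \<in> Lp_space M p" by (rule Lp_cong_AE(1)[OF L(1) fm[OF i] eq'])
      have "Lp_int M p (%x. f x \<bullet> i) = Lp_int M p (Io (%y. h y \<bullet> i))" by (rule Lp_cong_AE(2)[OF L(1) fm[OF i] eq'])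
      also have "... <= C2 * Lp_int M p (%y. h y \<bullet> i)" using L(2) by (simp only: C2_def)
      also have "... <= T" unfolding T_def using C by (intro mult_mono hi Lp_int_nonneg) auto
      finally show "Lp_int M p (%x. f x \<bullet> i) <= T" .
      obtain d where d: "d \<in> Lp_space M p" "has_weak_deriv (Io (%y. h y \<bullet> i)) d" "Lp_int M p d <= C1 * Lp_int M p (%y. h y \<bullet> i)"
        using C1(2)[OF hi(1)] by blast
      have "has_weak_deriv (%x. f x \<bullet> i) d"
        by (rule has_weak_deriv_cong[OF d(2) p fL d(1) eq' _ Lp_spaceD(1)[OF L(1)] Lp_spaceD(1)[OF d(1)]]) simp
      moreover have "C1 * Lp_int M p (%y. h y \<bullet> i) <= T"
        unfolding T_def using C by (intro mult_mono hi Lp_int_nonneg) auto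
      ultimately show "\<exists>d. d \<in> Lp_space M p & has_weak_deriv (%x. f x \<bullet> i) d & Lp_int M p d <= T"
        using d by (intro exI[of _ d] conjI) (assumption | linarith)+
    qed
    have "\<forall>i\<in>Basis. \<exists>d. d \<in> Lp_space M p & has_weak_deriv (%x. f x \<bullet> i) d & Lp_int M p d <= T" using fi(3) by blast
    from bchoice[OF this] obtain k where k: "!!i. i \<in> Basis ==> k i \<in> Lp_space M p"
      "!!i. i \<in> Basis ==> has_weak_deriv (%x. f x \<bullet> i) (k i)" "!!i. i \<in> Basis ==> Lp_int M p (k i) <= T" by blast
    define g where "g x = (\<Sum>i\<in>Basis. k i x *\<^sub>R i)" for x
    have gc: "(%x. g x \<bullet> i) = k i" if "i \<in> Basis" for i
      using that by (simp add: g_def fun_eq_iff)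
    have gi: "(%x. g x \<bullet> i) \<in> Lp_space M p" "Lp_int M p (%x. g x \<bullet> i) <= T" if "i \<in> Basis" for i
      using k(1,3)[OF that] fun_cong[OF gc[OF that]] gc[OF that] by simp_all
    have "has_weak_deriv f g" unfolding has_weak_deriv_componentwise[of f] using k(2) by (simp add: gc)
    thus ?thesis
      using Lp_componentI[OF fi(1) p0 fi(2)] Lp_componentI[OF gi(1) p0 gi(2)] unfolding DT by blast
  qed
  thus ?thesis using D by blast
qed

lemma sobolev_eq_potential:
  assumes p: "1 < p"
  shows "(sobolev_space \<nu> p :: (real => 'a::euclidean_space) set) = potential_space \<nu> p 1"
proof (intro set_eqI iffI)
  fix f :: "real => 'a"
  assume "f \<in> sobolev_space \<nu> p"
  then obtain g where f: "f \<in> Lp_space M p" "g \<in> Lp_space M p" "has_weak_deriv f g"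
    unfolding sobolev_space_def M_eq[symmetric] by blast
  then obtain h where "is_potential_of \<nu> p 1 f h"
    using sobolev_to_potential[OF p, where 'a = 'a] by blast
  thus "f \<in> potential_space \<nu> p 1"
    unfolding potential_space_def M_eq[symmetric] using Lp_spaceD(1)[OF f(1)] by blast
next
  fix f :: "real => 'a"
  assume "f \<in> potential_space \<nu> p 1"
  then obtain h where "f \<in> borel_measurable M" "is_potential_of \<nu> p 1 f h"
    unfolding potential_space_def M_eq[symmetric] by blast
  thus "f \<in> sobolev_space \<nu> p"
    unfolding sobolev_space_def M_eq[symmetric] using potential_to_sobolev[OF p, where 'a = 'a] by blast
qed

lemma norms_equivalent:
  assumes p: "1 < p"
  shows "\<exists>c C. 0 < c & 0 < C & (\<forall>f :: real => 'a::euclidean_space. f \<in> sobolev_space \<nu> p -->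
    c * sobolev_norm \<nu> p f <= potential_norm \<nu> p 1 f & potential_norm \<nu> p 1 f <= C * sobolev_norm \<nu> p f)"
proof -
  obtain C1 where C1: "0 < C1" "!!f g :: real => 'a. f \<in> Lp_space M p ==> g \<in> Lp_space M p ==> has_weak_deriv f g ==>
    \<exists>h. is_potential_of \<nu> p 1 f h & Lp_int M p h <= C1 * (Lp_int M p f + Lp_int M p g)"
    using sobolev_to_potential[OF p, where 'a = 'a] by blast
  obtain C2 where C2: "0 < C2" "!!f h :: real => 'a. f \<in> borel_measurable M ==> is_potential_of \<nu> p 1 f h ==>
    f \<in> Lp_space M p & Lp_int M p f <= C2 * Lp_int M p h &
    (\<exists>g\<in>Lp_space M p. has_weak_deriv f g & Lp_int M p g <= C2 * Lp_int M p h)"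
    using potential_to_sobolev[OF p, where 'a = 'a] by blast
  \<comment> \<open>In \<open>c\<close> the factor 2 counts the two summands of the Sobolev norm,
    each at most \<open>C2 powr (1 / p)\<close> times the potential norm. In \<open>C\<close> the
    factor \<open>2 powr (1 / p)\<close> is the cost of splitting the root of a sum.\<close>
  define c C where "c = 1 / (2 * C2 powr (1 / p))" and "C = C1 powr (1 / p) * 2 powr (1 / p)"
  have cC: "0 < c" "0 < C" using C1(1) C2(1) by (simp_all add: c_def C_def)
  have "c * sobolev_norm \<nu> p f <= potential_norm \<nu> p 1 f & potential_norm \<nu> p 1 f <= C * sobolev_norm \<nu> p f"
    if f: "f \<in> sobolev_space \<nu> p" for f :: "real => 'a" proof -
    obtain g0 where f: "f \<in> Lp_space M p" and g0: "g0 \<in> Lp_space M p" "has_weak_deriv f g0"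
      using f unfolding sobolev_space_def M_eq[symmetric] by blast
    obtain h where h: "is_potential_of \<nu> p 1 f h" "Lp_int M p h <= C1 * (Lp_int M p f + Lp_int M p g0)"
      using C1(2)[OF f g0] by blast
    obtain g where g: "g \<in> Lp_space M p" "has_weak_deriv f g" "Lp_int M p g <= C2 * Lp_int M p h"
      and fle: "Lp_int M p f <= C2 * Lp_int M p h"
      using C2(2)[OF Lp_spaceD(1)[OF f] h(1)] by blast
    have n: "0 <= Lp_int M p f" "0 <= Lp_int M p g0" "0 <= Lp_int M p g" "0 <= Lp_int M p h" by (rule Lp_int_nonneg)+
    have root: "x powr (1 / p) <= C2 powr (1 / p) * Lp_int M p h powr (1 / p)" if "0 <= x" "x <= C2 * Lp_int M p h" for x
      using powr_mono2[of "1 / p" x "C2 * Lp_int M p h"] that p C2(1) n(4) by (simp add: powr_mult)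
    have "sobolev_norm \<nu> p f <= 2 * C2 powr (1 / p) * Lp_int M p h powr (1 / p)"
      unfolding sobolev_norm_eq[OF g(1,2)] using root[OF n(1) fle] root[OF n(3) g(3)] by linarith
    hence 1: "c * sobolev_norm \<nu> p f <= potential_norm \<nu> p 1 f"
      unfolding potential_norm_eq[OF p h(1)] c_def using C2(1) by (simp add: field_simps)
    have "Lp_int M p h powr (1 / p) <= (C1 * (Lp_int M p f + Lp_int M p g0)) powr (1 / p)"
      using p n h(2) by (intro powr_mono2) auto
    also have "... = C1 powr (1 / p) * (Lp_int M p f + Lp_int M p g0) powr (1 / p)"
      using C1(1) n by (intro powr_mult)
    also have "... <= C1 powr (1 / p) * (2 powr (1 / p) * (Lp_int M p f powr (1 / p) + Lp_int M p g0 powr (1 / p)))"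
      using p n by (intro mult_left_mono powr_add_le) auto
    finally have "potential_norm \<nu> p 1 f <= C * sobolev_norm \<nu> p f"
      unfolding potential_norm_eq[OF p h(1)] sobolev_norm_eq[OF g0] C_def by (simp only: mult.assoc)
    with 1 show ?thesis by blast
  qed
  with cC show ?thesis by blast
qed

end

theorem theorem8p8:
  fixes \<nu> p :: real
  assumes "\<nu> \<ge> -1/2" and "1 < p"
  shows "(sobolev_space \<nu> p :: (real \<Rightarrow> 'a::{real_normed_field,euclidean_space}) set)
           = potential_space \<nu> p 1
         \<and> (\<exists>c C. 0 < c \<and> 0 < C \<and>
              (\<forall>f :: real \<Rightarrow> 'a. f \<in> sobolev_space \<nu> p \<longrightarrow>
                 c * sobolev_norm \<nu> p f \<le> potential_norm \<nu> p 1 f \<and>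
                 potential_norm \<nu> p 1 f \<le> C * sobolev_norm \<nu> p f))"
proof -
  interpret bessel \<nu> by unfold_locales (use assms in simp)
  show ?thesis using sobolev_eq_potential[OF assms(2)] norms_equivalent[OF assms(2)] by blast
qed

end
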